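(* Suppose there is a constant $\gamma\in[0,1/2)$ with $k_u\lesssim p^\gamma$, and that $n\ge c\,k_u\log p$ for a suitable (sufficiently large) constant $c>0$. Suppose that $k_u\gg\sqrt n/\log p$ and that the loading vector $\xi$ satisfies $$H(k_u;\xi)\asymp H(n/\log p;\xi).$$ Then, for any $1\le k\le k_u$, $$\tau_{\mathrm{adap}}(k_u,k;\xi)\asymp\frac{k_u\log p}{n}\,\nu_2,\qquad \nu_2=H(k_u;\xi).$$
   Context: Model: one observes $n$ i.i.d. pairs $Z_i=(Y_i,X_{i\cdot})\in\mathbb R\times\mathbb R^p$, with $X_{i\cdot}\sim\mathcal N(0,\Sigma)$, $Y_i=X_{i\cdot}^\top\beta+\varepsilon_i$, $\varepsilon_i\sim\mathcal N(0,\sigma^2)$ independent of the $X$'s. Write $\theta=(\beta,\Sigma,\sigma)$, and $\mathbb E_\theta$ for expectation under the law of the data $\mathcal Z=(Z_1,\dots,Z_n)$. For fixed constants $M_1>1$, $M_2>0$, $$\Theta(k)=\{(\beta,\Sigma,\sigma):\|\beta\|_0\le k,\ 1/M_1\le\lambda_{\min}(\Sigma)\le\lambda_{\max}(\Sigma)\le M_1,\ 0<\sigma\le M_2\}.$$ For $t_0\in\mathbb R$ and $\tau>0$: $\Theta(k;\xi,t_0)=\{\theta\in\Theta(k):\xi^\top\beta=t_0\}$ and $\Theta_{\pm\tau}(k;\xi,t_0)=\{\theta\in\Theta(k):|\xi^\top\beta-t_0|\ge\tau\}$. $\Psi_\alpha(\Theta)$ is the set of tests $\psi=\psi(\mathcal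 Z)\in[0,1]$ with $\sup_{\theta\in\Theta}\mathbb E_\theta\psi\le\alpha$. For fixed $\alpha,\eta\in(0,1)$ with $\alpha+\eta<1$, $$\tau_{\mathrm{adap}}(k_u,k;\xi)=\inf\Big\{\tau:\ \sup_{\psi\in\Psi_\alpha(\Theta(k_u;\xi,t_0))}\ \inf_{\theta\in\Theta_{\pm\tau}(k;\xi,t_0)}\mathbb E_\theta\psi\ge1-\eta\Big\}.$$ The loading vector $\xi\in\mathbb R^p$ is nonzero, ordered so that $|\xi_1|\ge\dots\ge|\xi_p|$. For $t>0$, $H(t;\xi)=\big(\sum_{j\le\lceil t\rceil\wedge p}\xi_j^2\big)^{1/2}$. Asymptotics: $n,p,k_u\to\infty$ along a sequence; $M_1,M_2,\alpha,\eta,\gamma$ are fixed; $k,\xi,t_0$ may vary along the sequence. $a\lesssim b$ means $a\le Cb$ for a constant $C>0$ along the sequence (for all sufficiently large $n$); $a\asymp b$ means $a\lesssim b$ and $b\lesssim a$; $a\gg b$ means $b/a\to0$. *)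

theory Defs
  imports
    "HOL-Probability.Probability"
    "HOL-Library.Landau_Symbols"
    "Jordan_Normal_Form.Spectral_Radius"
    "Jordan_Normal_Form.Gauss_Jordan_Elimination"
begin

text \<open>
  The dimension \<open>p\<close> varies along the asymptotic sequence, so deterministic vectors and matrices
  are taken from \<open>Jordan_Normal_Form\<close> (with carriers \<open>carrier_vec p\<close>, \<open>carrier_mat p p\<close>), and random
  vectors live in the product space over the index set \<open>{..<p}\<close>. Coordinates are numbered from 0.
  Several constants (\<open>vec\<close>, \<open>det\<close>, \<open>$\<close>, \<open>\<bullet>\<close>) exist in \<open>HOL-Analysis\<close> as well, so the matrix
  library's versions are written with qualified names.
\<close>

section \<open>The Gaussian linear model\<close>

text \<open>The law \<open>N(0, \<Sigma>)\<close> for positive definite \<open>\<Sigma>\<close>, by its Lebesgue density. The option type comes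
  from \<^const>\<open>mat_inverse\<close>, which returns \<open>Some\<close> exactly on invertible matrices.\<close>

definition mvn :: "nat \<Rightarrow> real mat \<Rightarrow> (nat \<Rightarrow> real) measure" where
  "mvn p \<Sigma> = density (\<Pi>\<^sub>M i\<in>{..<p}. lborel)
     (\<lambda>x. ennreal (exp (- Matrix.scalar_prod (Matrix.vec p x)
                            (the (mat_inverse \<Sigma>) *\<^sub>v Matrix.vec p x) / 2)
                   / sqrt ((2 * pi) ^ p * Determinant.det \<Sigma>)))"

type_synonym obs = "real \<times> (nat \<Rightarrow> real)"

type_synonym param = "real vec \<times> real mat \<times> real"

definition obs_space :: "nat \<Rightarrow> obs measure" where
  "obs_space p = borel \<Otimes>\<^sub>M (\<Pi>\<^sub>M i\<in>{..<p}. borel)"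

definition data_space :: "nat \<Rightarrow> nat \<Rightarrow> (nat \<Rightarrow> obs) measure" where
  "data_space n p = (\<Pi>\<^sub>M i\<in>{..<n}. obs_space p)"

text \<open>The law of \<open>(Y, X)\<close> with \<open>Y = X\<^sup>T \<beta> + \<epsilon>\<close>, where \<open>X\<close> and \<open>\<epsilon>\<close> are independent.\<close>

fun obs_law :: "nat \<Rightarrow> param \<Rightarrow> obs measure" where
  "obs_law p (\<beta>, \<Sigma>, \<sigma>) =
     distr (mvn p \<Sigma> \<Otimes>\<^sub>M density lborel (normal_density 0 \<sigma>)) (obs_space p)
       (\<lambda>(x, e). (Matrix.scalar_prod (Matrix.vec p x) \<beta> + e, x))"

definition data_law :: "nat \<Rightarrow> nat \<Rightarrow> param \<Rightarrow> (nat \<Rightarrow> obs) measure" where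
  "data_law n p \<theta> = (\<Pi>\<^sub>M i\<in>{..<n}. obs_law p \<theta>)"

abbreviation expect :: "nat \<Rightarrow> nat \<Rightarrow> param \<Rightarrow> ((nat \<Rightarrow> obs) \<Rightarrow> real) \<Rightarrow> real" where
  "expect n p \<theta> \<psi> \<equiv> integral\<^sup>L (data_law n p \<theta>) \<psi>"


section \<open>Parameter spaces\<close>

definition l0_norm :: "real vec \<Rightarrow> nat" where
  "l0_norm v = card {i. i < dim_vec v \<and> Matrix.vec_index v i \<noteq> 0}"

definition lambda_min :: "real mat \<Rightarrow> real" where
  "lambda_min A = Min (spectrum A)"

definition lambda_max :: "real mat \<Rightarrow> real" where
  "lambda_max A = Max (spectrum A)"

definition param_space :: "real \<Rightarrow> real \<Rightarrow> nat \<Rightarrow> nat \<Rightarrow> param set" where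
  "param_space M1 M2 p k =
     {(\<beta>, \<Sigma>, \<sigma>). \<beta> \<in> carrier_vec p \<and> \<Sigma> \<in> carrier_mat p p \<and> transpose_mat \<Sigma> = \<Sigma> \<and>
        l0_norm \<beta> \<le> k \<and>
        1 / M1 \<le> lambda_min \<Sigma> \<and> lambda_min \<Sigma> \<le> lambda_max \<Sigma> \<and> lambda_max \<Sigma> \<le> M1 \<and>
        0 < \<sigma> \<and> \<sigma> \<le> M2}"

definition null_space :: "real \<Rightarrow> real \<Rightarrow> nat \<Rightarrow> nat \<Rightarrow> real vec \<Rightarrow> real \<Rightarrow> param set" where
  "null_space M1 M2 p k \<xi> t0 =
     {(\<beta>, \<Sigma>, \<sigma>). (\<beta>, \<Sigma>, \<sigma>) \<in> param_space M1 M2 p k \<and> Matrix.scalar_prod \<xi> \<beta> = t0}"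

definition alt_space :: "real \<Rightarrow> real \<Rightarrow> real \<Rightarrow> nat \<Rightarrow> nat \<Rightarrow> real vec \<Rightarrow> real \<Rightarrow> param set" where
  "alt_space M1 M2 \<tau> p k \<xi> t0 =
     {(\<beta>, \<Sigma>, \<sigma>). (\<beta>, \<Sigma>, \<sigma>) \<in> param_space M1 M2 p k \<and> \<bar>Matrix.scalar_prod \<xi> \<beta> - t0\<bar> \<ge> \<tau>}"


section \<open>Tests and the adaptive detection boundary\<close>

text \<open>Suprema and infima are taken in \<^typ>\<open>ereal\<close>, so that those over empty sets have their usual
  values; in particular the boundary is \<open>\<infinity>\<close> if no \<open>\<tau>\<close> is detectable.\<close>

definition tests :: "nat \<Rightarrow> nat \<Rightarrow> real \<Rightarrow> param set \<Rightarrow> ((nat \<Rightarrow> obs) \<Rightarrow> real) set" where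
  "tests n p \<alpha> T =
     {\<psi> \<in> borel_measurable (data_space n p).
        (\<forall>z\<in>space (data_space n p). 0 \<le> \<psi> z \<and> \<psi> z \<le> 1) \<and>
        (SUP \<theta>\<in>T. ereal (expect n p \<theta> \<psi>)) \<le> ereal \<alpha>}"

definition tau_adap ::
  "real \<Rightarrow> real \<Rightarrow> real \<Rightarrow> real \<Rightarrow> nat \<Rightarrow> nat \<Rightarrow> real \<Rightarrow> nat \<Rightarrow> nat \<Rightarrow> real vec \<Rightarrow> ereal" where
  "tau_adap M1 M2 \<alpha> \<eta> n p t0 ku k \<xi> =
     (INF \<tau>\<in>{\<tau>::real. 0 < \<tau> \<and>
              (SUP \<psi>\<in>tests n p \<alpha> (null_space M1 M2 p ku \<xi> t0).
                 INF \<theta>\<in>alt_space M1 M2 \<tau> p k \<xi> t0. ereal (expect n p \<theta> \<psi>)) \<ge> ereal (1 - \<eta>)}.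
        ereal \<tau>)"


section \<open>Loading vector and asymptotic order\<close>

definition loading_vector :: "nat \<Rightarrow> real vec \<Rightarrow> bool" where
  "loading_vector p \<xi> \<longleftrightarrow> \<xi> \<in> carrier_vec p \<and> \<xi> \<noteq> 0\<^sub>v p \<and>
     (\<forall>i j. i \<le> j \<and> j < p \<longrightarrow> \<bar>Matrix.vec_index \<xi> j\<bar> \<le> \<bar>Matrix.vec_index \<xi> i\<bar>)"

definition H :: "real \<Rightarrow> real vec \<Rightarrow> real" where
  "H t \<xi> = sqrt (\<Sum>j<min (nat \<lceil>t\<rceil>) (dim_vec \<xi>). (Matrix.vec_index \<xi> j)\<^sup>2)"

text \<open>The Landau symbols are not available on \<^typ>\<open>ereal\<close>; the following relations extend them to
  nonnegative extended-real sequences.\<close>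

definition asymp_le :: "(nat \<Rightarrow> ereal) \<Rightarrow> (nat \<Rightarrow> ereal) \<Rightarrow> bool" where
  "asymp_le a b \<longleftrightarrow> (\<exists>C::real. C > 0 \<and> (\<forall>\<^sub>F m in sequentially. a m \<le> ereal C * b m))"

definition asymp_eq :: "(nat \<Rightarrow> ereal) \<Rightarrow> (nat \<Rightarrow> ereal) \<Rightarrow> bool" where
  "asymp_eq a b \<longleftrightarrow> asymp_le a b \<and> asymp_le b a"

end

theory Submission
  imports Defs
begin

text \<open>
  Detection: let \<open>h\<close> be \<open>\<xi>\<close> truncated to its \<open>n / log p\<close> largest entries. From the covariates alone one finds a
  direction \<open>u\<close> whose image under the Gram matrix is uniformly close to \<open>h\<close> and whose quadratic form is at most a
  multiple of \<open>|h|\<^sup>2\<close>. The null hypothesis is accepted if some \<open>k\<^sub>u\<close>-sparse \<open>b\<close> with \<open>\<xi> \<bullet> b\<close> near \<open>t\<^sub>0\<close> has small residual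
  correlations with every covariate and with \<open>u\<close>. The true \<open>\<beta>\<close> has these correlations small as well; as the Gram
  matrix is well conditioned on sparse vectors, \<open>\<beta>\<close> and \<open>b\<close> are then close in \<open>\<ell>\<^sub>1\<close>, at rate \<open>k\<^sub>u (log p / n)\<^sup>1\<^sup>/\<^sup>2\<close>, and
  comparing the correlations with \<open>u\<close> bounds \<open>\<xi> \<bullet> (\<beta> - b)\<close> by a multiple of \<open>|h| k\<^sub>u log p / n\<close>.

  Impossibility: one alternative, with a one-sparse coefficient vector and identity covariance, is compared with a uniform
  mixture of null parameters. In these, \<open>v\<close> is the normalized head of \<open>\<xi>\<close>, \<open>u\<close> is a random sparse direction orthogonal to
  \<open>\<xi>\<close> and to \<open>v\<close>, a spiked covariance correlates \<open>x \<bullet> v\<close> and \<open>x \<bullet> u\<close> with strength \<open>a\<close>, and the coefficients move by a multiple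
  of \<open>a u - a\<^sup>2 v\<close>. The likelihood ratio sees the shift only through the overlaps of independent copies of \<open>u\<close>, while
  \<open>\<xi> \<bullet> \<beta>\<close> moves by order \<open>a\<^sup>2 |h|\<close>. With \<open>a\<^sup>2\<close> a small multiple of \<open>k\<^sub>u log p / n\<close>, the second moment tends to 1 because
  \<open>k\<^sub>u\<^sup>2 / p\<close> decays polynomially.
\<close>

section \<open>Quadratic forms and spectral bounds\<close>

text \<open>The null parameters arise from changing a single conditional law. With \<open>r\<close>
  the standardized error of the alternative, \<open>V = x \<bullet> v\<close>,
  \<open>U = x \<bullet> u\<close> and \<open>D = r + V\<close>, let \<open>U\<close> given
  everything else be \<open>N(a D, 1)\<close> instead of \<open>N(0, 1)\<close>. The model stays
  Gaussian and linear: regressing \<open>r\<close> on \<open>(V, U)\<close> gives the shift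
  \<open>(a U - a\<^sup>2 V) / (1 + a\<^sup>2)\<close> and a smaller noise level. Hence the forms of
  \<open>null_beta\<close>, \<open>spiked_cov\<close> and \<open>likelihood_ratio\<close>. The
  boundary is free of \<open>k\<close> because detection uses only \<open>k \<le> ku\<close>, while
  the hard alternative is already available for \<open>k = 1\<close>. The cut at
  \<open>n / log p\<close> balances two errors: entries beyond it are at most
  \<open>|h| sqrt (log p / n)\<close>, which is also the accuracy to which a Gram image can match
  \<open>h\<close>. The score in direction \<open>u\<close> fluctuates by order
  \<open>|h| / sqrt n\<close>; this is negligible against \<open>|h| ku log p / n\<close> because
  \<open>ku\<close> dominates \<open>sqrt n / log p\<close>. As \<open>u\<close> depends on the
  whole design, this fluctuation is controlled by conditioning and Chebyshev's inequality, not by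
  exponential bounds.\<close>

definition bform :: "nat \<Rightarrow> (nat \<Rightarrow> nat \<Rightarrow> real) \<Rightarrow> (nat \<Rightarrow> real) \<Rightarrow> (nat \<Rightarrow> real) \<Rightarrow> real" where
  "bform p S a b = (\<Sum>i<p. \<Sum>j<p. a i * S i j * b j)"

abbreviation qform :: "nat \<Rightarrow> (nat \<Rightarrow> nat \<Rightarrow> real) \<Rightarrow> (nat \<Rightarrow> real) \<Rightarrow> real" where
  "qform p S a \<equiv> bform p S a a"

abbreviation entries :: "real mat \<Rightarrow> nat \<Rightarrow> nat \<Rightarrow> real" where
  "entries A \<equiv> (\<lambda>i j. A $$ (i, j))"

lemma bform_swap:
  assumes "\<And>i j. i < p \<Longrightarrow> j < p \<Longrightarrow> S i j = S j i"
  shows "bform p S a b = bform p S b a"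
  unfolding bform_def
  by (subst sum.swap, intro sum.cong refl) (use assms in \<open>auto simp: mult.commute mult.left_commute\<close>)

lemma bform_rows: "bform p S a b = (\<Sum>i<p. a i * (\<Sum>j<p. S i j * b j))"
  unfolding bform_def by (simp add: sum_distrib_left mult.assoc)

lemma qform_add_scaled:
  assumes "\<And>i j. i < p \<Longrightarrow> j < p \<Longrightarrow> S i j = S j i"
  shows "qform p S (\<lambda>i. a i + c * b i) = qform p S a + 2 * c * bform p S a b + c\<^sup>2 * qform p S b"
proof -
  have "qform p S (\<lambda>i. a i + c * b i)
      = qform p S a + c * bform p S a b + c * bform p S b a + c\<^sup>2 * qform p S b"
    unfolding bform_def
    by (simp add: sum_distrib_left sum.distrib algebra_simps power2_eq_square)
  also have "bform p S b a = bform p S a b" using assms by (rule bform_swap)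
  finally show ?thesis by simp
qed

lemma qform_scale: "qform p S (\<lambda>i. c * a i) = c\<^sup>2 * qform p S a"
  unfolding bform_def by (simp add: sum_distrib_left algebra_simps power2_eq_square)

text \<open>Each product \<open>a i * a j\<close> is at most the squared norm. The constant is
  crude, but only its finiteness matters: it bounds the Rayleigh quotient and supplies a step size
  in \<open>Rayleigh_lower\<close>.\<close>

lemma abs_qform_le: "\<bar>qform p S a\<bar> \<le> (\<Sum>i<p. \<Sum>j<p. \<bar>S i j\<bar>) * (\<Sum>i<p. (a i)\<^sup>2)"
proof -
  have *: "\<bar>a i * S i j * a j\<bar> \<le> \<bar>S i j\<bar> * (\<Sum>i<p. (a i)\<^sup>2)" if "i < p" "j < p" for i j
  proof -
    have le: "(a l)\<^sup>2 \<le> (\<Sum>i<p. (a i)\<^sup>2)" if "l < p" for l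
      using that by (intro member_le_sum) auto
    have "2 * (\<bar>a i\<bar> * \<bar>a j\<bar>) \<le> (a i)\<^sup>2 + (a j)\<^sup>2"
      using sum_squares_bound[of "\<bar>a i\<bar>" "\<bar>a j\<bar>"] by simp
    then have "\<bar>a i\<bar> * \<bar>a j\<bar> \<le> (\<Sum>i<p. (a i)\<^sup>2)" using le[OF that(1)] le[OF that(2)] by linarith
    then have "\<bar>S i j\<bar> * (\<bar>a i\<bar> * \<bar>a j\<bar>) \<le> \<bar>S i j\<bar> * (\<Sum>i<p. (a i)\<^sup>2)"
      by (rule mult_left_mono) simp
    then show ?thesis by (simp add: abs_mult mult.commute mult.left_commute)
  qed
  have "\<bar>qform p S a\<bar> \<le> (\<Sum>i<p. \<Sum>j<p. \<bar>a i * S i j * a j\<bar>)"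
    unfolding bform_def by (intro order.trans[OF sum_abs] sum_mono) auto
  also have "\<dots> \<le> (\<Sum>i<p. \<Sum>j<p. \<bar>S i j\<bar> * (\<Sum>i<p. (a i)\<^sup>2))"
    by (intro sum_mono *) auto
  finally show ?thesis by (simp add: sum_distrib_right)
qed

lemma eigenvalueI_det:
  fixes A :: "'a :: field mat"
  assumes "A \<in> carrier_mat p p" and "Determinant.det (A - \<mu> \<cdot>\<^sub>m 1\<^sub>m p) = 0"
  shows "\<mu> \<in> spectrum A"
proof -
  have "A - \<mu> \<cdot>\<^sub>m 1\<^sub>m p = char_matrix A \<mu>"
    using assms(1) by (auto simp: char_matrix_def)
  then show ?thesis unfolding spectrum_def using eigenvalue_det[OF assms(1)] assms(2) by auto
qed

lemma left_inverse_exists: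
  fixes A :: "'a :: field mat"
  assumes "A \<in> carrier_mat p p" and "Determinant.det A \<noteq> 0"
  obtains B where "B \<in> carrier_mat p p" "B * A = 1\<^sub>m p" "A * B = 1\<^sub>m p" "mat_inverse A = Some B"
proof -
  have "mat_inverse A \<noteq> None"
    using det_non_zero_imp_unit[OF assms] mat_inverse(1)[OF assms(1)] by metis
  then obtain B where B: "mat_inverse A = Some B" by auto
  from mat_inverse(2)[OF assms(1) B] B that show ?thesis by blast
qed

text \<open>If the smallest value \<open>\<mu>\<close> of the Rayleigh quotient were no eigenvalue, then \<open>M = S - \<mu> I\<close>
  would be positive semidefinite and invertible. Expanding the form at \<open>x - M x / K\<close> bounds it
  below by a multiple of \<open>|M x|\<^sup>2\<close>, hence of \<open>|x|\<^sup>2\<close>, contradicting the choice of \<open>\<mu>\<close>.\<close>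

lemma Rayleigh_lower:
  assumes S: "S \<in> carrier_mat p p" and sym: "transpose_mat S = S" and p: "p > 0"
  obtains \<mu> where "\<mu> \<in> spectrum S" "\<And>x. \<mu> * (\<Sum>i<p. (x i)\<^sup>2) \<le> qform p (entries S) x"
proof -
  have symS: "S $$ (i, j) = S $$ (j, i)" if "i < p" "j < p" for i j
    using sym S that by (metis carrier_matD index_transpose_mat(1))
  define R where "R = {qform p (entries S) x |x. (\<Sum>i<p. (x i)\<^sup>2) = 1}"
  define \<mu> where "\<mu> = Inf R"
  define K0 where "K0 = (\<Sum>i<p. \<Sum>j<p. \<bar>S $$ (i, j)\<bar>)"
  have bdd: "bdd_below R"
  proof (rule bdd_belowI[of _ "- K0"])
    fix r assume "r \<in> R"
    then obtain x where x: "r = qform p (entries S) x" "(\<Sum>i<p. (x i)\<^sup>2) = 1" by (auto simp: R_def)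
    show "- K0 \<le> r" using abs_qform_le[of p "entries S" x] x by (simp add: K0_def)
  qed
  have "(\<Sum>i<p. (if i = 0 then 1 else 0 :: real)\<^sup>2) = 1"
    using p by (simp add: if_distrib[of "\<lambda>x. x\<^sup>2"] sum.delta cong: if_cong)
  then have ne: "R \<noteq> {}" by (auto simp: R_def)
  have low: "\<mu> * (\<Sum>i<p. (x i)\<^sup>2) \<le> qform p (entries S) x" for x
  proof (cases "(\<Sum>i<p. (x i)\<^sup>2) = 0")
    case True
    then have "x i = 0" if "i < p" for i using that by (subst (asm) sum_nonneg_eq_0_iff) auto
    then have "qform p (entries S) x = 0" unfolding bform_def by simp
    with True show ?thesis by simp
  next
    case False
    define N where "N = (\<Sum>i<p. (x i)\<^sup>2)"
    have N: "N > 0" using False sum_nonneg[of "{..<p}" "\<lambda>i. (x i)\<^sup>2"] by (auto simp: N_def less_le)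
    have "(\<Sum>i<p. (1 / sqrt N * x i)\<^sup>2) = (1 / sqrt N)\<^sup>2 * N"
      unfolding power_mult_distrib N_def by (simp add: sum_distrib_left)
    also have "\<dots> = 1" using N by (simp add: power_divide)
    finally have "qform p (entries S) (\<lambda>i. 1 / sqrt N * x i) \<in> R"
      unfolding R_def by (intro CollectI exI[of _ "\<lambda>i. 1 / sqrt N * x i"] conjI refl)
    then have "\<mu> \<le> qform p (entries S) (\<lambda>i. 1 / sqrt N * x i)"
      unfolding \<mu>_def using bdd by (rule cInf_lower)
    also have "\<dots> = qform p (entries S) x / N"
      unfolding qform_scale using N by (simp add: power_divide)
    finally show ?thesis using N by (simp add: N_def field_simps)
  qed
  define M where "M = S - \<mu> \<cdot>\<^sub>m 1\<^sub>m p"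
  have M: "M \<in> carrier_mat p p" using S unfolding M_def by (intro minus_carrier_mat) auto
  have Mij: "M $$ (i, j) = S $$ (i, j) - (if i = j then \<mu> else 0)" if "i < p" "j < p" for i j
    using that S by (auto simp: M_def)
  have symM: "M $$ (i, j) = M $$ (j, i)" if "i < p" "j < p" for i j
    using symS that by (auto simp: Mij)
  have qM: "qform p (entries M) x = qform p (entries S) x - \<mu> * (\<Sum>i<p. (x i)\<^sup>2)" for x
  proof -
    have "qform p (entries M) x
        = (\<Sum>i<p. \<Sum>j<p. x i * S $$ (i, j) * x j - (if i = j then \<mu> * (x i)\<^sup>2 else 0))"
      unfolding bform_def by (intro sum.cong refl) (auto simp: Mij algebra_simps power2_eq_square)
    then show ?thesis
      unfolding bform_def by (simp add: sum_subtractf sum_distrib_left sum.delta)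
  qed
  have psd: "qform p (entries M) x \<ge> 0" for x using low[of x] by (simp add: qM)
  have "\<mu> \<in> spectrum S"
  proof (rule ccontr)
    assume "\<mu> \<notin> spectrum S"
    with eigenvalueI_det[OF S] have "Determinant.det M \<noteq> 0" by (auto simp: M_def)
    then obtain C where C: "C \<in> carrier_mat p p" "C * M = 1\<^sub>m p"
      using left_inverse_exists[OF M] by metis
    \<comment> \<open>\<open>K\<close> bounds the form of \<open>M\<close> and \<open>K'\<close> the
      squared norm of its inverse; adding 1 makes both positive.\<close>
    define K where "K = (\<Sum>i<p. \<Sum>j<p. \<bar>M $$ (i, j)\<bar>) + 1"
    define K' where "K' = (\<Sum>i<p. \<Sum>j<p. (C $$ (i, j))\<^sup>2) + 1"
    have K: "K > 0" "K' > 0" by (auto simp: K_def K'_def intro!: add_nonneg_pos sum_nonneg)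
    have gap: "(\<Sum>i<p. (x i)\<^sup>2) / (K * K') \<le> qform p (entries M) x" for x
    proof -
      define y where "y i = (\<Sum>j<p. M $$ (i, j) * x j)" for i
      define Y where "Y = (\<Sum>i<p. (y i)\<^sup>2)"
      have Y0: "Y \<ge> 0" by (auto simp: Y_def intro: sum_nonneg)
      have yx: "bform p (entries M) x y = Y"
        by (subst bform_swap[OF symM]) (auto simp: bform_rows y_def[symmetric] Y_def power2_eq_square)
      have "0 \<le> qform p (entries M) (\<lambda>i. x i + (- 1 / K) * y i)" by (rule psd)
      also have "\<dots> = qform p (entries M) x - 2 / K * Y + (1 / K)\<^sup>2 * qform p (entries M) y"
        by (subst qform_add_scaled[OF symM]) (auto simp: yx power2_eq_square)
      also have "(1 / K)\<^sup>2 * qform p (entries M) y \<le> (1 / K)\<^sup>2 * (K * Y)"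
      proof (rule mult_left_mono)
        have "qform p (entries M) y \<le> (K - 1) * Y"
          using abs_qform_le[of p "entries M" y] by (simp add: K_def Y_def)
        also have "\<dots> \<le> K * Y" using Y0 by (intro mult_right_mono) auto
        finally show "qform p (entries M) y \<le> K * Y" .
      qed simp
      also have "(1 / K)\<^sup>2 * (K * Y) = Y / K" using K by (simp add: power2_eq_square)
      finally have 1: "Y / K \<le> qform p (entries M) x" by simp
      have xC: "x i = (\<Sum>j<p. C $$ (i, j) * y j)" if i: "i < p" for i
      proof -
        have "(\<Sum>j<p. C $$ (i, j) * y j) = (\<Sum>k<p. (\<Sum>j<p. C $$ (i, j) * M $$ (j, k)) * x k)"
          unfolding y_def sum_distrib_left sum_distrib_right
          by (subst sum.swap) (simp add: mult.assoc)
        also have "\<dots> = (\<Sum>k<p. (C * M) $$ (i, k) * x k)"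
          using i C(1) M by (intro sum.cong refl) (auto simp: scalar_prod_def lessThan_atLeast0)
        also have "\<dots> = x i" unfolding C(2) using i by (simp add: if_distrib if_distribR sum.delta cong: if_cong)
        finally show ?thesis by simp
      qed
      have "(\<Sum>i<p. (x i)\<^sup>2) = (\<Sum>i<p. (\<Sum>j<p. C $$ (i, j) * y j)\<^sup>2)"
        by (intro sum.cong) (use xC in auto)
      also have "\<dots> \<le> (\<Sum>i<p. (\<Sum>j<p. (C $$ (i, j))\<^sup>2) * Y)"
        unfolding Y_def by (intro sum_mono Cauchy_Schwarz_ineq_sum)
      also have "\<dots> = (K' - 1) * Y" by (simp add: K'_def sum_distrib_right)
      also have "\<dots> \<le> K' * Y" using Y0 by (intro mult_right_mono) auto
      finally have "(\<Sum>i<p. (x i)\<^sup>2) / (K * K') \<le> (K' * Y) / (K * K')"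
        using K by (intro divide_right_mono) auto
      also have "\<dots> = Y / K" using K by simp
      finally show ?thesis using 1 by linarith
    qed
    have "\<mu> + 1 / (K * K') \<le> Inf R"
    proof (rule cInf_greatest[OF ne])
      fix r assume "r \<in> R"
      then obtain x where x: "r = qform p (entries S) x" "(\<Sum>i<p. (x i)\<^sup>2) = 1" by (auto simp: R_def)
      show "\<mu> + 1 / (K * K') \<le> r" using gap[of x] unfolding qM x by simp
    qed
    then have "1 / (K * K') \<le> 0" by (simp add: \<mu>_def)
    moreover have "1 / (K * K') > 0" using K by simp
    ultimately show False by simp
  qed
  then show thesis using low that by blast
qed

text \<open>Negation exchanges the two ends of the spectrum: an eigenvector of \<open>- S\<close>
  for \<open>\<mu>\<close> is one of \<open>S\<close> for \<open>- \<mu>\<close>.\<close>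

lemma Rayleigh_upper:
  assumes S: "S \<in> carrier_mat p p" and sym: "transpose_mat S = S" and p: "p > 0"
  obtains \<mu> where "\<mu> \<in> spectrum S" "\<And>x. qform p (entries S) x \<le> \<mu> * (\<Sum>i<p. (x i)\<^sup>2)"
proof -
  have "transpose_mat (- S) = - S" using sym S by (metis transpose_uminus)
  then obtain \<mu> where mu: "\<mu> \<in> spectrum (- S)"
    and le: "\<And>x. \<mu> * (\<Sum>i<p. (x i)\<^sup>2) \<le> qform p (entries (- S)) x"
    using Rayleigh_lower[of "- S" p] S p by auto
  have q: "qform p (entries (- S)) x = - qform p (entries S) x" for x
    unfolding bform_def sum_negf[symmetric] using S by (intro sum.cong refl) auto
  from mu obtain v where v: "v \<in> carrier_vec p" "v \<noteq> 0\<^sub>v p" "(- S) *\<^sub>v v = \<mu> \<cdot>\<^sub>v v"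
    using S by (auto simp: spectrum_def eigenvalue_def eigenvector_def)
  have "S *\<^sub>v v = (- \<mu>) \<cdot>\<^sub>v v"
  proof (rule eq_vecI)
    fix i assume "i < dim_vec ((- \<mu>) \<cdot>\<^sub>v v)"
    then have i: "i < p" using v by auto
    have "(- S) *\<^sub>v v = - (S *\<^sub>v v)" using S v by auto
    then have "Matrix.vec_index ((- S) *\<^sub>v v) i = - (Matrix.vec_index (S *\<^sub>v v) i)" using i S v by simp
    then show "Matrix.vec_index (S *\<^sub>v v) i = Matrix.vec_index ((- \<mu>) \<cdot>\<^sub>v v) i" using i v by simp
  qed (use S v in auto)
  then have "- \<mu> \<in> spectrum S" using v S by (auto simp: spectrum_def eigenvalue_def eigenvector_def)
  moreover have "qform p (entries S) x \<le> - \<mu> * (\<Sum>i<p. (x i)\<^sup>2)" for x using le[of x] q[of x] by simp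
  ultimately show thesis using that by blast
qed

lemma eigenvalue_qform:
  fixes S :: "real mat"
  assumes S: "S \<in> carrier_mat p p" and mu: "\<mu> \<in> spectrum S"
  obtains x where "(\<Sum>i<p. (x i)\<^sup>2) > 0" "qform p (entries S) x = \<mu> * (\<Sum>i<p. (x i)\<^sup>2)"
proof -
  from mu obtain v where v: "v \<in> carrier_vec p" "v \<noteq> 0\<^sub>v p" "S *\<^sub>v v = \<mu> \<cdot>\<^sub>v v"
    using S by (auto simp: spectrum_def eigenvalue_def eigenvector_def)
  have "\<exists>i<p. Matrix.vec_index v i \<noteq> 0" using v(1,2) by auto
  then have "(\<Sum>i<p. (Matrix.vec_index v i)\<^sup>2) > 0" by (auto intro!: sum_pos2)
  moreover have "(\<Sum>j<p. S $$ (i, j) * Matrix.vec_index v j) = \<mu> * Matrix.vec_index v i" if i: "i < p" for i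
  proof -
    have "Matrix.vec_index (S *\<^sub>v v) i = (\<Sum>j<p. S $$ (i, j) * Matrix.vec_index v j)"
      using S v(1) i by (auto simp: scalar_prod_def lessThan_atLeast0)
    then show ?thesis using v i by simp
  qed
  then have "qform p (entries S) (\<lambda>i. Matrix.vec_index v i) = \<mu> * (\<Sum>i<p. (Matrix.vec_index v i)\<^sup>2)"
    unfolding bform_rows by (simp add: sum_distrib_left power2_eq_square mult.left_commute)
  ultimately show thesis using that by blast
qed

text \<open>Replaces the spectral conditions, stated with \<open>Min\<close> and \<open>Max\<close>
  of a finite set, by bounds valid for every \<open>x\<close>; this is the shape in which the
  covariance condition is used later.\<close>

lemma param_space_qform:
  assumes "(\<beta>, \<Sigma>, \<sigma>) \<in> param_space M1 M2 p k" and "p > 0"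
  shows "(1 / M1) * (\<Sum>i<p. (x i)\<^sup>2) \<le> qform p (entries \<Sigma>) x"
    and "qform p (entries \<Sigma>) x \<le> M1 * (\<Sum>i<p. (x i)\<^sup>2)"
proof -
  from assms have S: "\<Sigma> \<in> carrier_mat p p" and sym: "transpose_mat \<Sigma> = \<Sigma>"
    and mn: "1 / M1 \<le> lambda_min \<Sigma>" and mx: "lambda_max \<Sigma> \<le> M1" by (auto simp: param_space_def)
  note fin = card_finite_spectrum(1)[OF S]
  have N: "0 \<le> (\<Sum>i<p. (x i)\<^sup>2)" by (simp add: sum_nonneg)
  obtain \<mu> where "\<mu> \<in> spectrum \<Sigma>" and le: "\<mu> * (\<Sum>i<p. (x i)\<^sup>2) \<le> qform p (entries \<Sigma>) x"
    using Rayleigh_lower[OF S sym assms(2)] by metis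
  then have "1 / M1 \<le> \<mu>" using mn Min_le[OF fin, of \<mu>] by (simp add: lambda_min_def)
  from mult_right_mono[OF this N] le show "(1 / M1) * (\<Sum>i<p. (x i)\<^sup>2) \<le> qform p (entries \<Sigma>) x" by simp
  obtain \<nu> where "\<nu> \<in> spectrum \<Sigma>" and le: "qform p (entries \<Sigma>) x \<le> \<nu> * (\<Sum>i<p. (x i)\<^sup>2)"
    using Rayleigh_upper[OF S sym assms(2)] by metis
  then have "\<nu> \<le> M1" using mx Max_ge[OF fin, of \<nu>] by (simp add: lambda_max_def)
  from mult_right_mono[OF this N] le show "qform p (entries \<Sigma>) x \<le> M1 * (\<Sum>i<p. (x i)\<^sup>2)" by simp
qed

lemma param_spaceI:
  assumes "\<beta> \<in> carrier_vec p" "\<Sigma> \<in> carrier_mat p p" "transpose_mat \<Sigma> = \<Sigma>" "l0_norm \<beta> \<le> k"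
    "0 < \<sigma>" "\<sigma> \<le> M2" "p > 0"
    and lo: "\<And>x. (1 / M1) * (\<Sum>i<p. (x i)\<^sup>2) \<le> qform p (entries \<Sigma>) x"
    and up: "\<And>x. qform p (entries \<Sigma>) x \<le> M1 * (\<Sum>i<p. (x i)\<^sup>2)"
  shows "(\<beta>, \<Sigma>, \<sigma>) \<in> param_space M1 M2 p k"
proof -
  note fin = card_finite_spectrum(1)[OF assms(2)]
  \<comment> \<open>\<open>Min\<close> and \<open>Max\<close> say nothing about an empty set, so a
    real eigenvalue must first be exhibited; symmetry provides one.\<close>
  have ne: "spectrum \<Sigma> \<noteq> {}" using Rayleigh_lower[OF assms(2,3,7)] by auto
  have "1 / M1 \<le> \<mu> \<and> \<mu> \<le> M1" if mu: "\<mu> \<in> spectrum \<Sigma>" for \<mu>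
  proof -
    obtain x where x: "(\<Sum>i<p. (x i)\<^sup>2) > 0" "qform p (entries \<Sigma>) x = \<mu> * (\<Sum>i<p. (x i)\<^sup>2)"
      using eigenvalue_qform[OF assms(2) mu] by metis
    have "1 / M1 * (\<Sum>i<p. (x i)\<^sup>2) \<le> \<mu> * (\<Sum>i<p. (x i)\<^sup>2)" "\<mu> * (\<Sum>i<p. (x i)\<^sup>2) \<le> M1 * (\<Sum>i<p. (x i)\<^sup>2)"
      using lo[of x] up[of x] unfolding x(2) by auto
    with x(1) show ?thesis by (metis mult_le_cancel_right_pos)
  qed
  then have "1 / M1 \<le> lambda_min \<Sigma>" "lambda_max \<Sigma> \<le> M1"
    unfolding lambda_min_def lambda_max_def using Min_in[OF fin ne] Max_in[OF fin ne] by blast+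
  moreover have "lambda_min \<Sigma> \<le> lambda_max \<Sigma>"
    unfolding lambda_min_def lambda_max_def using Min_le[OF fin Max_in[OF fin ne]] .
  ultimately show ?thesis using assms(1-6) by (simp add: param_space_def)
qed

text \<open>Induction by elimination of the first coordinate. A triangular factor is preferred to a
  symmetric root because the substitution \<open>x = L g\<close> can then be carried out one
  coordinate at a time.\<close>

lemma Cholesky_exists:
  fixes S :: "nat \<Rightarrow> nat \<Rightarrow> real"
  assumes "\<And>i j. i < p \<Longrightarrow> j < p \<Longrightarrow> S i j = S j i"
    and "\<And>x. (\<exists>i<p. x i \<noteq> 0) \<Longrightarrow> qform p S x > 0"
  obtains L where "\<And>i. i < p \<Longrightarrow> L i i > 0" "\<And>i j. i < j \<Longrightarrow> L i j = 0"
    "\<And>i j. i < p \<Longrightarrow> j < p \<Longrightarrow> S i j = (\<Sum>k<p. L i k * L j k)"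
  using assms
proof (induction p arbitrary: S thesis)
  case 0
  show ?case by (rule "0.prems"(1)[of "\<lambda>_ _. 0"]) auto
next
  case (Suc p)
  note sym = Suc.prems(2) and pd = Suc.prems(3)
  define \<alpha> where "\<alpha> = S 0 0"
  have "qform (Suc p) S (\<lambda>i. if i = 0 then 1 else 0) = \<alpha>"
    unfolding bform_def sum.lessThan_Suc_shift by (simp add: \<alpha>_def)
  with pd[of "\<lambda>i. if i = 0 then 1 else 0"] have \<alpha>: "\<alpha> > 0" by auto
  \<comment> \<open>The Schur complement of the entry \<open>\<alpha>\<close>.\<close>
  define T where "T i j = S (Suc i) (Suc j) - S (Suc i) 0 * S (Suc j) 0 / \<alpha>" for i j
  have T: "qform p T x > 0" if ex: "\<exists>i<p. x i \<noteq> 0" for x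
  proof -
    define t where "t = (\<Sum>i<p. x i * S (Suc i) 0)"
    \<comment> \<open>The first coordinate \<open>- t / \<alpha>\<close> minimizes the form of
      \<open>S\<close> over all extensions of \<open>x\<close>; the minimum is the form of
      \<open>T\<close> at \<open>x\<close>, which is therefore positive.\<close>
    define z where "z i = (case i of 0 \<Rightarrow> - t / \<alpha> | Suc i \<Rightarrow> x i)" for i
    obtain i where "i < p" "x i \<noteq> 0" using ex by blast
    then have "\<exists>i<Suc p. z i \<noteq> 0" by (intro exI[of _ "Suc i"]) (simp add: z_def)
    then have "0 < qform (Suc p) S z" by (rule pd)
    also have "qform (Suc p) S z = (- t / \<alpha>) * \<alpha> * (- t / \<alpha>) + (\<Sum>j<p. (- t / \<alpha>) * S 0 (Suc j) * x j)
        + (\<Sum>i<p. x i * S (Suc i) 0 * (- t / \<alpha>)) + (\<Sum>i<p. \<Sum>j<p. x i * S (Suc i) (Suc j) * x j)"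
      unfolding bform_def sum.lessThan_Suc_shift z_def \<alpha>_def by (simp add: sum.distrib sum_subtractf sum_negf)
    also have "(\<Sum>j<p. (- t / \<alpha>) * S 0 (Suc j) * x j) = (- t / \<alpha>) * t"
      unfolding t_def sum_distrib_left by (intro sum.cong refl) (use sym[of 0 "Suc _"] in \<open>auto simp: mult_ac\<close>)
    also have "(\<Sum>i<p. x i * S (Suc i) 0 * (- t / \<alpha>)) = t * (- t / \<alpha>)"
      unfolding t_def sum_distrib_right ..
    also have "(\<Sum>i<p. \<Sum>j<p. x i * S (Suc i) (Suc j) * x j) = qform p T x + t * t / \<alpha>"
    proof -
      have "t * t / \<alpha> = (\<Sum>i<p. \<Sum>j<p. x i * (S (Suc i) 0 * S (Suc j) 0 / \<alpha>) * x j)"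
        unfolding t_def sum_product sum_divide_distrib by (simp add: mult_ac)
      then show ?thesis unfolding bform_def T_def
        by (simp add: sum_subtractf right_diff_distrib left_diff_distrib)
    qed
    finally show ?thesis using \<alpha> by (simp add: field_simps)
  qed
  have symT: "T i j = T j i" if "i < p" "j < p" for i j using sym[of "Suc i" "Suc j"] that by (simp add: T_def)
  obtain L where L: "\<And>i. i < p \<Longrightarrow> L i i > 0" "\<And>i j. i < j \<Longrightarrow> L i j = 0"
    "\<And>i j. i < p \<Longrightarrow> j < p \<Longrightarrow> T i j = (\<Sum>k<p. L i k * L j k)"
    using Suc.IH[of T] symT T by blast
  define L' where "L' i j = (case j of 0 \<Rightarrow> S i 0 / sqrt \<alpha> | Suc j \<Rightarrow> (case i of 0 \<Rightarrow> 0 | Suc i \<Rightarrow> L i j))" for i j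
  show ?case
  proof (rule Suc.prems(1)[of L'])
    show "L' i i > 0" if "i < Suc p" for i
      using that L(1) \<alpha> by (cases i) (simp_all add: L'_def \<alpha>_def[symmetric])
    show "L' i j = 0" if "i < j" for i j
      using that L(2) by (auto simp: L'_def split: nat.split)
    show "S i j = (\<Sum>k<Suc p. L' i k * L' j k)" if ij: "i < Suc p" "j < Suc p" for i j
    proof -
      have "(\<Sum>k<Suc p. L' i k * L' j k) = S i 0 * S j 0 / \<alpha> + (\<Sum>k<p. L' i (Suc k) * L' j (Suc k))"
        unfolding sum.lessThan_Suc_shift using \<alpha> by (simp add: L'_def)
      moreover have "(\<Sum>k<p. L' i (Suc k) * L' j (Suc k)) = S i j - S i 0 * S j 0 / \<alpha>"
      proof (cases "i = 0 \<or> j = 0")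
        case True
        then show ?thesis using \<alpha> sym[OF ij] by (auto simp: L'_def \<alpha>_def)
      next
        case False
        then obtain i' j' where "i = Suc i'" "j = Suc j'" by (cases i; cases j) auto
        then show ?thesis using L(3)[of i' j'] ij by (simp add: L'_def T_def)
      qed
      ultimately show ?thesis by simp
    qed
  qed
qed

section \<open>Gaussian vectors\<close>

lemma PiM_density:
  fixes M :: "'i \<Rightarrow> 'a measure" and f :: "'i \<Rightarrow> 'a \<Rightarrow> ennreal"
  assumes I: "finite I" and M: "\<And>i. sigma_finite_measure (M i)"
    and D: "\<And>i. sigma_finite_measure (density (M i) (f i))"
    and f: "\<And>i. f i \<in> borel_measurable (M i)"
  shows "(\<Pi>\<^sub>M i\<in>I. density (M i) (f i)) = density (\<Pi>\<^sub>M i\<in>I. M i) (\<lambda>x. \<Prod>i\<in>I. f i (x i))"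
proof -
  interpret M: product_sigma_finite M by (rule product_sigma_finite.intro) (rule M)
  interpret D: product_sigma_finite "\<lambda>i. density (M i) (f i)" by (rule product_sigma_finite.intro) (rule D)
  have [measurable]: "(\<lambda>x. \<Prod>i\<in>I. f i (x i)) \<in> borel_measurable (\<Pi>\<^sub>M i\<in>I. M i)"
    using f by measurable
  show ?thesis
  proof (rule D.PiM_eqI[symmetric, OF I])
    show "sets (density (Pi\<^sub>M I M) (\<lambda>x. \<Prod>i\<in>I. f i (x i))) = sets (\<Pi>\<^sub>M i\<in>I. density (M i) (f i))"
      unfolding sets_density by (intro sets_PiM_cong) auto
    fix A assume "\<And>i. i \<in> I \<Longrightarrow> A i \<in> sets (density (M i) (f i))"
    then have A: "\<And>i. i \<in> I \<Longrightarrow> A i \<in> sets (M i)" by simp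
    then have AE: "Pi\<^sub>E I A \<in> sets (Pi\<^sub>M I M)" using I by (intro sets_PiM_I_finite) auto
    have "emeasure (density (Pi\<^sub>M I M) (\<lambda>x. \<Prod>i\<in>I. f i (x i))) (Pi\<^sub>E I A)
        = (\<integral>\<^sup>+x. (\<Prod>i\<in>I. f i (x i)) * indicator (Pi\<^sub>E I A) x \<partial>Pi\<^sub>M I M)"
      using AE by (simp add: emeasure_density)
    also have "\<dots> = (\<integral>\<^sup>+x. (\<Prod>i\<in>I. f i (x i) * indicator (A i) (x i)) \<partial>Pi\<^sub>M I M)"
    proof (rule nn_integral_cong)
      fix x assume x: "x \<in> space (Pi\<^sub>M I M)"
      have "indicator (Pi\<^sub>E I A) x = (\<Prod>i\<in>I. indicator (A i) (x i) :: ennreal)"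
      proof (cases "x \<in> Pi\<^sub>E I A")
        case True
        then show ?thesis by (auto simp: PiE_iff)
      next
        case False
        then obtain i where "i \<in> I" "x i \<notin> A i" using x by (auto simp: space_PiM PiE_iff)
        then have "(\<Prod>i\<in>I. indicator (A i) (x i) :: ennreal) = 0" using I by (intro prod_zero) (auto intro!: bexI[of _ i])
        with False show ?thesis by simp
      qed
      then show "(\<Prod>i\<in>I. f i (x i)) * indicator (Pi\<^sub>E I A) x = (\<Prod>i\<in>I. f i (x i) * indicator (A i) (x i))"
        by (simp add: prod.distrib)
    qed
    also have "\<dots> = (\<Prod>i\<in>I. \<integral>\<^sup>+x. f i x * indicator (A i) x \<partial>M i)"
      using I A f by (intro M.product_nn_integral_prod) auto
    also have "\<dots> = (\<Prod>i\<in>I. emeasure (density (M i) (f i)) (A i))"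
      using A f by (intro prod.cong) (auto simp: emeasure_density)
    finally show "emeasure (density (Pi\<^sub>M I M) (\<lambda>x. \<Prod>i\<in>I. f i (x i))) (Pi\<^sub>E I A)
        = (\<Prod>i\<in>I. emeasure (density (M i) (f i)) (A i))" .
  qed
qed

text \<open>Multiplication by \<open>L\<close>; the restriction keeps the image in the product
  space, whose points are \<open>undefined\<close> off \<open>{..<p}\<close>.\<close>

definition tri_map :: "nat \<Rightarrow> (nat \<Rightarrow> nat \<Rightarrow> real) \<Rightarrow> (nat \<Rightarrow> real) \<Rightarrow> nat \<Rightarrow> real" where
  "tri_map p L g = (\<lambda>i\<in>{..<p}. \<Sum>j<p. L i j * g j)"

lemma tri_map_measurable [measurable]:
  "tri_map p L \<in> (\<Pi>\<^sub>M i\<in>{..<p}. borel) \<rightarrow>\<^sub>M (\<Pi>\<^sub>M i\<in>{..<p}. borel)"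
  unfolding tri_map_def by measurable

lemma sets_PiM_lborel: "sets (\<Pi>\<^sub>M i\<in>I. lborel :: real measure) = sets (\<Pi>\<^sub>M i\<in>I. borel)"
  by (intro sets_PiM_cong) auto

text \<open>Among the rows up to \<open>p\<close> only row \<open>p\<close> involves coordinate
  \<open>p\<close>, and it does so affinely with slope \<open>L p p\<close>. Fubini and the
  one-dimensional substitution therefore yield one diagonal factor per coordinate.\<close>

lemma nn_integral_lower_triangular:
  fixes f :: "(nat \<Rightarrow> real) \<Rightarrow> ennreal"
  assumes "f \<in> borel_measurable (\<Pi>\<^sub>M i\<in>{..<p}. borel)"
    and "\<And>i. i < p \<Longrightarrow> L i i > 0" and tri: "\<And>i j. i < j \<Longrightarrow> L i j = 0"
  shows "(\<integral>\<^sup>+x. f x \<partial>(\<Pi>\<^sub>M i\<in>{..<p}. lborel))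
       = ennreal (\<Prod>i<p. L i i) * (\<integral>\<^sup>+x. f (tri_map p L x) \<partial>(\<Pi>\<^sub>M i\<in>{..<p}. lborel))"
  using assms(1,2)
proof (induction p arbitrary: f)
  case 0
  have [measurable_cong]: "sets (\<Pi>\<^sub>M i\<in>{}::nat set. lborel :: real measure) = sets (\<Pi>\<^sub>M i\<in>{}. borel)"
    by (rule sets_PiM_lborel)
  show ?case by (simp add: tri_map_def PiM_empty nn_integral_count_space_finite)
next
  case (Suc p)
  interpret product_sigma_finite "\<lambda>_::nat. lborel :: real measure" by standard
  have [measurable_cong]: "sets (\<Pi>\<^sub>M i\<in>I. lborel :: real measure) = sets (\<Pi>\<^sub>M i\<in>I. borel)" for I :: "nat set"
    by (rule sets_PiM_lborel)
  have ins: "{..<Suc p} = insert p {..<p}" by auto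
  have f[measurable]: "f \<in> borel_measurable (\<Pi>\<^sub>M i\<in>insert p {..<p}. borel)"
    using Suc.prems(1) unfolding ins .
  have upd[measurable]: "(\<lambda>(x, y). x(p := y)) \<in> (\<Pi>\<^sub>M i\<in>{..<p}. borel :: real measure) \<Otimes>\<^sub>M borel \<rightarrow>\<^sub>M (\<Pi>\<^sub>M i\<in>insert p {..<p}. borel)"
    by (rule measurable_add_dim)
  define g where "g x = (\<integral>\<^sup>+y. f (x(p := y)) \<partial>lborel)" for x
  have fu[measurable]: "(\<lambda>(x, y). f (x(p := y))) \<in> borel_measurable ((\<Pi>\<^sub>M i\<in>{..<p}. borel) \<Otimes>\<^sub>M lborel)"
    using measurable_compose[OF upd f] by (simp add: split_beta')
  have g[measurable]: "g \<in> borel_measurable (\<Pi>\<^sub>M i\<in>{..<p}. borel)"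
    unfolding g_def by measurable
  have Lp: "L p p > 0" using Suc.prems(2) by simp
  have "(\<integral>\<^sup>+x. f x \<partial>(\<Pi>\<^sub>M i\<in>{..<Suc p}. lborel)) = (\<integral>\<^sup>+x. g x \<partial>(\<Pi>\<^sub>M i\<in>{..<p}. lborel))"
    unfolding ins g_def by (rule product_nn_integral_insert) auto
  also have "\<dots> = ennreal (\<Prod>i<p. L i i) * (\<integral>\<^sup>+x. g (tri_map p L x) \<partial>(\<Pi>\<^sub>M i\<in>{..<p}. lborel))"
    using Suc.prems(2) by (intro Suc.IH g) auto
  also have "(\<integral>\<^sup>+x. g (tri_map p L x) \<partial>(\<Pi>\<^sub>M i\<in>{..<p}. lborel))
      = (\<integral>\<^sup>+x. ennreal (L p p) * (\<integral>\<^sup>+y. f (tri_map (Suc p) L (x(p := y))) \<partial>lborel) \<partial>(\<Pi>\<^sub>M i\<in>{..<p}. lborel))"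
  proof (rule nn_integral_cong)
    fix x assume x: "x \<in> space (\<Pi>\<^sub>M i\<in>{..<p}. lborel :: real measure)"
    have T: "tri_map p L x \<in> space (\<Pi>\<^sub>M i\<in>{..<p}. borel)" by (auto simp: tri_map_def space_PiM)
    have fT: "(\<lambda>y. f ((tri_map p L x)(p := y))) \<in> borel_measurable borel"
      using measurable_compose[OF measurable_Pair1'[OF T] fu] by simp
    have eq: "tri_map (Suc p) L (x(p := y)) = (tri_map p L x)(p := (\<Sum>j<p. L p j * x j) + L p p * y)" for y
    proof
      fix i
      consider "i < p" | "i = p" | "i > p" by linarith
      then show "tri_map (Suc p) L (x(p := y)) i = ((tri_map p L x)(p := (\<Sum>j<p. L p j * x j) + L p p * y)) i"
        by cases (auto simp: tri_map_def tri)
    qed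
    have "g (tri_map p L x) = ennreal (L p p) * (\<integral>\<^sup>+y. f ((tri_map p L x)(p := (\<Sum>j<p. L p j * x j) + L p p * y)) \<partial>lborel)"
      unfolding g_def using Lp fT by (subst nn_integral_real_affine[where c="L p p" and t="\<Sum>j<p. L p j * x j"]) auto
    then show "g (tri_map p L x) = ennreal (L p p) * (\<integral>\<^sup>+y. f (tri_map (Suc p) L (x(p := y))) \<partial>lborel)"
      unfolding eq .
  qed
  also have "\<dots> = ennreal (L p p) * (\<integral>\<^sup>+x. (\<integral>\<^sup>+y. f (tri_map (Suc p) L (x(p := y))) \<partial>lborel) \<partial>(\<Pi>\<^sub>M i\<in>{..<p}. lborel))"
  proof (rule nn_integral_cmult)
    have [measurable]: "f \<in> borel_measurable (\<Pi>\<^sub>M i\<in>{..<Suc p}. borel)" by (rule Suc.prems)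
    have "(\<lambda>z. f (tri_map (Suc p) L z)) \<in> borel_measurable (\<Pi>\<^sub>M i\<in>{..<Suc p}. borel)" by measurable
    then have m: "(\<lambda>z. f (tri_map (Suc p) L z)) \<in> borel_measurable (\<Pi>\<^sub>M i\<in>insert p {..<p}. borel)" unfolding ins .
    have "(\<lambda>(x, y). f (tri_map (Suc p) L (x(p := y)))) \<in> borel_measurable ((\<Pi>\<^sub>M i\<in>{..<p}. borel) \<Otimes>\<^sub>M lborel)"
      using measurable_compose[OF upd m] by (simp add: split_beta')
    then show "(\<lambda>x. \<integral>\<^sup>+y. f (tri_map (Suc p) L (x(p := y))) \<partial>lborel) \<in> borel_measurable (\<Pi>\<^sub>M i\<in>{..<p}. lborel)"
      by measurable
  qed
  also have "(\<integral>\<^sup>+x. (\<integral>\<^sup>+y. f (tri_map (Suc p) L (x(p := y))) \<partial>lborel) \<partial>(\<Pi>\<^sub>M i\<in>{..<p}. lborel))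
     = (\<integral>\<^sup>+x. f (tri_map (Suc p) L x) \<partial>(\<Pi>\<^sub>M i\<in>{..<Suc p}. lborel))"
  proof -
    have [measurable]: "f \<in> borel_measurable (\<Pi>\<^sub>M i\<in>{..<Suc p}. borel)" by (rule Suc.prems)
    have "(\<lambda>z. f (tri_map (Suc p) L z)) \<in> borel_measurable (\<Pi>\<^sub>M i\<in>{..<Suc p}. lborel)" by measurable
    then show ?thesis unfolding ins by (subst product_nn_integral_insert) auto
  qed
  finally show ?case
    using Suc.prems(2) by (simp add: ennreal_mult' prod_nonneg less_imp_le mult.assoc mult.left_commute mult.commute)
qed

abbreviation "gauss \<equiv> std_normal_distribution"

lemma nn_integral_gauss_scale:
  assumes [measurable]: "F \<in> borel_measurable borel" and a: "a \<noteq> 0"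
  shows "(\<integral>\<^sup>+z. F (a * z) \<partial>gauss) = (\<integral>\<^sup>+u. ennreal (normal_density 0 \<bar>a\<bar> u) * F u \<partial>lborel)"
proof -
  have "(\<integral>\<^sup>+u. ennreal (normal_density 0 \<bar>a\<bar> u) * F u \<partial>lborel)
      = \<bar>a\<bar> * (\<integral>\<^sup>+z. ennreal (normal_density 0 \<bar>a\<bar> (0 + a * z)) * F (0 + a * z) \<partial>lborel)"
    using a by (intro nn_integral_real_affine) auto
  also have "\<dots> = (\<integral>\<^sup>+z. \<bar>a\<bar> * (ennreal (normal_density 0 \<bar>a\<bar> (0 + a * z)) * F (0 + a * z)) \<partial>lborel)"
    by (rule nn_integral_cmult[symmetric]) measurable
  also have "\<dots> = (\<integral>\<^sup>+z. ennreal (std_normal_density z) * F (a * z) \<partial>lborel)"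
  proof (rule nn_integral_cong)
    fix z
    have "\<bar>a\<bar> * normal_density 0 \<bar>a\<bar> (a * z) = std_normal_density z"
      using a by (simp add: normal_density_def real_sqrt_mult power_mult_distrib field_simps)
    then show "ennreal \<bar>a\<bar> * (ennreal (normal_density 0 \<bar>a\<bar> (0 + a * z)) * F (0 + a * z))
        = ennreal (std_normal_density z) * F (a * z)"
      by (simp add: mult.assoc[symmetric] ennreal_mult[symmetric])
  qed
  finally show ?thesis by (simp add: nn_integral_density)
qed

text \<open>For nonzero coefficients this is the convolution formula for centered normal densities
  with standard deviations \<open>\<bar>a\<bar>\<close> and \<open>\<bar>b\<bar>\<close>. A zero
  coefficient has no density and is treated apart, its partner's sign being removed by
  symmetry.\<close>

lemma nn_integral_gauss_pair:
  fixes F :: "real \<Rightarrow> ennreal"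
  assumes F[measurable]: "F \<in> borel_measurable borel"
  shows "(\<integral>\<^sup>+y. \<integral>\<^sup>+z. F (c + a * y + b * z) \<partial>gauss \<partial>gauss) = (\<integral>\<^sup>+z. F (c + sqrt (a\<^sup>2 + b\<^sup>2) * z) \<partial>gauss)"
proof -
  interpret G: prob_space gauss by (rule prob_space_normal_density) simp
  have abs: "(\<integral>\<^sup>+z. F (c + a * z) \<partial>gauss) = (\<integral>\<^sup>+z. F (c + \<bar>a\<bar> * z) \<partial>gauss)" for a
  proof (cases "a = 0")
    case False
    have "(\<integral>\<^sup>+z. F (c + a * z) \<partial>gauss) = (\<integral>\<^sup>+u. ennreal (normal_density 0 \<bar>a\<bar> u) * F (c + u) \<partial>lborel)"
      using False by (intro nn_integral_gauss_scale[of "\<lambda>u. F (c + u)"]) auto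
    also have "\<dots> = (\<integral>\<^sup>+z. F (c + \<bar>a\<bar> * z) \<partial>gauss)"
      using False nn_integral_gauss_scale[of "\<lambda>u. F (c + u)" "\<bar>a\<bar>"] by auto
    finally show ?thesis .
  qed simp
  consider "a = 0" | "b = 0" | "a \<noteq> 0" "b \<noteq> 0" by blast
  then show ?thesis
  proof cases
    case 1
    then show ?thesis using abs[of b] G.emeasure_space_1 by (simp add: real_sqrt_abs)
  next
    case 2
    then show ?thesis using abs[of a] G.emeasure_space_1 by (simp add: real_sqrt_abs)
  next
    case 3
    let ?n = "\<lambda>s u. ennreal (normal_density 0 s u)"
    have "(\<integral>\<^sup>+y. \<integral>\<^sup>+z. F (c + a * y + b * z) \<partial>gauss \<partial>gauss)
        = (\<integral>\<^sup>+y. (\<integral>\<^sup>+t. ?n \<bar>b\<bar> t * F (c + a * y + t) \<partial>lborel) \<partial>gauss)"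
      by (intro nn_integral_cong nn_integral_gauss_scale[of "\<lambda>t. F (c + a * y + t)" b for y] 3) auto
    also have "\<dots> = (\<integral>\<^sup>+u. ?n \<bar>a\<bar> u * (\<integral>\<^sup>+t. ?n \<bar>b\<bar> t * F (c + u + t) \<partial>lborel) \<partial>lborel)"
      by (intro nn_integral_gauss_scale[of "\<lambda>u. \<integral>\<^sup>+t. ?n \<bar>b\<bar> t * F (c + u + t) \<partial>lborel"] 3) measurable
    also have "\<dots> = (\<integral>\<^sup>+u. ?n \<bar>a\<bar> u * (\<integral>\<^sup>+t. ?n \<bar>b\<bar> (t - u) * F (c + t) \<partial>lborel) \<partial>lborel)"
    proof (rule nn_integral_cong)
      fix u :: real
      have "(\<integral>\<^sup>+t. ?n \<bar>b\<bar> t * F (c + u + t) \<partial>lborel) = (\<integral>\<^sup>+t. ?n \<bar>b\<bar> (t - u) * F (c + t) \<partial>lborel)"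
        by (subst nn_integral_real_affine[where c=1 and t="- u" and f="\<lambda>t. ?n \<bar>b\<bar> t * F (c + u + t)"])
           (auto simp: algebra_simps)
      then show "?n \<bar>a\<bar> u * (\<integral>\<^sup>+t. ?n \<bar>b\<bar> t * F (c + u + t) \<partial>lborel)
          = ?n \<bar>a\<bar> u * (\<integral>\<^sup>+t. ?n \<bar>b\<bar> (t - u) * F (c + t) \<partial>lborel)" by simp
    qed
    also have "\<dots> = (\<integral>\<^sup>+u. \<integral>\<^sup>+t. ?n \<bar>a\<bar> u * (?n \<bar>b\<bar> (t - u) * F (c + t)) \<partial>lborel \<partial>lborel)"
      by (intro nn_integral_cong nn_integral_cmult[symmetric]) measurable
    also have "\<dots> = (\<integral>\<^sup>+t. \<integral>\<^sup>+u. ?n \<bar>a\<bar> u * (?n \<bar>b\<bar> (t - u) * F (c + t)) \<partial>lborel \<partial>lborel)"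
      by (rule lborel_pair.Fubini') measurable
    also have "\<dots> = (\<integral>\<^sup>+t. (\<integral>\<^sup>+u. ennreal (normal_density 0 \<bar>b\<bar> (t - u) * normal_density 0 \<bar>a\<bar> u) \<partial>lborel) * F (c + t) \<partial>lborel)"
      by (intro nn_integral_cong, subst nn_integral_multc[symmetric])
         (auto simp: ennreal_mult' mult_ac)
    also have "\<dots> = (\<integral>\<^sup>+t. ?n (sqrt (\<bar>b\<bar>\<^sup>2 + \<bar>a\<bar>\<^sup>2)) t * F (c + t) \<partial>lborel)"
      using conv_normal_density_zero_mean[of "\<bar>b\<bar>" "\<bar>a\<bar>"] 3 by (simp add: fun_eq_iff)
    also have "\<dots> = (\<integral>\<^sup>+z. F (c + sqrt (a\<^sup>2 + b\<^sup>2) * z) \<partial>gauss)"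
    proof -
      have pos: "a\<^sup>2 + b\<^sup>2 > 0" using 3 by (simp add: sum_power2_gt_zero_iff)
      have "sqrt (a\<^sup>2 + b\<^sup>2) \<noteq> 0" using pos unfolding real_sqrt_eq_zero_cancel_iff by linarith
      then show ?thesis
        using nn_integral_gauss_scale[of "\<lambda>u. F (c + u)" "sqrt (a\<^sup>2 + b\<^sup>2)"] by (simp add: add.commute)
    qed
    finally show ?thesis .
  qed
qed

lemma sets_PiM_gauss: "sets (\<Pi>\<^sub>M i\<in>I. gauss) = sets (\<Pi>\<^sub>M i\<in>I. borel :: real measure)"
  by (intro sets_PiM_cong) auto

lemma nn_integral_gauss_linear:
  fixes F :: "real \<Rightarrow> ennreal" and a :: "nat \<Rightarrow> real"
  assumes [measurable]: "F \<in> borel_measurable borel"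
  shows "(\<integral>\<^sup>+g. F (c + (\<Sum>i<p. a i * g i)) \<partial>(\<Pi>\<^sub>M i\<in>{..<p}. gauss)) = (\<integral>\<^sup>+z. F (c + sqrt (\<Sum>i<p. (a i)\<^sup>2) * z) \<partial>gauss)"
proof (induction p arbitrary: c)
  case 0
  interpret G: prob_space gauss by (rule prob_space_normal_density) simp
  show ?case using G.emeasure_space_1 by (simp add: PiM_empty nn_integral_count_space_finite)
next
  case (Suc p)
  interpret G: prob_space gauss by (rule prob_space_normal_density) simp
  interpret product_sigma_finite "\<lambda>_::nat. gauss" by standard
  have [measurable_cong]: "sets (\<Pi>\<^sub>M i\<in>I. gauss) = sets (\<Pi>\<^sub>M i\<in>I. borel)" for I :: "nat set"
    by (rule sets_PiM_gauss)
  have ins: "{..<Suc p} = insert p {..<p}" by auto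
  have "(\<integral>\<^sup>+g. F (c + (\<Sum>i<Suc p. a i * g i)) \<partial>(\<Pi>\<^sub>M i\<in>{..<Suc p}. gauss))
     = (\<integral>\<^sup>+y. (\<integral>\<^sup>+g. F (c + (\<Sum>i<Suc p. a i * (g(p := y)) i)) \<partial>(\<Pi>\<^sub>M i\<in>{..<p}. gauss)) \<partial>gauss)"
    unfolding ins by (rule product_nn_integral_insert_rev) (auto simp: ins[symmetric])
  also have "\<dots> = (\<integral>\<^sup>+y. (\<integral>\<^sup>+g. F ((c + a p * y) + (\<Sum>i<p. a i * g i)) \<partial>(\<Pi>\<^sub>M i\<in>{..<p}. gauss)) \<partial>gauss)"
    by (intro nn_integral_cong) (simp add: algebra_simps)
  also have "\<dots> = (\<integral>\<^sup>+y. (\<integral>\<^sup>+z. F (c + a p * y + sqrt (\<Sum>i<p. (a i)\<^sup>2) * z) \<partial>gauss) \<partial>gauss)"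
    unfolding Suc.IH ..
  also have "\<dots> = (\<integral>\<^sup>+z. F (c + sqrt ((a p)\<^sup>2 + (sqrt (\<Sum>i<p. (a i)\<^sup>2))\<^sup>2) * z) \<partial>gauss)"
    by (rule nn_integral_gauss_pair) measurable
  finally show ?case by (simp add: sum_nonneg add.commute)
qed

section \<open>Exponential moments and concentration of Gaussian squares\<close>

lemma nn_integral_gauss_exp_square:
  assumes "t < 1 / 2"
  shows "(\<integral>\<^sup>+z. ennreal (exp (t * z\<^sup>2)) \<partial>gauss) = ennreal (1 / sqrt (1 - 2 * t))"
proof -
  \<comment> \<open>The standard deviation for which the tilted standard density is \<open>s\<close>
    times a normal density.\<close>
  define s where "s = 1 / sqrt (1 - 2 * t)"
  have s: "s > 0" using assms by (simp add: s_def)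
  have s2: "1 / s\<^sup>2 = 1 - 2 * t" using assms by (simp add: s_def power_divide)
  interpret N: prob_space "density lborel (normal_density 0 s)" using s by (rule prob_space_normal_density)
  have *: "std_normal_density z * exp (t * z\<^sup>2) = s * normal_density 0 s z" for z
  proof -
    have "s * normal_density 0 s z = 1 / sqrt (2 * pi) * exp (- (z\<^sup>2 / 2) * (1 / s\<^sup>2))"
      using s by (simp add: normal_density_def real_sqrt_mult)
    also have "\<dots> = 1 / sqrt (2 * pi) * (exp (- z\<^sup>2 / 2) * exp (t * z\<^sup>2))"
    proof -
      have "- (z\<^sup>2 / 2) * (1 - 2 * t) = - z\<^sup>2 / 2 + t * z\<^sup>2" by (simp add: right_diff_distrib)
      then show ?thesis unfolding s2 exp_add[symmetric] by simp
    qed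
    finally show ?thesis by (simp add: normal_density_def)
  qed
  have "(\<integral>\<^sup>+z. ennreal (exp (t * z\<^sup>2)) \<partial>gauss) = (\<integral>\<^sup>+z. ennreal s * ennreal (normal_density 0 s z) \<partial>lborel)"
    using s by (simp add: nn_integral_density ennreal_mult[symmetric] *)
  also have "\<dots> = ennreal s * (\<integral>\<^sup>+z. ennreal (normal_density 0 s z) \<partial>lborel)"
    by (rule nn_integral_cmult) measurable
  also have "(\<integral>\<^sup>+z. ennreal (normal_density 0 s z) \<partial>lborel) = 1"
    using N.emeasure_space_1 by (simp add: emeasure_density)
  finally show ?thesis by (simp add: s_def)
qed

lemma nn_integral_gauss_exp:
  "(\<integral>\<^sup>+z. ennreal (exp (t * z)) \<partial>gauss) = ennreal (exp (t\<^sup>2 / 2))"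
proof -
  interpret N: prob_space "density lborel (normal_density t 1)" by (rule prob_space_normal_density) simp
  \<comment> \<open>Completing the square: exponential tilting only moves the mean to
    \<open>t\<close>.\<close>
  have *: "std_normal_density z * exp (t * z) = exp (t\<^sup>2 / 2) * normal_density t 1 z" for z
    by (simp add: normal_density_def exp_add[symmetric] power2_diff algebra_simps diff_divide_distrib add_divide_distrib)
  have "(\<integral>\<^sup>+z. ennreal (exp (t * z)) \<partial>gauss) = (\<integral>\<^sup>+z. ennreal (exp (t\<^sup>2 / 2)) * ennreal (normal_density t 1 z) \<partial>lborel)"
    by (simp add: nn_integral_density ennreal_mult[symmetric] *)
  also have "\<dots> = ennreal (exp (t\<^sup>2 / 2)) * (\<integral>\<^sup>+z. ennreal (normal_density t 1 z) \<partial>lborel)"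
    by (rule nn_integral_cmult) measurable
  also have "(\<integral>\<^sup>+z. ennreal (normal_density t 1 z) \<partial>lborel) = 1"
    using N.emeasure_space_1 by (simp add: emeasure_density)
  finally show ?thesis by simp
qed

lemma nn_integral_gauss_square: "(\<integral>\<^sup>+z. ennreal (z\<^sup>2) \<partial>gauss) = 1"
proof -
  have "has_bochner_integral lborel (\<lambda>x. std_normal_density x * x ^ (2 * 1)) (fact (2 * 1) / (2 ^ 1 * fact 1))"
    by (rule std_normal_moment_even)
  then have i: "integrable lborel (\<lambda>x. std_normal_density x * x\<^sup>2)" "(LBINT x. std_normal_density x * x\<^sup>2) = 1"
    by (auto simp: has_bochner_integral_iff)
  have "(\<integral>\<^sup>+z. ennreal (z\<^sup>2) \<partial>gauss) = (\<integral>\<^sup>+z. ennreal (std_normal_density z * z\<^sup>2) \<partial>lborel)"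
    by (simp add: nn_integral_density ennreal_mult[symmetric])
  also have "\<dots> = ennreal 1" using i by (subst nn_integral_eq_integral) auto
  finally show ?thesis by simp
qed

text \<open>The left side is the exponential moment of a centered squared normal variable. The bound
  comes from \<open>\<bar>ln (1 + y) - y\<bar> \<le> 2 * y\<^sup>2\<close> at
  \<open>y = - 2 * x\<close>, valid for \<open>\<bar>y\<bar> \<le> 1 / 2\<close>; hence the range of
  \<open>x\<close>.\<close>

lemma chi_square_mgf_bound:
  fixes x :: real
  assumes "\<bar>x\<bar> \<le> 1 / 4"
  shows "exp (- x) / sqrt (1 - 2 * x) \<le> exp (4 * x\<^sup>2)"
proof -
  have "\<bar>ln (1 + (- 2 * x)) - (- 2 * x)\<bar> \<le> 2 * (- 2 * x)\<^sup>2"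
    using assms by (intro abs_ln_one_plus_x_minus_x_bound) auto
  then have l: "- ln (1 - 2 * x) / 2 - x \<le> 4 * x\<^sup>2" by (simp add: power2_eq_square abs_le_iff)
  have pos: "1 - 2 * x > 0" using assms by auto
  have "sqrt (1 - 2 * x) = exp (ln (1 - 2 * x) / 2)"
    using pos by (simp add: ln_sqrt[symmetric])
  then have "exp (- x) / sqrt (1 - 2 * x) = exp (- x - ln (1 - 2 * x) / 2)"
    by (simp only: exp_diff)
  also have "\<dots> \<le> exp (4 * x\<^sup>2)" using l by simp
  finally show ?thesis .
qed

text \<open>Since \<open>v = 0\<close> is allowed, a centered Gaussian variable is described as a multiple of a standard one
  rather than by a density.\<close>

definition centered_gaussian :: "'a measure \<Rightarrow> ('a \<Rightarrow> real) \<Rightarrow> real \<Rightarrow> bool" where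
  "centered_gaussian N W v \<longleftrightarrow> W \<in> borel_measurable N \<and>
     (\<forall>F :: real \<Rightarrow> ennreal. F \<in> borel_measurable borel \<longrightarrow>
        (\<integral>\<^sup>+x. F (W x) \<partial>N) = (\<integral>\<^sup>+z. F (sqrt v * z) \<partial>gauss))"

lemma centered_gaussian_measurable: "centered_gaussian N W v \<Longrightarrow> W \<in> borel_measurable N"
  by (simp add: centered_gaussian_def)

lemma centered_gaussian_nn_integral:
  "centered_gaussian N W v \<Longrightarrow> F \<in> borel_measurable borel \<Longrightarrow>
    (\<integral>\<^sup>+x. F (W x) \<partial>N) = (\<integral>\<^sup>+z. F (sqrt v * z) \<partial>gauss)"
  by (simp add: centered_gaussian_def)

text \<open>Stated with an upper bound \<open>V\<close>, so that one range of \<open>s\<close>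
  serves all variances up to \<open>V\<close>, including zero.\<close>

lemma centered_gaussian_square_mgf:
  assumes W: "centered_gaussian N W v" and v: "0 \<le> v" "v \<le> V" and s: "\<bar>s\<bar> * V \<le> 1 / 4"
  shows "(\<integral>\<^sup>+x. ennreal (exp (s * ((W x)\<^sup>2 - v))) \<partial>N) \<le> ennreal (exp (4 * s\<^sup>2 * V\<^sup>2))"
proof -
  have sv: "\<bar>s * v\<bar> \<le> 1 / 4"
    using v s mult_left_mono[of v V "\<bar>s\<bar>"] by (simp add: abs_mult)
  have "(\<integral>\<^sup>+x. ennreal (exp (s * ((W x)\<^sup>2 - v))) \<partial>N) = (\<integral>\<^sup>+z. ennreal (exp (s * ((sqrt v * z)\<^sup>2 - v))) \<partial>gauss)"
    by (rule centered_gaussian_nn_integral[OF W]) measurable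
  also have "\<dots> = (\<integral>\<^sup>+z. ennreal (exp (- (s * v))) * ennreal (exp (s * v * z\<^sup>2)) \<partial>gauss)"
    using v by (intro nn_integral_cong)
      (simp add: ennreal_mult[symmetric] exp_add[symmetric] power_mult_distrib algebra_simps)
  also have "\<dots> = ennreal (exp (- (s * v))) * ennreal (1 / sqrt (1 - 2 * (s * v)))"
    using sv by (subst nn_integral_cmult) (auto simp: nn_integral_gauss_exp_square)
  also have "\<dots> = ennreal (exp (- (s * v)) / sqrt (1 - 2 * (s * v)))"
    using sv by (simp add: ennreal_mult[symmetric])
  also have "\<dots> \<le> ennreal (exp (4 * (s * v)\<^sup>2))"
    using chi_square_mgf_bound[OF sv] by (rule ennreal_leI)
  also have "\<dots> \<le> ennreal (exp (4 * s\<^sup>2 * V\<^sup>2))"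
    using v power_mono[of v V 2] mult_left_mono[of "v\<^sup>2" "V\<^sup>2" "s\<^sup>2"]
    by (intro ennreal_leI) (simp add: power_mult_distrib)
  finally show ?thesis .
qed

text \<open>Chernoff's method. The sign of \<open>s\<close> is free, and its two values give the two
  tails.\<close>

lemma chi_square_one_sided:
  fixes v V s A :: real
  assumes N: "prob_space N" and W: "centered_gaussian N W v" and v: "0 \<le> v" "v \<le> V"
    and s: "\<bar>s\<bar> * V \<le> 1 / 4"
  shows "emeasure (\<Pi>\<^sub>M i\<in>{..<n::nat}. N)
      {z \<in> space (\<Pi>\<^sub>M i\<in>{..<n}. N). A \<le> s * (\<Sum>i<n. (W (z i))\<^sup>2 - v)} \<le> ennreal (exp (4 * n * s\<^sup>2 * V\<^sup>2 - A))"
proof -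
  interpret N: prob_space N by fact
  interpret product_sigma_finite "\<lambda>_::nat. N" by standard
  let ?P = "\<Pi>\<^sub>M i\<in>{..<n}. N"
  have [measurable]: "W \<in> borel_measurable N" by (rule centered_gaussian_measurable[OF W])
  define u where "u z = ennreal (exp (s * (\<Sum>i<n. (W (z i))\<^sup>2 - v)))" for z
  have [measurable]: "u \<in> borel_measurable ?P" unfolding u_def by measurable
  have "emeasure ?P {z \<in> space ?P. A \<le> s * (\<Sum>i<n. (W (z i))\<^sup>2 - v)}
      = emeasure ?P {z \<in> space ?P. 1 \<le> ennreal (exp (- A)) * u z}"
  proof (intro arg_cong[where f="emeasure ?P"] Collect_cong conj_cong refl)
    fix z
    have "1 \<le> ennreal (exp (- A)) * u z \<longleftrightarrow> 1 \<le> exp (- A) * exp (s * (\<Sum>i<n. (W (z i))\<^sup>2 - v))"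
      unfolding u_def by (simp add: ennreal_mult[symmetric] flip: ennreal_1)
    then show "(A \<le> s * (\<Sum>i<n. (W (z i))\<^sup>2 - v)) = (1 \<le> ennreal (exp (- A)) * u z)"
      by (simp add: exp_add[symmetric])
  qed
  also have "\<dots> \<le> ennreal (exp (- A)) * (\<integral>\<^sup>+z. u z * indicator (space ?P) z \<partial>?P)"
    by (rule nn_integral_Markov_inequality) auto
  also have "(\<integral>\<^sup>+z. u z * indicator (space ?P) z \<partial>?P) = (\<integral>\<^sup>+z. u z \<partial>?P)"
    by (intro nn_integral_cong) auto
  also have "\<dots> = (\<integral>\<^sup>+z. (\<Prod>i<n. ennreal (exp (s * ((W (z i))\<^sup>2 - v)))) \<partial>?P)"
    unfolding u_def by (intro nn_integral_cong) (simp add: sum_distrib_left exp_sum prod_ennreal)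
  also have "\<dots> = (\<Prod>i<n. \<integral>\<^sup>+x. ennreal (exp (s * ((W x)\<^sup>2 - v))) \<partial>N)"
    by (rule product_nn_integral_prod) auto
  also have "\<dots> \<le> (\<Prod>i<n. ennreal (exp (4 * s\<^sup>2 * V\<^sup>2)))"
    using centered_gaussian_square_mgf[OF W v s] by (induction n) (auto intro: mult_mono)
  also have "\<dots> = ennreal (exp (4 * n * s\<^sup>2 * V\<^sup>2))"
    by (simp add: prod_ennreal ennreal_power exp_of_nat_mult[symmetric] mult_ac)
  also have "ennreal (exp (- A)) * ennreal (exp (4 * n * s\<^sup>2 * V\<^sup>2)) = ennreal (exp (4 * n * s\<^sup>2 * V\<^sup>2 - A))"
    by (simp add: ennreal_mult[symmetric] exp_add[symmetric])
  finally show ?thesis by (simp add: mult_left_mono)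
qed

lemma chi_square_concentration:
  fixes v V t :: real and n :: nat
  assumes N: "prob_space N" and W: "centered_gaussian N W v" and v: "0 \<le> v" "v \<le> V" and V: "V > 0"
    and t: "0 \<le> t" "t \<le> 2"
  shows "measure (\<Pi>\<^sub>M i\<in>{..<n}. N)
      {z \<in> space (\<Pi>\<^sub>M i\<in>{..<n}. N). n * V * t \<le> \<bar>(\<Sum>i<n. (W (z i))\<^sup>2) - n * v\<bar>} \<le> 2 * exp (- real n * t\<^sup>2 / 16)"
proof -
  interpret N: prob_space N by fact
  let ?P = "\<Pi>\<^sub>M i\<in>{..<n}. N"
  interpret P: prob_space ?P by (rule prob_space_PiM) (rule N)
  have [measurable]: "W \<in> borel_measurable N" by (rule centered_gaussian_measurable[OF W])
  \<comment> \<open>The value \<open>s = t / (8 * V)\<close> minimizes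
    \<open>4 * n * s\<^sup>2 * V\<^sup>2 - s * n * V * t\<close>. The level becomes
    \<open>n * t\<^sup>2 / 8\<close> and the Chernoff exponent
    \<open>n * t\<^sup>2 / 16 - n * t\<^sup>2 / 8\<close>; the condition \<open>t \<le> 2\<close> is
    \<open>\<bar>s\<bar> * V \<le> 1 / 4\<close>.\<close>
  define E where "E s = {z \<in> space ?P. n * t\<^sup>2 / 8 \<le> s * (\<Sum>i<n. (W (z i))\<^sup>2 - v)}" for s
  have [measurable]: "E s \<in> sets ?P" for s unfolding E_def by measurable
  have E: "measure ?P (E s) \<le> exp (- real n * t\<^sup>2 / 16)" if s: "\<bar>s\<bar> = t / (8 * V)" for s
  proof -
    have "s\<^sup>2 = (t / (8 * V))\<^sup>2" using s by (metis power2_abs)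
    then have "4 * n * s\<^sup>2 * V\<^sup>2 - n * t\<^sup>2 / 8 = - real n * t\<^sup>2 / 16"
      using V by (simp add: power_divide field_simps power_mult_distrib)
    moreover have "\<bar>s\<bar> * V \<le> 1 / 4" unfolding s using V t by simp
    ultimately have "emeasure ?P (E s) \<le> ennreal (exp (- real n * t\<^sup>2 / 16))"
      unfolding E_def using chi_square_one_sided[OF N W v, of s n "n * t\<^sup>2 / 8"] by simp
    then show ?thesis by (simp add: P.emeasure_eq_measure)
  qed
  have "{z \<in> space ?P. n * V * t \<le> \<bar>(\<Sum>i<n. (W (z i))\<^sup>2) - n * v\<bar>} \<subseteq> E (t / (8 * V)) \<union> E (- t / (8 * V))"
  proof
    fix z assume z: "z \<in> {z \<in> space ?P. n * V * t \<le> \<bar>(\<Sum>i<n. (W (z i))\<^sup>2) - n * v\<bar>}"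
    define D where "D = (\<Sum>i<n. (W (z i))\<^sup>2 - v)"
    have D: "(\<Sum>i<n. (W (z i))\<^sup>2) - n * v = D" by (simp add: D_def sum_subtractf)
    have nt: "n * t\<^sup>2 / 8 = t / (8 * V) * (n * V * t)" using V by (simp add: power2_eq_square)
    have "t / (8 * V) * (n * V * t) \<le> t / (8 * V) * \<bar>D\<bar>"
      using z t V by (intro mult_left_mono) (auto simp: D)
    then have "n * t\<^sup>2 / 8 \<le> t / (8 * V) * D \<or> n * t\<^sup>2 / 8 \<le> - t / (8 * V) * D"
      unfolding nt by (cases "D \<ge> 0") auto
    then show "z \<in> E (t / (8 * V)) \<union> E (- t / (8 * V))" using z by (auto simp: E_def D_def)
  qed
  then have "measure ?P {z \<in> space ?P. n * V * t \<le> \<bar>(\<Sum>i<n. (W (z i))\<^sup>2) - n * v\<bar>}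
      \<le> measure ?P (E (t / (8 * V)) \<union> E (- t / (8 * V)))"
    by (intro P.finite_measure_mono) auto
  also have "\<dots> \<le> measure ?P (E (t / (8 * V))) + measure ?P (E (- t / (8 * V)))"
    by (rule measure_Un_le) auto
  also have "\<dots> \<le> 2 * exp (- real n * t\<^sup>2 / 16)"
    using E[of "t / (8 * V)"] E[of "- t / (8 * V)"] t V by simp
  finally show ?thesis .
qed

lemma centered_gaussian_PiM:
  fixes a :: "nat \<Rightarrow> real"
  shows "centered_gaussian (\<Pi>\<^sub>M i\<in>{..<p}. gauss) (\<lambda>g. \<Sum>i<p. a i * g i) (\<Sum>i<p. (a i)\<^sup>2)"
  unfolding centered_gaussian_def
  using nn_integral_gauss_linear[where c=0 and a=a and p=p]
  by (auto intro!: borel_measurable_sum borel_measurable_times measurable_component_singleton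
      simp: measurable_cong_sets[OF sets_PiM_gauss refl])

lemma centered_gaussian_second_moment:
  assumes W: "centered_gaussian N W v" and v: "0 \<le> v"
  shows "(\<integral>\<^sup>+x. ennreal ((W x)\<^sup>2) \<partial>N) = ennreal v"
proof -
  have "(\<integral>\<^sup>+x. ennreal ((W x)\<^sup>2) \<partial>N) = (\<integral>\<^sup>+z. ennreal ((sqrt v * z)\<^sup>2) \<partial>gauss)"
    by (rule centered_gaussian_nn_integral[OF W]) measurable
  also have "\<dots> = (\<integral>\<^sup>+z. ennreal v * ennreal (z\<^sup>2) \<partial>gauss)"
    using v by (simp add: power_mult_distrib ennreal_mult)
  also have "\<dots> = ennreal v * (\<integral>\<^sup>+z. ennreal (z\<^sup>2) \<partial>gauss)"
    by (rule nn_integral_cmult) measurable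
  finally show ?thesis by (simp add: nn_integral_gauss_square)
qed

section \<open>Representation of \<open>mvn\<close> by a standard Gaussian vector\<close>

lemma prob_space_gauss: "prob_space gauss"
  by (rule prob_space_normal_density) simp

text \<open>The density of \<^const>\<open>mvn\<close> is that of \<open>L g\<close>, where \<open>\<Sigma> = L L\<^sup>T\<close> and \<open>g\<close> is standard Gaussian.\<close>

lemma mvn_density_tri_map:
  fixes S :: "real mat"
  assumes S: "S \<in> carrier_mat p p"
    and Lp: "\<And>i. i < p \<Longrightarrow> L i i > 0" and tri: "\<And>i j. i < j \<Longrightarrow> L i j = 0"
    and SL: "\<And>i j. i < p \<Longrightarrow> j < p \<Longrightarrow> S $$ (i, j) = (\<Sum>k<p. L i k * L j k)"
  shows "Matrix.scalar_prod (Matrix.vec p (tri_map p L g)) (the (mat_inverse S) *\<^sub>v Matrix.vec p (tri_map p L g))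
      = (\<Sum>i<p. (g i)\<^sup>2)"
    and "Determinant.det S = (\<Prod>i<p. L i i)\<^sup>2"
    and "\<exists>B. mat_inverse S = Some B \<and> B \<in> carrier_mat p p \<and> B * S = 1\<^sub>m p \<and> S * B = 1\<^sub>m p"
proof -
  define A where "A = Matrix.mat p p (\<lambda>(i, j). L i j)"
  have A: "A \<in> carrier_mat p p" by (simp add: A_def)
  have AT: "transpose_mat A \<in> carrier_mat p p" using A by simp
  have detA: "Determinant.det A = (\<Prod>i<p. L i i)"
  proof -
    have "Determinant.det A = prod_list (diag_mat A)"
      using tri by (intro det_lower_triangular[of p] A) (auto simp: A_def)
    also have "\<dots> = (\<Prod>i<p. L i i)"
      by (simp add: diag_mat_def A_def prod.list_conv_set_nth lessThan_atLeast0)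
    finally show ?thesis .
  qed
  have SA: "S = A * transpose_mat A"
    by (rule eq_matI) (use S in \<open>auto simp: A_def SL scalar_prod_def lessThan_atLeast0\<close>)
  show det: "Determinant.det S = (\<Prod>i<p. L i i)\<^sup>2"
    unfolding SA by (simp add: det_mult[OF A AT] det_transpose[OF A] detA power2_eq_square)
  have pos: "(\<Prod>i<p. L i i) > 0" using Lp by (intro prod_pos) auto
  then obtain B where B: "B \<in> carrier_mat p p" "B * S = 1\<^sub>m p" "S * B = 1\<^sub>m p" "mat_inverse S = Some B"
    using left_inverse_exists[OF S] unfolding det by (metis less_irrefl zero_less_power)
  then show "\<exists>B. mat_inverse S = Some B \<and> B \<in> carrier_mat p p \<and> B * S = 1\<^sub>m p \<and> S * B = 1\<^sub>m p" by blast
  obtain C where C: "C \<in> carrier_mat p p" "C * A = 1\<^sub>m p"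
    using left_inverse_exists[OF A] pos unfolding detA by (metis less_irrefl)
  define x where "x = Matrix.vec p (tri_map p L g)"
  define y where "y = Matrix.vec p g"
  have y: "y \<in> carrier_vec p" by (simp add: y_def)
  have xy: "x = A *\<^sub>v y"
    by (rule eq_vecI) (auto simp: x_def y_def A_def tri_map_def scalar_prod_def lessThan_atLeast0)
  have x: "x \<in> carrier_vec p" by (simp add: x_def)
  \<comment> \<open>Here \<open>z\<close> is the inverse of \<open>S\<close> applied to
    \<open>x\<close>. Cancelling \<open>A\<close> in \<open>A A\<^sup>T z = S z = x = A y\<close>
    gives \<open>A\<^sup>T z = y\<close>, so \<open>x \<bullet> z = y \<bullet> A\<^sup>T z\<close>
    is the squared norm of \<open>y\<close>.\<close>
  define z where "z = B *\<^sub>v x"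
  have z: "z \<in> carrier_vec p" using B x by (simp add: z_def)
  have "A *\<^sub>v (transpose_mat A *\<^sub>v z) = S *\<^sub>v z" unfolding SA using A AT z by simp
  also have "\<dots> = (S * B) *\<^sub>v x" unfolding z_def by (rule assoc_mult_mat_vec[OF S B(1) x, symmetric])
  also have "\<dots> = A *\<^sub>v y" using B(3) x xy by simp
  finally have "C *\<^sub>v (A *\<^sub>v (transpose_mat A *\<^sub>v z)) = C *\<^sub>v (A *\<^sub>v y)" by simp
  then have "(C * A) *\<^sub>v (transpose_mat A *\<^sub>v z) = (C * A) *\<^sub>v y"
    using assoc_mult_mat_vec[OF C(1) A mult_mat_vec_carrier[OF AT z]] assoc_mult_mat_vec[OF C(1) A y] by simp
  then have Az: "transpose_mat A *\<^sub>v z = y" using C(2) y z AT by simp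
  have "Matrix.scalar_prod x z = Matrix.scalar_prod (A *\<^sub>v y) z" unfolding xy ..
  also have "\<dots> = Matrix.scalar_prod y (transpose_mat A *\<^sub>v z)"
    using transpose_vec_mult_scalar[OF A y z] comm_scalar_prod[OF mult_mat_vec_carrier[OF A y] z]
      comm_scalar_prod[OF y mult_mat_vec_carrier[OF AT z]] by simp
  also have "\<dots> = (\<Sum>i<p. (g i)\<^sup>2)"
    unfolding Az by (simp add: y_def scalar_prod_def power2_eq_square lessThan_atLeast0)
  finally show "Matrix.scalar_prod (Matrix.vec p (tri_map p L g)) (the (mat_inverse S) *\<^sub>v Matrix.vec p (tri_map p L g))
      = (\<Sum>i<p. (g i)\<^sup>2)" by (simp add: B(4) x_def z_def)
qed

lemma scalar_prod_vec_measurable: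
  fixes B :: "real mat"
  assumes "B \<in> carrier_mat p p"
  shows "(\<lambda>x. Matrix.scalar_prod (Matrix.vec p x) (B *\<^sub>v Matrix.vec p x)) \<in> borel_measurable (\<Pi>\<^sub>M i\<in>{..<p}. borel)"
proof -
  have "Matrix.scalar_prod (Matrix.vec p x) (B *\<^sub>v Matrix.vec p x) = (\<Sum>i<p. x i * (\<Sum>j<p. B $$ (i, j) * x j))" for x
    using assms by (auto simp: scalar_prod_def lessThan_atLeast0 intro!: sum.cong)
  then show ?thesis by simp
qed

lemma gauss_PiM_density:
  "(\<Pi>\<^sub>M i\<in>{..<p::nat}. gauss) = density (\<Pi>\<^sub>M i\<in>{..<p}. lborel) (\<lambda>x. \<Prod>i<p. ennreal (std_normal_density (x i)))"
proof (rule PiM_density)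
  interpret G: prob_space gauss by (rule prob_space_gauss)
  show "sigma_finite_measure gauss" by (rule G.sigma_finite_measure_axioms)
qed (auto intro: lborel.sigma_finite_measure_axioms)

text \<open>Under \<open>x = L g\<close> the exponent becomes the squared norm of \<open>g\<close>,
  and the Jacobian \<open>\<Prod>i<p. L i i\<close> is the square root of the determinant in the
  normalization, so the two cancel.\<close>

lemma mvn_eq_distr:
  fixes S :: "real mat"
  assumes S: "S \<in> carrier_mat p p"
    and Lp: "\<And>i. i < p \<Longrightarrow> L i i > 0" and tri: "\<And>i j. i < j \<Longrightarrow> L i j = 0"
    and SL: "\<And>i j. i < p \<Longrightarrow> j < p \<Longrightarrow> S $$ (i, j) = (\<Sum>k<p. L i k * L j k)"
  shows "mvn p S = distr (\<Pi>\<^sub>M i\<in>{..<p}. gauss) (\<Pi>\<^sub>M i\<in>{..<p}. borel) (tri_map p L)"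
proof (rule measure_eqI)
  have c1[measurable_cong]: "sets (\<Pi>\<^sub>M i\<in>{..<p}. lborel :: real measure) = sets (\<Pi>\<^sub>M i\<in>{..<p}. borel)" by (rule sets_PiM_lborel)
  have c2[measurable_cong]: "sets (\<Pi>\<^sub>M i\<in>{..<p}. gauss) = sets (\<Pi>\<^sub>M i\<in>{..<p}. borel)" by (rule sets_PiM_gauss)
  show "sets (mvn p S) = sets (distr (\<Pi>\<^sub>M i\<in>{..<p}. gauss) (\<Pi>\<^sub>M i\<in>{..<p}. borel) (tri_map p L))"
    by (simp add: mvn_def c1)
  fix X assume "X \<in> sets (mvn p S)"
  then have X[measurable]: "X \<in> sets (\<Pi>\<^sub>M i\<in>{..<p}. borel)" by (simp add: mvn_def c1)
  define q where "q x = Matrix.scalar_prod (Matrix.vec p x) (the (mat_inverse S) *\<^sub>v Matrix.vec p x)" for x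
  note facts = mvn_density_tri_map[OF S Lp tri SL]
  have [measurable]: "q \<in> borel_measurable (\<Pi>\<^sub>M i\<in>{..<p}. borel)"
    unfolding q_def using facts(3) scalar_prod_vec_measurable by fastforce
  have qL: "q (tri_map p L g) = (\<Sum>i<p. (g i)\<^sup>2)" for g unfolding q_def using facts(1) by blast
  define c where "c = sqrt ((2 * pi) ^ p * Determinant.det S)"
  have pos: "(\<Prod>i<p. L i i) > 0" using Lp by (intro prod_pos) auto
  have c: "c = sqrt ((2 * pi) ^ p) * (\<Prod>i<p. L i i)"
    using facts(2) pos by (simp add: c_def real_sqrt_mult)
  have "emeasure (mvn p S) X = (\<integral>\<^sup>+x. ennreal (exp (- q x / 2) / c) * indicator X x \<partial>(\<Pi>\<^sub>M i\<in>{..<p}. lborel))"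
    unfolding mvn_def q_def[symmetric] c_def[symmetric] by (subst emeasure_density) auto
  also have "\<dots> = ennreal (\<Prod>i<p. L i i) * (\<integral>\<^sup>+g. ennreal (exp (- q (tri_map p L g) / 2) / c) * indicator X (tri_map p L g) \<partial>(\<Pi>\<^sub>M i\<in>{..<p}. lborel))"
    by (rule nn_integral_lower_triangular) (use Lp tri in auto)
  also have "\<dots> = (\<integral>\<^sup>+g. ennreal (\<Prod>i<p. L i i) * (ennreal (exp (- q (tri_map p L g) / 2) / c) * indicator X (tri_map p L g)) \<partial>(\<Pi>\<^sub>M i\<in>{..<p}. lborel))"
    by (rule nn_integral_cmult[symmetric]) measurable
  also have "\<dots> = (\<integral>\<^sup>+g. (\<Prod>i<p. ennreal (std_normal_density (g i))) * indicator X (tri_map p L g) \<partial>(\<Pi>\<^sub>M i\<in>{..<p}. lborel))"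
  proof (rule nn_integral_cong)
    fix g
    have "(\<Prod>i<p. L i i) * (exp (- q (tri_map p L g) / 2) / c) = exp (- (\<Sum>i<p. (g i)\<^sup>2) / 2) / sqrt ((2 * pi) ^ p)"
    proof -
      have "P * (e / (r * P)) = e / r" if "P > 0" for P e r :: real using that by simp
      from this[OF pos] show ?thesis unfolding qL c .
    qed
    also have "\<dots> = (\<Prod>i<p. std_normal_density (g i))"
    proof -
      have "(\<Prod>i<p. std_normal_density (g i)) = (\<Prod>i<p. exp (- (g i)\<^sup>2 / 2) / sqrt (2 * pi))"
        by (simp add: normal_density_def)
      also have "\<dots> = (\<Prod>i<p. exp (- (g i)\<^sup>2 / 2)) / sqrt (2 * pi) ^ p"
        by (simp add: prod_dividef)
      also have "(\<Prod>i<p. exp (- (g i)\<^sup>2 / 2)) = exp (- (\<Sum>i<p. (g i)\<^sup>2) / 2)"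
      proof -
        have "- (\<Sum>i<p. (g i)\<^sup>2) / 2 = (\<Sum>i<p. - (g i)\<^sup>2 / 2)"
          by (simp add: sum_negf sum_divide_distrib)
        then show ?thesis by (simp only: exp_sum[OF finite_lessThan])
      qed
      finally show ?thesis by (simp only: real_sqrt_power)
    qed
    finally have "ennreal (\<Prod>i<p. L i i) * ennreal (exp (- q (tri_map p L g) / 2) / c) = (\<Prod>i<p. ennreal (std_normal_density (g i)))"
      using pos by (simp add: ennreal_mult'[symmetric] prod_ennreal)
    then show "ennreal (\<Prod>i<p. L i i) * (ennreal (exp (- q (tri_map p L g) / 2) / c) * indicator X (tri_map p L g))
        = (\<Prod>i<p. ennreal (std_normal_density (g i))) * indicator X (tri_map p L g)"
      by (simp add: mult.assoc[symmetric])
  qed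
  also have "\<dots> = (\<integral>\<^sup>+g. indicator X (tri_map p L g) \<partial>(\<Pi>\<^sub>M i\<in>{..<p}. gauss))"
    unfolding gauss_PiM_density by (subst nn_integral_density) auto
  also have "\<dots> = (\<integral>\<^sup>+x. indicator X x \<partial>distr (\<Pi>\<^sub>M i\<in>{..<p}. gauss) (\<Pi>\<^sub>M i\<in>{..<p}. borel) (tri_map p L))"
    by (rule nn_integral_distr[symmetric]) auto
  also have "\<dots> = emeasure (distr (\<Pi>\<^sub>M i\<in>{..<p}. gauss) (\<Pi>\<^sub>M i\<in>{..<p}. borel) (tri_map p L)) X"
    by (rule nn_integral_indicator) auto
  finally show "emeasure (mvn p S) X = emeasure (distr (\<Pi>\<^sub>M i\<in>{..<p}. gauss) (\<Pi>\<^sub>M i\<in>{..<p}. borel) (tri_map p L)) X" .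
qed

section \<open>Laws of the linear model\<close>

lemma scalar_prod_vec_right:
  assumes "\<beta> \<in> carrier_vec p"
  shows "Matrix.scalar_prod (Matrix.vec p x) \<beta> = (\<Sum>j<p. x j * Matrix.vec_index \<beta> j)"
  using assms by (auto simp: scalar_prod_def lessThan_atLeast0 intro!: sum.cong)

lemma scalar_prod_sum:
  assumes "\<beta> \<in> carrier_vec p"
  shows "Matrix.scalar_prod \<xi> \<beta> = (\<Sum>j<p. Matrix.vec_index \<xi> j * Matrix.vec_index \<beta> j)"
  using assms by (auto simp: scalar_prod_def lessThan_atLeast0 intro!: sum.cong)

lemma sets_obs_law [simp, measurable_cong]: "sets (obs_law p \<theta>) = sets (obs_space p)"
  by (cases \<theta>) simp

declare obs_law.simps [simp del]

lemma sets_data_law [simp, measurable_cong]: "sets (data_law n p \<theta>) = sets (data_space n p)"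
  unfolding data_law_def data_space_def by (intro sets_PiM_cong) auto

lemma space_data_law: "space (data_law n p \<theta>) = space (data_space n p)"
  by (rule sets_eq_imp_space_eq) simp

lemma sets_mvn [simp, measurable_cong]: "sets (mvn p S) = sets (\<Pi>\<^sub>M i\<in>{..<p}. borel)"
  by (simp add: mvn_def sets_PiM_lborel)

lemma nn_integral_normal:
  assumes "F \<in> borel_measurable borel" "\<sigma> > 0"
  shows "(\<integral>\<^sup>+e. F e \<partial>density lborel (normal_density 0 \<sigma>)) = (\<integral>\<^sup>+z. F (\<sigma> * z) \<partial>gauss)"
  using nn_integral_gauss_scale[of F \<sigma>] assms by (simp add: nn_integral_density)

lemma param_space_Cholesky:
  assumes th: "(\<beta>, \<Sigma>, \<sigma>) \<in> param_space M1 M2 p k" and p: "p > 0" and M1: "M1 > 0"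
  obtains L where "\<And>i. i < p \<Longrightarrow> L i i > 0" "\<And>i j. i < j \<Longrightarrow> L i j = 0"
    "\<And>i j. i < p \<Longrightarrow> j < p \<Longrightarrow> \<Sigma> $$ (i, j) = (\<Sum>k<p. L i k * L j k)"
proof (rule Cholesky_exists[of p "entries \<Sigma>"])
  from th have S: "\<Sigma> \<in> carrier_mat p p" "transpose_mat \<Sigma> = \<Sigma>" by (auto simp: param_space_def)
  then show "\<Sigma> $$ (i, j) = \<Sigma> $$ (j, i)" if "i < p" "j < p" for i j
    using that by (metis carrier_matD index_transpose_mat(1))
  fix x :: "nat \<Rightarrow> real" assume "\<exists>i<p. x i \<noteq> 0"
  then have "(\<Sum>i<p. (x i)\<^sup>2) > 0" by (auto intro!: sum_pos2)
  then have "1 / M1 * (\<Sum>i<p. (x i)\<^sup>2) > 0" using M1 by simp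
  then show "qform p (entries \<Sigma>) x > 0" using param_space_qform(1)[OF th p, of x] by linarith
qed (use that in blast)

lemma prob_space_PiM_gauss: "prob_space (\<Pi>\<^sub>M i\<in>I. gauss)"
  by (rule prob_space_PiM) (rule prob_space_gauss)

lemma prob_space_mvn:
  assumes "(\<beta>, \<Sigma>, \<sigma>) \<in> param_space M1 M2 p k" and "p > 0" and "M1 > 0"
  shows "prob_space (mvn p \<Sigma>)"
proof -
  from assms(1) have S: "\<Sigma> \<in> carrier_mat p p" by (auto simp: param_space_def)
  obtain L where L: "\<And>i. i < p \<Longrightarrow> L i i > 0" "\<And>i j. i < j \<Longrightarrow> L i j = 0"
    "\<And>i j. i < p \<Longrightarrow> j < p \<Longrightarrow> \<Sigma> $$ (i, j) = (\<Sum>k<p. L i k * L j k)"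
    using param_space_Cholesky[OF assms] by blast
  interpret prob_space "\<Pi>\<^sub>M i\<in>{..<p}. gauss" by (rule prob_space_PiM_gauss)
  have mv: "mvn p \<Sigma> = distr (\<Pi>\<^sub>M i\<in>{..<p}. gauss) (\<Pi>\<^sub>M i\<in>{..<p}. borel) (tri_map p L)"
    by (rule mvn_eq_distr) (use S L in auto)
  show ?thesis unfolding mv
    by (rule prob_space_distr) (simp add: measurable_cong_sets[OF sets_PiM_gauss refl])
qed

definition obs_map :: "nat \<Rightarrow> real vec \<Rightarrow> (nat \<Rightarrow> real) \<times> real \<Rightarrow> obs" where
  "obs_map p \<beta> = (\<lambda>(x, e). (Matrix.scalar_prod (Matrix.vec p x) \<beta> + e, x))"

abbreviation noise :: "real \<Rightarrow> real measure" where
  "noise \<sigma> \<equiv> density lborel (\<lambda>x. ennreal (normal_density 0 \<sigma> x))"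

lemma obs_map_measurable:
  assumes "\<beta> \<in> carrier_vec p"
  shows "obs_map p \<beta> \<in> mvn p \<Sigma> \<Otimes>\<^sub>M noise \<sigma> \<rightarrow>\<^sub>M obs_space p"
  unfolding obs_map_def obs_space_def split_beta' scalar_prod_vec_right[OF assms] by measurable

lemma obs_law_eq: "obs_law p (\<beta>, \<Sigma>, \<sigma>) = distr (mvn p \<Sigma> \<Otimes>\<^sub>M noise \<sigma>) (obs_space p) (obs_map p \<beta>)"
  by (simp add: obs_map_def obs_law.simps)

lemma prob_space_obs_law:
  assumes th: "(\<beta>, \<Sigma>, \<sigma>) \<in> param_space M1 M2 p k" and "p > 0" and "M1 > 0"
  shows "prob_space (obs_law p (\<beta>, \<Sigma>, \<sigma>))"
proof -
  interpret M: prob_space "mvn p \<Sigma>" by (rule prob_space_mvn[OF assms])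
  interpret N: prob_space "noise \<sigma>" using th by (intro prob_space_normal_density) (auto simp: param_space_def)
  interpret MN: pair_prob_space "mvn p \<Sigma>" "noise \<sigma>" ..
  show ?thesis unfolding obs_law_eq
    by (rule MN.prob_space_distr) (use th in \<open>auto simp: param_space_def intro!: obs_map_measurable\<close>)
qed

lemma prob_space_data_law:
  assumes "(\<beta>, \<Sigma>, \<sigma>) \<in> param_space M1 M2 p k" and "p > 0" and "M1 > 0"
  shows "prob_space (data_law n p (\<beta>, \<Sigma>, \<sigma>))"
  unfolding data_law_def by (rule prob_space_PiM) (rule prob_space_obs_law[OF assms])

text \<open>The response minus its fitted value is the noise, so these are the linear forms in
  covariates and noise, written as functions of an observation. The class is closed under sums and
  differences, as polarization demands.\<close>

definition obs_lin :: "nat \<Rightarrow> real vec \<Rightarrow> (nat \<Rightarrow> real) \<Rightarrow> real \<Rightarrow> obs \<Rightarrow> real" where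
  "obs_lin p \<beta> a s z = (\<Sum>j<p. a j * snd z j) + s * (fst z - (\<Sum>j<p. snd z j * Matrix.vec_index \<beta> j))"

lemma obs_lin_measurable [measurable]: "obs_lin p \<beta> a s \<in> borel_measurable (obs_space p)"
  unfolding obs_lin_def obs_space_def by measurable

text \<open>With \<open>x = L g\<close> the form \<open>a \<bullet> x\<close> is
  \<open>b \<bullet> g\<close> for \<open>b = L\<^sup>T a\<close>, whose squared norm is the
  quadratic form of \<open>a\<close>; the independent noise adds
  \<open>s\<^sup>2 * \<sigma>\<^sup>2\<close>.\<close>

lemma centered_gaussian_obs_lin:
  assumes th: "(\<beta>, \<Sigma>, \<sigma>) \<in> param_space M1 M2 p k" and p: "p > 0" and M1: "M1 > 0"
  shows "centered_gaussian (obs_law p (\<beta>, \<Sigma>, \<sigma>)) (obs_lin p \<beta> a s) (qform p (entries \<Sigma>) a + s\<^sup>2 * \<sigma>\<^sup>2)"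
  unfolding centered_gaussian_def
proof (intro conjI allI impI)
  show "obs_lin p \<beta> a s \<in> borel_measurable (obs_law p (\<beta>, \<Sigma>, \<sigma>))"
    unfolding measurable_cong_sets[OF sets_obs_law refl] by measurable
  fix F :: "real \<Rightarrow> ennreal" assume F[measurable]: "F \<in> borel_measurable borel"
  from th have S: "\<Sigma> \<in> carrier_mat p p" and \<beta>: "\<beta> \<in> carrier_vec p" and \<sigma>: "\<sigma> > 0"
    by (auto simp: param_space_def)
  obtain L where L: "\<And>i. i < p \<Longrightarrow> L i i > 0" "\<And>i j. i < j \<Longrightarrow> L i j = 0"
    "\<And>i j. i < p \<Longrightarrow> j < p \<Longrightarrow> \<Sigma> $$ (i, j) = (\<Sum>k<p. L i k * L j k)"
    using param_space_Cholesky[OF assms] by blast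
  interpret N: prob_space "noise \<sigma>" using \<sigma> by (intro prob_space_normal_density) auto
  have c2[measurable_cong]: "sets (\<Pi>\<^sub>M i\<in>{..<p}. gauss) = sets (\<Pi>\<^sub>M i\<in>{..<p}. borel)" by (rule sets_PiM_gauss)
  note [measurable] = obs_map_measurable[OF \<beta>]
  define G where "G w = (\<integral>\<^sup>+z. F (0 + w + s * \<sigma> * z) \<partial>gauss)" for w
  have [measurable]: "G \<in> borel_measurable borel" 
  proof -
    interpret G: prob_space gauss by (rule prob_space_gauss)
    show ?thesis unfolding G_def by measurable
  qed
  define b where "b k = (\<Sum>j<p. a j * L j k)" for k
  have ol: "obs_lin p \<beta> a s (obs_map p \<beta> (x, e)) = (\<Sum>j<p. a j * x j) + s * e" for x e
    by (simp add: obs_lin_def obs_map_def scalar_prod_vec_right[OF \<beta>])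
  have bsum: "(\<Sum>j<p. a j * tri_map p L g j) = (\<Sum>k<p. b k * g k)" for g
  proof -
    have "(\<Sum>j<p. a j * tri_map p L g j) = (\<Sum>j<p. \<Sum>k<p. a j * L j k * g k)"
      by (simp add: tri_map_def sum_distrib_left mult.assoc)
    also have "\<dots> = (\<Sum>k<p. b k * g k)" unfolding b_def sum_distrib_right by (rule sum.swap)
    finally show ?thesis .
  qed
  have b2: "(\<Sum>k<p. (b k)\<^sup>2) = qform p (entries \<Sigma>) a"
  proof -
    have "(\<Sum>k<p. (b k)\<^sup>2) = (\<Sum>k<p. \<Sum>i<p. \<Sum>j<p. (a i * L i k) * (a j * L j k))"
      unfolding b_def power2_eq_square sum_product ..
    also have "\<dots> = (\<Sum>i<p. \<Sum>k<p. \<Sum>j<p. (a i * L i k) * (a j * L j k))" by (rule sum.swap)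
    also have "\<dots> = (\<Sum>i<p. \<Sum>j<p. \<Sum>k<p. (a i * L i k) * (a j * L j k))"
      by (intro sum.cong refl sum.swap)
    also have "\<dots> = qform p (entries \<Sigma>) a"
      unfolding bform_def by (intro sum.cong refl) (simp add: L(3) sum_distrib_left sum_distrib_right mult_ac)
    finally show ?thesis .
  qed
  have q0: "qform p (entries \<Sigma>) a \<ge> 0" unfolding b2[symmetric] by (simp add: sum_nonneg)
  have "(\<integral>\<^sup>+x. F (obs_lin p \<beta> a s x) \<partial>obs_law p (\<beta>, \<Sigma>, \<sigma>))
      = (\<integral>\<^sup>+w. F (obs_lin p \<beta> a s (obs_map p \<beta> w)) \<partial>(mvn p \<Sigma> \<Otimes>\<^sub>M noise \<sigma>))"
    unfolding obs_law_eq by (rule nn_integral_distr) measurable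
  also have "\<dots> = (\<integral>\<^sup>+x. \<integral>\<^sup>+e. F (obs_lin p \<beta> a s (obs_map p \<beta> (x, e))) \<partial>noise \<sigma> \<partial>mvn p \<Sigma>)"
    by (rule N.nn_integral_fst[symmetric]) measurable
  also have "\<dots> = (\<integral>\<^sup>+x. G (\<Sum>j<p. a j * x j) \<partial>mvn p \<Sigma>)"
  proof (rule nn_integral_cong)
    fix x
    show "(\<integral>\<^sup>+e. F (obs_lin p \<beta> a s (obs_map p \<beta> (x, e))) \<partial>noise \<sigma>) = G (\<Sum>j<p. a j * x j)"
      unfolding ol G_def using nn_integral_normal[of "\<lambda>e. F ((\<Sum>j<p. a j * x j) + s * e)" \<sigma>] \<sigma>
      by (simp add: mult.assoc)
  qed
  also have "\<dots> = (\<integral>\<^sup>+g. G (\<Sum>j<p. a j * tri_map p L g j) \<partial>(\<Pi>\<^sub>M i\<in>{..<p}. gauss))"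
  proof -
    have mv: "mvn p \<Sigma> = distr (\<Pi>\<^sub>M i\<in>{..<p}. gauss) (\<Pi>\<^sub>M i\<in>{..<p}. borel) (tri_map p L)"
      by (rule mvn_eq_distr) (use S L in auto)
    show ?thesis unfolding mv by (rule nn_integral_distr) measurable
  qed
  also have "\<dots> = (\<integral>\<^sup>+y. G (0 + sqrt (\<Sum>k<p. (b k)\<^sup>2) * y) \<partial>gauss)"
    unfolding bsum using nn_integral_gauss_linear[where F=G and c=0 and a=b and p=p] by simp
  also have "\<dots> = (\<integral>\<^sup>+z. F (0 + sqrt ((sqrt (\<Sum>k<p. (b k)\<^sup>2))\<^sup>2 + (s * \<sigma>)\<^sup>2) * z) \<partial>gauss)"
    unfolding G_def add_0 using nn_integral_gauss_pair[of F 0 "sqrt (\<Sum>k<p. (b k)\<^sup>2)" "s * \<sigma>"] by simp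
  finally show "(\<integral>\<^sup>+x. F (obs_lin p \<beta> a s x) \<partial>obs_law p (\<beta>, \<Sigma>, \<sigma>))
      = (\<integral>\<^sup>+z. F (sqrt (qform p (entries \<Sigma>) a + s\<^sup>2 * \<sigma>\<^sup>2) * z) \<partial>gauss)"
    using q0 by (simp add: b2 power_mult_distrib)
qed

text \<open>Polarization reduces products to squares: \<open>4 U W = (U + W)\<^sup>2 - (U - W)\<^sup>2\<close>.\<close>

lemma product_concentration:
  fixes v1 v2 V t :: real and n :: nat
  assumes N: "prob_space N"
    and W1: "centered_gaussian N (\<lambda>x. U x + W x) v1" and W2: "centered_gaussian N (\<lambda>x. U x - W x) v2"
    and v: "0 \<le> v1" "v1 \<le> V" "0 \<le> v2" "v2 \<le> V" and V: "V > 0" and t: "0 \<le> t" "t \<le> 2"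
    and m: "U \<in> borel_measurable N" "W \<in> borel_measurable N"
  shows "measure (\<Pi>\<^sub>M i\<in>{..<n}. N) {z \<in> space (\<Pi>\<^sub>M i\<in>{..<n}. N).
      n * V * t / 2 \<le> \<bar>(\<Sum>i<n. U (z i) * W (z i)) - n * (v1 - v2) / 4\<bar>} \<le> 4 * exp (- real n * t\<^sup>2 / 16)"
proof -
  interpret N: prob_space N by fact
  let ?P = "\<Pi>\<^sub>M i\<in>{..<n}. N"
  interpret P: prob_space ?P by (rule prob_space_PiM) (rule N)
  note [measurable] = m
  define E where "E g v = {z \<in> space ?P. n * V * t \<le> \<bar>(\<Sum>i<n. (g (z i))\<^sup>2) - n * v\<bar>}" for g and v :: real
  let ?a = "\<lambda>x. U x + W x" and ?d = "\<lambda>x. U x - W x"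
  have [measurable]: "E ?a v1 \<in> sets ?P" "E ?d v2 \<in> sets ?P" unfolding E_def by measurable
  have "{z \<in> space ?P. n * V * t / 2 \<le> \<bar>(\<Sum>i<n. U (z i) * W (z i)) - n * (v1 - v2) / 4\<bar>} \<subseteq> E ?a v1 \<union> E ?d v2"
  proof
    fix z assume z: "z \<in> {z \<in> space ?P. n * V * t / 2 \<le> \<bar>(\<Sum>i<n. U (z i) * W (z i)) - n * (v1 - v2) / 4\<bar>}"
    have "4 * (\<Sum>i<n. U (z i) * W (z i)) = (\<Sum>i<n. (?a (z i))\<^sup>2) - (\<Sum>i<n. (?d (z i))\<^sup>2)"
      unfolding sum_distrib_left sum_subtractf[symmetric]
      by (intro sum.cong refl) (simp add: power2_eq_square algebra_simps)
    then have "4 * ((\<Sum>i<n. U (z i) * W (z i)) - n * (v1 - v2) / 4)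
        = ((\<Sum>i<n. (?a (z i))\<^sup>2) - n * v1) - ((\<Sum>i<n. (?d (z i))\<^sup>2) - n * v2)"
      unfolding right_diff_distrib by (simp add: diff_divide_distrib)
    moreover have "n * V * t / 2 \<le> \<bar>(\<Sum>i<n. U (z i) * W (z i)) - n * (v1 - v2) / 4\<bar>"
      using z by simp
    \<comment> \<open>A difference of size \<open>2 * m\<close> forces one of its two terms to be at
      least \<open>m\<close> in absolute value.\<close>
    moreover have "m \<le> \<bar>a\<bar> \<or> m \<le> \<bar>d\<bar>" if "4 * q = a - d" "m / 2 \<le> \<bar>q\<bar>" for q a d m :: real
      using that by arith
    ultimately have "n * V * t \<le> \<bar>(\<Sum>i<n. (?a (z i))\<^sup>2) - n * v1\<bar> \<or> n * V * t \<le> \<bar>(\<Sum>i<n. (?d (z i))\<^sup>2) - n * v2\<bar>"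
      by blast
    then show "z \<in> E ?a v1 \<union> E ?d v2" using z by (auto simp: E_def)
  qed
  then have "measure ?P {z \<in> space ?P. n * V * t / 2 \<le> \<bar>(\<Sum>i<n. U (z i) * W (z i)) - n * (v1 - v2) / 4\<bar>}
      \<le> measure ?P (E ?a v1 \<union> E ?d v2)"
    by (intro P.finite_measure_mono) auto
  also have "\<dots> \<le> measure ?P (E ?a v1) + measure ?P (E ?d v2)"
    by (rule measure_Un_le) auto
  also have "\<dots> \<le> 2 * exp (- real n * t\<^sup>2 / 16) + 2 * exp (- real n * t\<^sup>2 / 16)"
    unfolding E_def by (intro add_mono chi_square_concentration[OF N W1] chi_square_concentration[OF N W2] v V t)
  finally show ?thesis by simp
qed

text \<open>Regroups \<open>n\<close> independent pairs into all first and all second components.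
  This allows the noise to be integrated with the whole design held fixed, although the data come
  observation by observation.\<close>

lemma nn_integral_PiM_pair:
  fixes f :: "(nat \<Rightarrow> 'a \<times> 'b) \<Rightarrow> ennreal"
  assumes M: "sigma_finite_measure M" and N: "sigma_finite_measure N"
    and f: "f \<in> borel_measurable (\<Pi>\<^sub>M i\<in>{..<n}. M \<Otimes>\<^sub>M N)"
  shows "(\<integral>\<^sup>+z. f z \<partial>(\<Pi>\<^sub>M i\<in>{..<n}. M \<Otimes>\<^sub>M N))
    = (\<integral>\<^sup>+x. \<integral>\<^sup>+y. f (\<lambda>i\<in>{..<n}. (x i, y i)) \<partial>(\<Pi>\<^sub>M i\<in>{..<n}. N) \<partial>(\<Pi>\<^sub>M i\<in>{..<n}. M))"
  using f
proof (induction n arbitrary: f)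
  case 0
  then show ?case by (simp add: PiM_empty nn_integral_count_space_finite)
next
  case (Suc n)
  interpret M: sigma_finite_measure M by fact
  interpret N: sigma_finite_measure N by fact
  interpret MN: pair_sigma_finite M N ..
  interpret PMN: product_sigma_finite "\<lambda>_::nat. M \<Otimes>\<^sub>M N" by standard
  interpret PM: product_sigma_finite "\<lambda>_::nat. M" by standard
  interpret PN: product_sigma_finite "\<lambda>_::nat. N" by standard
  interpret PNn: sigma_finite_measure "\<Pi>\<^sub>M i\<in>{..<n}. N" by (rule PN.sigma_finite) simp
  interpret PMn: sigma_finite_measure "\<Pi>\<^sub>M i\<in>{..<n}. M" by (rule PM.sigma_finite) simp
  have ins: "{..<Suc n} = insert n {..<n}" by auto
  note f[measurable] = Suc.prems[unfolded ins]
  have zip: "(\<lambda>i\<in>insert n {..<n}. ((x(n := a)) i, (y(n := b)) i)) = (\<lambda>i\<in>{..<n}. (x i, y i))(n := (a, b))"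
    for x y a b by (auto simp: fun_eq_iff)
  have z[measurable]: "(\<lambda>w. \<lambda>i\<in>{..<n}. (fst w i, snd w i)) \<in>
      (\<Pi>\<^sub>M i\<in>{..<n}. M) \<Otimes>\<^sub>M (\<Pi>\<^sub>M i\<in>{..<n}. N) \<rightarrow>\<^sub>M (\<Pi>\<^sub>M i\<in>{..<n}. M \<Otimes>\<^sub>M N)"
    by measurable
  have z2[measurable]: "(\<lambda>w. \<lambda>i\<in>insert n {..<n}. (fst w i, snd w i)) \<in>
      (\<Pi>\<^sub>M i\<in>insert n {..<n}. M) \<Otimes>\<^sub>M (\<Pi>\<^sub>M i\<in>insert n {..<n}. N) \<rightarrow>\<^sub>M (\<Pi>\<^sub>M i\<in>insert n {..<n}. M \<Otimes>\<^sub>M N)"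
    by measurable
  let ?f = "\<lambda>a b x y. f ((\<lambda>i\<in>{..<n}. (x i, y i))(n := (a, b)))"
  have "(\<integral>\<^sup>+z. f z \<partial>(\<Pi>\<^sub>M i\<in>{..<Suc n}. M \<Otimes>\<^sub>M N))
      = (\<integral>\<^sup>+c. \<integral>\<^sup>+z. f (z(n := c)) \<partial>(\<Pi>\<^sub>M i\<in>{..<n}. M \<Otimes>\<^sub>M N) \<partial>(M \<Otimes>\<^sub>M N))"
    unfolding ins by (rule PMN.product_nn_integral_insert_rev) auto
  also have "\<dots> = (\<integral>\<^sup>+c. (\<integral>\<^sup>+x. \<integral>\<^sup>+y. f ((\<lambda>i\<in>{..<n}. (x i, y i))(n := c)) \<partial>(\<Pi>\<^sub>M i\<in>{..<n}. N) \<partial>(\<Pi>\<^sub>M i\<in>{..<n}. M)) \<partial>(M \<Otimes>\<^sub>M N))"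
    by (intro nn_integral_cong Suc.IH) measurable
  also have "\<dots> = (\<integral>\<^sup>+a. \<integral>\<^sup>+b. (\<integral>\<^sup>+x. \<integral>\<^sup>+y. ?f a b x y \<partial>(\<Pi>\<^sub>M i\<in>{..<n}. N) \<partial>(\<Pi>\<^sub>M i\<in>{..<n}. M)) \<partial>N \<partial>M)"
    by (rule N.nn_integral_fst[symmetric]) measurable
  also have "\<dots> = (\<integral>\<^sup>+a. (\<integral>\<^sup>+x. (\<integral>\<^sup>+b. \<integral>\<^sup>+y. ?f a b x y \<partial>(\<Pi>\<^sub>M i\<in>{..<n}. N) \<partial>N) \<partial>(\<Pi>\<^sub>M i\<in>{..<n}. M)) \<partial>M)"
  proof (rule nn_integral_cong)
    fix a assume [measurable]: "a \<in> space M"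
    interpret Q: pair_sigma_finite N "\<Pi>\<^sub>M i\<in>{..<n}. M" ..
    show "(\<integral>\<^sup>+b. (\<integral>\<^sup>+x. \<integral>\<^sup>+y. ?f a b x y \<partial>(\<Pi>\<^sub>M i\<in>{..<n}. N) \<partial>(\<Pi>\<^sub>M i\<in>{..<n}. M)) \<partial>N)
        = (\<integral>\<^sup>+x. (\<integral>\<^sup>+b. \<integral>\<^sup>+y. ?f a b x y \<partial>(\<Pi>\<^sub>M i\<in>{..<n}. N) \<partial>N) \<partial>(\<Pi>\<^sub>M i\<in>{..<n}. M))"
      by (rule Q.Fubini'[symmetric]) measurable
  qed
  also have "\<dots> = (\<integral>\<^sup>+a. (\<integral>\<^sup>+x. (\<integral>\<^sup>+y. f (\<lambda>i\<in>insert n {..<n}. ((x(n := a)) i, y i)) \<partial>(\<Pi>\<^sub>M i\<in>insert n {..<n}. N)) \<partial>(\<Pi>\<^sub>M i\<in>{..<n}. M)) \<partial>M)"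
  proof (intro nn_integral_cong)
    fix a x assume [measurable]: "a \<in> space M" "x \<in> space (\<Pi>\<^sub>M i\<in>{..<n}. M)"
    have x': "x(n := a) \<in> space (\<Pi>\<^sub>M i\<in>insert n {..<n}. M)"
      using \<open>a \<in> space M\<close> \<open>x \<in> space _\<close> by (auto simp: space_PiM PiE_iff extensional_def)
    have m: "(\<lambda>y. f (\<lambda>i\<in>insert n {..<n}. ((x(n := a)) i, y i))) \<in> borel_measurable (\<Pi>\<^sub>M i\<in>insert n {..<n}. N)"
      using measurable_compose[OF measurable_Pair1'[OF x'] measurable_compose[OF z2 f]]
      unfolding fst_conv snd_conv .
    have "(\<integral>\<^sup>+y. f (\<lambda>i\<in>insert n {..<n}. ((x(n := a)) i, y i)) \<partial>(\<Pi>\<^sub>M i\<in>insert n {..<n}. N))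
        = (\<integral>\<^sup>+b. \<integral>\<^sup>+y. f (\<lambda>i\<in>insert n {..<n}. ((x(n := a)) i, (y(n := b)) i)) \<partial>(\<Pi>\<^sub>M i\<in>{..<n}. N) \<partial>N)"
      by (rule PN.product_nn_integral_insert_rev[OF _ _ m]) auto
    then show "(\<integral>\<^sup>+b. \<integral>\<^sup>+y. ?f a b x y \<partial>(\<Pi>\<^sub>M i\<in>{..<n}. N) \<partial>N)
        = (\<integral>\<^sup>+y. f (\<lambda>i\<in>insert n {..<n}. ((x(n := a)) i, y i)) \<partial>(\<Pi>\<^sub>M i\<in>insert n {..<n}. N))"
      unfolding zip by simp
  qed
  also have "\<dots> = (\<integral>\<^sup>+x. (\<integral>\<^sup>+y. f (\<lambda>i\<in>insert n {..<n}. (x i, y i)) \<partial>(\<Pi>\<^sub>M i\<in>insert n {..<n}. N)) \<partial>(\<Pi>\<^sub>M i\<in>insert n {..<n}. M))"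
  proof (rule PM.product_nn_integral_insert_rev[symmetric])
    interpret PNn': sigma_finite_measure "\<Pi>\<^sub>M i\<in>insert n {..<n}. N" by (rule PN.sigma_finite) simp
    show "(\<lambda>x. \<integral>\<^sup>+y. f (\<lambda>i\<in>insert n {..<n}. (x i, y i)) \<partial>(\<Pi>\<^sub>M i\<in>insert n {..<n}. N)) \<in> borel_measurable (\<Pi>\<^sub>M i\<in>insert n {..<n}. M)"
      by measurable
  qed auto
  finally show ?case unfolding ins .
qed

definition covariates :: "nat \<Rightarrow> (nat \<Rightarrow> obs) \<Rightarrow> nat \<Rightarrow> nat \<Rightarrow> real" where
  "covariates n z = (\<lambda>i\<in>{..<n}. snd (z i))"

lemma noise_scale: "\<sigma> > 0 \<Longrightarrow> noise \<sigma> = distr gauss (noise \<sigma>) (\<lambda>z. \<sigma> * z)"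
proof (rule measure_eqI)
  assume s: "\<sigma> > 0"
  fix A assume "A \<in> sets (noise \<sigma>)"
  then have A[measurable]: "A \<in> sets borel" by simp
  have "emeasure (noise \<sigma>) A = (\<integral>\<^sup>+e. indicator A e \<partial>noise \<sigma>)" by simp
  also have "\<dots> = (\<integral>\<^sup>+z. indicator A (\<sigma> * z) \<partial>gauss)"
    by (rule nn_integral_normal) (use s in auto)
  also have "\<dots> = (\<integral>\<^sup>+e. indicator A e \<partial>distr gauss (noise \<sigma>) (\<lambda>z. \<sigma> * z))"
    by (rule nn_integral_distr[symmetric]) auto
  also have "\<dots> = emeasure (distr gauss (noise \<sigma>) (\<lambda>z. \<sigma> * z)) A" by (rule nn_integral_indicator) simp
  finally show "emeasure (noise \<sigma>) A = emeasure (distr gauss (noise \<sigma>) (\<lambda>z. \<sigma> * z)) A" .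
qed simp

lemma PiM_noise_second_moment:
  fixes a :: "nat \<Rightarrow> real"
  assumes s: "\<sigma> > 0"
  shows "(\<integral>\<^sup>+e. ennreal ((\<Sum>i<n. a i * e i)\<^sup>2) \<partial>(\<Pi>\<^sub>M i\<in>{..<n}. noise \<sigma>)) = ennreal (\<sigma>\<^sup>2 * (\<Sum>i<n. (a i)\<^sup>2))"
proof -
  have pn: "prob_space (noise \<sigma>)" using s by (rule prob_space_normal_density)
  have [measurable_cong]: "sets (\<Pi>\<^sub>M i\<in>{..<n}. noise \<sigma>) = sets (\<Pi>\<^sub>M i\<in>{..<n}. borel)"
    "sets (\<Pi>\<^sub>M i\<in>{..<n}. gauss) = sets (\<Pi>\<^sub>M i\<in>{..<n}. borel)" by (intro sets_PiM_cong; simp)+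
  have "(\<Pi>\<^sub>M i\<in>{..<n}. noise \<sigma>) = (\<Pi>\<^sub>M i\<in>{..<n}. distr gauss (noise \<sigma>) (\<lambda>z. \<sigma> * z))"
    using noise_scale[OF s] by simp
  also have "\<dots> = distr (\<Pi>\<^sub>M i\<in>{..<n}. gauss) (\<Pi>\<^sub>M i\<in>{..<n}. noise \<sigma>) (compose {..<n} (\<lambda>z. \<sigma> * z))"
    by (rule distr_PiM_finite_prob_space'[symmetric]) (auto intro: prob_space_gauss pn)
  finally have eq: "(\<Pi>\<^sub>M i\<in>{..<n}. noise \<sigma>)
      = distr (\<Pi>\<^sub>M i\<in>{..<n}. gauss) (\<Pi>\<^sub>M i\<in>{..<n}. noise \<sigma>) (compose {..<n} (\<lambda>z. \<sigma> * z))" .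
  have com: "compose {..<n} (\<lambda>z. \<sigma> * z) \<in> (\<Pi>\<^sub>M i\<in>{..<n}. gauss) \<rightarrow>\<^sub>M (\<Pi>\<^sub>M i\<in>{..<n}. noise \<sigma>)"
    unfolding compose_def by measurable
  have "(\<integral>\<^sup>+e. ennreal ((\<Sum>i<n. a i * e i)\<^sup>2) \<partial>(\<Pi>\<^sub>M i\<in>{..<n}. noise \<sigma>))
      = (\<integral>\<^sup>+g. ennreal ((\<Sum>i<n. a i * compose {..<n} (\<lambda>z. \<sigma> * z) g i)\<^sup>2) \<partial>(\<Pi>\<^sub>M i\<in>{..<n}. gauss))"
    by (subst eq, rule nn_integral_distr[OF com]) simp
  also have "\<dots> = (\<integral>\<^sup>+g. ennreal ((\<Sum>i<n. (\<sigma> * a i) * g i)\<^sup>2) \<partial>(\<Pi>\<^sub>M i\<in>{..<n}. gauss))"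
    by (intro nn_integral_cong arg_cong[where f=ennreal] arg_cong[where f="\<lambda>x. x\<^sup>2"] sum.cong)
      (auto simp: compose_def)
  also have "\<dots> = ennreal (\<Sum>i<n. (\<sigma> * a i)\<^sup>2)"
    by (rule centered_gaussian_second_moment[OF centered_gaussian_PiM]) (simp add: sum_nonneg)
  finally show ?thesis by (simp add: power_mult_distrib sum_distrib_left)
qed

text \<open>Conditionally on the covariates, \<open>\<Sum> A\<^sub>i \<epsilon>\<^sub>i\<close> has variance \<open>\<sigma>\<^sup>2 \<Sum> A\<^sub>i\<^sup>2\<close>, even if the weights are chosen
  by looking at all covariates.\<close>

lemma conditional_second_moment:
  assumes th: "(\<beta>, \<Sigma>, \<sigma>) \<in> param_space M1 M2 p k" and p: "p > 0" and M1: "M1 > 0"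
    and A: "\<And>i. i < n \<Longrightarrow> A i \<in> borel_measurable (\<Pi>\<^sub>M i\<in>{..<n}. \<Pi>\<^sub>M j\<in>{..<p}. borel)"
    and K: "\<And>x. (\<Sum>i<n. (A i x)\<^sup>2) \<le> K"
  shows "(\<integral>\<^sup>+z. ennreal ((\<Sum>i<n. A i (covariates n z) * obs_lin p \<beta> (\<lambda>_. 0) 1 (z i))\<^sup>2) \<partial>data_law n p (\<beta>, \<Sigma>, \<sigma>))
    \<le> ennreal (\<sigma>\<^sup>2 * K)"
proof -
  let ?\<theta> = "(\<beta>, \<Sigma>, \<sigma>)"
  from th have \<beta>: "\<beta> \<in> carrier_vec p" and \<sigma>: "\<sigma> > 0" by (auto simp: param_space_def)
  interpret M: prob_space "mvn p \<Sigma>" by (rule prob_space_mvn[OF th p M1])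
  interpret N: prob_space "noise \<sigma>" using \<sigma> by (rule prob_space_normal_density)
  interpret MN: pair_prob_space "mvn p \<Sigma>" "noise \<sigma>" ..
  interpret PM: prob_space "\<Pi>\<^sub>M i\<in>{..<n}. mvn p \<Sigma>" by (rule prob_space_PiM) (rule M.prob_space_axioms)
  have cX: "sets (\<Pi>\<^sub>M i\<in>{..<n}. mvn p \<Sigma>) = sets (\<Pi>\<^sub>M i\<in>{..<n}. \<Pi>\<^sub>M j\<in>{..<p}. borel)"
    by (intro sets_PiM_cong) auto
  have cO: "sets (\<Pi>\<^sub>M i\<in>{..<n}. obs_law p ?\<theta>) = sets (\<Pi>\<^sub>M i\<in>{..<n}. obs_space p)"
    by (intro sets_PiM_cong sets_obs_law refl)
  have cE: "sets (\<Pi>\<^sub>M i\<in>{..<n}. noise \<sigma>) = sets (\<Pi>\<^sub>M i\<in>{..<n}. borel)" by (intro sets_PiM_cong) auto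
  note [measurable_cong] = cX cO cE
  have om: "obs_map p \<beta> \<in> mvn p \<Sigma> \<Otimes>\<^sub>M noise \<sigma> \<rightarrow>\<^sub>M obs_law p ?\<theta>"
    using obs_map_measurable[OF \<beta>, of \<Sigma> \<sigma>] measurable_cong_sets[OF refl sets_obs_law] by blast
  have "obs_law p ?\<theta> = distr (mvn p \<Sigma> \<Otimes>\<^sub>M noise \<sigma>) (obs_law p ?\<theta>) (obs_map p \<beta>)"
    by (subst (1) obs_law_eq, rule distr_cong) auto
  then have "data_law n p ?\<theta> = (\<Pi>\<^sub>M i\<in>{..<n}. distr (mvn p \<Sigma> \<Otimes>\<^sub>M noise \<sigma>) (obs_law p ?\<theta>) (obs_map p \<beta>))"
    unfolding data_law_def by simp
  also have "\<dots> = distr (\<Pi>\<^sub>M i\<in>{..<n}. mvn p \<Sigma> \<Otimes>\<^sub>M noise \<sigma>) (\<Pi>\<^sub>M i\<in>{..<n}. obs_law p ?\<theta>) (compose {..<n} (obs_map p \<beta>))"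
    by (rule distr_PiM_finite_prob_space'[symmetric])
      (auto intro: MN.prob_space_axioms prob_space_obs_law[OF th p M1] simp: om)
  finally have eq: "data_law n p ?\<theta> = distr (\<Pi>\<^sub>M i\<in>{..<n}. mvn p \<Sigma> \<Otimes>\<^sub>M noise \<sigma>) (\<Pi>\<^sub>M i\<in>{..<n}. obs_law p ?\<theta>) (compose {..<n} (obs_map p \<beta>))" .
  define f where "f z = ennreal ((\<Sum>i<n. A i (covariates n z) * obs_lin p \<beta> (\<lambda>_. 0) 1 (z i))\<^sup>2)" for z
  have snd_m: "snd \<in> obs_space p \<rightarrow>\<^sub>M (\<Pi>\<^sub>M j\<in>{..<p}. borel)" unfolding obs_space_def by measurable
  have cov: "covariates n \<in> (\<Pi>\<^sub>M i\<in>{..<n}. obs_space p) \<rightarrow>\<^sub>M (\<Pi>\<^sub>M i\<in>{..<n}. \<Pi>\<^sub>M j\<in>{..<p}. borel)"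
    unfolding covariates_def
    by (intro measurable_restrict, rule measurable_compose[OF _ snd_m], rule measurable_component_singleton)
  have fm: "f \<in> borel_measurable (\<Pi>\<^sub>M i\<in>{..<n}. obs_space p)"
  proof -
    have [measurable]: "(\<lambda>z. A i (covariates n z)) \<in> borel_measurable (\<Pi>\<^sub>M i\<in>{..<n}. obs_space p)" if "i < n" for i
      using measurable_compose[OF cov A[OF that]] .
    show ?thesis unfolding f_def by measurable
  qed
  have com: "compose {..<n} (obs_map p \<beta>) \<in> (\<Pi>\<^sub>M i\<in>{..<n}. mvn p \<Sigma> \<Otimes>\<^sub>M noise \<sigma>) \<rightarrow>\<^sub>M (\<Pi>\<^sub>M i\<in>{..<n}. obs_law p ?\<theta>)"
    unfolding compose_def
    by (intro measurable_restrict, rule measurable_compose[OF _ om], rule measurable_component_singleton)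
  have fm': "f \<in> borel_measurable (\<Pi>\<^sub>M i\<in>{..<n}. obs_law p ?\<theta>)"
    using fm measurable_cong_sets[OF cO refl] by blast
  have "(\<integral>\<^sup>+z. f z \<partial>data_law n p ?\<theta>) = (\<integral>\<^sup>+w. f (compose {..<n} (obs_map p \<beta>) w) \<partial>(\<Pi>\<^sub>M i\<in>{..<n}. mvn p \<Sigma> \<Otimes>\<^sub>M noise \<sigma>))"
    unfolding eq by (rule nn_integral_distr[OF com]) (simp add: fm')
  also have "\<dots> = (\<integral>\<^sup>+x. \<integral>\<^sup>+e. f (compose {..<n} (obs_map p \<beta>) (\<lambda>i\<in>{..<n}. (x i, e i))) \<partial>(\<Pi>\<^sub>M i\<in>{..<n}. noise \<sigma>) \<partial>(\<Pi>\<^sub>M i\<in>{..<n}. mvn p \<Sigma>))"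
    by (rule nn_integral_PiM_pair[OF M.sigma_finite_measure_axioms N.sigma_finite_measure_axioms measurable_compose[OF com fm']])
  also have "\<dots> = (\<integral>\<^sup>+x. \<integral>\<^sup>+e. ennreal ((\<Sum>i<n. A i x * e i)\<^sup>2) \<partial>(\<Pi>\<^sub>M i\<in>{..<n}. noise \<sigma>) \<partial>(\<Pi>\<^sub>M i\<in>{..<n}. mvn p \<Sigma>))"
  proof (intro nn_integral_cong)
    fix x :: "nat \<Rightarrow> nat \<Rightarrow> real" and e :: "nat \<Rightarrow> real"
    assume x: "x \<in> space (\<Pi>\<^sub>M i\<in>{..<n}. mvn p \<Sigma>)"
    let ?z = "compose {..<n} (obs_map p \<beta>) (\<lambda>i\<in>{..<n}. (x i, e i))"
    \<comment> \<open>The weights see only the design, which the observation map leaves unchanged;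
      in \<open>obs_lin\<close> the fitted part cancels and the noise remains.\<close>
    have "covariates n ?z = x"
      using x by (auto simp: covariates_def compose_def obs_map_def fun_eq_iff space_PiM PiE_iff extensional_def)
    moreover have "obs_lin p \<beta> (\<lambda>_. 0) 1 (?z i) = e i" if "i < n" for i
      using that by (simp add: obs_lin_def compose_def obs_map_def scalar_prod_vec_right[OF \<beta>])
    ultimately show "f ?z = ennreal ((\<Sum>i<n. A i x * e i)\<^sup>2)" unfolding f_def by simp
  qed
  also have "\<dots> = (\<integral>\<^sup>+x. ennreal (\<sigma>\<^sup>2 * (\<Sum>i<n. (A i x)\<^sup>2)) \<partial>(\<Pi>\<^sub>M i\<in>{..<n}. mvn p \<Sigma>))"
    unfolding PiM_noise_second_moment[OF \<sigma>] ..
  also have "\<dots> \<le> (\<integral>\<^sup>+x. ennreal (\<sigma>\<^sup>2 * K) \<partial>(\<Pi>\<^sub>M i\<in>{..<n}. mvn p \<Sigma>))"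
    by (intro nn_integral_mono ennreal_leI mult_left_mono K) auto
  also have "\<dots> = ennreal (\<sigma>\<^sup>2 * K)" using PM.emeasure_space_1 by simp
  finally show ?thesis unfolding f_def .
qed

section \<open>Spiked covariances\<close>

text \<open>Disjoint supports make the two sums depend on different coordinates, so independence is
  a matter of Fubini rather than of rotation invariance. Each coordinate is absorbed into one of the
  two sums by \<open>nn_integral_gauss_pair\<close>.\<close>

lemma nn_integral_gauss_linear2:
  fixes F :: "real \<Rightarrow> real \<Rightarrow> ennreal" and v w :: "nat \<Rightarrow> real"
  assumes F[measurable]: "(\<lambda>(a, b). F a b) \<in> borel_measurable (borel \<Otimes>\<^sub>M borel)"
    and vw: "\<And>i. i < p \<Longrightarrow> v i * w i = 0"
  shows "(\<integral>\<^sup>+g. F (c + (\<Sum>i<p. v i * g i)) (e + (\<Sum>i<p. w i * g i)) \<partial>(\<Pi>\<^sub>M i\<in>{..<p}. gauss))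
    = (\<integral>\<^sup>+s. \<integral>\<^sup>+t. F (c + sqrt (\<Sum>i<p. (v i)\<^sup>2) * s) (e + sqrt (\<Sum>i<p. (w i)\<^sup>2) * t) \<partial>gauss \<partial>gauss)"
  using vw
proof (induction p arbitrary: c e)
  case 0
  interpret G: prob_space gauss by (rule prob_space_gauss)
  show ?case using G.emeasure_space_1 by (simp add: PiM_empty nn_integral_count_space_finite)
next
  case (Suc p)
  interpret G: prob_space gauss by (rule prob_space_gauss)
  interpret GG: pair_sigma_finite gauss gauss ..
  interpret product_sigma_finite "\<lambda>_::nat. gauss" by standard
  have [measurable_cong]: "sets (\<Pi>\<^sub>M i\<in>I. gauss) = sets (\<Pi>\<^sub>M i\<in>I. borel)" for I :: "nat set"
    by (rule sets_PiM_gauss)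
  have ins: "{..<Suc p} = insert p {..<p}" by auto
  define V where "V = sqrt (\<Sum>i<p. (v i)\<^sup>2)"
  define W where "W = sqrt (\<Sum>i<p. (w i)\<^sup>2)"
  have V2: "V\<^sup>2 = (\<Sum>i<p. (v i)\<^sup>2)" "W\<^sup>2 = (\<Sum>i<p. (w i)\<^sup>2)" by (simp_all add: V_def W_def sum_nonneg)
  have V0: "V \<ge> 0" "W \<ge> 0" by (simp_all add: V_def W_def sum_nonneg)
  have m: "(\<lambda>g. F (c + (\<Sum>i<Suc p. v i * g i)) (e + (\<Sum>i<Suc p. w i * g i))) \<in> borel_measurable (\<Pi>\<^sub>M i\<in>insert p {..<p}. gauss)"
    unfolding ins[symmetric] by measurable
  have "(\<integral>\<^sup>+g. F (c + (\<Sum>i<Suc p. v i * g i)) (e + (\<Sum>i<Suc p. w i * g i)) \<partial>(\<Pi>\<^sub>M i\<in>{..<Suc p}. gauss))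
     = (\<integral>\<^sup>+y. (\<integral>\<^sup>+g. F (c + (\<Sum>i<Suc p. v i * (g(p := y)) i)) (e + (\<Sum>i<Suc p. w i * (g(p := y)) i)) \<partial>(\<Pi>\<^sub>M i\<in>{..<p}. gauss)) \<partial>gauss)"
    by (subst (1) ins, rule product_nn_integral_insert_rev[OF _ _ m]) auto
  also have "\<dots> = (\<integral>\<^sup>+y. (\<integral>\<^sup>+g. F ((c + v p * y) + (\<Sum>i<p. v i * g i)) ((e + w p * y) + (\<Sum>i<p. w i * g i)) \<partial>(\<Pi>\<^sub>M i\<in>{..<p}. gauss)) \<partial>gauss)"
    by (intro nn_integral_cong arg_cong2[where f=F]) (simp_all add: add_ac)
  also have "\<dots> = (\<integral>\<^sup>+y. \<integral>\<^sup>+s. \<integral>\<^sup>+t. F (c + v p * y + V * s) (e + w p * y + W * t) \<partial>gauss \<partial>gauss \<partial>gauss)"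
    unfolding V_def W_def using Suc.prems by (intro nn_integral_cong Suc.IH) auto
  also have "\<dots> = (\<integral>\<^sup>+s. \<integral>\<^sup>+t. F (c + sqrt ((v p)\<^sup>2 + V\<^sup>2) * s) (e + sqrt ((w p)\<^sup>2 + W\<^sup>2) * t) \<partial>gauss \<partial>gauss)"
  proof (cases "w p = 0")
    case True
    define G where "G a = (\<integral>\<^sup>+t. F a (e + W * t) \<partial>gauss)" for a
    have G: "G \<in> borel_measurable borel" unfolding G_def by measurable
    show ?thesis using nn_integral_gauss_pair[OF G, of c "v p" V] True V0 by (simp add: G_def)
  next
    case False
    then have vp: "v p = 0" using Suc.prems[of p] by simp
    have "(\<integral>\<^sup>+y. \<integral>\<^sup>+s. \<integral>\<^sup>+t. F (c + V * s) (e + w p * y + W * t) \<partial>gauss \<partial>gauss \<partial>gauss)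
        = (\<integral>\<^sup>+s. \<integral>\<^sup>+y. \<integral>\<^sup>+t. F (c + V * s) (e + w p * y + W * t) \<partial>gauss \<partial>gauss \<partial>gauss)"
      by (rule GG.Fubini') measurable
    also have "\<dots> = (\<integral>\<^sup>+s. \<integral>\<^sup>+t. F (c + V * s) (e + sqrt ((w p)\<^sup>2 + W\<^sup>2) * t) \<partial>gauss \<partial>gauss)"
      by (intro nn_integral_cong nn_integral_gauss_pair) measurable
    finally show ?thesis using vp V0 by simp
  qed
  finally show ?case by (simp add: V2 add.commute)
qed

definition mvn_density :: "nat \<Rightarrow> real mat \<Rightarrow> (nat \<Rightarrow> real) \<Rightarrow> real" where
  "mvn_density p \<Sigma> x = exp (- Matrix.scalar_prod (Matrix.vec p x) (the (mat_inverse \<Sigma>) *\<^sub>v Matrix.vec p x) / 2)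
     / sqrt ((2 * pi) ^ p * Determinant.det \<Sigma>)"

text \<open>Joint density of response and covariates, obtained by shifting the noise by the fitted
  value. Two parameters can then be compared pointwise.\<close>

lemma nn_integral_obs_law:
  assumes \<beta>: "\<beta> \<in> carrier_vec p" and \<sigma>: "\<sigma> > 0" and inv: "the (mat_inverse \<Sigma>) \<in> carrier_mat p p"
    and f: "f \<in> borel_measurable (obs_space p)"
  shows "(\<integral>\<^sup>+z. f z \<partial>obs_law p (\<beta>, \<Sigma>, \<sigma>)) = (\<integral>\<^sup>+x. \<integral>\<^sup>+y. ennreal (mvn_density p \<Sigma> x) *
      (ennreal (normal_density 0 \<sigma> (y - (\<Sum>j<p. x j * Matrix.vec_index \<beta> j))) * f (y, x)) \<partial>lborel \<partial>(\<Pi>\<^sub>M i\<in>{..<p}. lborel))"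
proof -
  interpret N: prob_space "noise \<sigma>" using \<sigma> by (rule prob_space_normal_density)
  have [measurable_cong]: "sets (\<Pi>\<^sub>M i\<in>{..<p}. lborel :: real measure) = sets (\<Pi>\<^sub>M i\<in>{..<p}. borel)" by (rule sets_PiM_lborel)
  have f'[measurable]: "f \<in> borel_measurable (borel \<Otimes>\<^sub>M (\<Pi>\<^sub>M i\<in>{..<p}. borel))" using f by (simp add: obs_space_def)
  note [measurable] = f obs_map_measurable[OF \<beta>]
  have [measurable]: "(\<lambda>x. Matrix.scalar_prod (Matrix.vec p x) (the (mat_inverse \<Sigma>) *\<^sub>v Matrix.vec p x)) \<in> borel_measurable (\<Pi>\<^sub>M i\<in>{..<p}. borel)"
    by (rule scalar_prod_vec_measurable[OF inv])
  have dm[measurable]: "mvn_density p \<Sigma> \<in> borel_measurable (\<Pi>\<^sub>M i\<in>{..<p}. borel)"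
    unfolding mvn_density_def[abs_def] by measurable
  define b where "b x = (\<Sum>j<p. x j * Matrix.vec_index \<beta> j)" for x
  have [measurable]: "b \<in> borel_measurable (\<Pi>\<^sub>M i\<in>{..<p}. borel)" unfolding b_def by measurable
  have "(\<integral>\<^sup>+z. f z \<partial>obs_law p (\<beta>, \<Sigma>, \<sigma>)) = (\<integral>\<^sup>+w. f (obs_map p \<beta> w) \<partial>(mvn p \<Sigma> \<Otimes>\<^sub>M noise \<sigma>))"
    unfolding obs_law_eq by (rule nn_integral_distr) measurable
  also have "\<dots> = (\<integral>\<^sup>+x. \<integral>\<^sup>+e. f (obs_map p \<beta> (x, e)) \<partial>noise \<sigma> \<partial>mvn p \<Sigma>)"
    by (rule N.nn_integral_fst[symmetric]) measurable
  also have "\<dots> = (\<integral>\<^sup>+x. \<integral>\<^sup>+e. f (b x + e, x) \<partial>noise \<sigma> \<partial>mvn p \<Sigma>)"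
    by (simp add: obs_map_def scalar_prod_vec_right[OF \<beta>] b_def)
  also have "\<dots> = (\<integral>\<^sup>+x. ennreal (mvn_density p \<Sigma> x) * (\<integral>\<^sup>+e. f (b x + e, x) \<partial>noise \<sigma>) \<partial>(\<Pi>\<^sub>M i\<in>{..<p}. lborel))"
    unfolding mvn_def mvn_density_def[symmetric]
    by (rule nn_integral_density) measurable
  also have "\<dots> = (\<integral>\<^sup>+x. \<integral>\<^sup>+y. ennreal (mvn_density p \<Sigma> x) * (ennreal (normal_density 0 \<sigma> (y - b x)) * f (y, x)) \<partial>lborel \<partial>(\<Pi>\<^sub>M i\<in>{..<p}. lborel))"
  proof (rule nn_integral_cong)
    fix x assume "x \<in> space (\<Pi>\<^sub>M i\<in>{..<p}. lborel :: real measure)"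
    then have x: "x \<in> space (\<Pi>\<^sub>M i\<in>{..<p}. borel)" by (simp add: space_PiM)
    have fx[measurable]: "(\<lambda>y. f (y, x)) \<in> borel_measurable borel"
      by (rule measurable_compose[OF measurable_Pair2'[OF x] f'])
    have "(\<integral>\<^sup>+e. f (b x + e, x) \<partial>noise \<sigma>) = (\<integral>\<^sup>+e. ennreal (normal_density 0 \<sigma> e) * f (b x + e, x) \<partial>lborel)"
      by (rule nn_integral_density) measurable
    also have "\<dots> = (\<integral>\<^sup>+y. ennreal (normal_density 0 \<sigma> (y - b x)) * f (y, x) \<partial>lborel)"
      by (subst nn_integral_real_affine[where c=1 and t="- b x" and f="\<lambda>e. ennreal (normal_density 0 \<sigma> e) * f (b x + e, x)"])
        (auto simp: algebra_simps)
    finally show "ennreal (mvn_density p \<Sigma> x) * (\<integral>\<^sup>+e. f (b x + e, x) \<partial>noise \<sigma>)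
       = (\<integral>\<^sup>+y. ennreal (mvn_density p \<Sigma> x) * (ennreal (normal_density 0 \<sigma> (y - b x)) * f (y, x)) \<partial>lborel)"
      by (simp add: nn_integral_cmult)
  qed
  finally show ?thesis unfolding b_def .
qed

text \<open>The covariance matrix under which \<open>x \<bullet> v\<close> is standard and \<open>x \<bullet> u\<close> is \<open>a (x \<bullet> v)\<close> plus an independent part
  of variance \<open>1 + a\<^sup>2\<close>, and its inverse.\<close>

definition spiked_cov :: "nat \<Rightarrow> real \<Rightarrow> (nat \<Rightarrow> real) \<Rightarrow> (nat \<Rightarrow> real) \<Rightarrow> real mat" where
  "spiked_cov p a v u = Matrix.mat p p (\<lambda>(i, j). (if i = j then 1 else 0) + (u i * a) * v j + (v i * a + u i * (2 * a\<^sup>2)) * u j)"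

definition spiked_inv :: "nat \<Rightarrow> real \<Rightarrow> (nat \<Rightarrow> real) \<Rightarrow> (nat \<Rightarrow> real) \<Rightarrow> real mat" where
  "spiked_inv p a v u = Matrix.mat p p (\<lambda>(i, j). (if i = j then 1 else 0)
     + v i * ((a\<^sup>2 * v j - a * u j) / (1 + a\<^sup>2)) + u i * ((- a * v j - a\<^sup>2 * u j) / (1 + a\<^sup>2)))"

text \<open>Both matrices are the identity plus a combination of products of \<open>v\<close> and
  \<open>u\<close>. Orthonormality reduces the product to a relation between coefficients, which is
  polynomial once \<open>1 + a\<^sup>2\<close> is cleared.\<close>

lemma spiked_inv_right:
  assumes v: "(\<Sum>j<p. (v j)\<^sup>2) = 1" and u: "(\<Sum>j<p. (u j)\<^sup>2) = 1" and vu: "(\<Sum>j<p. v j * u j) = 0"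
  shows "spiked_cov p a v u * spiked_inv p a v u = 1\<^sub>m p"
proof (rule eq_matI)
  fix i j assume "i < dim_row (1\<^sub>m p)" "j < dim_col (1\<^sub>m p :: real mat)"
  then have ij: "i < p" "j < p" by auto
  define \<alpha> where "\<alpha> = u i * a"
  define \<beta> where "\<beta> = v i * a + u i * (2 * a\<^sup>2)"
  define \<gamma> where "\<gamma> = (a\<^sup>2 * v j - a * u j) / (1 + a\<^sup>2)"
  define \<delta> where "\<delta> = (- a * v j - a\<^sup>2 * u j) / (1 + a\<^sup>2)"
  have pos: "1 + a\<^sup>2 \<noteq> 0" by (metis add_pos_nonneg less_numeral_extra(1) less_numeral_extra(3) zero_le_power2)
  have "(spiked_cov p a v u * spiked_inv p a v u) $$ (i, j)
     = (\<Sum>k<p. ((if i = k then 1 else 0) + \<alpha> * v k + \<beta> * u k) * ((if k = j then 1 else 0) + v k * \<gamma> + u k * \<delta>))"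
    using ij by (simp add: spiked_cov_def spiked_inv_def scalar_prod_def lessThan_atLeast0 \<alpha>_def \<beta>_def \<gamma>_def \<delta>_def)
  also have "\<dots> = (\<Sum>k<p. if k = i then (if i = j then 1 else 0) + v i * \<gamma> + u i * \<delta> else 0)
      + (\<Sum>k<p. if k = j then \<alpha> * v j + \<beta> * u j else 0)
      + (\<Sum>k<p. (\<alpha> * \<gamma>) * (v k)\<^sup>2 + (\<alpha> * \<delta> + \<beta> * \<gamma>) * (v k * u k) + (\<beta> * \<delta>) * (u k)\<^sup>2)"
    unfolding sum.distrib[symmetric] by (intro sum.cong refl) (auto simp: algebra_simps power2_eq_square)
  also have "\<dots> = (if i = j then 1 else 0) + v i * \<gamma> + u i * \<delta> + (\<alpha> * v j + \<beta> * u j) + (\<alpha> * \<gamma> + \<beta> * \<delta>)"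
    using ij v u vu by (simp add: sum.distrib sum_distrib_left[symmetric])
  also have "v i * \<gamma> + u i * \<delta> + (\<alpha> * v j + \<beta> * u j) + (\<alpha> * \<gamma> + \<beta> * \<delta>) = 0"
  proof -
    have "(1 + a\<^sup>2) * (v i * \<gamma> + u i * \<delta> + (\<alpha> * v j + \<beta> * u j) + (\<alpha> * \<gamma> + \<beta> * \<delta>))
      = (v i + \<alpha>) * ((1 + a\<^sup>2) * \<gamma>) + (u i + \<beta>) * ((1 + a\<^sup>2) * \<delta>) + (1 + a\<^sup>2) * (\<alpha> * v j + \<beta> * u j)"
      by (simp add: algebra_simps)
    also have "(1 + a\<^sup>2) * \<gamma> = a\<^sup>2 * v j - a * u j" using pos by (simp add: \<gamma>_def)
    also have "(1 + a\<^sup>2) * \<delta> = - a * v j - a\<^sup>2 * u j" using pos by (simp add: \<delta>_def)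
    also have "(v i + \<alpha>) * (a\<^sup>2 * v j - a * u j) + (u i + \<beta>) * (- a * v j - a\<^sup>2 * u j) + (1 + a\<^sup>2) * (\<alpha> * v j + \<beta> * u j) = 0"
      by (simp add: \<alpha>_def \<beta>_def algebra_simps power2_eq_square)
    finally show ?thesis using pos by simp
  qed
  then have "(if i = j then 1 else 0) + v i * \<gamma> + u i * \<delta> + (\<alpha> * v j + \<beta> * u j) + (\<alpha> * \<gamma> + \<beta> * \<delta>) = (if i = j then 1 else 0 :: real)"
    by simp
  finally show "(spiked_cov p a v u * spiked_inv p a v u) $$ (i, j) = 1\<^sub>m p $$ (i, j)" using ij by simp
qed (auto simp: spiked_cov_def spiked_inv_def)

lemma spiked_quadratic:
  fixes x v u :: "nat \<Rightarrow> real" and p :: nat and a :: real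
  defines "V \<equiv> (\<Sum>j<p. x j * v j)" and "U \<equiv> (\<Sum>j<p. x j * u j)"
  shows "qform p (entries (spiked_cov p a v u)) x = (\<Sum>j<p. (x j)\<^sup>2) + 2 * a * V * U + 2 * a\<^sup>2 * U\<^sup>2"
    and "qform p (entries (spiked_inv p a v u)) x = (\<Sum>j<p. (x j)\<^sup>2) + (a\<^sup>2 * V\<^sup>2 - 2 * a * V * U - a\<^sup>2 * U\<^sup>2) / (1 + a\<^sup>2)"
proof -
  \<comment> \<open>The common shape of both matrices, with coefficients \<open>c1\<close> to
    \<open>c4\<close> on the products of \<open>v\<close> and \<open>u\<close>.\<close>
  have gen: "(\<Sum>i<p. \<Sum>j<p. x i * ((if i = j then 1 else 0) + (c1 * v i + c2 * u i) * v j + (c3 * v i + c4 * u i) * u j) * x j)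
      = (\<Sum>j<p. (x j)\<^sup>2) + (c1 * V + c2 * U) * V + (c3 * V + c4 * U) * U" for c1 c2 c3 c4
  proof -
    have "(\<Sum>i<p. \<Sum>j<p. x i * ((if i = j then 1 else 0) + (c1 * v i + c2 * u i) * v j + (c3 * v i + c4 * u i) * u j) * x j)
      = (\<Sum>i<p. (\<Sum>j<p. if j = i then x i * x i else 0) + (\<Sum>j<p. x i * (c1 * v i + c2 * u i) * (x j * v j)) + (\<Sum>j<p. x i * (c3 * v i + c4 * u i) * (x j * u j)))"
      unfolding sum.distrib[symmetric] by (intro sum.cong refl) (auto simp: algebra_simps)
    also have "\<dots> = (\<Sum>i<p. (x i)\<^sup>2 + (c1 * (x i * v i) + c2 * (x i * u i)) * V + (c3 * (x i * v i) + c4 * (x i * u i)) * U)"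
      unfolding V_def U_def sum_distrib_left[symmetric]
      by (intro sum.cong refl) (simp add: algebra_simps power2_eq_square)
    also have "\<dots> = (\<Sum>j<p. (x j)\<^sup>2) + (c1 * V + c2 * U) * V + (c3 * V + c4 * U) * U"
      by (simp add: sum.distrib sum_distrib_right[symmetric] sum_distrib_left[symmetric] V_def[symmetric] U_def[symmetric])
    finally show ?thesis .
  qed
  have "qform p (entries (spiked_cov p a v u)) x
      = (\<Sum>i<p. \<Sum>j<p. x i * ((if i = j then 1 else 0) + (0 * v i + a * u i) * v j + (a * v i + (2 * a\<^sup>2) * u i) * u j) * x j)"
    unfolding bform_def by (intro sum.cong refl) (auto simp: spiked_cov_def algebra_simps)
  also have "\<dots> = (\<Sum>j<p. (x j)\<^sup>2) + 2 * a * V * U + 2 * a\<^sup>2 * U\<^sup>2"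
    unfolding gen by (simp add: algebra_simps power2_eq_square)
  finally show "qform p (entries (spiked_cov p a v u)) x = (\<Sum>j<p. (x j)\<^sup>2) + 2 * a * V * U + 2 * a\<^sup>2 * U\<^sup>2" .
  let ?q = "1 / (1 + a\<^sup>2)"
  have "qform p (entries (spiked_inv p a v u)) x
      = (\<Sum>i<p. \<Sum>j<p. x i * ((if i = j then 1 else 0) + ((a\<^sup>2 * ?q) * v i + (- a * ?q) * u i) * v j + ((- a * ?q) * v i + (- a\<^sup>2 * ?q) * u i) * u j) * x j)"
    unfolding bform_def by (intro sum.cong refl) (auto simp: spiked_inv_def diff_divide_distrib algebra_simps)
  also have "\<dots> = (\<Sum>j<p. (x j)\<^sup>2) + (a\<^sup>2 * V\<^sup>2 - 2 * a * V * U - a\<^sup>2 * U\<^sup>2) * ?q"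
    unfolding gen by (simp add: algebra_simps power2_eq_square)
  finally show "qform p (entries (spiked_inv p a v u)) x = (\<Sum>j<p. (x j)\<^sup>2) + (a\<^sup>2 * V\<^sup>2 - 2 * a * V * U - a\<^sup>2 * U\<^sup>2) / (1 + a\<^sup>2)"
    by simp
qed

lemma spiked_cov_carrier: "spiked_cov p a v u \<in> carrier_mat p p" "transpose_mat (spiked_cov p a v u) = spiked_cov p a v u"
  by (auto simp: spiked_cov_def intro!: eq_matI) (auto simp: algebra_simps)

text \<open>Cauchy-Schwarz bounds \<open>V\<close> and \<open>U\<close> by the norm of
  \<open>x\<close>, and the term with \<open>a\<^sup>2\<close> can only raise the lower bound. Small
  \<open>a\<close> thus keeps the eigenvalues in the prescribed range.\<close>

lemma spiked_cov_bounds: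
  assumes v: "(\<Sum>j<p. (v j)\<^sup>2) = 1" and u: "(\<Sum>j<p. (u j)\<^sup>2) = 1" and a: "a \<ge> 0"
  shows "(1 - 2 * a) * (\<Sum>j<p. (x j)\<^sup>2) \<le> qform p (entries (spiked_cov p a v u)) x"
    and "qform p (entries (spiked_cov p a v u)) x \<le> (1 + 2 * a + 2 * a\<^sup>2) * (\<Sum>j<p. (x j)\<^sup>2)"
proof -
  define V where "V = (\<Sum>j<p. x j * v j)"
  define U where "U = (\<Sum>j<p. x j * u j)"
  define X where "X = (\<Sum>j<p. (x j)\<^sup>2)"
  have V: "V\<^sup>2 \<le> X" using Cauchy_Schwarz_ineq_sum[of x v "{..<p}"] v by (simp add: V_def X_def)
  have U: "U\<^sup>2 \<le> X" using Cauchy_Schwarz_ineq_sum[of x u "{..<p}"] u by (simp add: U_def X_def)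
  have "\<bar>V * U\<bar> \<le> X"
  proof -
    have "2 * (\<bar>V\<bar> * \<bar>U\<bar>) \<le> V\<^sup>2 + U\<^sup>2" using sum_squares_bound[of "\<bar>V\<bar>" "\<bar>U\<bar>"] by simp
    then show ?thesis using V U by (simp add: abs_mult)
  qed
  then have "a * \<bar>V * U\<bar> \<le> a * X" using a by (intro mult_left_mono)
  then have "\<bar>2 * a * V * U\<bar> \<le> 2 * a * X" using a by (simp add: abs_mult)
  moreover have "0 \<le> 2 * a\<^sup>2 * U\<^sup>2" "2 * a\<^sup>2 * U\<^sup>2 \<le> 2 * a\<^sup>2 * X" using U by (auto intro: mult_left_mono)
  ultimately have "X - 2 * a * X \<le> X + 2 * a * V * U + 2 * a\<^sup>2 * U\<^sup>2" "X + 2 * a * V * U + 2 * a\<^sup>2 * U\<^sup>2 \<le> X + 2 * a * X + 2 * a\<^sup>2 * X"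
    by linarith+
  then show "(1 - 2 * a) * (\<Sum>j<p. (x j)\<^sup>2) \<le> qform p (entries (spiked_cov p a v u)) x"
    "qform p (entries (spiked_cov p a v u)) x \<le> (1 + 2 * a + 2 * a\<^sup>2) * (\<Sum>j<p. (x j)\<^sup>2)"
    unfolding spiked_quadratic V_def[symmetric] U_def[symmetric] X_def[symmetric] by (simp_all add: algebra_simps)
qed

section \<open>Likelihood ratios\<close>

text \<open>Coordinate 0 carries the largest entry of the loading, which is nonzero, so a suitable
  \<open>b\<close> attains any value of \<open>\<xi> \<bullet> \<beta>\<close>.\<close>

definition coord_beta :: "nat \<Rightarrow> real \<Rightarrow> real vec" where
  "coord_beta p b = Matrix.vec p (\<lambda>j. if j = 0 then b else 0)"

text \<open>The added term is the regression of the standardized error \<open>r\<close> on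
  \<open>V = x \<bullet> v\<close> and \<open>U = x \<bullet> u\<close> when
  \<open>U = a * (r + V) + g\<close> with \<open>r\<close>, \<open>V\<close>, \<open>g\<close>
  independent standard normal, rescaled by \<open>\<sigma>0\<close>. The residual variance of
  \<open>r\<close> is \<open>1 / (1 + a\<^sup>2)\<close>.\<close>

definition null_beta :: "nat \<Rightarrow> real \<Rightarrow> real \<Rightarrow> real \<Rightarrow> (nat \<Rightarrow> real) \<Rightarrow> (nat \<Rightarrow> real) \<Rightarrow> real vec" where
  "null_beta p b \<sigma>0 a v u = Matrix.vec p (\<lambda>j. (if j = 0 then b else 0) + \<sigma>0 * ((a * u j - a\<^sup>2 * v j) / (1 + a\<^sup>2)))"

text \<open>Standardized error of the alternative plus \<open>x \<bullet> v\<close>. For a unit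
  vector \<open>v\<close> it has variance 2 under the alternative.\<close>

definition deviation :: "nat \<Rightarrow> real \<Rightarrow> real \<Rightarrow> (nat \<Rightarrow> real) \<Rightarrow> obs \<Rightarrow> real" where
  "deviation p b \<sigma>0 v z = (fst z - snd z 0 * b) / \<sigma>0 + (\<Sum>j<p. snd z j * v j)"

text \<open>Density of \<open>N(a D, 1)\<close> relative to \<open>N(0, 1)\<close> at
  \<open>x \<bullet> u\<close>, with \<open>D\<close> the deviation: this conditional law is all
  that separates a spiked null from the alternative.\<close>

definition likelihood_ratio :: "nat \<Rightarrow> real \<Rightarrow> real \<Rightarrow> real \<Rightarrow> (nat \<Rightarrow> real) \<Rightarrow> (nat \<Rightarrow> real) \<Rightarrow> obs \<Rightarrow> real" where
  "likelihood_ratio p b \<sigma>0 a v u z =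
     exp (a * deviation p b \<sigma>0 v z * (\<Sum>j<p. snd z j * u j) - a\<^sup>2 * (deviation p b \<sigma>0 v z)\<^sup>2 / 2)"

lemma deviation_measurable [measurable]: "p > 0 \<Longrightarrow> deviation p b \<sigma>0 v \<in> borel_measurable (obs_space p)"
  unfolding deviation_def obs_space_def by measurable

lemma linear_measurable [measurable]: "(\<lambda>z. \<Sum>j<p. snd z j * w j) \<in> borel_measurable (obs_space p)"
  unfolding obs_space_def by measurable

lemma likelihood_ratio_measurable [measurable]:
  "p > 0 \<Longrightarrow> likelihood_ratio p b \<sigma>0 a v u \<in> borel_measurable (obs_space p)"
  unfolding likelihood_ratio_def by measurable

lemma scalar_prod_qform:
  assumes "B \<in> carrier_mat p p"
  shows "Matrix.scalar_prod (Matrix.vec p x) (B *\<^sub>v Matrix.vec p x) = qform p (entries B) x"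
  unfolding bform_rows using assms by (auto simp: scalar_prod_def lessThan_atLeast0 intro!: sum.cong)

lemma mat_inverse_right:
  fixes A :: "real mat"
  assumes A: "A \<in> carrier_mat p p" and B: "B \<in> carrier_mat p p" and AB: "A * B = 1\<^sub>m p"
    and C: "mat_inverse A = Some C"
  shows "C = B"
proof -
  have C': "C \<in> carrier_mat p p" "C * A = 1\<^sub>m p" using mat_inverse(2)[OF A C] by auto
  have "C = C * (A * B)" using AB C' by simp
  also have "\<dots> = (C * A) * B" 
    by (rule assoc_mult_mat[symmetric, OF C'(1) A B])
  also have "\<dots> = B" using C' B by simp
  finally show ?thesis .
qed

lemma param_space_inverse:
  assumes th: "(\<beta>, \<Sigma>, \<sigma>) \<in> param_space M1 M2 p k" and "p > 0" "M1 > 0"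
    and B: "B \<in> carrier_mat p p" "\<Sigma> * B = 1\<^sub>m p"
  shows "the (mat_inverse \<Sigma>) = B" and "Determinant.det \<Sigma> > 0"
proof -
  from th have S: "\<Sigma> \<in> carrier_mat p p" by (auto simp: param_space_def)
  obtain L where L: "\<And>i. i < p \<Longrightarrow> L i i > 0" "\<And>i j. i < j \<Longrightarrow> L i j = 0"
    "\<And>i j. i < p \<Longrightarrow> j < p \<Longrightarrow> \<Sigma> $$ (i, j) = (\<Sum>k<p. L i k * L j k)"
    using param_space_Cholesky[OF assms(1-3)] by blast
  obtain C where "mat_inverse \<Sigma> = Some C"
    using mvn_density_tri_map(3)[where L=L, OF S] L by blast
  with mat_inverse_right[OF S B] show "the (mat_inverse \<Sigma>) = B" by simp
  have "Determinant.det \<Sigma> = (\<Prod>i<p. L i i)\<^sup>2"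
    using mvn_density_tri_map(2)[where L=L, OF S] L by blast
  moreover have "(\<Prod>i<p. L i i) > 0" using L(1) by (intro prod_pos) auto
  then have "(\<Prod>i<p. L i i)\<^sup>2 > 0" by (rule zero_less_power)
  ultimately show "Determinant.det \<Sigma> > 0" by (simp only:)
qed

lemma mat_inverse_one: "the (mat_inverse (1\<^sub>m p :: real mat)) = 1\<^sub>m p"
proof -
  obtain C where "mat_inverse (1\<^sub>m p :: real mat) = Some C" using left_inverse_exists[of "1\<^sub>m p" p] by auto
  with mat_inverse_right[of "1\<^sub>m p" p "1\<^sub>m p"] show ?thesis by simp
qed

lemma qform_one: "qform p (entries (1\<^sub>m p)) x = (\<Sum>j<p. (x j)\<^sup>2)"
proof -
  have "qform p (entries (1\<^sub>m p)) x = (\<Sum>i<p. \<Sum>j<p. if j = i then x i * x i else 0)"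
    unfolding bform_def by (intro sum.cong refl) auto
  then show ?thesis by (simp add: power2_eq_square)
qed

text \<open>The constant is left existential: its value involves the determinant of the spiked
  covariance, and total mass determines it later.\<close>

lemma density_ratio:
  assumes p: "p > 0" and M1: "M1 > 0" and s0: "\<sigma>0 > 0"
    and v: "(\<Sum>j<p. (v j)\<^sup>2) = 1" and u: "(\<Sum>j<p. (u j)\<^sup>2) = 1" and vu: "(\<Sum>j<p. v j * u j) = 0"
    and th: "(null_beta p b \<sigma>0 a v u, spiked_cov p a v u, \<sigma>0 / sqrt (1 + a\<^sup>2)) \<in> param_space M1 M2 p k"
  obtains c where "c > 0" "\<And>x y. mvn_density p (spiked_cov p a v u) x *
      normal_density 0 (\<sigma>0 / sqrt (1 + a\<^sup>2)) (y - (\<Sum>j<p. x j * Matrix.vec_index (null_beta p b \<sigma>0 a v u) j))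
    = c * likelihood_ratio p b \<sigma>0 a v u (y, x) *
      (mvn_density p (1\<^sub>m p) x * normal_density 0 \<sigma>0 (y - (\<Sum>j<p. x j * Matrix.vec_index (coord_beta p b) j)))"
proof -
  let ?S = "spiked_cov p a v u"
  define A where "A = 1 + a\<^sup>2"
  have A: "A > 0" by (simp add: A_def add_pos_nonneg)
  have Q: "spiked_inv p a v u \<in> carrier_mat p p" by (simp add: spiked_inv_def)
  note inv = param_space_inverse[OF th p M1 Q spiked_inv_right[OF v u vu]]
  note inv1 = mat_inverse_one
  define c where "c = sqrt A / sqrt (Determinant.det ?S)"
  have c: "c > 0" using A inv(2) by (simp add: c_def)
  show thesis
  proof (rule that[OF c])
    fix x y
    define V where "V = (\<Sum>j<p. x j * v j)"
    define U where "U = (\<Sum>j<p. x j * u j)"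
    define X where "X = (\<Sum>j<p. (x j)\<^sup>2)"
    define r where "r = (y - x 0 * b) / \<sigma>0"
    define m where "m = (a * U - a\<^sup>2 * V) / A"
    have x0: "(\<Sum>j<p. x j * (if j = 0 then b else 0)) = x 0 * b"
      using p by (simp add: if_distrib[of "\<lambda>t. _ * t"] sum.delta cong: if_cong)
    have nb: "(\<Sum>j<p. x j * Matrix.vec_index (null_beta p b \<sigma>0 a v u) j) = x 0 * b + \<sigma>0 * m"
    proof -
      have "(\<Sum>j<p. x j * Matrix.vec_index (null_beta p b \<sigma>0 a v u) j)
          = (\<Sum>j<p. x j * (if j = 0 then b else 0) + \<sigma>0 / A * (a * (x j * u j) - a\<^sup>2 * (x j * v j)))"
        by (intro sum.cong refl)
          (simp add: null_beta_def A_def distrib_left right_diff_distrib diff_divide_distrib mult_ac)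
      also have "\<dots> = x 0 * b + \<sigma>0 / A * (a * U - a\<^sup>2 * V)"
        by (simp only: sum.distrib x0 sum_distrib_left[symmetric] sum_subtractf U_def V_def)
      finally show ?thesis by (simp add: m_def)
    qed
    have cb: "(\<Sum>j<p. x j * Matrix.vec_index (coord_beta p b) j) = x 0 * b"
      unfolding x0[symmetric] by (intro sum.cong refl) (simp add: coord_beta_def)
    have y1: "y - (x 0 * b + \<sigma>0 * m) = \<sigma>0 * (r - m)" "y - x 0 * b = \<sigma>0 * r"
    proof -
      show "y - x 0 * b = \<sigma>0 * r" using s0 by (simp add: r_def)
      then show "y - (x 0 * b + \<sigma>0 * m) = \<sigma>0 * (r - m)" by (simp add: right_diff_distrib)
    qed
    have d: "deviation p b \<sigma>0 v (y, x) = r + V" by (simp add: deviation_def r_def V_def)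
    have D1: "mvn_density p ?S x = exp (- (X + (a\<^sup>2 * V\<^sup>2 - 2 * a * V * U - a\<^sup>2 * U\<^sup>2) / A) / 2) / (sqrt ((2 * pi) ^ p) * sqrt (Determinant.det ?S))"
      unfolding mvn_density_def inv(1) scalar_prod_qform[OF Q] spiked_quadratic A_def X_def V_def U_def real_sqrt_mult ..
    have D2: "mvn_density p (1\<^sub>m p) x = exp (- X / 2) / sqrt ((2 * pi) ^ p)"
      unfolding mvn_density_def inv1 scalar_prod_qform[OF one_carrier_mat] qform_one X_def by simp
    have N1: "normal_density 0 (\<sigma>0 / sqrt (1 + a\<^sup>2)) (\<sigma>0 * (r - m)) = sqrt A / (sqrt (2 * pi) * \<sigma>0) * exp (- (A * (r - m)\<^sup>2) / 2)"
    proof -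
      have "sqrt (2 * pi * (\<sigma>0 / sqrt A)\<^sup>2) = sqrt (2 * pi) * (\<sigma>0 / sqrt A)"
        using s0 A by (simp add: real_sqrt_mult)
      moreover have "- (\<sigma>0 * (r - m))\<^sup>2 / (2 * (\<sigma>0 / sqrt A)\<^sup>2) = - (A * (r - m)\<^sup>2) / 2"
        using s0 A by (simp add: power_mult_distrib power_divide)
      ultimately show ?thesis using A by (simp add: normal_density_def A_def[symmetric])
    qed
    have N2: "normal_density 0 \<sigma>0 (\<sigma>0 * r) = 1 / (sqrt (2 * pi) * \<sigma>0) * exp (- r\<^sup>2 / 2)"
    proof -
      have "sqrt (2 * pi * \<sigma>0\<^sup>2) = sqrt (2 * pi) * \<sigma>0" using s0 by (simp add: real_sqrt_mult)
      moreover have "- (\<sigma>0 * r)\<^sup>2 / (2 * \<sigma>0\<^sup>2) = - r\<^sup>2 / 2" using s0 by (simp add: power_mult_distrib)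
      ultimately show ?thesis by (simp add: normal_density_def)
    qed
    \<comment> \<open>Completing the square. \<open>A\<close> is the inverse error variance in units
      of \<open>\<sigma>0\<^sup>2\<close>; the parts of the two exponents with denominator
      \<open>A\<close> combine into \<open>a\<^sup>2 * V\<^sup>2 - 2 * a * U * V\<close>.\<close>
    have ex: "- (X + (a\<^sup>2 * V\<^sup>2 - 2 * a * V * U - a\<^sup>2 * U\<^sup>2) / A) / 2 + - (A * (r - m)\<^sup>2) / 2
        = (a * (r + V) * U - a\<^sup>2 * (r + V)\<^sup>2 / 2) + (- X / 2 + - r\<^sup>2 / 2)"
    proof -
      have "A * (r - m)\<^sup>2 = A * r\<^sup>2 - 2 * r * (A * m) + (A * m)\<^sup>2 / A"
        using A by (simp add: power2_eq_square algebra_simps)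
      also have "A * m = a * U - a\<^sup>2 * V" using A by (simp add: m_def)
      finally have 1: "A * (r - m)\<^sup>2 = A * r\<^sup>2 - 2 * r * (a * U - a\<^sup>2 * V) + (a * U - a\<^sup>2 * V)\<^sup>2 / A" .
      have "(a\<^sup>2 * V\<^sup>2 - 2 * a * V * U - a\<^sup>2 * U\<^sup>2) + (a * U - a\<^sup>2 * V)\<^sup>2 = A * (a\<^sup>2 * V\<^sup>2 - 2 * a * U * V)"
        by (simp add: A_def power2_eq_square algebra_simps)
      then have 2: "(a\<^sup>2 * V\<^sup>2 - 2 * a * V * U - a\<^sup>2 * U\<^sup>2) / A + (a * U - a\<^sup>2 * V)\<^sup>2 / A = a\<^sup>2 * V\<^sup>2 - 2 * a * U * V"
        using A by (simp add: add_divide_distrib[symmetric])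
      have "X + (a\<^sup>2 * V\<^sup>2 - 2 * a * V * U - a\<^sup>2 * U\<^sup>2) / A + A * (r - m)\<^sup>2
          = X + A * r\<^sup>2 - 2 * r * (a * U - a\<^sup>2 * V) + (a\<^sup>2 * V\<^sup>2 - 2 * a * U * V)"
        unfolding 1 2[symmetric] by simp
      also have "\<dots> = X + r\<^sup>2 - 2 * (a * (r + V) * U - a\<^sup>2 * (r + V)\<^sup>2 / 2)"
        by (simp add: A_def power2_eq_square algebra_simps)
      finally have 3: "X + (a\<^sup>2 * V\<^sup>2 - 2 * a * V * U - a\<^sup>2 * U\<^sup>2) / A + A * (r - m)\<^sup>2
          = X + r\<^sup>2 - 2 * (a * (r + V) * U - a\<^sup>2 * (r + V)\<^sup>2 / 2)" .
      have "- (X + Q) / 2 + - R / 2 = T + (- X / 2 + - s / 2)" if "X + Q + R = X + s - 2 * T" for X Q R s T :: real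
        using that by (simp add: field_simps)
      from this[OF 3] show ?thesis .
    qed
    have ee: "exp (- (X + (a\<^sup>2 * V\<^sup>2 - 2 * a * V * U - a\<^sup>2 * U\<^sup>2) / A) / 2) * exp (- (A * (r - m)\<^sup>2) / 2)
        = exp (a * (r + V) * U - a\<^sup>2 * (r + V)\<^sup>2 / 2) * (exp (- X / 2) * exp (- r\<^sup>2 / 2))"
      unfolding exp_add[symmetric] ex ..
    have lr: "likelihood_ratio p b \<sigma>0 a v u (y, x) = exp (a * (r + V) * U - a\<^sup>2 * (r + V)\<^sup>2 / 2)"
      by (simp add: likelihood_ratio_def d U_def)
    have "mvn_density p ?S x * normal_density 0 (\<sigma>0 / sqrt (1 + a\<^sup>2)) (\<sigma>0 * (r - m))
        = c / (sqrt ((2 * pi) ^ p) * (sqrt (2 * pi) * \<sigma>0)) *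
          (exp (- (X + (a\<^sup>2 * V\<^sup>2 - 2 * a * V * U - a\<^sup>2 * U\<^sup>2) / A) / 2) * exp (- (A * (r - m)\<^sup>2) / 2))"
      unfolding D1 N1 c_def by (simp add: mult_ac)
    also have "\<dots> = c * likelihood_ratio p b \<sigma>0 a v u (y, x) * (mvn_density p (1\<^sub>m p) x * normal_density 0 \<sigma>0 (\<sigma>0 * r))"
      unfolding ee lr D2 N2 by (simp add: mult_ac)
    finally show "mvn_density p ?S x * normal_density 0 (\<sigma>0 / sqrt (1 + a\<^sup>2)) (y - (\<Sum>j<p. x j * Matrix.vec_index (null_beta p b \<sigma>0 a v u) j))
      = c * likelihood_ratio p b \<sigma>0 a v u (y, x) *
        (mvn_density p (1\<^sub>m p) x * normal_density 0 \<sigma>0 (y - (\<Sum>j<p. x j * Matrix.vec_index (coord_beta p b) j)))"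
      unfolding nb cb y1 .
  qed
qed

text \<open>Under the alternative the error and \<open>x \<bullet> v\<close> are independent
  standard variables, hence the factor \<open>sqrt 2\<close>; \<open>w\<close> lives off the support
  of \<open>v\<close>, so \<open>x \<bullet> w\<close> is independent of both.\<close>

lemma nn_integral_deviation:
  fixes F :: "real \<Rightarrow> real \<Rightarrow> ennreal"
  assumes F[measurable]: "(\<lambda>(a, b). F a b) \<in> borel_measurable (borel \<Otimes>\<^sub>M borel)"
    and p: "p > 0" and s0: "\<sigma>0 > 0" and v: "(\<Sum>j<p. (v j)\<^sup>2) = 1" and vw: "\<And>j. j < p \<Longrightarrow> v j * w j = 0"
  shows "(\<integral>\<^sup>+z. F (deviation p b \<sigma>0 v z) (\<Sum>j<p. snd z j * w j) \<partial>obs_law p (coord_beta p b, 1\<^sub>m p, \<sigma>0))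
    = (\<integral>\<^sup>+s. \<integral>\<^sup>+t. F (sqrt 2 * s) (sqrt (\<Sum>j<p. (w j)\<^sup>2) * t) \<partial>gauss \<partial>gauss)"
proof -
  interpret N: prob_space "noise \<sigma>0" using s0 by (rule prob_space_normal_density)
  interpret G: prob_space gauss by (rule prob_space_gauss)
  interpret GG: pair_sigma_finite gauss gauss ..
  have [measurable_cong]: "sets (\<Pi>\<^sub>M i\<in>{..<p}. gauss) = sets (\<Pi>\<^sub>M i\<in>{..<p}. borel)" by (rule sets_PiM_gauss)
  have \<beta>: "coord_beta p b \<in> carrier_vec p" by (simp add: coord_beta_def)
  have cb: "(\<Sum>j<p. x j * Matrix.vec_index (coord_beta p b) j) = x 0 * b" for x
  proof -
    have "(\<Sum>j<p. x j * Matrix.vec_index (coord_beta p b) j) = (\<Sum>j<p. if j = 0 then x 0 * b else 0)"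
      by (intro sum.cong refl) (simp add: coord_beta_def)
    then show ?thesis using p by simp
  qed
  note [measurable] = obs_map_measurable[OF \<beta>]
  define f where "f z = F (deviation p b \<sigma>0 v z) (\<Sum>j<p. snd z j * w j)" for z
  have [measurable]: "f \<in> borel_measurable (obs_space p)" unfolding f_def[abs_def] using p by measurable
  define V where "V x = (\<Sum>j<p. v j * x j)" for x
  define T where "T x = (\<Sum>j<p. w j * x j)" for x
  have [measurable]: "V \<in> borel_measurable (\<Pi>\<^sub>M i\<in>{..<p}. borel)" "T \<in> borel_measurable (\<Pi>\<^sub>M i\<in>{..<p}. borel)"
    unfolding V_def T_def by measurable
  have fm: "f (obs_map p (coord_beta p b) (x, e)) = F (e / \<sigma>0 + V x) (T x)" for x e
    by (simp add: f_def deviation_def obs_map_def scalar_prod_vec_right[OF \<beta>] cb V_def T_def mult.commute)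
  define F' where "F' a c = (\<integral>\<^sup>+z. F (z + a) c \<partial>gauss)" for a c
  have F'[measurable]: "(\<lambda>(a, c). F' a c) \<in> borel_measurable (borel \<Otimes>\<^sub>M borel)"
    unfolding F'_def by measurable
  let ?L = "\<lambda>i j :: nat. if i = j then 1 else 0 :: real"
  have mv: "mvn p (1\<^sub>m p) = distr (\<Pi>\<^sub>M i\<in>{..<p}. gauss) (\<Pi>\<^sub>M i\<in>{..<p}. borel) (tri_map p ?L)"
    by (rule mvn_eq_distr) (auto simp: if_distrib[of "\<lambda>t. t * _"] sum.delta cong: if_cong)
  have tri: "tri_map p ?L g j = g j" if "j < p" for g j
    using that by (simp add: tri_map_def if_distrib[of "\<lambda>t. t * _"] sum.delta cong: if_cong)
  have "(\<integral>\<^sup>+z. f z \<partial>obs_law p (coord_beta p b, 1\<^sub>m p, \<sigma>0)) = (\<integral>\<^sup>+q. f (obs_map p (coord_beta p b) q) \<partial>(mvn p (1\<^sub>m p) \<Otimes>\<^sub>M noise \<sigma>0))"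
    unfolding obs_law_eq by (rule nn_integral_distr) measurable
  also have "\<dots> = (\<integral>\<^sup>+x. \<integral>\<^sup>+e. f (obs_map p (coord_beta p b) (x, e)) \<partial>noise \<sigma>0 \<partial>mvn p (1\<^sub>m p))"
    by (rule N.nn_integral_fst[symmetric]) measurable
  also have "\<dots> = (\<integral>\<^sup>+x. F' (V x) (T x) \<partial>mvn p (1\<^sub>m p))"
  proof (rule nn_integral_cong)
    fix x
    show "(\<integral>\<^sup>+e. f (obs_map p (coord_beta p b) (x, e)) \<partial>noise \<sigma>0) = F' (V x) (T x)"
      unfolding fm F'_def using nn_integral_normal[of "\<lambda>e. F (e / \<sigma>0 + V x) (T x)" \<sigma>0] s0 by simp
  qed
  also have "\<dots> = (\<integral>\<^sup>+g. F' (V (tri_map p ?L g)) (T (tri_map p ?L g)) \<partial>(\<Pi>\<^sub>M i\<in>{..<p}. gauss))"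
    unfolding mv by (rule nn_integral_distr) measurable
  also have "\<dots> = (\<integral>\<^sup>+g. F' (0 + (\<Sum>j<p. v j * g j)) (0 + (\<Sum>j<p. w j * g j)) \<partial>(\<Pi>\<^sub>M i\<in>{..<p}. gauss))"
    by (simp add: V_def T_def tri)
  also have "\<dots> = (\<integral>\<^sup>+s. \<integral>\<^sup>+t. F' (0 + sqrt (\<Sum>j<p. (v j)\<^sup>2) * s) (0 + sqrt (\<Sum>j<p. (w j)\<^sup>2) * t) \<partial>gauss \<partial>gauss)"
    by (rule nn_integral_gauss_linear2[OF F' vw])
  also have "\<dots> = (\<integral>\<^sup>+s. \<integral>\<^sup>+z. \<integral>\<^sup>+t. F (z + s) (sqrt (\<Sum>j<p. (w j)\<^sup>2) * t) \<partial>gauss \<partial>gauss \<partial>gauss)"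
  proof (rule nn_integral_cong)
    fix s :: real
    have "(\<integral>\<^sup>+t. \<integral>\<^sup>+z. F (z + s) (sqrt (\<Sum>j<p. (w j)\<^sup>2) * t) \<partial>gauss \<partial>gauss)
        = (\<integral>\<^sup>+z. \<integral>\<^sup>+t. F (z + s) (sqrt (\<Sum>j<p. (w j)\<^sup>2) * t) \<partial>gauss \<partial>gauss)"
      by (rule GG.Fubini') measurable
    then show "(\<integral>\<^sup>+t. F' (0 + sqrt (\<Sum>j<p. (v j)\<^sup>2) * s) (0 + sqrt (\<Sum>j<p. (w j)\<^sup>2) * t) \<partial>gauss)
        = (\<integral>\<^sup>+z. \<integral>\<^sup>+t. F (z + s) (sqrt (\<Sum>j<p. (w j)\<^sup>2) * t) \<partial>gauss \<partial>gauss)"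
      by (simp add: F'_def v)
  qed
  also have "\<dots> = (\<integral>\<^sup>+s. \<integral>\<^sup>+z. (\<lambda>c. \<integral>\<^sup>+t. F c (sqrt (\<Sum>j<p. (w j)\<^sup>2) * t) \<partial>gauss) (0 + 1 * s + 1 * z) \<partial>gauss \<partial>gauss)"
    by (simp add: add.commute)
  also have "\<dots> = (\<integral>\<^sup>+s. (\<lambda>c. \<integral>\<^sup>+t. F c (sqrt (\<Sum>j<p. (w j)\<^sup>2) * t) \<partial>gauss) (0 + sqrt (1\<^sup>2 + 1\<^sup>2) * s) \<partial>gauss)"
    by (rule nn_integral_gauss_pair) measurable
  finally show ?thesis unfolding f_def by simp
qed

text \<open>Integrating \<open>x \<bullet> w\<close> first, with the deviation fixed at
  \<open>sqrt 2 * s\<close>, adds \<open>a\<^sup>2 * s\<^sup>2\<close> times the squared norm of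
  \<open>w\<close> to the exponent, by the normal moment generating function.\<close>

lemma nn_integral_deviation_exp:
  assumes p: "p > 0" and s0: "\<sigma>0 > 0" and v: "(\<Sum>j<p. (v j)\<^sup>2) = 1" and vw: "\<And>j. j < p \<Longrightarrow> v j * w j = 0"
  shows "(\<integral>\<^sup>+z. ennreal (exp (a * deviation p b \<sigma>0 v z * (\<Sum>j<p. snd z j * w j) - q * (deviation p b \<sigma>0 v z)\<^sup>2)) \<partial>obs_law p (coord_beta p b, 1\<^sub>m p, \<sigma>0))
    = (\<integral>\<^sup>+s. ennreal (exp ((a\<^sup>2 * (\<Sum>j<p. (w j)\<^sup>2) - 2 * q) * s\<^sup>2)) \<partial>gauss)"
proof -
  define W where "W = (\<Sum>j<p. (w j)\<^sup>2)"
  have W: "W \<ge> 0" by (simp add: W_def sum_nonneg)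
  have "(\<integral>\<^sup>+z. ennreal (exp (a * deviation p b \<sigma>0 v z * (\<Sum>j<p. snd z j * w j) - q * (deviation p b \<sigma>0 v z)\<^sup>2)) \<partial>obs_law p (coord_beta p b, 1\<^sub>m p, \<sigma>0))
     = (\<integral>\<^sup>+s. \<integral>\<^sup>+t. ennreal (exp (a * (sqrt 2 * s) * (sqrt W * t) - q * (sqrt 2 * s)\<^sup>2)) \<partial>gauss \<partial>gauss)"
    unfolding W_def
    by (rule nn_integral_deviation[where F="\<lambda>d t. ennreal (exp (a * d * t - q * d\<^sup>2))", OF _ p s0 v vw]) measurable
  also have "\<dots> = (\<integral>\<^sup>+s. ennreal (exp ((a\<^sup>2 * W - 2 * q) * s\<^sup>2)) \<partial>gauss)"
  proof (rule nn_integral_cong)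
    fix s :: real
    have "(\<integral>\<^sup>+t. ennreal (exp (a * (sqrt 2 * s) * (sqrt W * t) - q * (sqrt 2 * s)\<^sup>2)) \<partial>gauss)
        = (\<integral>\<^sup>+t. ennreal (exp (- 2 * q * s\<^sup>2)) * ennreal (exp ((a * sqrt 2 * s * sqrt W) * t)) \<partial>gauss)"
      by (intro nn_integral_cong) (simp add: ennreal_mult[symmetric] exp_add[symmetric] power_mult_distrib mult_ac)
    also have "\<dots> = ennreal (exp (- 2 * q * s\<^sup>2)) * ennreal (exp ((a * sqrt 2 * s * sqrt W)\<^sup>2 / 2))"
      by (subst nn_integral_cmult) (auto simp: nn_integral_gauss_exp)
    also have "\<dots> = ennreal (exp (- 2 * q * s\<^sup>2 + (a * sqrt 2 * s * sqrt W)\<^sup>2 / 2))"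
      by (simp only: exp_add ennreal_mult exp_ge_zero)
    also have "- 2 * q * s\<^sup>2 + (a * sqrt 2 * s * sqrt W)\<^sup>2 / 2 = (a\<^sup>2 * W - 2 * q) * s\<^sup>2"
      using W by (simp add: power_mult_distrib algebra_simps)
    finally show "(\<integral>\<^sup>+t. ennreal (exp (a * (sqrt 2 * s) * (sqrt W * t) - q * (sqrt 2 * s)\<^sup>2)) \<partial>gauss)
        = ennreal (exp ((a\<^sup>2 * W - 2 * q) * s\<^sup>2))" .
  qed
  finally show ?thesis unfolding W_def .
qed

lemma nn_integral_likelihood_ratio:
  assumes p: "p > 0" and s0: "\<sigma>0 > 0" and v: "(\<Sum>j<p. (v j)\<^sup>2) = 1" and u: "(\<Sum>j<p. (u j)\<^sup>2) = 1"
    and vu: "\<And>j. j < p \<Longrightarrow> v j * u j = 0"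
  shows "(\<integral>\<^sup>+z. ennreal (likelihood_ratio p b \<sigma>0 a v u z) \<partial>obs_law p (coord_beta p b, 1\<^sub>m p, \<sigma>0)) = 1"
proof -
  interpret G: prob_space gauss by (rule prob_space_gauss)
  have "(\<integral>\<^sup>+z. ennreal (likelihood_ratio p b \<sigma>0 a v u z) \<partial>obs_law p (coord_beta p b, 1\<^sub>m p, \<sigma>0))
     = (\<integral>\<^sup>+z. ennreal (exp (a * deviation p b \<sigma>0 v z * (\<Sum>j<p. snd z j * u j) - a\<^sup>2 / 2 * (deviation p b \<sigma>0 v z)\<^sup>2)) \<partial>obs_law p (coord_beta p b, 1\<^sub>m p, \<sigma>0))"
    by (simp add: likelihood_ratio_def)
  also have "\<dots> = (\<integral>\<^sup>+s. ennreal (exp ((a\<^sup>2 * (\<Sum>j<p. (u j)\<^sup>2) - 2 * (a\<^sup>2 / 2)) * s\<^sup>2)) \<partial>gauss)"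
    by (rule nn_integral_deviation_exp[OF p s0 v vu])
  finally show ?thesis using u G.emeasure_space_1 by simp
qed

text \<open>The product has an exponent of the same kind with \<open>w = u + u'\<close>, of squared
  norm \<open>2 + 2 * \<kappa>\<close>. The part without overlap cancels against the quadratic term,
  leaving the exponential moment of a square with coefficient
  \<open>2 * a\<^sup>2 * \<kappa>\<close>.\<close>

lemma nn_integral_likelihood_ratio_mult:
  assumes p: "p > 0" and s0: "\<sigma>0 > 0" and v: "(\<Sum>j<p. (v j)\<^sup>2) = 1"
    and u: "(\<Sum>j<p. (u j)\<^sup>2) = 1" "\<And>j. j < p \<Longrightarrow> v j * u j = 0"
    and u': "(\<Sum>j<p. (u' j)\<^sup>2) = 1" "\<And>j. j < p \<Longrightarrow> v j * u' j = 0"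
    and \<kappa>: "(\<Sum>j<p. u j * u' j) = \<kappa>" "0 \<le> \<kappa>" "4 * a\<^sup>2 * \<kappa> \<le> 1 / 2"
  shows "(\<integral>\<^sup>+z. ennreal (likelihood_ratio p b \<sigma>0 a v u z * likelihood_ratio p b \<sigma>0 a v u' z) \<partial>obs_law p (coord_beta p b, 1\<^sub>m p, \<sigma>0))
    \<le> ennreal (exp (4 * a\<^sup>2 * \<kappa>))"
proof -
  define x where "x = 2 * a\<^sup>2 * \<kappa>"
  have x: "0 \<le> x" "x \<le> 1 / 4" using \<kappa> by (auto simp: x_def)
  have W: "(\<Sum>j<p. (u j + u' j)\<^sup>2) = 2 + 2 * \<kappa>"
    using u(1) u'(1) \<kappa>(1) by (simp add: power2_sum sum.distrib sum_distrib_left[symmetric] mult.assoc)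
  have vw: "v j * (u j + u' j) = 0" if "j < p" for j
    unfolding distrib_left u(2)[OF that] u'(2)[OF that] by simp
  have lr: "likelihood_ratio p b \<sigma>0 a v u z * likelihood_ratio p b \<sigma>0 a v u' z
     = exp (a * deviation p b \<sigma>0 v z * (\<Sum>j<p. snd z j * (u j + u' j)) - a\<^sup>2 * (deviation p b \<sigma>0 v z)\<^sup>2)" for z
    unfolding likelihood_ratio_def exp_add[symmetric] distrib_left sum.distrib by (rule arg_cong[where f=exp]) simp
  have "(\<integral>\<^sup>+z. ennreal (likelihood_ratio p b \<sigma>0 a v u z * likelihood_ratio p b \<sigma>0 a v u' z) \<partial>obs_law p (coord_beta p b, 1\<^sub>m p, \<sigma>0))
      = (\<integral>\<^sup>+s. ennreal (exp ((a\<^sup>2 * (\<Sum>j<p. (u j + u' j)\<^sup>2) - 2 * a\<^sup>2) * s\<^sup>2)) \<partial>gauss)"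
    unfolding lr by (rule nn_integral_deviation_exp[OF p s0 v vw])
  also have "a\<^sup>2 * (\<Sum>j<p. (u j + u' j)\<^sup>2) - 2 * a\<^sup>2 = x" unfolding W by (simp add: x_def algebra_simps)
  also have "(\<integral>\<^sup>+s. ennreal (exp (x * s\<^sup>2)) \<partial>gauss) = ennreal (1 / sqrt (1 - 2 * x))"
    using x by (intro nn_integral_gauss_exp_square) simp
  also have "\<dots> \<le> ennreal (exp (4 * a\<^sup>2 * \<kappa>))"
  proof (rule ennreal_leI)
    \<comment> \<open>Removing the centering costs a factor \<open>exp x\<close>, and
      \<open>4 * x\<^sup>2 \<le> x\<close> on the range at hand.\<close>
    have "exp (- x) / sqrt (1 - 2 * x) \<le> exp (4 * x\<^sup>2)" using x by (intro chi_square_mgf_bound) auto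
    then have "exp x * (exp (- x) / sqrt (1 - 2 * x)) \<le> exp x * exp (4 * x\<^sup>2)" by (intro mult_left_mono) auto
    then have "1 / sqrt (1 - 2 * x) \<le> exp (x + 4 * x\<^sup>2)" by (simp add: exp_add exp_minus)
    also have "x + 4 * x\<^sup>2 \<le> x + 4 * (x * (1 / 4))"
      unfolding power2_eq_square using x by (intro add_left_mono mult_left_mono) auto
    then have "exp (x + 4 * x\<^sup>2) \<le> exp (2 * x)" by simp
    finally show "1 / sqrt (1 - 2 * x) \<le> exp (4 * a\<^sup>2 * \<kappa>)" by (simp add: x_def mult.assoc)
  qed
  finally show ?thesis .
qed

lemma obs_law_spiked:
  assumes p: "p > 0" and M1: "M1 > 0" and s0: "\<sigma>0 > 0"
    and v: "(\<Sum>j<p. (v j)\<^sup>2) = 1" and u: "(\<Sum>j<p. (u j)\<^sup>2) = 1" and vu: "\<And>j. j < p \<Longrightarrow> v j * u j = 0"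
    and th: "(null_beta p b \<sigma>0 a v u, spiked_cov p a v u, \<sigma>0 / sqrt (1 + a\<^sup>2)) \<in> param_space M1 M2 p k"
  shows "obs_law p (null_beta p b \<sigma>0 a v u, spiked_cov p a v u, \<sigma>0 / sqrt (1 + a\<^sup>2))
    = density (obs_law p (coord_beta p b, 1\<^sub>m p, \<sigma>0)) (\<lambda>z. ennreal (likelihood_ratio p b \<sigma>0 a v u z))"
proof -
  let ?S = "spiked_cov p a v u" and ?\<beta> = "null_beta p b \<sigma>0 a v u" and ?\<sigma> = "\<sigma>0 / sqrt (1 + a\<^sup>2)"
  let ?P = "obs_law p (?\<beta>, ?S, ?\<sigma>)" and ?P1 = "obs_law p (coord_beta p b, 1\<^sub>m p, \<sigma>0)"
  let ?lr = "likelihood_ratio p b \<sigma>0 a v u"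
  interpret P: prob_space ?P by (rule prob_space_obs_law[OF th p M1])
  have A: "1 + a\<^sup>2 > 0" by (simp add: add_pos_nonneg)
  have vu0: "(\<Sum>j<p. v j * u j) = 0" by (intro sum.neutral ballI, rule vu) simp
  have Q: "spiked_inv p a v u \<in> carrier_mat p p" by (simp add: spiked_inv_def)
  have inv: "the (mat_inverse ?S) = spiked_inv p a v u"
    by (rule param_space_inverse[OF th p M1 Q spiked_inv_right[OF v u vu0]])
  have inv1: "the (mat_inverse (1\<^sub>m p :: real mat)) \<in> carrier_mat p p"
    unfolding mat_inverse_one by (rule one_carrier_mat)
  obtain c where c: "c > 0" and ratio: "\<And>x y. mvn_density p ?S x * normal_density 0 ?\<sigma> (y - (\<Sum>j<p. x j * Matrix.vec_index ?\<beta> j))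
    = c * ?lr (y, x) * (mvn_density p (1\<^sub>m p) x * normal_density 0 \<sigma>0 (y - (\<Sum>j<p. x j * Matrix.vec_index (coord_beta p b) j)))"
    by (rule density_ratio[OF p M1 s0 v u vu0 th]) (rule that)
  note [measurable] = likelihood_ratio_measurable[OF p]
  have lr0: "?lr z \<ge> 0" for z by (simp add: likelihood_ratio_def)
  have md0: "mvn_density p (1\<^sub>m p) x \<ge> 0" "Determinant.det ?S > 0" for x
    using param_space_inverse(2)[OF th p M1 Q spiked_inv_right[OF v u vu0]] by (simp_all add: mvn_density_def)
  have md1: "mvn_density p ?S x \<ge> 0" for x using md0(2) by (simp add: mvn_density_def)
  have key: "(\<integral>\<^sup>+z. f z \<partial>?P) = (\<integral>\<^sup>+z. ennreal (c * ?lr z) * f z \<partial>?P1)"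
    if f[measurable]: "f \<in> borel_measurable (obs_space p)" for f
  proof -
    have "(\<integral>\<^sup>+z. f z \<partial>?P) = (\<integral>\<^sup>+x. \<integral>\<^sup>+y. ennreal (mvn_density p ?S x) *
      (ennreal (normal_density 0 ?\<sigma> (y - (\<Sum>j<p. x j * Matrix.vec_index ?\<beta> j))) * f (y, x)) \<partial>lborel \<partial>(\<Pi>\<^sub>M i\<in>{..<p}. lborel))"
      by (rule nn_integral_obs_law) (use s0 A inv Q in \<open>auto simp: null_beta_def\<close>)
    also have "\<dots> = (\<integral>\<^sup>+x. \<integral>\<^sup>+y. ennreal (mvn_density p (1\<^sub>m p) x) *
      (ennreal (normal_density 0 \<sigma>0 (y - (\<Sum>j<p. x j * Matrix.vec_index (coord_beta p b) j))) * (ennreal (c * ?lr (y, x)) * f (y, x))) \<partial>lborel \<partial>(\<Pi>\<^sub>M i\<in>{..<p}. lborel))"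
    proof (intro nn_integral_cong)
      fix x y
      let ?n = "normal_density 0 ?\<sigma> (y - (\<Sum>j<p. x j * Matrix.vec_index ?\<beta> j))"
      let ?n1 = "normal_density 0 \<sigma>0 (y - (\<Sum>j<p. x j * Matrix.vec_index (coord_beta p b) j))"
      have n: "?n \<ge> 0" "?n1 \<ge> 0" by simp_all
      have "ennreal (mvn_density p ?S x) * ennreal ?n = ennreal (mvn_density p ?S x * ?n)"
        using md1 n by (intro ennreal_mult[symmetric])
      also have "\<dots> = ennreal (mvn_density p (1\<^sub>m p) x * ?n1 * (c * ?lr (y, x)))"
        unfolding ratio by (simp add: mult_ac)
      also have "\<dots> = ennreal (mvn_density p (1\<^sub>m p) x) * ennreal ?n1 * ennreal (c * ?lr (y, x))"
        using md0(1) n c lr0 by (simp add: ennreal_mult)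
      finally show "ennreal (mvn_density p ?S x) * (ennreal ?n * f (y, x)) = ennreal (mvn_density p (1\<^sub>m p) x) * (ennreal ?n1 * (ennreal (c * ?lr (y, x)) * f (y, x)))"
        by (simp add: mult.assoc[symmetric])
    qed
    also have "\<dots> = (\<integral>\<^sup>+z. ennreal (c * ?lr z) * f z \<partial>?P1)"
      by (rule nn_integral_obs_law[symmetric]) (use s0 inv1 in \<open>auto simp: coord_beta_def\<close>)
    finally show ?thesis .
  qed
  \<comment> \<open>The spiked law and the reweighted one both have total mass one, which forces the
    constant of \<open>density_ratio\<close> to be 1.\<close>
  have "1 = (\<integral>\<^sup>+z. 1 \<partial>?P)" using P.emeasure_space_1 by simp
  also have "\<dots> = (\<integral>\<^sup>+z. ennreal c * ennreal (?lr z) \<partial>?P1)"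
    using c lr0 by (subst key) (auto simp: ennreal_mult)
  also have "\<dots> = ennreal c * (\<integral>\<^sup>+z. ennreal (?lr z) \<partial>?P1)" by (rule nn_integral_cmult) measurable
  also have "\<dots> = ennreal c" using nn_integral_likelihood_ratio[OF p s0 v u vu, of b a] by simp
  finally have c1: "c = 1" using c by (simp add: ennreal_eq_1 flip: ennreal_1)
  show ?thesis
  proof (rule measure_eqI)
    fix X assume "X \<in> sets ?P"
    then have X[measurable]: "X \<in> sets (obs_space p)" by simp
    have "emeasure ?P X = (\<integral>\<^sup>+z. indicator X z \<partial>?P)" by simp
    also have "\<dots> = (\<integral>\<^sup>+z. ennreal (?lr z) * indicator X z \<partial>?P1)" using c1 by (subst key) auto
    also have "\<dots> = emeasure (density ?P1 (\<lambda>z. ennreal (?lr z))) X" by (rule emeasure_density[symmetric]) auto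
    finally show "emeasure ?P X = emeasure (density ?P1 (\<lambda>z. ennreal (?lr z))) X" .
  qed simp
qed

text \<open>Le Cam's method with a second moment bound; the mixture has mean one under \<open>P\<close>, and
  \<open>1 - x \<le> \<epsilon> / 2 + (1 - x)\<^sup>2 / (2 \<epsilon>)\<close> replaces the Cauchy--Schwarz inequality.\<close>

lemma mixture_second_moment:
  fixes \<Lambda> :: "'g \<Rightarrow> 'a \<Rightarrow> real" and \<psi> :: "'a \<Rightarrow> real"
  assumes P: "prob_space P" and G: "finite G" "G \<noteq> {}"
    and \<Lambda>: "\<And>g. g \<in> G \<Longrightarrow> \<Lambda> g \<in> borel_measurable P" "\<And>g z. g \<in> G \<Longrightarrow> \<Lambda> g z \<ge> 0"
    and one: "\<And>g. g \<in> G \<Longrightarrow> (\<integral>\<^sup>+z. ennreal (\<Lambda> g z) \<partial>P) = 1"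
    and prod: "\<And>g g'. g \<in> G \<Longrightarrow> g' \<in> G \<Longrightarrow> (\<integral>\<^sup>+z. ennreal (\<Lambda> g z * \<Lambda> g' z) \<partial>P) \<le> ennreal (E g g')"
    and E: "\<And>g g'. g \<in> G \<Longrightarrow> g' \<in> G \<Longrightarrow> E g g' \<ge> 0"
    and avg: "(\<Sum>g\<in>G. \<Sum>g'\<in>G. E g g') / (real (card G))\<^sup>2 \<le> 1 + \<epsilon>\<^sup>2" and \<epsilon>: "\<epsilon> > 0"
    and \<psi>: "\<psi> \<in> borel_measurable P" "\<And>z. z \<in> space P \<Longrightarrow> 0 \<le> \<psi> z \<and> \<psi> z \<le> 1"
    and null: "\<And>g. g \<in> G \<Longrightarrow> (\<integral>z. \<Lambda> g z * \<psi> z \<partial>P) \<le> \<alpha>"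
  shows "(\<integral>z. \<psi> z \<partial>P) \<le> \<alpha> + \<epsilon>"
proof -
  interpret prob_space P by fact
  note [measurable] = \<Lambda>(1) \<psi>(1)
  define N where "N = real (card G)"
  have N: "N > 0" using G by (simp add: N_def card_gt_0_iff)
  have i1: "integrable P (\<Lambda> g)" "(\<integral>z. \<Lambda> g z \<partial>P) = 1" if "g \<in> G" for g
  proof -
    show i: "integrable P (\<Lambda> g)" using one[OF that] \<Lambda>[OF that] by (intro integrableI_nonneg) auto
    have "ennreal (\<integral>z. \<Lambda> g z \<partial>P) = ennreal 1"
      using nn_integral_eq_integral[OF i] one[OF that] \<Lambda>(2)[OF that] by simp
    then show "(\<integral>z. \<Lambda> g z \<partial>P) = 1" by (simp add: integral_nonneg_AE \<Lambda>(2)[OF that])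
  qed
  have i2: "integrable P (\<lambda>z. \<Lambda> g z * \<Lambda> g' z)" "(\<integral>z. \<Lambda> g z * \<Lambda> g' z \<partial>P) \<le> E g g'" if g: "g \<in> G" "g' \<in> G" for g g'
  proof -
    have nn: "\<Lambda> g z * \<Lambda> g' z \<ge> 0" for z using \<Lambda>(2) g by simp
    show i: "integrable P (\<lambda>z. \<Lambda> g z * \<Lambda> g' z)"
      using prod[OF g] g nn by (intro integrableI_nonneg) (auto intro: le_less_trans[OF _ ennreal_less_top])
    have "ennreal (\<integral>z. \<Lambda> g z * \<Lambda> g' z \<partial>P) \<le> ennreal (E g g')"
      using nn_integral_eq_integral[OF i] prod[OF g] nn by simp
    then show "(\<integral>z. \<Lambda> g z * \<Lambda> g' z \<partial>P) \<le> E g g'" using E[OF g] by simp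
  qed
  define M where "M z = (\<Sum>g\<in>G. \<Lambda> g z) / N" for z
  have [measurable]: "M \<in> borel_measurable P" unfolding M_def by measurable
  have M2: "(M z)\<^sup>2 = (\<Sum>g\<in>G. \<Sum>g'\<in>G. \<Lambda> g z * \<Lambda> g' z) / N\<^sup>2" for z
    by (simp add: M_def power_divide power2_eq_square sum_product)
  have iM: "integrable P M" "(\<integral>z. M z \<partial>P) = 1"
    unfolding M_def using i1 N by (auto simp: N_def)
  have iM2: "integrable P (\<lambda>z. (M z)\<^sup>2)"
    unfolding M2 using i2 by (intro Bochner_Integration.integrable_divide Bochner_Integration.integrable_sum) auto
  have "(\<integral>z. (M z)\<^sup>2 \<partial>P) = (\<Sum>g\<in>G. \<Sum>g'\<in>G. (\<integral>z. \<Lambda> g z * \<Lambda> g' z \<partial>P)) / N\<^sup>2"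
    unfolding M2 using i2 by (simp add: Bochner_Integration.integral_sum)
  also have "\<dots> \<le> (\<Sum>g\<in>G. \<Sum>g'\<in>G. E g g') / N\<^sup>2"
    by (intro divide_right_mono sum_mono i2) auto
  finally have m2: "(\<integral>z. (M z)\<^sup>2 \<partial>P) \<le> 1 + \<epsilon>\<^sup>2" using avg by (simp add: N_def)
  have i\<psi>: "integrable P \<psi>"
    using \<psi> by (intro integrable_const_bound[of _ 1]) auto
  have i\<Lambda>\<psi>: "integrable P (\<lambda>z. \<Lambda> g z * \<psi> z)" if "g \<in> G" for g
    by (rule Bochner_Integration.integrable_bound[OF i1(1)[OF that]])
      (use \<psi> \<Lambda> that in \<open>auto simp: abs_mult intro!: AE_I2 mult_left_le\<close>)
  have M\<psi>: "integrable P (\<lambda>z. M z * \<psi> z)" "(\<integral>z. M z * \<psi> z \<partial>P) \<le> \<alpha>"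
  proof -
    have eq: "M z * \<psi> z = (\<Sum>g\<in>G. \<Lambda> g z * \<psi> z) / N" for z by (simp add: M_def sum_distrib_right)
    show "integrable P (\<lambda>z. M z * \<psi> z)" unfolding eq using i\<Lambda>\<psi> by (intro Bochner_Integration.integrable_divide Bochner_Integration.integrable_sum) auto
    have "(\<integral>z. M z * \<psi> z \<partial>P) = (\<Sum>g\<in>G. (\<integral>z. \<Lambda> g z * \<psi> z \<partial>P)) / N"
      unfolding eq using i\<Lambda>\<psi> by (simp add: Bochner_Integration.integral_sum)
    also have "\<dots> \<le> (\<Sum>g\<in>G. \<alpha>) / N" using N by (intro divide_right_mono sum_mono null) auto
    also have "\<dots> = \<alpha>" using N by (simp add: N_def)
    finally show "(\<integral>z. M z * \<psi> z \<partial>P) \<le> \<alpha>" .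
  qed
  have "(\<integral>z. \<psi> z \<partial>P) \<le> (\<integral>z. M z * \<psi> z + (\<epsilon> / 2 + (1 - 2 * M z + (M z)\<^sup>2) / (2 * \<epsilon>)) \<partial>P)"
  proof (rule integral_mono)
    show "integrable P (\<lambda>z. M z * \<psi> z + (\<epsilon> / 2 + (1 - 2 * M z + (M z)\<^sup>2) / (2 * \<epsilon>)))"
      using M\<psi>(1) iM(1) iM2 by auto
    fix z assume z: "z \<in> space P"
    have "0 \<le> (\<epsilon> - \<bar>1 - M z\<bar>)\<^sup>2 / (2 * \<epsilon>)" using \<epsilon> by simp
    also have "\<dots> = \<epsilon> / 2 - \<bar>1 - M z\<bar> + \<bar>1 - M z\<bar>\<^sup>2 / (2 * \<epsilon>)"
    proof -
      have "(\<epsilon> - t)\<^sup>2 / (2 * \<epsilon>) = \<epsilon> / 2 - t + t\<^sup>2 / (2 * \<epsilon>)" for t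
        using \<epsilon> by (simp add: field_simps power2_eq_square)
      then show ?thesis .
    qed
    finally have "\<bar>1 - M z\<bar> \<le> \<epsilon> / 2 + (1 - M z)\<^sup>2 / (2 * \<epsilon>)" by simp
    moreover have "(1 - M z) * \<psi> z \<le> \<bar>1 - M z\<bar>"
    proof -
      have "(1 - M z) * \<psi> z \<le> \<bar>1 - M z\<bar> * \<psi> z" using \<psi>(2)[OF z] by (intro mult_right_mono) auto
      also have "\<dots> \<le> \<bar>1 - M z\<bar>" using \<psi>(2)[OF z] by (intro mult_left_le) auto
      finally show ?thesis .
    qed
    moreover have "(1 - M z)\<^sup>2 = 1 - 2 * M z + (M z)\<^sup>2" by (simp add: power2_diff)
    ultimately show "\<psi> z \<le> M z * \<psi> z + (\<epsilon> / 2 + (1 - 2 * M z + (M z)\<^sup>2) / (2 * \<epsilon>))"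
      by (simp add: left_diff_distrib)
  qed (rule i\<psi>)
  also have "\<dots> = (\<integral>z. M z * \<psi> z \<partial>P) + (\<epsilon> / 2 + (1 - 2 * (\<integral>z. M z \<partial>P) + (\<integral>z. (M z)\<^sup>2 \<partial>P)) / (2 * \<epsilon>))"
    using M\<psi>(1) iM(1) iM2 by (simp add: prob_space)
  \<comment> \<open>As the mixture \<open>M\<close> has mean one, the expectation of
    \<open>(1 - M)\<^sup>2\<close> is its second moment minus one, at most
    \<open>\<epsilon>\<^sup>2\<close>.\<close>
  also have "\<dots> \<le> \<alpha> + (\<epsilon> / 2 + \<epsilon>\<^sup>2 / (2 * \<epsilon>))"
    using M\<psi>(2) m2 iM(2) \<epsilon> by (intro add_mono divide_right_mono order_refl) auto
  also have "\<dots> = \<alpha> + \<epsilon>" using \<epsilon> by (simp add: power2_eq_square)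
  finally show ?thesis .
qed

section \<open>A prior on the null hypothesis\<close>

lemma orthogonal_pair_exists:
  fixes x y :: real
  obtains e f where "e\<^sup>2 + f\<^sup>2 = 1" "e * x + f * y = 0"
proof (cases "x\<^sup>2 + y\<^sup>2 = 0")
  case True
  then have "x = 0" by (simp add: sum_power2_eq_zero_iff)
  then show thesis using that[of 1 0] by simp
next
  case False
  define \<rho> where "\<rho> = sqrt (x\<^sup>2 + y\<^sup>2)"
  have "\<rho>\<^sup>2 = x\<^sup>2 + y\<^sup>2" by (simp add: \<rho>_def)
  moreover have "\<rho>\<^sup>2 \<noteq> 0" using False calculation by simp
  ultimately have "(y / \<rho>)\<^sup>2 + (- x / \<rho>)\<^sup>2 = 1" by (simp add: power_divide add_divide_distrib[symmetric] add.commute)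
  moreover have "y / \<rho> * x + - x / \<rho> * y = 0" by simp
  ultimately show thesis by (rule that)
qed

text \<open>The vector \<open>W m\<close> lives on the coordinates \<open>h + 2 m\<close> and \<open>h + 2 m + 1\<close>; two coordinates always leave room for a
  unit vector orthogonal to the loading \<open>x\<close>.\<close>

definition pair_frame :: "nat \<Rightarrow> (nat \<Rightarrow> real) \<Rightarrow> (nat \<Rightarrow> nat \<Rightarrow> real) \<Rightarrow> bool" where
  "pair_frame h x W \<longleftrightarrow> (\<forall>m. (\<forall>j. j \<noteq> h + 2 * m \<longrightarrow> j \<noteq> h + 2 * m + 1 \<longrightarrow> W m j = 0) \<and>
     (W m (h + 2 * m))\<^sup>2 + (W m (h + 2 * m + 1))\<^sup>2 = 1 \<and>
     W m (h + 2 * m) * x (h + 2 * m) + W m (h + 2 * m + 1) * x (h + 2 * m + 1) = 0)"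

lemma pair_frame_exists: "\<exists>W. pair_frame h x W"
proof -
  have "\<exists>e f. e\<^sup>2 + f\<^sup>2 = 1 \<and> e * x (h + 2 * m) + f * x (h + 2 * m + 1) = 0" for m
    by (rule orthogonal_pair_exists[of "x (h + 2 * m)" "x (h + 2 * m + 1)"]) blast
  then obtain e f where ef: "\<And>m. (e m)\<^sup>2 + (f m)\<^sup>2 = 1 \<and> e m * x (h + 2 * m) + f m * x (h + 2 * m + 1) = (0 :: real)"
    by metis
  show ?thesis
    by (rule exI[of _ "\<lambda>m j. if j = h + 2 * m then e m else if j = h + 2 * m + 1 then f m else 0"])
      (use ef in \<open>simp add: pair_frame_def\<close>)
qed

lemma pair_frame_sum:
  assumes W: "pair_frame h x W" and m: "h + 2 * m + 1 < p"
  shows "(\<Sum>j<p. W m j * \<phi> j) = W m (h + 2 * m) * \<phi> (h + 2 * m) + W m (h + 2 * m + 1) * \<phi> (h + 2 * m + 1)"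
proof -
  have "(\<Sum>j<p. W m j * \<phi> j) = (\<Sum>j\<in>{h + 2 * m, h + 2 * m + 1}. W m j * \<phi> j)"
    using W m by (intro sum.mono_neutral_right) (auto simp: pair_frame_def)
  then show ?thesis by simp
qed

lemma pair_frame_inner:
  assumes W: "pair_frame h x W" and m: "h + 2 * m + 1 < p"
  shows "(\<Sum>j<p. W m j * W m' j) = (if m = m' then 1 else 0)"
proof (cases "m = m'")
  case True
  then show ?thesis unfolding pair_frame_sum[OF W m] using W by (simp add: pair_frame_def power2_eq_square)
next
  case False
  then have "h + 2 * m \<noteq> h + 2 * m'" "h + 2 * m \<noteq> h + 2 * m' + 1" "h + 2 * m + 1 \<noteq> h + 2 * m'" "h + 2 * m + 1 \<noteq> h + 2 * m' + 1"
    by presburger+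
  then have "W m' (h + 2 * m) = 0" "W m' (h + 2 * m + 1) = 0" using W unfolding pair_frame_def by blast+
  then show ?thesis unfolding pair_frame_sum[OF W m] using False by simp
qed

text \<open>One of \<open>B\<close> frame vectors is chosen in each of \<open>s\<close> blocks, so that the overlap of two independent uniform
  choices is binomial.\<close>

definition prior_dir :: "nat \<Rightarrow> nat \<Rightarrow> (nat \<Rightarrow> nat \<Rightarrow> real) \<Rightarrow> (nat \<Rightarrow> nat) \<Rightarrow> nat \<Rightarrow> real" where
  "prior_dir s B W g j = (\<Sum>t<s. W (t * B + g t) j) / sqrt s"

lemma block_index_less: "t < s \<Longrightarrow> c < B \<Longrightarrow> t * B + c < s * (B :: nat)"
proof -
  assume "t < s" "c < B"
  then have "t * B + c < t * B + B" by simp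
  also have "\<dots> = Suc t * B" by simp
  also have "\<dots> \<le> s * B" using \<open>t < s\<close> by (intro mult_le_mono1) simp
  finally show ?thesis .
qed

lemma block_pair_less:
  fixes t s c B h p :: nat
  assumes "t < s" "c < B" "h + 2 * (s * B) \<le> p"
  shows "h + 2 * (t * B + c) + 1 < p"
proof -
  define m where "m = t * B + c"
  define l where "l = s * B"
  have "m < l" unfolding m_def l_def using assms by (intro block_index_less)
  with assms(3) show ?thesis unfolding m_def[symmetric] l_def[symmetric] by linarith
qed

lemma block_index_eq_iff: "c < B \<Longrightarrow> c' < B \<Longrightarrow> t * B + c = t' * B + c' \<longleftrightarrow> t = t' \<and> c = (c' :: nat)"
proof -
  assume c: "c < B" "c' < B"
  have "(t * B + c) div B = t" "(t' * B + c') div B = t'" using c by auto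
  then show ?thesis by auto
qed

text \<open>Only terms with \<open>t = t'\<close> and the same choice survive, because a frame index
  determines its block and its position; each contributes \<open>1 / s\<close>.\<close>

lemma prior_dir_inner:
  assumes W: "pair_frame h x W" and p: "h + 2 * (s * B) \<le> p" and s: "s > 0"
    and g: "g \<in> {..<s} \<rightarrow>\<^sub>E {..<B}" "g' \<in> {..<s} \<rightarrow>\<^sub>E {..<B}"
  shows "(\<Sum>j<p. prior_dir s B W g j * prior_dir s B W g' j) = card {t. t < s \<and> g t = g' t} / s"
proof -
  have gB: "g t < B" "g' t < B" if "t < s" for t using g that by auto
  have idx: "h + 2 * (t * B + g t) + 1 < p" if "t < s" for t
    by (rule block_pair_less[OF that gB(1)[OF that] p])
  have "(\<Sum>j<p. prior_dir s B W g j * prior_dir s B W g' j)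
      = (\<Sum>j<p. (\<Sum>t<s. \<Sum>t'<s. W (t * B + g t) j * W (t' * B + g' t') j) / s)"
    by (intro sum.cong refl) (simp add: prior_dir_def sum_product)
  also have "\<dots> = (\<Sum>t<s. \<Sum>t'<s. \<Sum>j<p. W (t * B + g t) j * W (t' * B + g' t') j) / s"
    unfolding sum_divide_distrib[symmetric] by (subst sum.swap, subst (2) sum.swap) (rule refl)
  also have "(\<Sum>t<s. \<Sum>t'<s. \<Sum>j<p. W (t * B + g t) j * W (t' * B + g' t') j)
      = (\<Sum>t<s. \<Sum>t'<s. if t' = t then (if g t = g' t then 1 else 0) else 0)"
  proof (intro sum.cong refl)
    fix t t' assume "t \<in> {..<s}" "t' \<in> {..<s}"
    then have t: "t < s" "t' < s" by auto
    show "(\<Sum>j<p. W (t * B + g t) j * W (t' * B + g' t') j) = (if t' = t then (if g t = g' t then 1 else 0) else 0)"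
      unfolding pair_frame_inner[OF W idx[OF t(1)]] block_index_eq_iff[OF gB(1)[OF t(1)] gB(2)[OF t(2)]] by auto
  qed
  also have "\<dots> = (\<Sum>t<s. if g t = g' t then 1 else 0)" by simp
  also have "\<dots> = card {t. t < s \<and> g t = g' t}"
    by (simp add: sum.If_cases Int_def conj_commute)
  finally show ?thesis .
qed

text \<open>Keeps the \<open>u\<close> part of the coefficient shift invisible to the loading, so
  that \<open>\<xi> \<bullet> \<beta>\<close> moves through \<open>v\<close> alone.\<close>

lemma prior_dir_orthogonal:
  assumes W: "pair_frame h x W" and p: "h + 2 * (s * B) \<le> p" and g: "g \<in> {..<s} \<rightarrow>\<^sub>E {..<B}"
  shows "(\<Sum>j<p. prior_dir s B W g j * x j) = 0"
proof -
  have "(\<Sum>j<p. prior_dir s B W g j * x j) = (\<Sum>j<p. \<Sum>t<s. W (t * B + g t) j * x j) / sqrt s"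
    by (simp add: prior_dir_def sum_divide_distrib sum_distrib_right)
  also have "(\<Sum>j<p. \<Sum>t<s. W (t * B + g t) j * x j) = (\<Sum>t<s. \<Sum>j<p. W (t * B + g t) j * x j)" by (rule sum.swap)
  also have "\<dots> = (\<Sum>t<s. 0)"
  proof (intro sum.cong refl)
    fix t assume "t \<in> {..<s}"
    then have t: "t < s" "g t < B" using g by auto
    show "(\<Sum>j<p. W (t * B + g t) j * x j) = 0"
      unfolding pair_frame_sum[OF W block_pair_less[OF t p]] using W unfolding pair_frame_def by blast
  qed
  finally show ?thesis by simp
qed

lemma prior_dir_head:
  assumes W: "pair_frame h x W" and j: "j < h"
  shows "prior_dir s B W g j = 0"
proof -
  have "W m j = 0" for m using W j unfolding pair_frame_def by (metis not_add_less1 add.assoc)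
  then show ?thesis by (simp add: prior_dir_def)
qed

lemma prior_dir_support:
  assumes W: "pair_frame h x W"
  shows "finite {j. prior_dir s B W g j \<noteq> 0}" "card {j. prior_dir s B W g j \<noteq> 0} \<le> 2 * s"
proof -
  define S where "S = (\<Union>t<s. {h + 2 * (t * B + g t), h + 2 * (t * B + g t) + 1})"
  have sub: "{j. prior_dir s B W g j \<noteq> 0} \<subseteq> S"
  proof
    fix j assume "j \<in> {j. prior_dir s B W g j \<noteq> 0}"
    then have "(\<Sum>t<s. W (t * B + g t) j) \<noteq> 0" by (auto simp: prior_dir_def)
    then obtain t where t: "t \<in> {..<s}" "W (t * B + g t) j \<noteq> 0" by (rule sum.not_neutral_contains_not_neutral)
    then have "j = h + 2 * (t * B + g t) \<or> j = h + 2 * (t * B + g t) + 1"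
      using W unfolding pair_frame_def by blast
    then show "j \<in> S" unfolding S_def by (intro UN_I[OF t(1)]) simp
  qed
  have fin: "finite S" by (auto simp: S_def)
  show "finite {j. prior_dir s B W g j \<noteq> 0}" by (rule finite_subset[OF sub fin])
  have "card S \<le> (\<Sum>t<s. card {h + 2 * (t * B + g t), h + 2 * (t * B + g t) + 1})"
    unfolding S_def by (intro card_UN_le) auto
  also have "\<dots> = 2 * s" by simp
  finally show "card {j. prior_dir s B W g j \<noteq> 0} \<le> 2 * s" using card_mono[OF fin sub] by linarith
qed

text \<open>Factorizing over blocks computes the average exactly: it is
  \<open>((B - 1 + c) / B) ^ s\<close>, the generating function at \<open>c\<close> of a binomial
  variable with \<open>s\<close> trials and success probability \<open>1 / B\<close>.\<close>

lemma overlap_exp_sum: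
  fixes c :: real and s B :: nat
  assumes B: "B > 0" and c: "c > 0"
  shows "(\<Sum>g\<in>{..<s} \<rightarrow>\<^sub>E {..<B}. \<Sum>g'\<in>{..<s} \<rightarrow>\<^sub>E {..<B}. c ^ card {t. t < s \<and> g t = g' t}) / (real (card ({..<s::nat} \<rightarrow>\<^sub>E {..<B})))\<^sup>2
    \<le> exp (s * c / B)"
proof -
  let ?G = "{..<s} \<rightarrow>\<^sub>E {..<B}"
  have inner: "(\<Sum>g'\<in>?G. c ^ card {t. t < s \<and> g t = g' t}) = (real B - 1 + c) ^ s" if g: "g \<in> ?G" for g
  proof -
    have "(\<Sum>g'\<in>?G. c ^ card {t. t < s \<and> g t = g' t}) = (\<Sum>g'\<in>?G. \<Prod>t<s. if g t = g' t then c else 1)"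
      by (intro sum.cong refl) (simp add: prod.If_cases Int_def conj_commute)
    also have "\<dots> = (\<Prod>t<s. \<Sum>b<B. if g t = b then c else 1)"
      by (rule prod_sum_PiE[symmetric]) auto
    also have "\<dots> = (\<Prod>t<s. real B - 1 + c)"
    proof (rule prod.cong[OF refl])
      fix t assume "t \<in> {..<s}"
      then have t: "g t < B" using g by auto
      have "(\<Sum>b<B. if g t = b then c else 1) = (\<Sum>b<B. (if b = g t then c - 1 else 0) + 1)"
        by (intro sum.cong refl) auto
      also have "\<dots> = real B - 1 + c" using t by (simp add: sum.distrib)
      finally show "(\<Sum>b<B. if g t = b then c else 1) = real B - 1 + c" .
    qed
    finally show ?thesis by simp
  qed
  have cG: "real (card ?G) = real B ^ s" by (simp add: card_PiE)
  have "(\<Sum>g\<in>?G. \<Sum>g'\<in>?G. c ^ card {t. t < s \<and> g t = g' t}) = real B ^ s * (real B - 1 + c) ^ s"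
    using inner by (simp add: cG)
  then have "(\<Sum>g\<in>?G. \<Sum>g'\<in>?G. c ^ card {t. t < s \<and> g t = g' t}) / (real (card ?G))\<^sup>2 = ((real B - 1 + c) / B) ^ s"
    using B by (simp add: cG power2_eq_square power_divide)
  also have "\<dots> \<le> (exp (c / B)) ^ s"
  proof (rule power_mono)
    have "(real B - 1 + c) / B \<le> 1 + c / B" using B by (simp add: add_divide_distrib diff_divide_distrib)
    also have "\<dots> \<le> exp (c / B)" by (rule exp_ge_add_one_self)
    finally show "(real B - 1 + c) / B \<le> exp (c / B)" .
    show "0 \<le> (real B - 1 + c) / B" using B c by simp
  qed
  also have "\<dots> = exp (s * c / B)" by (simp add: exp_of_nat_mult[symmetric])
  finally show ?thesis .
qed

section \<open>Admissible parameters for the prior and the resulting lower bound\<close>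

lemma spiked_param:
  fixes M1 M2 :: real
  assumes M1: "M1 > 1" and M2: "M2 > 0" and p: "p > 0" and a: "0 \<le> a" "2 * a \<le> 1 - 1 / M1" "1 + 2 * a + 2 * a\<^sup>2 \<le> M1"
    and v: "(\<Sum>j<p. (v j)\<^sup>2) = 1" "\<And>j. j \<ge> h \<Longrightarrow> v j = 0" and h: "h > 0"
    and u: "(\<Sum>j<p. (u j)\<^sup>2) = 1" "finite {j. u j \<noteq> 0}" "card {j. u j \<noteq> 0} \<le> 2 * s"
    and k: "h + 2 * s \<le> k"
  shows "(null_beta p b M2 a v u, spiked_cov p a v u, M2 / sqrt (1 + a\<^sup>2)) \<in> param_space M1 M2 p k"
proof (rule param_spaceI[OF _ spiked_cov_carrier])
  show "null_beta p b M2 a v u \<in> carrier_vec p" by (simp add: null_beta_def)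
  \<comment> \<open>The head contains coordinate 0 because \<open>h > 0\<close>, so the
    alternative's own entry does not enlarge the support.\<close>
  have "{i. i < dim_vec (null_beta p b M2 a v u) \<and> Matrix.vec_index (null_beta p b M2 a v u) i \<noteq> 0} \<subseteq> {..<h} \<union> {j. u j \<noteq> 0}"
  proof
    fix i assume i: "i \<in> {i. i < dim_vec (null_beta p b M2 a v u) \<and> Matrix.vec_index (null_beta p b M2 a v u) i \<noteq> 0}"
    show "i \<in> {..<h} \<union> {j. u j \<noteq> 0}"
    proof (rule ccontr)
      assume "i \<notin> {..<h} \<union> {j. u j \<noteq> 0}"
      then have "h \<le> i" "u i = 0" by auto
      then have "u i = 0" "v i = 0" "i \<noteq> 0" using v(2) h by auto
      moreover have "i < p" using i by (simp add: null_beta_def)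
      ultimately have "Matrix.vec_index (null_beta p b M2 a v u) i = 0" by (simp add: null_beta_def)
      then show False using i by simp
    qed
  qed
  then have "l0_norm (null_beta p b M2 a v u) \<le> card ({..<h} \<union> {j. u j \<noteq> 0})"
    unfolding l0_norm_def using u(2) by (intro card_mono) auto
  also have "\<dots> \<le> h + 2 * s" using card_Un_le[of "{..<h}" "{j. u j \<noteq> 0}"] u(3) by simp
  finally show "l0_norm (null_beta p b M2 a v u) \<le> k" using k by simp
  \<comment> \<open>The null has a smaller noise level than the alternative, so the alternative may
    take the largest admissible one, \<open>M2\<close>.\<close>
  have r: "sqrt (1 + a\<^sup>2) \<ge> 1" by simp
  then have "sqrt (1 + a\<^sup>2) > 0" by linarith
  then show "0 < M2 / sqrt (1 + a\<^sup>2)" using M2 by (intro divide_pos_pos)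
  show "M2 / sqrt (1 + a\<^sup>2) \<le> M2" by (rule order.trans[OF divide_left_mono[OF r less_imp_le[OF M2]]]) (use \<open>sqrt (1 + a\<^sup>2) > 0\<close> in simp_all)
  fix x :: "nat \<Rightarrow> real"
  have X: "0 \<le> (\<Sum>i<p. (x i)\<^sup>2)" by (simp add: sum_nonneg)
  have "1 / M1 \<le> 1 - 2 * a" using a by simp
  from mult_right_mono[OF this X] show "1 / M1 * (\<Sum>i<p. (x i)\<^sup>2) \<le> qform p (entries (spiked_cov p a v u)) x"
    using spiked_cov_bounds(1)[OF v(1) u(1) a(1), of x] by linarith
  from mult_right_mono[OF a(3) X] show "qform p (entries (spiked_cov p a v u)) x \<le> M1 * (\<Sum>i<p. (x i)\<^sup>2)"
    using spiked_cov_bounds(2)[OF v(1) u(1) a(1), of x] by linarith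
qed (rule p)

lemma coord_param:
  fixes M1 M2 :: real
  assumes M1: "M1 > 1" and M2: "M2 > 0" and p: "p > 0" and k: "k \<ge> 1"
  shows "(coord_beta p b, 1\<^sub>m p, M2) \<in> param_space M1 M2 p k"
proof (rule param_spaceI)
  have "{i. i < dim_vec (coord_beta p b) \<and> Matrix.vec_index (coord_beta p b) i \<noteq> 0} \<subseteq> {0}"
    by (auto simp: coord_beta_def split: if_splits)
  then have "l0_norm (coord_beta p b) \<le> card {0::nat}" unfolding l0_norm_def by (intro card_mono) auto
  then show "l0_norm (coord_beta p b) \<le> k" using k by simp
  fix x :: "nat \<Rightarrow> real"
  have X: "0 \<le> (\<Sum>i<p. (x i)\<^sup>2)" by (simp add: sum_nonneg)
  have "1 / M1 \<le> 1" "1 \<le> M1" using M1 by auto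
  from mult_right_mono[OF this(1) X] mult_right_mono[OF this(2) X]
  show "1 / M1 * (\<Sum>i<p. (x i)\<^sup>2) \<le> qform p (entries (1\<^sub>m p)) x" "qform p (entries (1\<^sub>m p)) x \<le> M1 * (\<Sum>i<p. (x i)\<^sup>2)"
    unfolding qform_one by simp_all
qed (use p M2 in \<open>auto simp: coord_beta_def\<close>)

text \<open>A test of level \<open>\<alpha>\<close> on the mixture has power at most
  \<open>\<alpha> + \<epsilon>\<close> at the alternative, so no separation up to that of the
  alternative from \<open>t0\<close> is detectable. Head length \<open>h\<close>, number of blocks
  \<open>s\<close> and block size \<open>B\<close> stay free; \<open>8 * a\<^sup>2 \<le> 1\<close>
  meets the range of \<open>nn_integral_likelihood_ratio_mult\<close> even at full overlap.\<close>

lemma tau_adap_lower: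
  fixes M1 M2 \<alpha> \<eta> a \<epsilon> t0 :: real and n p ku k h s B :: nat and \<xi> :: "real vec"
  assumes M1: "M1 > 1" and M2: "M2 > 0" and a: "0 < a" "2 * a \<le> 1 - 1 / M1" "1 + 2 * a + 2 * a\<^sup>2 \<le> M1" "8 * a\<^sup>2 \<le> 1"
    and h: "h > 0" and s: "s > 0" and B: "B > 0" and p: "h + 2 * (s * B) \<le> p" and ku: "h + 2 * s \<le> ku" and k: "k \<ge> 1"
    and \<xi>: "\<xi> \<in> carrier_vec p" "Matrix.vec_index \<xi> 0 \<noteq> 0"
    and \<epsilon>: "\<epsilon> > 0" "\<alpha> + \<epsilon> < 1 - \<eta>" and chi: "exp (s * exp (4 * real n * a\<^sup>2 / s) / B) \<le> 1 + \<epsilon>\<^sup>2"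
  shows "ereal (M2 * (a\<^sup>2 / (1 + a\<^sup>2)) * sqrt (\<Sum>j<h. (Matrix.vec_index \<xi> j)\<^sup>2)) \<le> tau_adap M1 M2 \<alpha> \<eta> n p t0 ku k \<xi>"
proof -
  define x where "x j = Matrix.vec_index \<xi> j" for j
  define R where "R = sqrt (\<Sum>j<h. (x j)\<^sup>2)"
  define \<tau>' where "\<tau>' = M2 * (a\<^sup>2 / (1 + a\<^sup>2)) * R"
  \<comment> \<open>Chosen so that the alternative has
    \<open>\<xi> \<bullet> \<beta> = t0 + \<tau>'\<close>; the shift along \<open>v\<close> in the
    null lowers this by exactly \<open>\<tau>'\<close>.\<close>
  define b where "b = (t0 + \<tau>') / x 0"
  define v where "v j = (if j < h then x j / R else 0)" for j
  have p0: "p > 0" and hp: "h \<le> p" using p h by auto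
  have M10: "M1 > 0" using M1 by simp
  have A: "1 + a\<^sup>2 > 0" by (simp add: add_pos_nonneg)
  have "(x 0)\<^sup>2 \<le> (\<Sum>j<h. (x j)\<^sup>2)" using h by (intro member_le_sum) auto
  moreover have "(x 0)\<^sup>2 > 0" using \<xi>(2) by (simp add: x_def)
  ultimately have R2: "(\<Sum>j<h. (x j)\<^sup>2) > 0" by linarith
  then have R: "R > 0" "R\<^sup>2 = (\<Sum>j<h. (x j)\<^sup>2)" by (simp_all add: R_def less_imp_le)
  have vsum: "(\<Sum>j<p. v j * \<phi> j) = (\<Sum>j<h. x j * \<phi> j) / R" for \<phi>
  proof -
    have "(\<Sum>j<p. v j * \<phi> j) = (\<Sum>j<h. v j * \<phi> j)" using hp by (intro sum.mono_neutral_right) (auto simp: v_def)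
    also have "\<dots> = (\<Sum>j<h. x j * \<phi> j / R)" by (intro sum.cong) (auto simp: v_def)
    finally show ?thesis by (simp add: sum_divide_distrib)
  qed
  have v1: "(\<Sum>j<p. (v j)\<^sup>2) = 1"
  proof -
    have "(\<Sum>j<p. (v j)\<^sup>2) = (\<Sum>j<h. x j * v j) / R" using vsum[of v] by (simp add: power2_eq_square)
    also have "(\<Sum>j<h. x j * v j) = (\<Sum>j<h. (x j)\<^sup>2 / R)" by (intro sum.cong) (auto simp: v_def power2_eq_square)
    also have "\<dots> / R = R\<^sup>2 / R / R" by (simp add: R(2) sum_divide_distrib)
    finally show ?thesis using R(1) by (simp add: power2_eq_square)
  qed
  have vx: "(\<Sum>j<p. v j * x j) = R"
  proof -
    have "(\<Sum>j<p. v j * x j) = R\<^sup>2 / R" unfolding vsum R(2) by (simp add: power2_eq_square)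
    then show ?thesis using R(1) by (simp add: power2_eq_square)
  qed
  obtain W where W: "pair_frame h x W" using pair_frame_exists by blast
  define G where "G = ({..<s} \<rightarrow>\<^sub>E {..<B})"
  have G: "finite G" "G \<noteq> {}" using B by (auto simp: G_def PiE_eq_empty_iff intro!: finite_PiE)
  define u where "u = prior_dir s B W"
  have uu: "(\<Sum>j<p. u g j * u g' j) = card {t. t < s \<and> g t = g' t} / s" if "g \<in> G" "g' \<in> G" for g g'
    unfolding u_def by (rule prior_dir_inner[OF W p s]) (use that in \<open>auto simp: G_def\<close>)
  have u1: "(\<Sum>j<p. (u g j)\<^sup>2) = 1" if "g \<in> G" for g
    using uu[OF that that] s by (simp add: power2_eq_square)
  have vu: "v j * u g j = 0" for g j
    using prior_dir_head[OF W, of j s B g] by (cases "j < h") (auto simp: u_def v_def)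
  have ux: "(\<Sum>j<p. u g j * x j) = 0" if "g \<in> G" for g
    unfolding u_def by (rule prior_dir_orthogonal[OF W p]) (use that in \<open>auto simp: G_def\<close>)
  define \<theta> where "\<theta> g = (null_beta p b M2 a v (u g), spiked_cov p a v (u g), M2 / sqrt (1 + a\<^sup>2))" for g
  define \<theta>1 where "\<theta>1 = (coord_beta p b, 1\<^sub>m p :: real mat, M2)"
  have th: "\<theta> g \<in> param_space M1 M2 p ku" if "g \<in> G" for g
    unfolding \<theta>_def
    by (rule spiked_param[OF M1 M2 p0 _ a(2,3) v1 _ h u1[OF that] _ _ ku])
      (use a prior_dir_support[OF W] in \<open>auto simp: v_def u_def\<close>)
  have th1: "\<theta>1 \<in> param_space M1 M2 p k" unfolding \<theta>1_def by (rule coord_param[OF M1 M2 p0 k])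
  have xb: "(\<Sum>j<p. x j * (if j = 0 then b else 0)) = t0 + \<tau>'"
  proof -
    have "(\<Sum>j<p. x j * (if j = 0 then b else 0)) = (\<Sum>j<p. if j = 0 then x 0 * b else 0)" by (intro sum.cong) auto
    then show ?thesis using p0 \<xi>(2) by (simp add: b_def x_def)
  qed
  have null: "\<theta> g \<in> null_space M1 M2 p ku \<xi> t0" if g: "g \<in> G" for g
  proof -
    have "Matrix.scalar_prod \<xi> (null_beta p b M2 a v (u g)) = (\<Sum>j<p. x j * Matrix.vec_index (null_beta p b M2 a v (u g)) j)"
      unfolding x_def by (rule scalar_prod_sum) (simp add: null_beta_def)
    also have "\<dots> = (\<Sum>j<p. x j * (if j = 0 then b else 0) + M2 / (1 + a\<^sup>2) * (a * (u g j * x j) - a\<^sup>2 * (v j * x j)))"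
      by (intro sum.cong refl) (simp add: null_beta_def distrib_left right_diff_distrib diff_divide_distrib mult_ac)
    also have "\<dots> = t0 + \<tau>' + M2 / (1 + a\<^sup>2) * (a * 0 - a\<^sup>2 * R)"
      by (simp only: sum.distrib xb sum_distrib_left[symmetric] sum_subtractf ux[OF g] vx)
    also have "\<dots> = t0" by (simp add: \<tau>'_def)
    finally show ?thesis using th[OF g] by (simp add: null_space_def \<theta>_def)
  qed
  have alt: "\<theta>1 \<in> alt_space M1 M2 \<tau> p k \<xi> t0" if "\<tau> \<le> \<tau>'" for \<tau>
  proof -
    have "Matrix.scalar_prod \<xi> (coord_beta p b) = (\<Sum>j<p. x j * Matrix.vec_index (coord_beta p b) j)"
      unfolding x_def by (rule scalar_prod_sum) (simp add: coord_beta_def)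
    also have "\<dots> = t0 + \<tau>'" unfolding xb[symmetric] by (intro sum.cong refl) (simp add: coord_beta_def)
    finally show ?thesis using th1 that by (simp add: alt_space_def \<theta>1_def)
  qed
  define lr where "lr g = likelihood_ratio p b M2 a v (u g)" for g
  have lrm[measurable]: "lr g \<in> borel_measurable (obs_space p)" for g
    unfolding lr_def by (rule likelihood_ratio_measurable[OF p0])
  have lr0: "lr g z \<ge> 0" for g z by (simp add: lr_def likelihood_ratio_def)
  have P1: "prob_space (obs_law p \<theta>1)" unfolding \<theta>1_def
    by (rule prob_space_obs_law[OF _ p0 M10]) (use th1 in \<open>simp add: \<theta>1_def\<close>)
  interpret P1: prob_space "obs_law p \<theta>1" by (rule P1)
  interpret PP: product_sigma_finite "\<lambda>_::nat. obs_law p \<theta>1" by standard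
  have law: "obs_law p (\<theta> g) = density (obs_law p \<theta>1) (\<lambda>z. ennreal (lr g z))" if g: "g \<in> G" for g
    unfolding \<theta>_def \<theta>1_def lr_def
    by (rule obs_law_spiked[OF p0 M10 M2 v1 u1[OF g] vu]) (use th[OF g] in \<open>simp add: \<theta>_def\<close>)
  define \<Lambda> where "\<Lambda> g z = (\<Prod>i<n. lr g (z i))" for g and z :: "nat \<Rightarrow> obs"
  let ?P = "data_law n p \<theta>1"
  have Pdef: "?P = (\<Pi>\<^sub>M i\<in>{..<n}. obs_law p \<theta>1)" by (simp add: data_law_def)
  have PP: "prob_space ?P" unfolding Pdef by (rule prob_space_PiM) (rule P1)
  have \<Lambda>0: "\<Lambda> g z \<ge> 0" for g z unfolding \<Lambda>_def by (intro prod_nonneg) (auto simp: lr0)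
  have \<Lambda>m: "\<Lambda> g \<in> borel_measurable ?P" for g unfolding Pdef \<Lambda>_def by measurable
  have dlaw: "data_law n p (\<theta> g) = density ?P (\<lambda>z. ennreal (\<Lambda> g z))" if g: "g \<in> G" for g
  proof -
    obtain \<beta> \<Sigma> \<sigma> where e: "\<theta> g = (\<beta>, \<Sigma>, \<sigma>)" by (cases "\<theta> g") auto
    have "prob_space (obs_law p (\<theta> g))" unfolding e
      by (rule prob_space_obs_law[OF _ p0 M10]) (use th[OF g] e in simp)
    then interpret Pg: prob_space "density (obs_law p \<theta>1) (\<lambda>z. ennreal (lr g z))" unfolding law[OF g] .
    have "data_law n p (\<theta> g) = density ?P (\<lambda>z. \<Prod>i<n. ennreal (lr g (z i)))"
      unfolding data_law_def law[OF g]
      by (rule PiM_density) (auto intro: P1.sigma_finite_measure_axioms Pg.sigma_finite_measure_axioms)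
    then show ?thesis by (simp add: \<Lambda>_def prod_ennreal lr0)
  qed
  have one: "(\<integral>\<^sup>+z. ennreal (\<Lambda> g z) \<partial>?P) = 1" if g: "g \<in> G" for g
  proof -
    have "(\<integral>\<^sup>+z. ennreal (\<Lambda> g z) \<partial>?P) = (\<integral>\<^sup>+z. (\<Prod>i<n. ennreal (lr g (z i))) \<partial>?P)" by (simp add: \<Lambda>_def prod_ennreal lr0)
    also have "\<dots> = (\<Prod>i<n. \<integral>\<^sup>+z. ennreal (lr g z) \<partial>obs_law p \<theta>1)"
      unfolding Pdef by (rule PP.product_nn_integral_prod) auto
    also have "(\<integral>\<^sup>+z. ennreal (lr g z) \<partial>obs_law p \<theta>1) = 1"
      unfolding lr_def \<theta>1_def by (rule nn_integral_likelihood_ratio[OF p0 M2 v1 u1[OF g] vu])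
    finally show ?thesis by simp
  qed
  \<comment> \<open>A common block has the share \<open>1 / s\<close> of the overlap; over
    \<open>n\<close> observations it multiplies the second moment bound by this factor.\<close>
  define c where "c = exp (4 * real n * a\<^sup>2 / s)"
  have prod: "(\<integral>\<^sup>+z. ennreal (\<Lambda> g z * \<Lambda> g' z) \<partial>?P) \<le> ennreal (c ^ card {t. t < s \<and> g t = g' t})"
    if g: "g \<in> G" "g' \<in> G" for g g'
  proof -
    let ?J = "card {t. t < s \<and> g t = g' t}"
    define \<kappa> where "\<kappa> = ?J / real s"
    have "?J \<le> card {..<s}" by (intro card_mono) auto
    then have \<kappa>: "0 \<le> \<kappa>" "\<kappa> \<le> 1" using s by (simp_all add: \<kappa>_def)
    have "a\<^sup>2 * \<kappa> \<le> a\<^sup>2 * 1" using \<kappa> by (intro mult_left_mono) auto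
    then have k2: "4 * a\<^sup>2 * \<kappa> \<le> 1 / 2" using a(4) by simp
    have "(\<integral>\<^sup>+z. ennreal (\<Lambda> g z * \<Lambda> g' z) \<partial>?P) = (\<integral>\<^sup>+z. (\<Prod>i<n. ennreal (lr g (z i) * lr g' (z i))) \<partial>?P)"
      by (simp add: \<Lambda>_def prod_ennreal lr0 prod.distrib)
    also have "\<dots> = (\<Prod>i<n. \<integral>\<^sup>+z. ennreal (lr g z * lr g' z) \<partial>obs_law p \<theta>1)"
      unfolding Pdef by (rule PP.product_nn_integral_prod) auto
    also have "\<dots> \<le> (\<Prod>i<n. ennreal (exp (4 * a\<^sup>2 * \<kappa>)))"
    proof -
      have le: "(\<integral>\<^sup>+z. ennreal (lr g z * lr g' z) \<partial>obs_law p \<theta>1) \<le> ennreal (exp (4 * a\<^sup>2 * \<kappa>))"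
        unfolding lr_def \<theta>1_def
        by (rule nn_integral_likelihood_ratio_mult[OF p0 M2 v1 u1[OF g(1)] vu u1[OF g(2)] vu _ \<kappa>(1) k2])
          (use uu[OF g] in \<open>simp add: \<kappa>_def\<close>)
      show ?thesis by (induction n) (auto intro: mult_mono le)
    qed
    also have "\<dots> = ennreal (exp (4 * a\<^sup>2 * \<kappa>) ^ n)" by (simp add: ennreal_power)
    also have "exp (4 * a\<^sup>2 * \<kappa>) ^ n = c ^ ?J"
      by (simp add: c_def exp_of_nat_mult[symmetric] \<kappa>_def mult_ac)
    finally show ?thesis .
  qed
  have test: "expect n p \<theta>1 \<psi> \<le> \<alpha> + \<epsilon>" if \<psi>: "\<psi> \<in> tests n p \<alpha> (null_space M1 M2 p ku \<xi> t0)" for \<psi>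
  proof (rule mixture_second_moment[OF PP G, where \<Lambda> = \<Lambda> and E = "\<lambda>g g'. c ^ card {t. t < s \<and> g t = g' t}"])
    have "c > 0" by (simp add: c_def)
    then show "(\<Sum>g\<in>G. \<Sum>g'\<in>G. c ^ card {t. t < s \<and> g t = g' t}) / (real (card G))\<^sup>2 \<le> 1 + \<epsilon>\<^sup>2"
      using overlap_exp_sum[OF B, of c s] chi unfolding G_def c_def by linarith
    show \<psi>m: "\<psi> \<in> borel_measurable ?P"
      unfolding measurable_cong_sets[OF sets_data_law refl] using \<psi> by (simp add: tests_def)
    show "0 \<le> \<psi> z \<and> \<psi> z \<le> 1" if "z \<in> space ?P" for z using \<psi> that by (simp add: tests_def space_data_law)
    fix g assume g: "g \<in> G"
    have "(SUP \<theta>\<in>null_space M1 M2 p ku \<xi> t0. ereal (expect n p \<theta> \<psi>)) \<le> ereal \<alpha>" using \<psi> by (simp add: tests_def)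
    then have "ereal (expect n p (\<theta> g) \<psi>) \<le> ereal \<alpha>" using null[OF g] by (simp add: SUP_le_iff)
    moreover have "expect n p (\<theta> g) \<psi> = (\<integral>z. \<Lambda> g z * \<psi> z \<partial>?P)"
      unfolding dlaw[OF g] using \<psi>m \<Lambda>m \<Lambda>0 by (subst integral_density) auto
    ultimately show "(\<integral>z. \<Lambda> g z * \<psi> z \<partial>?P) \<le> \<alpha>" by simp
  qed (use \<Lambda>m \<Lambda>0 one prod \<epsilon>(1) in \<open>auto simp: c_def\<close>)
  have "ereal \<tau>' \<le> tau_adap M1 M2 \<alpha> \<eta> n p t0 ku k \<xi>"
    unfolding tau_adap_def
  proof (rule INF_greatest)
    fix \<tau> assume \<tau>: "\<tau> \<in> {\<tau>. 0 < \<tau> \<and> ereal (1 - \<eta>) \<le> (SUP \<psi>\<in>tests n p \<alpha> (null_space M1 M2 p ku \<xi> t0).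
        INF \<theta>\<in>alt_space M1 M2 \<tau> p k \<xi> t0. ereal (expect n p \<theta> \<psi>))}"
    show "ereal \<tau>' \<le> ereal \<tau>"
    proof (rule ccontr)
      assume "\<not> ereal \<tau>' \<le> ereal \<tau>"
      \<comment> \<open>A smaller separation enlarges the alternative set, which therefore contains
        \<open>\<theta>1\<close>; the power there caps the infimum.\<close>
      then have "\<tau> \<le> \<tau>'" by simp
      have "(SUP \<psi>\<in>tests n p \<alpha> (null_space M1 M2 p ku \<xi> t0). INF \<theta>\<in>alt_space M1 M2 \<tau> p k \<xi> t0. ereal (expect n p \<theta> \<psi>)) \<le> ereal (\<alpha> + \<epsilon>)"
      proof (rule SUP_least)
        fix \<psi> assume "\<psi> \<in> tests n p \<alpha> (null_space M1 M2 p ku \<xi> t0)"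
        from test[OF this] have "ereal (expect n p \<theta>1 \<psi>) \<le> ereal (\<alpha> + \<epsilon>)" by simp
        with alt[OF \<open>\<tau> \<le> \<tau>'\<close>] show "(INF \<theta>\<in>alt_space M1 M2 \<tau> p k \<xi> t0. ereal (expect n p \<theta> \<psi>)) \<le> ereal (\<alpha> + \<epsilon>)"
          by (rule INF_lower2)
      qed
      moreover have "ereal (1 - \<eta>) \<le> (SUP \<psi>\<in>tests n p \<alpha> (null_space M1 M2 p ku \<xi> t0). INF \<theta>\<in>alt_space M1 M2 \<tau> p k \<xi> t0. ereal (expect n p \<theta> \<psi>))"
        using \<tau> by simp
      ultimately have "ereal (1 - \<eta>) \<le> ereal (\<alpha> + \<epsilon>)" by (rule order.trans[rotated])
      with \<epsilon>(2) show False by simp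
    qed
  qed
  then show ?thesis by (simp add: \<tau>'_def R_def x_def)
qed

section \<open>Debiasing and sparse eigenvalues\<close>

definition unit_fun :: "nat \<Rightarrow> nat \<Rightarrow> real" where "unit_fun j = (\<lambda>l. if l = j then 1 else 0)"

definition gram :: "nat \<Rightarrow> nat \<Rightarrow> (nat \<Rightarrow> nat \<Rightarrow> real) \<Rightarrow> (nat \<Rightarrow> real) \<Rightarrow> (nat \<Rightarrow> real) \<Rightarrow> real" where
  "gram p n x a b = (\<Sum>i<n. (\<Sum>j<p. a j * x i j) * (\<Sum>j<p. b j * x i j)) / n"

text \<open>Empirical covariance of the direction \<open>a\<close> with the residual at
  \<open>b\<close>; at the true coefficients and for fixed \<open>a\<close> it has mean
  zero.\<close>

definition score :: "nat \<Rightarrow> nat \<Rightarrow> (nat \<Rightarrow> obs) \<Rightarrow> (nat \<Rightarrow> real) \<Rightarrow> (nat \<Rightarrow> real) \<Rightarrow> real" where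
  "score p n z b a = (\<Sum>i<n. (\<Sum>j<p. a j * snd (z i) j) * (fst (z i) - (\<Sum>j<p. snd (z i) j * b j))) / n"

lemma sum_unit_fun: "j < p \<Longrightarrow> (\<Sum>l<p. unit_fun j l * f l) = f j"
  by (simp add: unit_fun_def sum.delta if_distrib[of "\<lambda>c. c * _"] cong: if_cong)

text \<open>The response cancels, so the comparison of two coefficient vectors involves the design
  alone; small scores at both make the Gram image of their difference small.\<close>

lemma score_diff:
  "score p n z b a - score p n z c a = gram p n (covariates n z) a (\<lambda>j. c j - b j)"
proof -
  have "fst (z i) - (\<Sum>j<p. snd (z i) j * b j) - (fst (z i) - (\<Sum>j<p. snd (z i) j * c j))
      = (\<Sum>j<p. (c j - b j) * covariates n z i j)" if "i < n" for i
    using that by (simp add: covariates_def sum_subtractf left_diff_distrib right_diff_distrib mult.commute)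
  moreover have "(\<Sum>j<p. a j * covariates n z i j) = (\<Sum>j<p. a j * snd (z i) j)" if "i < n" for i
    using that by (simp add: covariates_def)
  ultimately have "(\<Sum>i<n. (\<Sum>j<p. a j * snd (z i) j) * (fst (z i) - (\<Sum>j<p. snd (z i) j * b j)))
     - (\<Sum>i<n. (\<Sum>j<p. a j * snd (z i) j) * (fst (z i) - (\<Sum>j<p. snd (z i) j * c j)))
     = (\<Sum>i<n. (\<Sum>j<p. a j * covariates n z i j) * (\<Sum>j<p. (c j - b j) * covariates n z i j))"
    unfolding sum_subtractf[symmetric] by (intro sum.cong refl) (simp add: right_diff_distrib[symmetric])
  then show ?thesis by (simp add: score_def gram_def diff_divide_distrib[symmetric])
qed

lemma gram_expand: "gram p n x a b = (\<Sum>j<p. a j * gram p n x (unit_fun j) b)"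
proof -
  have "(\<Sum>j<p. a j * gram p n x (unit_fun j) b) = (\<Sum>j<p. a j * ((\<Sum>i<n. x i j * (\<Sum>j<p. b j * x i j)) / n))"
    by (intro sum.cong refl) (simp add: gram_def sum_unit_fun)
  also have "\<dots> = (\<Sum>j<p. \<Sum>i<n. a j * x i j * (\<Sum>j<p. b j * x i j)) / n"
    by (simp add: sum_divide_distrib sum_distrib_left mult.assoc)
  also have "\<dots> = gram p n x a b"
    unfolding gram_def by (subst sum.swap) (simp add: sum_distrib_right)
  finally show ?thesis by simp
qed

lemma gram_commute: "gram p n x a b = gram p n x b a"
  by (simp add: gram_def mult.commute)

lemma gram_scale: "gram p n x (\<lambda>j. c * a j) (\<lambda>j. c * a j) = c\<^sup>2 * gram p n x a a"
proof -
  have "(\<Sum>j<p. c * a j * x i j) = c * (\<Sum>j<p. a j * x i j)" for i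
    by (simp add: sum_distrib_left mult.assoc)
  then show ?thesis
    by (simp add: gram_def power2_eq_square sum_distrib_left sum_divide_distrib mult_ac)
qed

lemma sum_abs_square_le_support:
  fixes f :: "nat \<Rightarrow> real"
  assumes "card {j. j < p \<and> f j \<noteq> 0} \<le> s"
  shows "(\<Sum>j<p. \<bar>f j\<bar>)\<^sup>2 \<le> s * (\<Sum>j<p. (f j)\<^sup>2)"
proof -
  let ?S = "{j. j < p \<and> f j \<noteq> 0}"
  have "(\<Sum>j<p. \<bar>f j\<bar>) = (\<Sum>j\<in>?S. 1 * \<bar>f j\<bar>)" by (simp, rule sum.mono_neutral_right) auto
  then have "(\<Sum>j<p. \<bar>f j\<bar>)\<^sup>2 \<le> (\<Sum>j\<in>?S. 1\<^sup>2) * (\<Sum>j\<in>?S. \<bar>f j\<bar>\<^sup>2)"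
    using Cauchy_Schwarz_ineq_sum[of "\<lambda>_. 1" "\<lambda>j. \<bar>f j\<bar>" ?S] by simp
  also have "\<dots> = card ?S * (\<Sum>j<p. (f j)\<^sup>2)"
    by (simp, rule disjI2, rule sum.mono_neutral_left) auto
  also have "\<dots> \<le> s * (\<Sum>j<p. (f j)\<^sup>2)"
    using assms by (intro mult_right_mono sum_nonneg) auto
  finally show ?thesis .
qed

text \<open>The loading is split as \<open>\<xi> = (\<xi> - h) + (h - G u) + G u\<close> with the Gram matrix \<open>G\<close>; the first two parts are controlled by the
  \<open>\<ell>\<^sub>1\<close>-error of \<open>b\<close>, the last one by the debiasing scores.\<close>

lemma debiased_error:
  fixes b \<beta> \<xi> h u :: "nat \<Rightarrow> real"
  assumes sb: "\<And>j. j < p \<Longrightarrow> \<bar>score p n z b (unit_fun j)\<bar> < lam"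
    and s\<beta>: "\<And>j. j < p \<Longrightarrow> \<bar>score p n z \<beta> (unit_fun j)\<bar> < lam"
    and kb: "card {j. j < p \<and> b j \<noteq> 0} \<le> k" and k\<beta>: "card {j. j < p \<and> \<beta> j \<noteq> 0} \<le> k"
    and \<kappa>: "\<kappa> > 0"
    and sparse: "\<And>\<delta>. card {j. j < p \<and> \<delta> j \<noteq> 0} \<le> 2 * k \<Longrightarrow>
        \<kappa> * (\<Sum>j<p. (\<delta> j)\<^sup>2) \<le> gram p n (covariates n z) \<delta> \<delta>"
    and tail: "\<And>j. j < p \<Longrightarrow> \<bar>\<xi> j - h j\<bar> \<le> T"
    and u: "\<And>j. j < p \<Longrightarrow> \<bar>gram p n (covariates n z) (unit_fun j) u - h j\<bar> \<le> \<mu>"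
    and ub: "\<bar>score p n z b u\<bar> \<le> 2 * \<tau>" and u\<beta>: "\<bar>score p n z \<beta> u\<bar> \<le> \<tau>"
    and pos: "p > 0"
  shows "\<bar>(\<Sum>j<p. \<xi> j * \<beta> j) - (\<Sum>j<p. \<xi> j * b j)\<bar> \<le> (T + \<mu>) * (4 * k * lam / \<kappa>) + 3 * \<tau>"
proof -
  let ?x = "covariates n z"
  define \<delta> where "\<delta> j = \<beta> j - b j" for j
  define D where "D = (\<Sum>j<p. \<bar>\<delta> j\<bar>)"
  have D0: "D \<ge> 0" by (auto simp: D_def intro: sum_nonneg)
  have "{j. j < p \<and> \<delta> j \<noteq> 0} \<subseteq> {j. j < p \<and> b j \<noteq> 0} \<union> {j. j < p \<and> \<beta> j \<noteq> 0}"
    by (auto simp: \<delta>_def)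
  then have "card {j. j < p \<and> \<delta> j \<noteq> 0} \<le> card ({j. j < p \<and> b j \<noteq> 0} \<union> {j. j < p \<and> \<beta> j \<noteq> 0})"
    by (intro card_mono) auto
  also have "\<dots> \<le> 2 * k" using card_Un_le[of "{j. j < p \<and> b j \<noteq> 0}" "{j. j < p \<and> \<beta> j \<noteq> 0}"] kb k\<beta> by linarith
  finally have k\<delta>: "card {j. j < p \<and> \<delta> j \<noteq> 0} \<le> 2 * k" .
  have g\<delta>: "\<bar>gram p n ?x (unit_fun j) \<delta>\<bar> \<le> 2 * lam" if "j < p" for j
    using score_diff[of p n z b "unit_fun j" \<beta>] sb[OF that] s\<beta>[OF that] unfolding \<delta>_def by linarith
  \<comment> \<open>Sparsity of the difference passes from \<open>D\<^sup>2\<close> to the squared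
    norm, the eigenvalue bound from there to the Gram form, and the scores bound that form by
    \<open>2 * lam * D\<close>. Dividing by \<open>D\<close> gives the rate.\<close>
  have "\<kappa> * D\<^sup>2 \<le> \<kappa> * (real (2 * k) * (\<Sum>j<p. (\<delta> j)\<^sup>2))"
    unfolding D_def using \<kappa> by (intro mult_left_mono sum_abs_square_le_support k\<delta>) auto
  also have "\<dots> = 2 * k * (\<kappa> * (\<Sum>j<p. (\<delta> j)\<^sup>2))" by simp
  also have "\<dots> \<le> 2 * k * gram p n ?x \<delta> \<delta>" by (intro mult_left_mono sparse k\<delta>) auto
  also have "gram p n ?x \<delta> \<delta> \<le> (\<Sum>j<p. \<bar>\<delta> j\<bar> * (2 * lam))"
    unfolding gram_expand[of p n ?x \<delta>]
  proof (rule sum_mono)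
    fix j assume j: "j \<in> {..<p}"
    have "\<delta> j * gram p n ?x (unit_fun j) \<delta> \<le> \<bar>\<delta> j\<bar> * \<bar>gram p n ?x (unit_fun j) \<delta>\<bar>"
      by (metis abs_ge_self abs_mult)
    also have "\<dots> \<le> \<bar>\<delta> j\<bar> * (2 * lam)" using g\<delta> j by (intro mult_left_mono) auto
    finally show "\<delta> j * gram p n ?x (unit_fun j) \<delta> \<le> \<bar>\<delta> j\<bar> * (2 * lam)" .
  qed
  also have "\<dots> = 2 * lam * D" by (simp add: D_def sum_distrib_right[symmetric])
  finally have "\<kappa> * D\<^sup>2 \<le> 2 * k * (2 * lam * D)" by (simp add: mult_left_mono)
  then have "D * (\<kappa> * D) \<le> D * (4 * k * lam)" by (simp add: power2_eq_square mult_ac)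
  moreover have "lam > 0" using sb[OF pos] by linarith
  ultimately have "\<kappa> * D \<le> 4 * k * lam" using D0 by (cases "D = 0") auto
  then have D: "D \<le> 4 * k * lam / \<kappa>" using \<kappa> by (simp add: field_simps)
  have weighted: "\<bar>\<Sum>j<p. f j * \<delta> j\<bar> \<le> c * D" if "\<And>j. j < p \<Longrightarrow> \<bar>f j\<bar> \<le> c" for f c
  proof -
    have "\<bar>\<Sum>j<p. f j * \<delta> j\<bar> \<le> (\<Sum>j<p. c * \<bar>\<delta> j\<bar>)"
      using that by (intro order.trans[OF sum_abs] sum_mono) (auto simp: abs_mult intro!: mult_right_mono)
    then show ?thesis by (simp add: D_def sum_distrib_left)
  qed
  have "(\<Sum>j<p. \<xi> j * \<beta> j) - (\<Sum>j<p. \<xi> j * b j)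
      = (\<Sum>j<p. (\<xi> j - h j) * \<delta> j) + (\<Sum>j<p. (h j - gram p n ?x (unit_fun j) u) * \<delta> j)
        + (\<Sum>j<p. \<delta> j * gram p n ?x (unit_fun j) u)"
    unfolding sum.distrib[symmetric] sum_subtractf[symmetric]
    by (intro sum.cong refl) (simp add: \<delta>_def algebra_simps)
  also have "(\<Sum>j<p. \<delta> j * gram p n ?x (unit_fun j) u) = score p n z b u - score p n z \<beta> u"
    unfolding gram_expand[symmetric] score_diff \<delta>_def by (rule gram_commute)
  finally have "\<bar>(\<Sum>j<p. \<xi> j * \<beta> j) - (\<Sum>j<p. \<xi> j * b j)\<bar> \<le> T * D + \<mu> * D + 3 * \<tau>"
    using weighted[of "\<lambda>j. \<xi> j - h j" T, OF tail] weighted[of "\<lambda>j. h j - gram p n ?x (unit_fun j) u" \<mu>]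
      u ub u\<beta> by (force simp: abs_minus_commute)
  also have "\<dots> = (T + \<mu>) * D + 3 * \<tau>" by (simp add: algebra_simps)
  also have "(T + \<mu>) * D \<le> (T + \<mu>) * (4 * k * lam / \<kappa>)"
    using tail[OF pos] u[OF pos] D by (intro mult_left_mono) auto
  finally show ?thesis by simp
qed

section \<open>Sparse eigenvalues by discretization\<close>

definition grid :: "nat \<Rightarrow> nat \<Rightarrow> nat \<Rightarrow> (nat \<Rightarrow> real) set" where
  "grid p s N = (\<lambda>f j. \<Sum>l<s. if fst (f l) = j then real_of_int (snd (f l)) / real N else 0)
     ` ({..<s} \<rightarrow>\<^sub>E {..<p} \<times> {- int N..int N})"

lemma finite_grid: "finite (grid p s N)"
  unfolding grid_def by (intro finite_imageI finite_PiE) auto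

text \<open>Points are described by \<open>s\<close> slots, each holding a coordinate and a multiple
  of \<open>1 / N\<close> between -1 and 1, rather than by supports. The description is redundant,
  but the count is a plain power.\<close>

lemma card_grid: "card (grid p s N) \<le> (p * (2 * N + 1)) ^ s"
proof -
  have "card (grid p s N) \<le> card ({..<s} \<rightarrow>\<^sub>E {..<p} \<times> {- int N..int N})"
    unfolding grid_def by (intro card_image_le finite_PiE) auto
  also have "\<dots> = (p * nat (2 * int N + 1)) ^ s"
    by (simp add: card_PiE card_cartesian_product)
  also have "nat (2 * int N + 1) = 2 * N + 1" by simp
  finally show ?thesis .
qed

lemma grid_approx:
  fixes \<delta> :: "nat \<Rightarrow> real"
  assumes card: "card {j. j < p \<and> \<delta> j \<noteq> 0} \<le> s" and \<delta>: "\<And>j. j < p \<Longrightarrow> \<bar>\<delta> j\<bar> \<le> 1" and p: "p > 0" and N: "N > 0"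
  obtains y where "y \<in> grid p s N" "\<And>j. j < p \<Longrightarrow> \<bar>\<delta> j - y j\<bar> \<le> 1 / N" "\<And>j. j < p \<Longrightarrow> \<delta> j = 0 \<Longrightarrow> y j = 0"
proof -
  let ?S = "{j. j < p \<and> \<delta> j \<noteq> 0}"
  obtain h where h: "bij_betw h {0..<card ?S} ?S" using ex_bij_betw_nat_finite[of ?S] by auto
  \<comment> \<open>Each nonzero entry is rounded down to the grid; spare slots add 0 at coordinate
    0.\<close>
  define f where "f = (\<lambda>l\<in>{..<s}. if l < card ?S then (h l, \<lfloor>N * \<delta> (h l)\<rfloor>) else (0, 0 :: int))"
  define y where "y j = (\<Sum>l<s. if fst (f l) = j then real_of_int (snd (f l)) / real N else 0)" for j
  have hS: "h l \<in> ?S" if "l < card ?S" for l using h that by (auto simp: bij_betw_def)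
  have fl: "-int N \<le> \<lfloor>N * \<delta> j\<rfloor> \<and> \<lfloor>N * \<delta> j\<rfloor> \<le> int N" if "j < p" for j
  proof -
    have "\<bar>real N * \<delta> j\<bar> \<le> N" using \<delta>[OF that] by (simp add: abs_mult mult_left_le)
    then show ?thesis by (simp add: le_floor_iff floor_le_iff abs_le_iff)
  qed
  have "f \<in> {..<s} \<rightarrow>\<^sub>E {..<p} \<times> {- int N..int N}"
    using hS fl p by (auto simp: f_def PiE_iff)
  then have yg: "y \<in> grid p s N" unfolding grid_def y_def[abs_def] by (rule image_eqI[OF refl])
  have yj: "y j = (if j \<in> ?S then real_of_int \<lfloor>N * \<delta> j\<rfloor> / N else 0)" for j
  proof -
    have "y j = (\<Sum>l<s. if l < card ?S \<and> h l = j then real_of_int \<lfloor>N * \<delta> j\<rfloor> / N else 0)"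
      unfolding y_def by (intro sum.cong refl) (auto simp: f_def)
    also have "\<dots> = (\<Sum>l\<in>{0..<card ?S}. if h l = j then real_of_int \<lfloor>N * \<delta> j\<rfloor> / N else 0)"
      using card by (intro sum.mono_neutral_cong_right) auto
    also have "\<dots> = (\<Sum>i\<in>?S. if i = j then real_of_int \<lfloor>N * \<delta> j\<rfloor> / N else 0)"
      by (rule sum.reindex_bij_betw[OF h])
    also have "\<dots> = (if j \<in> ?S then real_of_int \<lfloor>N * \<delta> j\<rfloor> / N else 0)"
    proof -
      have "finite ?S" by simp
      then show ?thesis by (simp only: sum.delta)
    qed
    finally show ?thesis .
  qed
  show thesis
  proof (rule that[OF yg])
    fix j assume j: "j < p"
    have "\<bar>\<delta> j - real_of_int \<lfloor>N * \<delta> j\<rfloor> / N\<bar> = \<bar>N * \<delta> j - real_of_int \<lfloor>N * \<delta> j\<rfloor>\<bar> / N"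
    proof -
      have "\<delta> j - real_of_int \<lfloor>N * \<delta> j\<rfloor> / N = (N * \<delta> j - real_of_int \<lfloor>N * \<delta> j\<rfloor>) / N"
        using N by (simp add: diff_divide_distrib)
      then show ?thesis by (simp add: abs_divide)
    qed
    also have "\<dots> \<le> 1 / N"
    proof (rule divide_right_mono)
      show "\<bar>N * \<delta> j - real_of_int \<lfloor>N * \<delta> j\<rfloor>\<bar> \<le> 1" by linarith
    qed simp
    finally have *: "\<bar>\<delta> j - real_of_int \<lfloor>N * \<delta> j\<rfloor> / N\<bar> \<le> 1 / N" .
    show "\<bar>\<delta> j - y j\<bar> \<le> 1 / N"
    proof (cases "\<delta> j = 0")
      case True
      then show ?thesis unfolding yj by simp
    next
      case False
      then have "y j = real_of_int \<lfloor>N * \<delta> j\<rfloor> / N" unfolding yj using j by simp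
      then show ?thesis using * by (simp only:)
    qed
    show "y j = 0" if "\<delta> j = 0" using that unfolding yj by simp
  qed
qed

text \<open>Cauchy-Schwarz in each row reduces the form to the diagonal of the Gram matrix at the
  price of a factor \<open>s\<close>. This suffices for the discretization error, whose entries are
  tiny.\<close>

lemma gram_sparse_le:
  fixes e :: "nat \<Rightarrow> real"
  assumes card: "card {j. j < p \<and> e j \<noteq> 0} \<le> s" and e: "\<And>j. j < p \<Longrightarrow> \<bar>e j\<bar> \<le> \<epsilon>"
    and D: "\<And>j. j < p \<Longrightarrow> gram p n x (unit_fun j) (unit_fun j) \<le> D" and D0: "D \<ge> 0"
  shows "gram p n x e e \<le> D * (s * \<epsilon>)\<^sup>2"
proof -
  let ?S = "{j. j < p \<and> e j \<noteq> 0}"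
  have row: "(\<Sum>j<p. e j * x i j)\<^sup>2 \<le> s * (\<Sum>j<p. (e j)\<^sup>2 * (x i j)\<^sup>2)" for i
  proof -
    have sub: "{j. j < p \<and> e j * x i j \<noteq> 0} \<subseteq> ?S" by auto
    have "(\<Sum>j<p. e j * x i j)\<^sup>2 \<le> (\<Sum>j<p. \<bar>e j * x i j\<bar>)\<^sup>2"
      by (simp add: abs_le_square_iff[symmetric] sum_nonneg)
    also have "\<dots> \<le> s * (\<Sum>j<p. (e j * x i j)\<^sup>2)"
      using card card_mono[OF _ sub] by (intro sum_abs_square_le_support) auto
    finally show ?thesis by (simp add: power_mult_distrib)
  qed
  have uu: "gram p n x (unit_fun j) (unit_fun j) = (\<Sum>i<n. (x i j)\<^sup>2) / n" if "j < p" for j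
    by (simp add: gram_def sum_unit_fun[OF that] power2_eq_square)
  have "gram p n x e e = (\<Sum>i<n. (\<Sum>j<p. e j * x i j)\<^sup>2) / n" by (simp add: gram_def power2_eq_square)
  also have "\<dots> \<le> (\<Sum>i<n. s * (\<Sum>j<p. (e j)\<^sup>2 * (x i j)\<^sup>2)) / n"
    by (intro divide_right_mono sum_mono row) auto
  also have "\<dots> = s * ((\<Sum>i<n. \<Sum>j<p. (e j)\<^sup>2 * (x i j)\<^sup>2) / n)" by (simp add: sum_distrib_left[symmetric])
  finally have 1: "gram p n x e e \<le> s * ((\<Sum>i<n. \<Sum>j<p. (e j)\<^sup>2 * (x i j)\<^sup>2) / n)" .
  have "(\<Sum>i<n. \<Sum>j<p. (e j)\<^sup>2 * (x i j)\<^sup>2) / n = (\<Sum>j<p. (e j)\<^sup>2 * gram p n x (unit_fun j) (unit_fun j))"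
    by (subst sum.swap) (simp add: uu sum_divide_distrib sum_distrib_left)
  also have "\<dots> = (\<Sum>j\<in>?S. (e j)\<^sup>2 * gram p n x (unit_fun j) (unit_fun j))"
    by (rule sum.mono_neutral_right) auto
  also have "\<dots> \<le> (\<Sum>j\<in>?S. \<epsilon>\<^sup>2 * D)"
  proof (rule sum_mono)
    fix j assume j: "j \<in> ?S"
    then have "(e j)\<^sup>2 \<le> \<epsilon>\<^sup>2" using power_mono[OF e[of j], of 2] by simp
    then have "(e j)\<^sup>2 * gram p n x (unit_fun j) (unit_fun j) \<le> (e j)\<^sup>2 * D" "(e j)\<^sup>2 * D \<le> \<epsilon>\<^sup>2 * D"
      using D[of j] j D0 by (auto intro: mult_left_mono mult_right_mono)
    then show "(e j)\<^sup>2 * gram p n x (unit_fun j) (unit_fun j) \<le> \<epsilon>\<^sup>2 * D" by linarith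
  qed
  also have "\<dots> = card ?S * (\<epsilon>\<^sup>2 * D)" by simp
  also have "\<dots> \<le> s * (\<epsilon>\<^sup>2 * D)"
    using card D0 by (intro mult_right_mono) auto
  finally have "s * ((\<Sum>i<n. \<Sum>j<p. (e j)\<^sup>2 * (x i j)\<^sup>2) / n) \<le> s * (s * (\<epsilon>\<^sup>2 * D))"
    by (intro mult_left_mono) auto
  also have "s * (s * (\<epsilon>\<^sup>2 * D)) = D * (s * \<epsilon>)\<^sup>2" by (simp add: power2_eq_square)
  finally show ?thesis using 1 by linarith
qed

text \<open>Scale to unit norm and split \<open>d = y + e\<close> with \<open>y\<close> on the grid.
  After halving, the grid bound gives at least \<open>127 / 1024\<close> times
  \<open>1 / M1\<close>; the condition \<open>16 * M1 * s \<le> N\<close> makes the loss from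
  \<open>e\<close> at most \<open>1 / (128 * M1)\<close>, which leaves more than
  \<open>1 / (16 * M1)\<close>.\<close>

lemma sparse_eigenvalue:
  fixes M1 :: real and s N :: nat
  assumes M1: "M1 > 1" and p: "p > 0" and s: "s > 0" and N: "16 * M1 * s \<le> N"
    and g: "\<And>y. y \<in> grid p s N \<Longrightarrow> (\<Sum>j<p. (y j)\<^sup>2) / (2 * M1) \<le> gram p n x y y"
    and D: "\<And>j. j < p \<Longrightarrow> gram p n x (unit_fun j) (unit_fun j) \<le> 2 * M1"
    and card: "card {j. j < p \<and> \<delta> j \<noteq> 0} \<le> s"
  shows "1 / (16 * M1) * (\<Sum>j<p. (\<delta> j)\<^sup>2) \<le> gram p n x \<delta> \<delta>"
proof -
  have N0: "N > 0" 
  proof (rule ccontr)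
    assume "\<not> N > 0"
    moreover have "16 * M1 * s > 0" using M1 s by simp
    ultimately show False using N by simp
  qed
  have unit: "1 / (16 * M1) \<le> gram p n x d d"
    if dc: "card {j. j < p \<and> d j \<noteq> 0} \<le> s" and d1: "(\<Sum>j<p. (d j)\<^sup>2) = 1" for d
  proof -
    have d_le: "\<bar>d j\<bar> \<le> 1" if "j < p" for j
    proof -
      have "(d j)\<^sup>2 \<le> (\<Sum>j<p. (d j)\<^sup>2)" using that by (intro member_le_sum) auto
      then show ?thesis unfolding d1 by (simp add: abs_square_le_1)
    qed
    obtain y where y: "y \<in> grid p s N" "\<And>j. j < p \<Longrightarrow> \<bar>d j - y j\<bar> \<le> 1 / N" "\<And>j. j < p \<Longrightarrow> d j = 0 \<Longrightarrow> y j = 0"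
      using grid_approx[OF dc d_le p N0] by blast
    define e where "e j = d j - y j" for j
    have sub: "{j. j < p \<and> e j \<noteq> 0} \<subseteq> {j. j < p \<and> d j \<noteq> 0}" using y(3) by (auto simp: e_def)
    have ec: "card {j. j < p \<and> e j \<noteq> 0} \<le> s" using dc card_mono[OF _ sub] by auto
    define \<epsilon> where "\<epsilon> = real s * (1 / real N)"
    have eps: "0 \<le> \<epsilon>" "\<epsilon> \<le> 1 / (16 * M1)"
      using N N0 M1 by (auto simp: \<epsilon>_def field_simps)
    have eps2: "\<epsilon>\<^sup>2 \<le> 1 / (256 * M1\<^sup>2)"
      using power_mono[OF eps(2,1), of 2] by (simp add: power_divide power_mult_distrib)
    have ge: "gram p n x e e \<le> 2 * M1 * \<epsilon>\<^sup>2"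
      unfolding \<epsilon>_def by (rule gram_sparse_le[OF ec _ D]) (use y(2) M1 in \<open>auto simp: e_def\<close>)
    have e1: "(\<Sum>j<p. (e j)\<^sup>2) \<le> (\<Sum>j<p. \<bar>e j\<bar>)\<^sup>2"
    proof -
      have "(\<Sum>j<p. (e j)\<^sup>2) \<le> (\<Sum>j<p. \<bar>e j\<bar> * (\<Sum>l<p. \<bar>e l\<bar>))"
      proof (rule sum_mono)
        fix j assume "j \<in> {..<p}"
        then have "\<bar>e j\<bar> \<le> (\<Sum>l<p. \<bar>e l\<bar>)" by (intro member_le_sum) auto
        then have "\<bar>e j\<bar> * \<bar>e j\<bar> \<le> \<bar>e j\<bar> * (\<Sum>l<p. \<bar>e l\<bar>)" by (intro mult_left_mono) auto
        then show "(e j)\<^sup>2 \<le> \<bar>e j\<bar> * (\<Sum>l<p. \<bar>e l\<bar>)" by (simp add: power2_eq_square)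
      qed
      then show ?thesis by (simp add: power2_eq_square sum_distrib_right)
    qed

    have "(\<Sum>j<p. \<bar>e j\<bar>) = (\<Sum>j | j < p \<and> e j \<noteq> 0. \<bar>e j\<bar>)" by (rule sum.mono_neutral_right) auto
    also have "\<dots> \<le> (\<Sum>j | j < p \<and> e j \<noteq> 0. 1 / N)" using y(2) by (intro sum_mono) (auto simp: e_def)
    also have "\<dots> \<le> \<epsilon>" using ec by (simp add: \<epsilon>_def divide_right_mono)
    finally have "(\<Sum>j<p. \<bar>e j\<bar>)\<^sup>2 \<le> \<epsilon>\<^sup>2" by (intro power_mono) (auto intro: sum_nonneg)
    with e1 have e2: "(\<Sum>j<p. (e j)\<^sup>2) \<le> \<epsilon>\<^sup>2" by linarith
    \<comment> \<open>Equivalent to \<open>(a + c)\<^sup>2 \<ge> 0\<close>. Applied to coordinates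
      and to rows of the design, it disposes of the cross terms.\<close>
    have half: "a\<^sup>2 \<ge> b\<^sup>2 / 2 - c\<^sup>2" if "b = a - c" for a b c :: real
      unfolding that using sum_squares_ge_zero[of "a + c" 0] by (simp add: power2_eq_square algebra_simps)
    have "(\<Sum>j<p. (y j)\<^sup>2) \<ge> (\<Sum>j<p. (d j)\<^sup>2 / 2 - (e j)\<^sup>2)"
    proof (rule sum_mono)
      fix j
      show "(d j)\<^sup>2 / 2 - (e j)\<^sup>2 \<le> (y j)\<^sup>2"
        using half[of "d j" "y j" "y j - d j"] by (simp add: e_def power2_commute)
    qed
    then have y2: "(\<Sum>j<p. (y j)\<^sup>2) \<ge> 1 / 2 - \<epsilon>\<^sup>2"
      using e2 d1 by (simp add: sum_subtractf sum_divide_distrib[symmetric])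
    have gap: "gram p n x d d \<ge> gram p n x y y / 2 - gram p n x e e"
    proof -
      have row: "(\<Sum>j<p. y j * x i j) = (\<Sum>j<p. d j * x i j) - (\<Sum>j<p. e j * x i j)" for i
        by (simp add: e_def sum_subtractf[symmetric] left_diff_distrib)
      have "(\<Sum>i<n. (\<Sum>j<p. y j * x i j)\<^sup>2 / 2 - (\<Sum>j<p. e j * x i j)\<^sup>2) \<le> (\<Sum>i<n. (\<Sum>j<p. d j * x i j)\<^sup>2)"
        by (intro sum_mono half[OF row])
      then have "(\<Sum>i<n. (\<Sum>j<p. y j * x i j)\<^sup>2) / 2 / n - (\<Sum>i<n. (\<Sum>j<p. e j * x i j)\<^sup>2) / n
          \<le> (\<Sum>i<n. (\<Sum>j<p. d j * x i j)\<^sup>2) / n"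
        using divide_right_mono[of "(\<Sum>i<n. (\<Sum>j<p. y j * x i j)\<^sup>2 / 2 - (\<Sum>j<p. e j * x i j)\<^sup>2)" _ "real n"]
        by (simp add: sum_subtractf sum_divide_distrib[symmetric] diff_divide_distrib)
      then show ?thesis by (simp add: gram_def power2_eq_square)
    qed
    define Q where "Q = (1 / 2 - \<epsilon>\<^sup>2) / (2 * M1)"
    have "Q \<le> (\<Sum>j<p. (y j)\<^sup>2) / (2 * M1)" unfolding Q_def using y2 M1 by (intro divide_right_mono) auto
    then have Q: "Q \<le> gram p n x y y" using g[OF y(1)] by linarith
    have "2 * M1 * \<epsilon>\<^sup>2 \<le> 1 / (128 * M1)"
      using mult_left_mono[OF eps2, of "2 * M1"] M1 by (simp add: power2_eq_square)
    moreover have "\<epsilon>\<^sup>2 \<le> 1 / 256"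
    proof -
      have "M1\<^sup>2 \<ge> 1" using M1 by (simp add: one_le_power)
      then have "1 / (256 * M1\<^sup>2) \<le> 1 / 256" by (intro divide_left_mono) auto
      with eps2 show ?thesis by linarith
    qed
    then have "(127 / 256) / (2 * M1) \<le> Q" unfolding Q_def using M1 by (intro divide_right_mono) auto
    then have "127 / 512 * (1 / M1) \<le> Q" by simp
    moreover have "1 / (16 * M1) = 1 / 16 * (1 / M1)" "1 / (128 * M1) = 1 / 128 * (1 / M1)" by simp_all
    moreover have "1 / M1 > 0" using M1 by simp
    ultimately show ?thesis using ge gap Q by linarith
  qed
  define R where "R = (\<Sum>j<p. (\<delta> j)\<^sup>2)"
  show ?thesis
  proof (cases "R = 0")
    case True
    have "0 \<le> gram p n x \<delta> \<delta>" by (simp add: gram_def sum_nonneg)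
    with True show ?thesis by (simp add: R_def)
  next
    case False
    then have R: "R > 0" by (simp add: R_def sum_nonneg less_le)
    let ?c = "1 / sqrt R"
    have "?c \<noteq> 0" using R by simp
    then have "{j. j < p \<and> ?c * \<delta> j \<noteq> 0} = {j. j < p \<and> \<delta> j \<noteq> 0}" by auto
    then have c1: "card {j. j < p \<and> ?c * \<delta> j \<noteq> 0} \<le> s" using card by simp
    have c2: "(\<Sum>j<p. (?c * \<delta> j)\<^sup>2) = 1"
      using R by (simp only: power_mult_distrib sum_distrib_left[symmetric] R_def[symmetric]) (simp add: power_divide)
    have "1 / (16 * M1) \<le> ?c\<^sup>2 * gram p n x \<delta> \<delta>" using unit[OF c1 c2] by (simp only: gram_scale)
    then have "1 / (16 * M1) \<le> gram p n x \<delta> \<delta> / R" using R by (simp add: power_divide)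
    then show ?thesis using R by (simp only: R_def[symmetric] pos_le_divide_eq)
  qed
qed

section \<open>Measurable choice of a debiasing direction\<close>

text \<open>The exceptional set is only covered by a measurable one, since events such as
  \<open>restricted_eigenvalue\<close> quantify over uncountably many vectors.\<close>

definition whp :: "'a measure \<Rightarrow> real \<Rightarrow> ('a \<Rightarrow> bool) \<Rightarrow> bool" where
  "whp P \<epsilon> Q \<longleftrightarrow> (\<exists>B\<in>sets P. measure P B \<le> \<epsilon> \<and> {z \<in> space P. \<not> Q z} \<subseteq> B)"

lemma whpI:
  assumes "{z \<in> space P. R z} \<in> sets P" "measure P {z \<in> space P. R z} \<le> \<epsilon>"
    and "\<And>z. z \<in> space P \<Longrightarrow> \<not> R z \<Longrightarrow> Q z"
  shows "whp P \<epsilon> Q"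
  unfolding whp_def by (intro bexI[of _ "{z \<in> space P. R z}"]) (use assms in auto)

lemma whp_mono:
  assumes "whp P \<epsilon> Q" "\<epsilon> \<le> \<epsilon>'" "\<And>z. z \<in> space P \<Longrightarrow> Q z \<Longrightarrow> R z"
  shows "whp P \<epsilon>' R"
proof -
  from assms(1) obtain B where "B \<in> sets P" "measure P B \<le> \<epsilon>" "{z \<in> space P. \<not> Q z} \<subseteq> B"
    by (auto simp: whp_def)
  then show ?thesis unfolding whp_def using assms(2,3) by (intro bexI[of _ B]) auto
qed

lemma whp_conj:
  assumes "whp P \<epsilon> Q" "whp P \<delta> R"
  shows "whp P (\<epsilon> + \<delta>) (\<lambda>z. Q z \<and> R z)"
proof -
  from assms obtain B C where B: "B \<in> sets P" "measure P B \<le> \<epsilon>" "{z \<in> space P. \<not> Q z} \<subseteq> B"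
    and C: "C \<in> sets P" "measure P C \<le> \<delta>" "{z \<in> space P. \<not> R z} \<subseteq> C"
    by (auto simp: whp_def)
  have "measure P (B \<union> C) \<le> \<epsilon> + \<delta>" using measure_Un_le[OF B(1) C(1)] B(2) C(2) by linarith
  then show ?thesis unfolding whp_def using B C by (intro bexI[of _ "B \<union> C"]) auto
qed

lemma whp_ball:
  fixes \<epsilon> :: real
  assumes "finite I" "\<And>i. i \<in> I \<Longrightarrow> whp P \<epsilon> (Q i)"
  shows "whp P (card I * \<epsilon>) (\<lambda>z. \<forall>i\<in>I. Q i z)"
  using assms
proof (induction I)
  case empty
  show ?case by (rule whpI[of P "\<lambda>_. False"]) auto
next
  case (insert i I)
  have "whp P (\<epsilon> + card I * \<epsilon>) (\<lambda>z. Q i z \<and> (\<forall>i\<in>I. Q i z))"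
    by (rule whp_conj) (use insert in auto)
  then show ?case by (rule whp_mono) (use insert.hyps in \<open>auto simp: distrib_right\<close>)
qed

lemma snd_component_measurable [measurable]:
  assumes "i < n" "j < p"
  shows "(\<lambda>z. snd (z i) j) \<in> borel_measurable (data_space n p)"
proof -
  have s: "(\<lambda>w. snd w j) \<in> borel_measurable (obs_space p)"
    unfolding obs_space_def
    by (rule measurable_compose[OF measurable_snd measurable_component_singleton]) (use assms in simp)
  show ?thesis unfolding data_space_def
    by (rule measurable_compose[OF _ s], rule measurable_component_singleton) (use assms in auto)
qed

lemma fst_component_measurable [measurable]:
  assumes "i < n"
  shows "(\<lambda>z. fst (z i)) \<in> borel_measurable (data_space n p)"
proof -
  have s: "fst \<in> borel_measurable (obs_space p)" unfolding obs_space_def by measurable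
  show ?thesis unfolding data_space_def
    by (rule measurable_compose[OF _ s], rule measurable_component_singleton) (use assms in auto)
qed

lemma covariates_measurable:
  "covariates n \<in> data_space n p \<rightarrow>\<^sub>M (\<Pi>\<^sub>M i\<in>{..<n}. \<Pi>\<^sub>M j\<in>{..<p}. borel)"
proof -
  have s: "snd \<in> obs_space p \<rightarrow>\<^sub>M (\<Pi>\<^sub>M j\<in>{..<p}. borel)" unfolding obs_space_def by measurable
  show ?thesis unfolding data_space_def covariates_def
    by (intro measurable_restrict, rule measurable_compose[OF _ s], rule measurable_component_singleton)
qed

lemma entry_measurable [measurable]:
  assumes "i < n" "j < p"
  shows "(\<lambda>x. x i j) \<in> borel_measurable (\<Pi>\<^sub>M i\<in>{..<n}. \<Pi>\<^sub>M j\<in>{..<p}. borel :: real measure)"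
  by (rule measurable_compose[OF measurable_component_singleton[of i] measurable_component_singleton[of j]])
    (use assms in auto)

lemma gram_measurable:
  assumes [measurable]: "\<And>j. j < p \<Longrightarrow> (\<lambda>x. a x j) \<in> borel_measurable (\<Pi>\<^sub>M i\<in>{..<n}. \<Pi>\<^sub>M j\<in>{..<p}. borel)"
      "\<And>j. j < p \<Longrightarrow> (\<lambda>x. b x j) \<in> borel_measurable (\<Pi>\<^sub>M i\<in>{..<n}. \<Pi>\<^sub>M j\<in>{..<p}. borel)"
  shows "(\<lambda>x. gram p n x (a x) (b x)) \<in> borel_measurable (\<Pi>\<^sub>M i\<in>{..<n}. \<Pi>\<^sub>M j\<in>{..<p}. borel)"
  unfolding gram_def by measurable

text \<open>Zero entries stay zero, so the approximants are at least as sparse as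
  \<open>w\<close>.\<close>

lemma rational_sequence:
  fixes w :: "nat \<Rightarrow> real"
  obtains U where "\<And>m. U m \<in> {..<p} \<rightarrow>\<^sub>E \<rat>" "\<And>j. j < p \<Longrightarrow> (\<lambda>m. U m j) \<longlonglongrightarrow> w j"
    "\<And>j m. j < p \<Longrightarrow> w j = 0 \<Longrightarrow> U m j = 0"
proof -
  have "\<exists>q\<in>\<rat>. \<bar>q - x\<bar> < 1 / Suc m \<and> (x = 0 \<longrightarrow> q = 0)" for x :: real and m :: nat
  proof (cases "x = 0")
    case False
    obtain q where "q \<in> \<rat>" "x < q" "q < x + 1 / Suc m"
      using Rats_dense_in_real[of x "x + 1 / Suc m"] by auto
    then show ?thesis using False by (intro bexI[of _ q]) auto
  qed (auto intro!: bexI[of _ 0])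
  then obtain q :: "real \<Rightarrow> nat \<Rightarrow> real" where q: "\<And>x m. q x m \<in> \<rat>"
      "\<And>x m. \<bar>q x m - x\<bar> < 1 / Suc m" "\<And>x m. x = 0 \<Longrightarrow> q x m = 0"
    by metis
  define U where "U m = (\<lambda>j\<in>{..<p}. q (w j) m)" for m
  show thesis
  proof (rule that[of U])
    fix j assume j: "j < p"
    have "(\<lambda>m. q (w j) m - w j) \<longlonglongrightarrow> 0"
      by (rule Lim_null_comparison[OF _ LIMSEQ_inverse_real_of_nat])
        (use q(2) in \<open>auto simp: inverse_eq_divide intro!: always_eventually less_imp_le\<close>)
    then show "(\<lambda>m. U m j) \<longlonglongrightarrow> w j" using j by (simp add: U_def LIM_zero_iff)
  qed (auto simp: U_def q)
qed

text \<open>Strict inequalities make this an open condition in \<open>u\<close>, so that a feasible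
  vector can be replaced by a rational one.\<close>

definition feasible :: "nat \<Rightarrow> nat \<Rightarrow> (nat \<Rightarrow> real) \<Rightarrow> real \<Rightarrow> real \<Rightarrow> (nat \<Rightarrow> nat \<Rightarrow> real) \<Rightarrow> (nat \<Rightarrow> real) \<Rightarrow> bool" where
  "feasible p n h \<mu> K x u \<longleftrightarrow> (\<forall>j<p. \<bar>gram p n x (unit_fun j) u - h j\<bar> < \<mu>) \<and> gram p n x u u < K"

text \<open>Searching an enumeration of the rational vectors makes the choice of a debiasing direction measurable.\<close>

definition direction :: "nat \<Rightarrow> nat \<Rightarrow> (nat \<Rightarrow> real) \<Rightarrow> real \<Rightarrow> real \<Rightarrow> (nat \<Rightarrow> nat \<Rightarrow> real) \<Rightarrow> nat \<Rightarrow> real" where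
  "direction p n h \<mu> K x =
     (if \<exists>m. feasible p n h \<mu> K x (from_nat_into ({..<p} \<rightarrow>\<^sub>E \<rat>) m)
      then from_nat_into ({..<p} \<rightarrow>\<^sub>E \<rat>) (LEAST m. feasible p n h \<mu> K x (from_nat_into ({..<p} \<rightarrow>\<^sub>E \<rat>) m))
      else (\<lambda>_. 0))"

lemma countable_rational_vectors: "countable ({..<p::nat} \<rightarrow>\<^sub>E (\<rat> :: real set))"
  by (intro countable_PiE) (auto intro: countable_rat)

lemma feasible_measurable:
  "Measurable.pred (\<Pi>\<^sub>M i\<in>{..<n}. \<Pi>\<^sub>M j\<in>{..<p}. borel) (\<lambda>x. feasible p n h \<mu> K x u)"
proof -
  have [measurable]: "(\<lambda>x. gram p n x a b) \<in> borel_measurable (\<Pi>\<^sub>M i\<in>{..<n}. \<Pi>\<^sub>M j\<in>{..<p}. borel)" for a b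
    by (rule gram_measurable) auto
  show ?thesis unfolding feasible_def by measurable
qed

lemma direction_measurable:
  "(\<lambda>x. direction p n h \<mu> K x j) \<in> borel_measurable (\<Pi>\<^sub>M i\<in>{..<n}. \<Pi>\<^sub>M j\<in>{..<p}. borel)"
proof -
  let ?F = "\<lambda>x m. feasible p n h \<mu> K x (from_nat_into ({..<p} \<rightarrow>\<^sub>E \<rat>) m)"
  have [measurable]: "Measurable.pred (\<Pi>\<^sub>M i\<in>{..<n}. \<Pi>\<^sub>M j\<in>{..<p}. borel) (\<lambda>x. ?F x m)" for m
    by (rule feasible_measurable)
  have L: "(\<lambda>x. LEAST m. ?F x m) \<in> (\<Pi>\<^sub>M i\<in>{..<n}. \<Pi>\<^sub>M j\<in>{..<p}. borel) \<rightarrow>\<^sub>M count_space UNIV"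
    by (rule measurable_Least) (rule feasible_measurable)
  have "(\<lambda>x. direction p n h \<mu> K x j)
      = (\<lambda>x. if \<exists>m. ?F x m then (\<lambda>m. from_nat_into ({..<p} \<rightarrow>\<^sub>E \<rat>) m j) (LEAST m. ?F x m) else 0)"
    by (rule ext) (simp only: direction_def if_distribR)
  also have "\<dots> \<in> borel_measurable (\<Pi>\<^sub>M i\<in>{..<n}. \<Pi>\<^sub>M j\<in>{..<p}. borel)"
  proof (rule measurable_If)
    show "(\<lambda>x. (\<lambda>m. from_nat_into ({..<p} \<rightarrow>\<^sub>E \<rat>) m j) (LEAST m. ?F x m))
        \<in> borel_measurable (\<Pi>\<^sub>M i\<in>{..<n}. \<Pi>\<^sub>M j\<in>{..<p}. borel)"
      by (rule measurable_compose[OF L]) simp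
    show "{x \<in> space (\<Pi>\<^sub>M i\<in>{..<n}. \<Pi>\<^sub>M j\<in>{..<p}. borel). \<exists>m. ?F x m} \<in> sets (\<Pi>\<^sub>M i\<in>{..<n}. \<Pi>\<^sub>M j\<in>{..<p}. borel)"
      by measurable
  qed simp
  finally show ?thesis .
qed

text \<open>Holds for every design, because the direction is 0 when the search fails;
  \<open>conditional_second_moment\<close> asks for such an unconditional bound on the
  weights.\<close>

lemma gram_direction_le: "K \<ge> 0 \<Longrightarrow> gram p n x (direction p n h \<mu> K x) (direction p n h \<mu> K x) \<le> K"
proof (cases "\<exists>m. feasible p n h \<mu> K x (from_nat_into ({..<p} \<rightarrow>\<^sub>E \<rat>) m)")
  case True
  then have "feasible p n h \<mu> K x (direction p n h \<mu> K x)"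
    unfolding direction_def using LeastI_ex[OF True] by (simp only: if_True)
  then show ?thesis unfolding feasible_def by simp
next
  case False
  assume "K \<ge> 0"
  then show ?thesis using False by (simp only: direction_def if_False gram_def) simp
qed

lemma tendsto_gram:
  assumes "\<And>j. j < p \<Longrightarrow> (\<lambda>m. a m j) \<longlonglongrightarrow> a' j" "\<And>j. j < p \<Longrightarrow> (\<lambda>m. b m j) \<longlonglongrightarrow> b' j"
  shows "(\<lambda>m. gram p n x (a m) (b m)) \<longlonglongrightarrow> gram p n x a' b'"
  unfolding gram_def divide_inverse
  by (intro tendsto_mult tendsto_sum tendsto_const assms) auto

lemma tendsto_score:
  assumes "\<And>j. j < p \<Longrightarrow> (\<lambda>m. b m j) \<longlonglongrightarrow> b' j"
  shows "(\<lambda>m. score p n z (b m) a) \<longlonglongrightarrow> score p n z b' a"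
  unfolding score_def divide_inverse
  by (intro tendsto_mult tendsto_sum tendsto_diff tendsto_const assms) auto

lemma direction_feasible:
  assumes "feasible p n h \<mu> K x w"
  shows "feasible p n h \<mu> K x (direction p n h \<mu> K x)"
proof -
  obtain U where U: "\<And>m. U m \<in> {..<p} \<rightarrow>\<^sub>E \<rat>" "\<And>j. j < p \<Longrightarrow> (\<lambda>m. U m j) \<longlonglongrightarrow> w j"
    by (rule rational_sequence[of p w]) (rule that)
  have "\<forall>\<^sub>F m in sequentially. \<bar>gram p n x (unit_fun j) (U m) - h j\<bar> < \<mu>" if "j < p" for j
  proof (rule order_tendstoD)
    show "(\<lambda>m. \<bar>gram p n x (unit_fun j) (U m) - h j\<bar>) \<longlonglongrightarrow> \<bar>gram p n x (unit_fun j) w - h j\<bar>"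
      by (intro tendsto_intros tendsto_gram U(2)) auto
    show "\<bar>gram p n x (unit_fun j) w - h j\<bar> < \<mu>" using assms that by (simp add: feasible_def)
  qed
  then have "\<forall>\<^sub>F m in sequentially. \<forall>j\<in>{..<p}. \<bar>gram p n x (unit_fun j) (U m) - h j\<bar> < \<mu>"
    by (intro eventually_ball_finite) auto
  moreover have "\<forall>\<^sub>F m in sequentially. gram p n x (U m) (U m) < K"
    by (rule order_tendstoD[OF tendsto_gram[OF U(2) U(2)]]) (use assms in \<open>auto simp: feasible_def\<close>)
  ultimately have "\<forall>\<^sub>F m in sequentially. feasible p n h \<mu> K x (U m)"
    by eventually_elim (simp add: feasible_def)
  then obtain m where m: "feasible p n h \<mu> K x (U m)" by (metis eventually_sequentially order_refl)
  obtain l where "from_nat_into ({..<p} \<rightarrow>\<^sub>E \<rat>) l = U m"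
    using from_nat_into_surj[OF countable_rational_vectors U(1)] by blast
  with m have ex: "\<exists>l. feasible p n h \<mu> K x (from_nat_into ({..<p} \<rightarrow>\<^sub>E \<rat>) l)" by metis
  then show ?thesis unfolding direction_def using LeastI_ex[OF ex] by (simp only: if_True)
qed

text \<open>Supplies the population counterpart of the debiasing direction: the inverse of
  \<open>\<Sigma>\<close> applied to \<open>h\<close>, with norm at most \<open>M1\<close> times
  that of \<open>h\<close>.\<close>

lemma param_space_solve:
  assumes th: "(\<beta>, \<Sigma>, \<sigma>) \<in> param_space M1 M2 p k" and p: "p > 0" and M1: "M1 > 0"
  obtains w where "\<And>j. j < p \<Longrightarrow> (\<Sum>l<p. \<Sigma> $$ (j, l) * w l) = h j"
    "(\<Sum>j<p. (w j)\<^sup>2) \<le> M1\<^sup>2 * (\<Sum>j<p. (h j)\<^sup>2)"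
proof -
  from th have S: "\<Sigma> \<in> carrier_mat p p" by (auto simp: param_space_def)
  obtain L where L: "\<And>i. i < p \<Longrightarrow> L i i > 0" "\<And>i j. i < j \<Longrightarrow> L i j = 0"
    "\<And>i j. i < p \<Longrightarrow> j < p \<Longrightarrow> \<Sigma> $$ (i, j) = (\<Sum>k<p. L i k * L j k)"
    using param_space_Cholesky[OF assms] by blast
  obtain B where B: "B \<in> carrier_mat p p" "\<Sigma> * B = 1\<^sub>m p"
    using mvn_density_tri_map(3)[where L=L, OF S] L by blast
  define w where "w l = (\<Sum>j<p. B $$ (l, j) * h j)" for l
  have w1: "(\<Sum>l<p. \<Sigma> $$ (j, l) * w l) = h j" if j: "j < p" for j
  proof -
    have "(\<Sum>l<p. \<Sigma> $$ (j, l) * w l) = (\<Sum>m<p. (\<Sum>l<p. \<Sigma> $$ (j, l) * B $$ (l, m)) * h m)"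
      unfolding w_def sum_distrib_left sum_distrib_right by (subst sum.swap) (simp add: mult.assoc)
    also have "\<dots> = (\<Sum>m<p. (\<Sigma> * B) $$ (j, m) * h m)"
      using j S B(1) by (intro sum.cong refl) (auto simp: scalar_prod_def lessThan_atLeast0)
    also have "\<dots> = (\<Sum>m<p. if m = j then h m else 0)"
      unfolding B(2) using j by (intro sum.cong refl) auto
    also have "\<dots> = h j" using j by simp
    finally show ?thesis .
  qed
  have "(1 / M1) * (\<Sum>j<p. (w j)\<^sup>2) \<le> qform p (entries \<Sigma>) w" by (rule param_space_qform(1)[OF th p])
  also have "\<dots> = (\<Sum>j<p. w j * h j)"
    unfolding bform_rows by (intro sum.cong refl) (simp add: w1)
  \<comment> \<open>The weights are chosen so that half of the left side can be absorbed.\<close>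
  also have "\<dots> \<le> (\<Sum>j<p. (w j)\<^sup>2 / (2 * M1) + M1 * (h j)\<^sup>2 / 2)"
  proof (rule sum_mono)
    fix j
    have "0 \<le> (w j - M1 * h j)\<^sup>2 / (2 * M1)" using M1 by simp
    also have "\<dots> = (w j)\<^sup>2 / (2 * M1) + M1 * (h j)\<^sup>2 / 2 - w j * h j"
      using M1 by (simp add: field_simps power2_eq_square)
    finally show "w j * h j \<le> (w j)\<^sup>2 / (2 * M1) + M1 * (h j)\<^sup>2 / 2" by simp
  qed
  also have "\<dots> = (1 / M1) * (\<Sum>j<p. (w j)\<^sup>2) / 2 + M1 / 2 * (\<Sum>j<p. (h j)\<^sup>2)"
    by (simp add: sum.distrib sum_divide_distrib[symmetric] sum_distrib_left[symmetric] mult.commute)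
  finally have "(1 / M1) * (\<Sum>j<p. (w j)\<^sup>2) \<le> M1 * (\<Sum>j<p. (h j)\<^sup>2)" by simp
  then have "M1 * ((1 / M1) * (\<Sum>j<p. (w j)\<^sup>2)) \<le> M1 * (M1 * (\<Sum>j<p. (h j)\<^sup>2))"
    using M1 by (intro mult_left_mono) auto
  then have "(\<Sum>j<p. (w j)\<^sup>2) \<le> M1\<^sup>2 * (\<Sum>j<p. (h j)\<^sup>2)" using M1 by (simp add: power2_eq_square mult.assoc)
  with w1 that show thesis by blast
qed

section \<open>High-probability bounds for Gram forms and scores\<close>

lemma qform_unit_fun: "j < p \<Longrightarrow> bform p S (unit_fun j) b = (\<Sum>l<p. S j l * b l)"
  unfolding bform_rows by (rule sum_unit_fun)

lemma sum_unit_fun_square: "j < p \<Longrightarrow> (\<Sum>l<p. (unit_fun j l)\<^sup>2) = 1"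
  using sum_unit_fun[of j p "unit_fun j"] by (simp add: power2_eq_square unit_fun_def)

text \<open>Polarized concentration, with \<open>V\<close> bounding the forms of
  \<open>a + b\<close> and \<open>a - b\<close>. Stated with forms instead of norms it permits a
  relative error, which is how it is used on the grid.\<close>

lemma whp_gram_qform:
  fixes a b :: "nat \<Rightarrow> real" and V t :: real
  assumes th: "(\<beta>, \<Sigma>, \<sigma>) \<in> param_space M1 M2 p k" and p: "p > 0" and M1: "M1 > 0" and n: "n > 0"
    and V: "qform p (entries \<Sigma>) (\<lambda>j. a j + b j) \<le> V" "qform p (entries \<Sigma>) (\<lambda>j. a j - b j) \<le> V" "V > 0"
    and t: "0 \<le> t" "t \<le> 2"
  shows "whp (data_law n p (\<beta>, \<Sigma>, \<sigma>)) (4 * exp (- real n * t\<^sup>2 / 16))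
    (\<lambda>z. \<bar>gram p n (covariates n z) a b - bform p (entries \<Sigma>) a b\<bar> < V * t / 2)"
proof -
  let ?\<theta> = "(\<beta>, \<Sigma>, \<sigma>)" and ?q = "qform p (entries \<Sigma>)"
  from th have S: "\<Sigma> \<in> carrier_mat p p" "transpose_mat \<Sigma> = \<Sigma>" by (auto simp: param_space_def)
  then have sym: "\<Sigma> $$ (i, j) = \<Sigma> $$ (j, i)" if "i < p" "j < p" for i j
    using that by (metis carrier_matD index_transpose_mat(1))
  let ?U = "obs_lin p \<beta> a 0" and ?W = "obs_lin p \<beta> b 0"
  have s1: "(\<lambda>z. ?U z + ?W z) = obs_lin p \<beta> (\<lambda>j. a j + b j) 0" "(\<lambda>z. ?U z - ?W z) = obs_lin p \<beta> (\<lambda>j. a j - b j) 0"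
    by (simp_all add: obs_lin_def fun_eq_iff sum.distrib sum_subtractf distrib_right left_diff_distrib)
  define R where "R z \<longleftrightarrow> n * V * t / 2 \<le> \<bar>(\<Sum>i<n. ?U (z i) * ?W (z i)) - n * (?q (\<lambda>j. a j + b j) - ?q (\<lambda>j. a j - b j)) / 4\<bar>" for z
  have nonneg: "0 \<le> ?q x" for x
  proof -
    have "0 \<le> (1 / M1) * (\<Sum>i<p. (x i)\<^sup>2)" using M1 by (simp add: sum_nonneg)
    also have "\<dots> \<le> ?q x" by (rule param_space_qform(1)[OF th p])
    finally show ?thesis .
  qed
  have pol: "(?q (\<lambda>j. a j + b j) - ?q (\<lambda>j. a j - b j)) / 4 = bform p (entries \<Sigma>) a b"
    using qform_add_scaled[where p=p and S="entries \<Sigma>" and a=a and b=b and c=1, OF sym]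
      qform_add_scaled[where p=p and S="entries \<Sigma>" and a=a and b=b and c="- 1", OF sym] by simp
  have m: "measure (data_law n p ?\<theta>) {z \<in> space (data_law n p ?\<theta>). R z} \<le> 4 * exp (- real n * t\<^sup>2 / 16)"
    unfolding data_law_def R_def
  proof (rule product_concentration[OF prob_space_obs_law[OF th p M1]])
    show "centered_gaussian (obs_law p ?\<theta>) (\<lambda>z. ?U z + ?W z) (?q (\<lambda>j. a j + b j))"
      "centered_gaussian (obs_law p ?\<theta>) (\<lambda>z. ?U z - ?W z) (?q (\<lambda>j. a j - b j))"
      unfolding s1 using centered_gaussian_obs_lin[OF th p M1, of _ 0] by simp_all
  qed (use nonneg V t in auto)
  show ?thesis
  proof (rule whpI[OF _ m])
    show "{z \<in> space (data_law n p ?\<theta>). R z} \<in> sets (data_law n p ?\<theta>)"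
      unfolding data_law_def R_def by measurable
    fix z assume "\<not> R z"
    then have "\<bar>(\<Sum>i<n. ?U (z i) * ?W (z i)) - n * bform p (entries \<Sigma>) a b\<bar> < n * V * t / 2"
      unfolding R_def by (simp add: pol[symmetric])
    moreover have "(\<Sum>i<n. ?U (z i) * ?W (z i)) = n * gram p n (covariates n z) a b"
      using n by (simp add: gram_def obs_lin_def covariates_def)
    ultimately have "n * \<bar>gram p n (covariates n z) a b - bform p (entries \<Sigma>) a b\<bar> < n * (V * t / 2)"
      by (simp add: right_diff_distrib[symmetric] abs_mult mult.assoc)
    then show "\<bar>gram p n (covariates n z) a b - bform p (entries \<Sigma>) a b\<bar> < V * t / 2"
      using n by (simp only: mult_less_cancel_left_pos of_nat_0_less_iff)
  qed
qed

lemma whp_gram: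
  fixes a b :: "nat \<Rightarrow> real" and V t :: real
  assumes th: "(\<beta>, \<Sigma>, \<sigma>) \<in> param_space M1 M2 p k" and p: "p > 0" and M1: "M1 > 0" and n: "n > 0"
    and V: "M1 * (\<Sum>j<p. (a j + b j)\<^sup>2) \<le> V" "M1 * (\<Sum>j<p. (a j - b j)\<^sup>2) \<le> V" "V > 0"
    and t: "0 \<le> t" "t \<le> 2"
  shows "whp (data_law n p (\<beta>, \<Sigma>, \<sigma>)) (4 * exp (- real n * t\<^sup>2 / 16))
    (\<lambda>z. \<bar>gram p n (covariates n z) a b - bform p (entries \<Sigma>) a b\<bar> < V * t / 2)"
proof (rule whp_gram_qform[OF th p M1 n _ _ V(3) t])
  show "qform p (entries \<Sigma>) (\<lambda>j. a j + b j) \<le> V" "qform p (entries \<Sigma>) (\<lambda>j. a j - b j) \<le> V"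
    using param_space_qform(2)[OF th p, of "\<lambda>j. a j + b j"] param_space_qform(2)[OF th p, of "\<lambda>j. a j - b j"] V(1,2)
    by linarith+
qed

text \<open>Covariate and noise are independent, so their sum and their difference have the same
  variance and the polarized mean is 0.\<close>

lemma whp_score:
  assumes th: "(\<beta>, \<Sigma>, \<sigma>) \<in> param_space M1 M2 p k" and p: "p > 0" and M1: "M1 > 0" and n: "n > 0"
    and t: "0 \<le> t" "t \<le> 2" and j: "j < p"
  shows "whp (data_law n p (\<beta>, \<Sigma>, \<sigma>)) (4 * exp (- real n * t\<^sup>2 / 16))
    (\<lambda>z. \<bar>score p n z (\<lambda>j. Matrix.vec_index \<beta> j) (unit_fun j)\<bar> < (M1 + M2\<^sup>2) * t / 2)"
proof -
  let ?\<theta> = "(\<beta>, \<Sigma>, \<sigma>)" and ?v = "qform p (entries \<Sigma>) (unit_fun j) + \<sigma>\<^sup>2"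
  let ?U = "obs_lin p \<beta> (unit_fun j) 0" and ?W = "obs_lin p \<beta> (\<lambda>_. 0) 1"
  from th have \<sigma>: "0 < \<sigma>" "\<sigma> \<le> M2" by (auto simp: param_space_def)
  define V where "V = M1 + M2\<^sup>2"
  have V: "V > 0" using M1 by (simp add: V_def add_pos_nonneg)
  have s1: "(\<lambda>z. ?U z + ?W z) = obs_lin p \<beta> (unit_fun j) 1" "(\<lambda>z. ?U z - ?W z) = obs_lin p \<beta> (unit_fun j) (- 1)"
    by (auto simp: obs_lin_def fun_eq_iff)
  have q: "0 \<le> qform p (entries \<Sigma>) (unit_fun j)" "qform p (entries \<Sigma>) (unit_fun j) \<le> M1"
  proof -
    have "0 \<le> (1 / M1) * (\<Sum>l<p. (unit_fun j l)\<^sup>2)" using M1 by (simp add: sum_nonneg)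
    then show "0 \<le> qform p (entries \<Sigma>) (unit_fun j)" using param_space_qform(1)[OF th p, of "unit_fun j"] by linarith
    show "qform p (entries \<Sigma>) (unit_fun j) \<le> M1"
      using param_space_qform(2)[OF th p, of "unit_fun j"] by (simp add: sum_unit_fun_square[OF j])
  qed
  define R where "R z \<longleftrightarrow> n * V * t / 2 \<le> \<bar>(\<Sum>i<n. ?U (z i) * ?W (z i)) - n * (?v - ?v) / 4\<bar>" for z
  have m: "measure (data_law n p ?\<theta>) {z \<in> space (data_law n p ?\<theta>). R z} \<le> 4 * exp (- real n * t\<^sup>2 / 16)"
    unfolding data_law_def R_def
  proof (rule product_concentration[OF prob_space_obs_law[OF th p M1]])
    show "centered_gaussian (obs_law p ?\<theta>) (\<lambda>z. ?U z + ?W z) ?v" "centered_gaussian (obs_law p ?\<theta>) (\<lambda>z. ?U z - ?W z) ?v"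
      unfolding s1 using centered_gaussian_obs_lin[OF th p M1, of "unit_fun j" 1]
        centered_gaussian_obs_lin[OF th p M1, of "unit_fun j" "- 1"] by simp_all
    show "?v \<le> V" "?v \<le> V" using q(2) power_mono[OF \<sigma>(2), of 2] \<sigma>(1) unfolding V_def by linarith+
  qed (use q V t in auto)
  show ?thesis
  proof (rule whpI[OF _ m])
    show "{z \<in> space (data_law n p ?\<theta>). R z} \<in> sets (data_law n p ?\<theta>)"
      unfolding data_law_def R_def by measurable
    fix z assume "\<not> R z"
    then have "\<bar>\<Sum>i<n. ?U (z i) * ?W (z i)\<bar> < n * V * t / 2" unfolding R_def by simp
    moreover have "(\<Sum>i<n. ?U (z i) * ?W (z i)) = n * score p n z (\<lambda>j. Matrix.vec_index \<beta> j) (unit_fun j)"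
      using n by (simp add: score_def obs_lin_def)
    ultimately have "n * \<bar>score p n z (\<lambda>j. Matrix.vec_index \<beta> j) (unit_fun j)\<bar> < n * (V * t / 2)"
      by (simp add: abs_mult mult.assoc)
    then show "\<bar>score p n z (\<lambda>j. Matrix.vec_index \<beta> j) (unit_fun j)\<bar> < (M1 + M2\<^sup>2) * t / 2"
      using n by (simp only: mult_less_cancel_left_pos of_nat_0_less_iff V_def)
  qed
qed

lemma score_measurable:
  assumes [measurable]: "\<And>j. j < p \<Longrightarrow> (\<lambda>z. a z j) \<in> borel_measurable (data_space n p)"
  shows "(\<lambda>z. score p n z b (a z)) \<in> borel_measurable (data_space n p)"
  unfolding score_def by measurable

lemma direction_covariates_measurable:
  "(\<lambda>z. direction p n h \<mu> K (covariates n z) j) \<in> borel_measurable (data_space n p)"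
  by (rule measurable_compose[OF covariates_measurable direction_measurable])

text \<open>The direction depends on the whole design, so the summands are not independent and
  \<open>product_concentration\<close> does not apply. Given the design, the second moment is
  controlled, and Chebyshev's inequality concludes.\<close>

lemma whp_debiasing_score:
  fixes K \<tau> :: real
  assumes th: "(\<beta>, \<Sigma>, \<sigma>) \<in> param_space M1 M2 p k" and p: "p > 0" and M1: "M1 > 0" and n: "n > 0"
    and K: "K \<ge> 0" and \<tau>: "\<tau> > 0"
  shows "whp (data_law n p (\<beta>, \<Sigma>, \<sigma>)) (M2\<^sup>2 * K / (n * \<tau>\<^sup>2))
    (\<lambda>z. \<bar>score p n z (\<lambda>j. Matrix.vec_index \<beta> j) (direction p n h \<mu> K (covariates n z))\<bar> < \<tau>)"
proof -
  let ?P = "data_law n p (\<beta>, \<Sigma>, \<sigma>)"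
  interpret P: prob_space ?P by (rule prob_space_data_law[OF th p M1])
  from th have \<sigma>: "0 < \<sigma>" "\<sigma> \<le> M2" by (auto simp: param_space_def)
  define A where "A i x = (\<Sum>j<p. direction p n h \<mu> K x j * x i j)" for i and x :: "nat \<Rightarrow> nat \<Rightarrow> real"
  define Q where "Q z = (\<Sum>i<n. A i (covariates n z) * obs_lin p \<beta> (\<lambda>_. 0) 1 (z i))" for z
  have Q: "Q z = n * score p n z (\<lambda>j. Matrix.vec_index \<beta> j) (direction p n h \<mu> K (covariates n z))" for z
    using n by (simp add: Q_def A_def score_def obs_lin_def covariates_def)

  have A[measurable]: "A i \<in> borel_measurable (\<Pi>\<^sub>M i\<in>{..<n}. \<Pi>\<^sub>M j\<in>{..<p}. borel)" if "i < n" for i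
    unfolding A_def
    by (intro borel_measurable_sum borel_measurable_times direction_measurable entry_measurable) (use that in auto)
  have Am: "(\<Sum>i<n. (A i x)\<^sup>2) \<le> n * K" for x
  proof -
    have "(\<Sum>i<n. (A i x)\<^sup>2) = n * gram p n x (direction p n h \<mu> K x) (direction p n h \<mu> K x)"
      using n by (simp add: gram_def A_def power2_eq_square)
    also have "\<dots> \<le> n * K" by (intro mult_left_mono gram_direction_le K) auto
    finally show ?thesis .
  qed
  have Qm[measurable]: "Q \<in> borel_measurable ?P"
    unfolding Q using score_measurable[OF direction_covariates_measurable] by measurable
  define c where "c = 1 / (n\<^sup>2 * \<tau>\<^sup>2)"
  have c: "c > 0" using n \<tau> by (simp add: c_def)
  \<comment> \<open>The event \<open>\<bar>Q z\<bar> \<ge> n * \<tau>\<close>, in the form that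
    Markov's inequality expects.\<close>
  define R where "R z \<longleftrightarrow> 1 \<le> ennreal c * ennreal ((Q z)\<^sup>2)" for z
  have "emeasure ?P {z \<in> space ?P. R z} \<le> ennreal c * (\<integral>\<^sup>+z. ennreal ((Q z)\<^sup>2) * indicator (space ?P) z \<partial>?P)"
    unfolding R_def
  proof (rule nn_integral_Markov_inequality)
    show "(\<lambda>z. ennreal ((Q z)\<^sup>2) * indicator (space ?P) z) \<in> borel_measurable ?P"
      using Qm by (intro borel_measurable_times_ennreal measurable_compose[OF _ measurable_ennreal] borel_measurable_power) auto
  qed (rule sets.top)
  also have "(\<integral>\<^sup>+z. ennreal ((Q z)\<^sup>2) * indicator (space ?P) z \<partial>?P) = (\<integral>\<^sup>+z. ennreal ((Q z)\<^sup>2) \<partial>?P)"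
    by (intro nn_integral_cong) auto
  also have "\<dots> \<le> ennreal (\<sigma>\<^sup>2 * (n * K))"
    unfolding Q_def by (rule conditional_second_moment[OF th p M1 A Am])
  also have "\<dots> \<le> ennreal (M2\<^sup>2 * (n * K))"
    using \<sigma> K by (intro ennreal_leI mult_right_mono power_mono) auto
  also have "ennreal c * ennreal (M2\<^sup>2 * (n * K)) = ennreal (M2\<^sup>2 * K / (n * \<tau>\<^sup>2))"
  proof -
    have "ennreal c * ennreal (M2\<^sup>2 * (n * K)) = ennreal (c * (M2\<^sup>2 * (n * K)))"
      using c K by (intro ennreal_mult[symmetric]) auto
    moreover have "c * (M2\<^sup>2 * (n * K)) = M2\<^sup>2 * K / (n * \<tau>\<^sup>2)"
      using n \<tau> by (simp add: c_def power2_eq_square)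
    ultimately show ?thesis by simp
  qed
  finally have m: "measure ?P {z \<in> space ?P. R z} \<le> M2\<^sup>2 * K / (n * \<tau>\<^sup>2)"
    using K n \<tau> by (simp add: P.emeasure_eq_measure mult_left_mono)
  show ?thesis
  proof (rule whpI[OF _ m])
    show "{z \<in> space ?P. R z} \<in> sets ?P" unfolding R_def by measurable
    fix z assume "\<not> R z"
    then have "c * (Q z)\<^sup>2 < 1" using c by (simp add: R_def ennreal_mult[symmetric] not_le flip: ennreal_1)
    then have "(Q z)\<^sup>2 < (n * \<tau>)\<^sup>2" using n \<tau> by (simp add: c_def power_mult_distrib)
    then have "\<bar>Q z\<bar>\<^sup>2 < (n * \<tau>)\<^sup>2" by simp
    then have "\<bar>Q z\<bar> < n * \<tau>" by (rule power2_less_imp_less) (use \<tau> in simp)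
    then show "\<bar>score p n z (\<lambda>j. Matrix.vec_index \<beta> j) (direction p n h \<mu> K (covariates n z))\<bar> < \<tau>"
      unfolding Q using n by (simp add: abs_mult)
  qed
qed

section \<open>Detection by an explicit test\<close>

text \<open>The uniform size of the scores; the absolute error sum of a sparse fit is of order
  \<open>ku\<close> times this.\<close>

definition l1_rate :: "nat \<Rightarrow> nat \<Rightarrow> real" where "l1_rate n p = sqrt (ln (real p) / n)"

lemma nat_ceiling_bounds:
  fixes x :: real
  assumes "0 \<le> x"
  shows "x \<le> real (nat \<lceil>x\<rceil>)" and "real (nat \<lceil>x\<rceil>) \<le> x + 1"
proof -
  have "real (nat \<lceil>x\<rceil>) = of_int \<lceil>x\<rceil>" using assms by (intro of_nat_nat) simp
  then show "x \<le> real (nat \<lceil>x\<rceil>)" "real (nat \<lceil>x\<rceil>) \<le> x + 1" by linarith+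
qed

text \<open>The resolution that \<open>sparse_eigenvalue\<close> asks for at sparsity
  \<open>2 * k\<close>, rounded up.\<close>

definition grid_res :: "real \<Rightarrow> nat \<Rightarrow> nat" where "grid_res M1 k = nat \<lceil>32 * M1 * k\<rceil>"

text \<open>A slot has at most \<open>p ^ 3\<close> values: one factor \<open>p\<close> counts
  coordinates, one absorbs \<open>k \<le> p\<close> in the resolution and one the constant
  \<open>64 * M1 + 3\<close>. There are \<open>2 * k\<close> slots.\<close>

lemma card_grid_le:
  fixes M1 :: real
  assumes M1: "M1 > 1" and k: "k \<ge> 1" "k \<le> p" and p: "64 * M1 + 3 \<le> real p"
  shows "real (card (grid p (2 * k) (grid_res M1 k))) \<le> exp (6 * real k * ln (real p))"
proof -
  let ?N = "grid_res M1 k"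
  have p0: "real p > 0" using p M1 by linarith
  have p1: "real p \<ge> 1" using p M1 by linarith
  have "real ?N \<le> 32 * M1 * k + 1"
    unfolding grid_res_def by (rule nat_ceiling_bounds(2)) (use M1 in simp)
  also have "32 * M1 * k \<le> 32 * M1 * p" using k M1 by (intro mult_left_mono) auto
  finally have "2 * real ?N + 1 \<le> 64 * M1 * p + 3 * 1" by simp
  also have "\<dots> \<le> 64 * M1 * p + 3 * real p" using p1 by (intro add_left_mono mult_left_mono) auto
  also have "\<dots> = (64 * M1 + 3) * p" by (simp add: algebra_simps)
  also have "\<dots> \<le> real p * p" using p p0 by (intro mult_right_mono) auto
  finally have "real p * (2 * real ?N + 1) \<le> real p * (real p * p)" using p0 by (intro mult_left_mono) auto
  also have "\<dots> = real p ^ 3" by (simp add: power3_eq_cube)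
  finally have "(real p * (2 * real ?N + 1)) ^ (2 * k) \<le> (real p ^ 3) ^ (2 * k)"
    using p0 by (intro power_mono) auto
  also have "\<dots> = real p ^ (6 * k)" by (simp add: power_mult[symmetric])
  also have "\<dots> = exp (ln (real p)) ^ (6 * k)" using p0 by simp
  also have "\<dots> = exp (real (6 * k) * ln (real p))" by (simp only: exp_of_nat_mult[symmetric])
  also have "\<dots> = exp (6 * real k * ln (real p))" by simp
  finally have 1: "(real p * (2 * real ?N + 1)) ^ (2 * k) \<le> exp (6 * real k * ln (real p))" .
  have "real (card (grid p (2 * k) ?N)) \<le> real ((p * (2 * ?N + 1)) ^ (2 * k))"
    using card_grid by (simp only: of_nat_le_iff)
  also have "\<dots> = (real p * (2 * real ?N + 1)) ^ (2 * k)"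
    by (simp only: of_nat_power of_nat_mult of_nat_add of_nat_1 of_nat_numeral)
  finally show ?thesis using 1 by linarith
qed

definition restricted_eigenvalue :: "nat \<Rightarrow> nat \<Rightarrow> real \<Rightarrow> nat \<Rightarrow> (nat \<Rightarrow> nat \<Rightarrow> real) \<Rightarrow> bool" where
  "restricted_eigenvalue p n \<kappa> s x \<longleftrightarrow>
     (\<forall>\<delta>. card {j. j < p \<and> \<delta> j \<noteq> 0} \<le> s \<longrightarrow> \<kappa> * (\<Sum>j<p. (\<delta> j)\<^sup>2) \<le> gram p n x \<delta> \<delta>)"

text \<open>A union bound over \<open>p\<close> diagonal entries and at most
  \<open>exp (6 * k * ln p)\<close> grid points, the latter failing with probability at most
  \<open>4 * exp (- n / 256)\<close> each. Since \<open>2048 = 8 * 256\<close>, the exponent left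
  over is \<open>- 2 * k * ln p\<close>.\<close>

lemma whp_restricted_eigenvalue:
  fixes M1 M2 :: real
  assumes th: "(\<beta>, \<Sigma>, \<sigma>) \<in> param_space M1 M2 p k" and M1: "M1 > 1" and k: "k \<ge> 1" "k \<le> p"
    and p: "64 * M1 + 3 \<le> real p" and n: "2048 * k * ln (real p) \<le> real n"
  shows "whp (data_law n p (\<beta>, \<Sigma>, \<sigma>)) (8 / p) (\<lambda>z. restricted_eigenvalue p n (1 / (16 * M1)) (2 * k) (covariates n z))"
proof -
  let ?P = "data_law n p (\<beta>, \<Sigma>, \<sigma>)"
  have p0: "p > 0" using p M1 by (cases p) auto
  have p3: "real p \<ge> 3" using p M1 by linarith
  then have l: "ln (real p) > 0" by simp
  have kl: "ln (real p) \<le> k * ln (real p)" using k l mult_right_mono[of 1 "real k" "ln (real p)"] by simp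
  have nk: "2048 * (k * ln (real p)) \<le> n" using n by (simp add: mult.assoc)
  have n0: "n > 0" using n kl l by (cases n) auto
  have e1: "exp (- ln (real p)) = 1 / p" using p0 by (simp add: exp_minus inverse_eq_divide)
  have diag: "whp ?P (4 * exp (- real n / 64)) (\<lambda>z. gram p n (covariates n z) (unit_fun j) (unit_fun j) \<le> 2 * M1)"
    if j: "j < p" for j
  proof -
    have "(\<Sum>l<p. (unit_fun j l + unit_fun j l)\<^sup>2) = (\<Sum>l<p. 4 * (unit_fun j l)\<^sup>2)"
      by (intro sum.cong refl) (simp add: power2_eq_square)
    then have s: "(\<Sum>l<p. (unit_fun j l + unit_fun j l)\<^sup>2) = 4"
      using sum_unit_fun_square[OF j] by (simp add: sum_distrib_left[symmetric])
    have "whp ?P (4 * exp (- real n * (1 / 2)\<^sup>2 / 16))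
        (\<lambda>z. \<bar>gram p n (covariates n z) (unit_fun j) (unit_fun j) - qform p (entries \<Sigma>) (unit_fun j)\<bar> < (4 * M1) * (1 / 2) / 2)"
      by (rule whp_gram[OF th p0 _ n0]) (use M1 s in auto)
    then show ?thesis
    proof (rule whp_mono)
      show "4 * exp (- real n * (1 / 2)\<^sup>2 / 16) \<le> 4 * exp (- real n / 64)" by (simp add: power2_eq_square)
      fix z assume "\<bar>gram p n (covariates n z) (unit_fun j) (unit_fun j) - qform p (entries \<Sigma>) (unit_fun j)\<bar> < (4 * M1) * (1 / 2) / 2"
      moreover have "qform p (entries \<Sigma>) (unit_fun j) \<le> M1"
        using param_space_qform(2)[OF th p0, of "unit_fun j"] by (simp add: sum_unit_fun_square[OF j])
      ultimately show "gram p n (covariates n z) (unit_fun j) (unit_fun j) \<le> 2 * M1" by (simp add: abs_less_iff)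
    qed
  qed
  have gr: "whp ?P (4 * exp (- real n / 256)) (\<lambda>z. (\<Sum>j<p. (y j)\<^sup>2) / (2 * M1) \<le> gram p n (covariates n z) y y)" for y
  proof (cases "(\<Sum>j<p. (y j)\<^sup>2) = 0")
    case True
    then show ?thesis
      by (intro whpI[of ?P "\<lambda>_. False"]) (auto simp: gram_def intro!: divide_nonneg_nonneg sum_nonneg)
  next
    case False
    define v where "v = qform p (entries \<Sigma>) y"
    define Y where "Y = (\<Sum>j<p. (y j)\<^sup>2)"
    have Y: "Y > 0" using False by (simp add: Y_def less_le sum_nonneg)
    have vlo: "Y / M1 \<le> v" using param_space_qform(1)[OF th p0, of y] by (simp add: v_def Y_def)
    have v: "v > 0" using vlo Y M1 by (smt (verit) divide_pos_pos)
    \<comment> \<open>With \<open>a = b = y\<close> the polarized forms are \<open>4 * v\<close> and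
      0, so the accuracy \<open>t = 1 / 4\<close> is a relative error of one half.\<close>
    have q2: "qform p (entries \<Sigma>) (\<lambda>j. y j + y j) = 4 * v"
      using qform_scale[of p "entries \<Sigma>" 2 y] by (simp add: v_def mult_2[symmetric])
    have q0: "qform p (entries \<Sigma>) (\<lambda>j. y j - y j) = 0" by (simp add: bform_def)
    have "whp ?P (4 * exp (- real n * (1 / 4)\<^sup>2 / 16))
        (\<lambda>z. \<bar>gram p n (covariates n z) y y - v\<bar> < (4 * v) * (1 / 4) / 2)"
      unfolding v_def
      by (rule whp_gram_qform[OF th p0 _ n0]) (use M1 v q2 q0 in \<open>auto simp: v_def\<close>)
    then show ?thesis
    proof (rule whp_mono)
      show "4 * exp (- real n * (1 / 4)\<^sup>2 / 16) \<le> 4 * exp (- real n / 256)" by (simp add: power2_eq_square)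
      fix z assume "\<bar>gram p n (covariates n z) y y - v\<bar> < (4 * v) * (1 / 4) / 2"
      then have "v / 2 \<le> gram p n (covariates n z) y y" unfolding abs_less_iff by linarith
      moreover have "Y / (2 * M1) \<le> v / 2" using vlo by simp
      ultimately show "(\<Sum>j<p. (y j)\<^sup>2) / (2 * M1) \<le> gram p n (covariates n z) y y" by (simp add: Y_def)
    qed
  qed
  have "whp ?P (card {..<p} * (4 * exp (- real n / 64)) + card (grid p (2 * k) (grid_res M1 k)) * (4 * exp (- real n / 256)))
     (\<lambda>z. (\<forall>j\<in>{..<p}. gram p n (covariates n z) (unit_fun j) (unit_fun j) \<le> 2 * M1) \<and>
       (\<forall>y\<in>grid p (2 * k) (grid_res M1 k). (\<Sum>j<p. (y j)\<^sup>2) / (2 * M1) \<le> gram p n (covariates n z) y y))"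
    by (intro whp_conj whp_ball finite_grid finite_lessThan gr) (use diag in auto)
  then show ?thesis
  proof (rule whp_mono)
    have "real n / 64 \<ge> 2 * ln (real p)" using nk kl l by linarith
    then have "exp (- real n / 64) \<le> exp (- ln (real p)) * exp (- ln (real p))" by (simp add: exp_add[symmetric])
    then have "real p * (4 * exp (- real n / 64)) \<le> real p * (4 * (1 / p * (1 / p)))"
      unfolding e1 by (intro mult_left_mono) auto
    also have "\<dots> = 4 / p" using p0 by simp
    finally have 1: "card {..<p} * (4 * exp (- real n / 64)) \<le> 4 / p" by simp
    have "real (card (grid p (2 * k) (grid_res M1 k))) * (4 * exp (- real n / 256)) \<le> exp (6 * real k * ln (real p)) * (4 * exp (- real n / 256))"
      by (rule mult_right_mono[OF card_grid_le[OF M1 k p]]) simp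
    also have "\<dots> = 4 * exp (6 * real k * ln (real p) - real n / 256)" 
    proof -
      have "6 * real k * ln (real p) - real n / 256 = 6 * real k * ln (real p) + (- real n / 256)" by simp
      then show ?thesis by (simp only: exp_add mult.left_commute)
    qed
    also have "\<dots> \<le> 4 * exp (- ln (real p))"
    proof -
      have "6 * real k * ln (real p) - n / 256 \<le> - ln (real p)" using nk kl l by linarith
      then show ?thesis by simp
    qed
    finally show "card {..<p} * (4 * exp (- real n / 64)) + card (grid p (2 * k) (grid_res M1 k)) * (4 * exp (- real n / 256)) \<le> 8 / p"
      using 1 unfolding e1 by simp
  next
    fix z assume z: "(\<forall>j\<in>{..<p}. gram p n (covariates n z) (unit_fun j) (unit_fun j) \<le> 2 * M1) \<and>
       (\<forall>y\<in>grid p (2 * k) (grid_res M1 k). (\<Sum>j<p. (y j)\<^sup>2) / (2 * M1) \<le> gram p n (covariates n z) y y)"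
    have N: "16 * M1 * real (2 * k) \<le> real (grid_res M1 k)"
    proof -
      have "16 * M1 * real (2 * k) = 32 * M1 * k" by simp
      also have "\<dots> \<le> real (nat \<lceil>32 * M1 * k\<rceil>)" by (rule nat_ceiling_bounds(1)) (use M1 in simp)
      finally show ?thesis unfolding grid_res_def .
    qed
    show "restricted_eigenvalue p n (1 / (16 * M1)) (2 * k) (covariates n z)"
      unfolding restricted_eigenvalue_def
    proof (intro allI impI)
      fix \<delta> :: "nat \<Rightarrow> real" assume "card {j. j < p \<and> \<delta> j \<noteq> 0} \<le> 2 * k"
      then show "1 / (16 * M1) * (\<Sum>j<p. (\<delta> j)\<^sup>2) \<le> gram p n (covariates n z) \<delta> \<delta>"
        by (intro sparse_eigenvalue[OF M1 p0 _ N]) (use k z in auto)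
    qed
  qed
qed

lemma sum_add_square_le:
  fixes a b :: "nat \<Rightarrow> real"
  shows "(\<Sum>j<p. (a j + b j)\<^sup>2) \<le> 2 * ((\<Sum>j<p. (a j)\<^sup>2) + (\<Sum>j<p. (b j)\<^sup>2))"
    and "(\<Sum>j<p. (a j - b j)\<^sup>2) \<le> 2 * ((\<Sum>j<p. (a j)\<^sup>2) + (\<Sum>j<p. (b j)\<^sup>2))"
proof -
  have *: "(x + y)\<^sup>2 \<le> 2 * (x\<^sup>2 + y\<^sup>2)" for x y :: real
    using sum_squares_bound[of x y] by (simp add: power2_sum)
  show "(\<Sum>j<p. (a j + b j)\<^sup>2) \<le> 2 * ((\<Sum>j<p. (a j)\<^sup>2) + (\<Sum>j<p. (b j)\<^sup>2))"
    unfolding sum.distrib[symmetric] sum_distrib_left by (intro sum_mono *)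
  show "(\<Sum>j<p. (a j - b j)\<^sup>2) \<le> 2 * ((\<Sum>j<p. (a j)\<^sup>2) + (\<Sum>j<p. (b j)\<^sup>2))"
    unfolding sum.distrib[symmetric] sum_distrib_left
    by (intro sum_mono) (use *[of _ "- _"] in simp)
qed

text \<open>The witness comes from \<open>param_space_solve\<close>: its population image is exactly
  \<open>h\<close>, so only sampling fluctuations remain. Accuracy
  \<open>t = 8 * l1_rate n p\<close> has failure probability \<open>4 * exp (- 4 * ln p)\<close> per
  row, which survives a union over \<open>p\<close> rows.\<close>

lemma whp_feasible:
  fixes M1 M2 :: real
  assumes th: "(\<beta>, \<Sigma>, \<sigma>) \<in> param_space M1 M2 p k" and M1: "M1 > 1" and p: "real p \<ge> 3"
    and n: "256 * ln (real p) \<le> real n" and hn: "hn > 0" "(\<Sum>j<p. (h j)\<^sup>2) = hn\<^sup>2"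
  shows "whp (data_law n p (\<beta>, \<Sigma>, \<sigma>)) (8 / p) (\<lambda>z. \<exists>w. feasible p n h (8 * M1 * (1 + M1\<^sup>2) * hn * l1_rate n p) (2 * M1 ^ 3 * hn\<^sup>2) (covariates n z) w)"
proof -
  let ?P = "data_law n p (\<beta>, \<Sigma>, \<sigma>)"
  have p0: "p > 0" using p by (cases p) auto
  have l: "ln (real p) > 0" using p by simp
  have n0: "n > 0" using n l by (cases n) auto
  have e1: "exp (- ln (real p)) = 1 / p" using p0 by (simp add: exp_minus inverse_eq_divide)
  define r where "r = l1_rate n p"
  have r2: "r\<^sup>2 = ln (real p) / n" using l by (simp add: r_def l1_rate_def)
  have r: "0 \<le> r" "r \<le> 1 / 4"
  proof -
    show "0 \<le> r" using l by (simp add: r_def l1_rate_def)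
    have "ln (real p) / n \<le> 1 / 16" using n n0 l by (simp add: field_simps)
    then have "r\<^sup>2 \<le> (1 / 4)\<^sup>2" unfolding r2 by (simp add: power_divide)
    then show "r \<le> 1 / 4" by (rule power2_le_imp_le) simp
  qed
  have M10: "M1 > 0" using M1 by simp
  obtain w where w: "\<And>j. j < p \<Longrightarrow> (\<Sum>l<p. \<Sigma> $$ (j, l) * w l) = h j" "(\<Sum>j<p. (w j)\<^sup>2) \<le> M1\<^sup>2 * (\<Sum>j<p. (h j)\<^sup>2)"
    using param_space_solve[OF th p0 M10, of h] by metis
  have w2: "(\<Sum>j<p. (w j)\<^sup>2) \<le> M1\<^sup>2 * hn\<^sup>2" using w(2) hn by simp
  \<comment> \<open>Normalization balances the polarized sums with the unit vectors: their norms are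
    bounded in terms of \<open>M1\<close>, and the error becomes proportional to
    \<open>hn\<close>.\<close>
  define w' where "w' j = w j / hn" for j
  have w'2: "(\<Sum>j<p. (w' j)\<^sup>2) \<le> M1\<^sup>2"
  proof -
    have "(\<Sum>j<p. (w' j)\<^sup>2) = (\<Sum>j<p. (w j)\<^sup>2) / hn\<^sup>2" by (simp add: w'_def power_divide sum_divide_distrib)
    also have "\<dots> \<le> M1\<^sup>2 * hn\<^sup>2 / hn\<^sup>2" by (intro divide_right_mono w2) auto
    finally show ?thesis using hn by simp
  qed
  have gw: "gram p n x a w = hn * gram p n x a w'" for x a
  proof -
    have "(\<Sum>j<p. w j * x i j) = hn * (\<Sum>j<p. w' j * x i j)" for i
      using hn by (simp add: w'_def sum_divide_distrib[symmetric])
    then show ?thesis by (simp add: gram_def sum_distrib_left mult_ac)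
  qed
  have row: "whp ?P (4 * exp (- 4 * ln (real p))) (\<lambda>z. \<bar>gram p n (covariates n z) (unit_fun j) w - h j\<bar> < 8 * M1 * (1 + M1\<^sup>2) * hn * r)"
    if j: "j < p" for j
  proof -
    let ?V = "2 * M1 * (1 + M1\<^sup>2)"
    have "whp ?P (4 * exp (- real n * (8 * r)\<^sup>2 / 16))
        (\<lambda>z. \<bar>gram p n (covariates n z) (unit_fun j) w' - bform p (entries \<Sigma>) (unit_fun j) w'\<bar> < ?V * (8 * r) / 2)"
    proof (rule whp_gram[OF th p0 M10 n0])
      have "2 * ((\<Sum>l<p. (unit_fun j l)\<^sup>2) + (\<Sum>l<p. (w' l)\<^sup>2)) \<le> 2 * (1 + M1\<^sup>2)"
        using sum_unit_fun_square[OF j] w'2 by simp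
      then have "(\<Sum>l<p. (unit_fun j l + w' l)\<^sup>2) \<le> 2 * (1 + M1\<^sup>2)" "(\<Sum>l<p. (unit_fun j l - w' l)\<^sup>2) \<le> 2 * (1 + M1\<^sup>2)"
        using sum_add_square_le[of "unit_fun j" w' p] by linarith+
      then have "M1 * (\<Sum>l<p. (unit_fun j l + w' l)\<^sup>2) \<le> M1 * (2 * (1 + M1\<^sup>2))" "M1 * (\<Sum>l<p. (unit_fun j l - w' l)\<^sup>2) \<le> M1 * (2 * (1 + M1\<^sup>2))"
        using M10 by (simp_all only: mult_left_mono less_imp_le)
      then show "M1 * (\<Sum>l<p. (unit_fun j l + w' l)\<^sup>2) \<le> ?V" "M1 * (\<Sum>l<p. (unit_fun j l - w' l)\<^sup>2) \<le> ?V"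
        by (simp_all only: mult.left_commute mult.assoc)
      show "?V > 0" using M10 by (simp add: add_pos_nonneg)
    qed (use r in auto)
    then show ?thesis
    proof (rule whp_mono)
      show "4 * exp (- real n * (8 * r)\<^sup>2 / 16) \<le> 4 * exp (- 4 * ln (real p))"
        using n0 by (simp add: power_mult_distrib r2)
      fix z assume "\<bar>gram p n (covariates n z) (unit_fun j) w' - bform p (entries \<Sigma>) (unit_fun j) w'\<bar> < ?V * (8 * r) / 2"
      moreover have "bform p (entries \<Sigma>) (unit_fun j) w' = h j / hn"
        unfolding qform_unit_fun[OF j] w'_def using w(1)[OF j] by (simp add: sum_divide_distrib[symmetric])
      ultimately have "hn * \<bar>gram p n (covariates n z) (unit_fun j) w' - h j / hn\<bar> < hn * (?V * (8 * r) / 2)"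
        using hn by simp
      moreover have "hn * \<bar>gram p n (covariates n z) (unit_fun j) w' - h j / hn\<bar> = \<bar>gram p n (covariates n z) (unit_fun j) w - h j\<bar>"
      proof -
        have "gram p n (covariates n z) (unit_fun j) w - h j = hn * (gram p n (covariates n z) (unit_fun j) w' - h j / hn)"
          using hn unfolding gw right_diff_distrib by simp
        then show ?thesis using hn by (simp add: abs_mult)
      qed
      ultimately show "\<bar>gram p n (covariates n z) (unit_fun j) w - h j\<bar> < 8 * M1 * (1 + M1\<^sup>2) * hn * r"
      proof -
        have "hn * (?V * (8 * r) / 2) = 8 * M1 * (1 + M1\<^sup>2) * hn * r" by simp
        then show ?thesis if "hn * \<bar>gram p n (covariates n z) (unit_fun j) w' - h j / hn\<bar> < hn * (?V * (8 * r) / 2)"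
          "hn * \<bar>gram p n (covariates n z) (unit_fun j) w' - h j / hn\<bar> = \<bar>gram p n (covariates n z) (unit_fun j) w - h j\<bar>"
          using that by (simp only:)
      qed
    qed
  qed
  have sq: "whp ?P (4 * exp (- 4 * ln (real p))) (\<lambda>z. gram p n (covariates n z) w w < 2 * M1 ^ 3 * hn\<^sup>2)"
  proof -
    have s: "(\<Sum>j<p. (w j + w j)\<^sup>2) = 4 * (\<Sum>j<p. (w j)\<^sup>2)"
      unfolding sum_distrib_left by (intro sum.cong refl) (simp add: power2_eq_square)
    have V: "M1 * (\<Sum>j<p. (w j)\<^sup>2) \<le> M1 ^ 3 * hn\<^sup>2"
      using mult_left_mono[OF w2, of M1] M10 by (simp add: power3_eq_cube power2_eq_square mult_ac)
    have "whp ?P (4 * exp (- real n * (1 / 2)\<^sup>2 / 16))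
        (\<lambda>z. \<bar>gram p n (covariates n z) w w - qform p (entries \<Sigma>) w\<bar> < (4 * (M1 ^ 3 * hn\<^sup>2)) * (1 / 2) / 2)"
    proof (rule whp_gram[OF th p0 M10 n0])
      show "M1 * (\<Sum>j<p. (w j + w j)\<^sup>2) \<le> 4 * (M1 ^ 3 * hn\<^sup>2)" unfolding s using V by linarith
      show "M1 * (\<Sum>j<p. (w j - w j)\<^sup>2) \<le> 4 * (M1 ^ 3 * hn\<^sup>2)" using M10 by simp
      show "4 * (M1 ^ 3 * hn\<^sup>2) > 0" using M10 hn by simp
    qed auto
    then show ?thesis
    proof (rule whp_mono)
      show "4 * exp (- real n * (1 / 2)\<^sup>2 / 16) \<le> 4 * exp (- 4 * ln (real p))" using n by (simp add: power2_eq_square)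
      fix z assume "\<bar>gram p n (covariates n z) w w - qform p (entries \<Sigma>) w\<bar> < (4 * (M1 ^ 3 * hn\<^sup>2)) * (1 / 2) / 2"
      moreover have "qform p (entries \<Sigma>) w \<le> M1 ^ 3 * hn\<^sup>2"
        using param_space_qform(2)[OF th p0, of w] V by linarith
      ultimately show "gram p n (covariates n z) w w < 2 * M1 ^ 3 * hn\<^sup>2" by (simp add: abs_less_iff)
    qed
  qed
  have "whp ?P (card {..<p} * (4 * exp (- 4 * ln (real p))) + 4 * exp (- 4 * ln (real p)))
     (\<lambda>z. (\<forall>j\<in>{..<p}. \<bar>gram p n (covariates n z) (unit_fun j) w - h j\<bar> < 8 * M1 * (1 + M1\<^sup>2) * hn * r)
        \<and> gram p n (covariates n z) w w < 2 * M1 ^ 3 * hn\<^sup>2)"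
    by (intro whp_conj whp_ball finite_lessThan sq) (use row in auto)
  then show ?thesis
  proof (rule whp_mono)
    have "exp (- 4 * ln (real p)) \<le> exp (- ln (real p)) * exp (- ln (real p))" using l by (simp add: exp_add[symmetric])
    then have e4: "exp (- 4 * ln (real p)) \<le> 1 / p * (1 / p)" unfolding e1 .
    have "real p * exp (- 4 * ln (real p)) \<le> real p * (1 / p * (1 / p))" by (intro mult_left_mono e4) auto
    also have "\<dots> = 1 / p" using p0 by simp
    finally have "real p * exp (- 4 * ln (real p)) \<le> 1 / p" .
    moreover have "1 / real p * (1 / p) \<le> 1 / p" using p by (intro mult_left_le) auto
    ultimately show "card {..<p} * (4 * exp (- 4 * ln (real p))) + 4 * exp (- 4 * ln (real p)) \<le> 8 / p" using e4 by simp
  qed (auto simp: feasible_def r_def)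
qed

text \<open>Only rational candidates are searched, so that the acceptance region is a countable union.\<close>

definition accepts :: "nat \<Rightarrow> nat \<Rightarrow> (nat \<Rightarrow> real) \<Rightarrow> real \<Rightarrow> real \<Rightarrow> real \<Rightarrow> (nat \<Rightarrow> real) \<Rightarrow> real \<Rightarrow> nat \<Rightarrow> real \<Rightarrow> (nat \<Rightarrow> obs) \<Rightarrow> bool" where
  "accepts p n h \<mu> K lam \<xi> t0 k \<tau> z \<longleftrightarrow>
     (\<exists>b\<in>{b \<in> {..<p} \<rightarrow>\<^sub>E \<rat>. card {j. j < p \<and> b j \<noteq> 0} \<le> k}.
        \<bar>(\<Sum>j<p. \<xi> j * b j) - t0\<bar> < \<tau> \<and> (\<forall>j<p. \<bar>score p n z b (unit_fun j)\<bar> < lam) \<and>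
        \<bar>score p n z b (direction p n h \<mu> K (covariates n z))\<bar> < 2 * \<tau>)"

lemma accepts_measurable: "Measurable.pred (data_space n p) (accepts p n h \<mu> K lam \<xi> t0 k \<tau>)"
  unfolding pred_def accepts_def
proof (rule sets.sets_Collect_countable_Ex')
  show "countable {b \<in> {..<p} \<rightarrow>\<^sub>E (\<rat> :: real set). card {j. j < p \<and> b j \<noteq> 0} \<le> k}"
    by (rule countable_Collect[OF countable_rational_vectors])
  fix b :: "nat \<Rightarrow> real"
  define S where "S j z = score p n z b (unit_fun j)" for j z
  define D where "D z = score p n z b (direction p n h \<mu> K (covariates n z))" for z
  have [measurable]: "S j \<in> borel_measurable (data_space n p)" for j
    unfolding S_def[abs_def] by (rule score_measurable) simp
  have [measurable]: "D \<in> borel_measurable (data_space n p)"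
    unfolding D_def[abs_def] by (rule score_measurable) (rule direction_covariates_measurable)
  have "{z \<in> space (data_space n p). \<bar>(\<Sum>j<p. \<xi> j * b j) - t0\<bar> < \<tau> \<and> (\<forall>j<p. \<bar>S j z\<bar> < lam) \<and> \<bar>D z\<bar> < 2 * \<tau>}
      \<in> sets (data_space n p)"
    by measurable
  then show "{z \<in> space (data_space n p). \<bar>(\<Sum>j<p. \<xi> j * b j) - t0\<bar> < \<tau> \<and>
      (\<forall>j<p. \<bar>score p n z b (unit_fun j)\<bar> < lam) \<and>
      \<bar>score p n z b (direction p n h \<mu> K (covariates n z))\<bar> < 2 * \<tau>} \<in> sets (data_space n p)"
    unfolding S_def D_def .
qed

text \<open>The true coefficients need not be rational. But the inequalities in
  \<open>accepts\<close> are strict, \<open>t0\<close> has to be met only up to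
  \<open>\<tau>\<close>, and rational approximants keep the zeros; so a late approximant is an
  admissible candidate.\<close>

lemma accepts_null:
  assumes k: "card {j. j < p \<and> \<beta> j \<noteq> 0} \<le> k" and \<xi>: "(\<Sum>j<p. \<xi> j * \<beta> j) = t0" and \<tau>: "\<tau> > 0"
    and s: "\<And>j. j < p \<Longrightarrow> \<bar>score p n z \<beta> (unit_fun j)\<bar> < lam"
    and d: "\<bar>score p n z \<beta> (direction p n h \<mu> K (covariates n z))\<bar> < \<tau>"
  shows "accepts p n h \<mu> K lam \<xi> t0 k \<tau> z"
proof -
  obtain U where U: "\<And>m. U m \<in> {..<p} \<rightarrow>\<^sub>E \<rat>" "\<And>j. j < p \<Longrightarrow> (\<lambda>m. U m j) \<longlonglongrightarrow> \<beta> j"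
      "\<And>j m. j < p \<Longrightarrow> \<beta> j = 0 \<Longrightarrow> U m j = 0"
    by (rule rational_sequence[of p \<beta>]) (rule that)
  have c: "card {j. j < p \<and> U m j \<noteq> 0} \<le> k" for m
  proof -
    have "{j. j < p \<and> U m j \<noteq> 0} \<subseteq> {j. j < p \<and> \<beta> j \<noteq> 0}" using U(3) by auto
    from card_mono[OF _ this] k show ?thesis by auto
  qed
  have "(\<lambda>m. \<bar>(\<Sum>j<p. \<xi> j * U m j) - t0\<bar>) \<longlonglongrightarrow> \<bar>(\<Sum>j<p. \<xi> j * \<beta> j) - t0\<bar>"
    by (intro tendsto_rabs tendsto_diff tendsto_sum tendsto_mult tendsto_const U(2)) simp
  then have 1: "\<forall>\<^sub>F m in sequentially. \<bar>(\<Sum>j<p. \<xi> j * U m j) - t0\<bar> < \<tau>"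
    by (rule order_tendstoD) (simp add: \<xi> \<tau>)
  have "\<forall>\<^sub>F m in sequentially. \<bar>score p n z (U m) (unit_fun j)\<bar> < lam" if "j < p" for j
    by (rule order_tendstoD[OF tendsto_rabs[OF tendsto_score[OF U(2)]]]) (use s that in auto)
  then have 2: "\<forall>\<^sub>F m in sequentially. \<forall>j\<in>{..<p}. \<bar>score p n z (U m) (unit_fun j)\<bar> < lam"
    by (intro eventually_ball_finite) auto
  have 3: "\<forall>\<^sub>F m in sequentially. \<bar>score p n z (U m) (direction p n h \<mu> K (covariates n z))\<bar> < 2 * \<tau>"
    by (rule order_tendstoD[OF tendsto_rabs[OF tendsto_score[OF U(2)]]]) (use d \<tau> in auto)
  from 1 2 3 have "\<forall>\<^sub>F m in sequentially. \<bar>(\<Sum>j<p. \<xi> j * U m j) - t0\<bar> < \<tau> \<and>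
      (\<forall>j<p. \<bar>score p n z (U m) (unit_fun j)\<bar> < lam) \<and>
      \<bar>score p n z (U m) (direction p n h \<mu> K (covariates n z))\<bar> < 2 * \<tau>"
    by eventually_elim auto
  from eventually_happens'[OF sequentially_bot this]
  obtain m where "\<bar>(\<Sum>j<p. \<xi> j * U m j) - t0\<bar> < \<tau> \<and>
      (\<forall>j<p. \<bar>score p n z (U m) (unit_fun j)\<bar> < lam) \<and>
      \<bar>score p n z (U m) (direction p n h \<mu> K (covariates n z))\<bar> < 2 * \<tau>"
    by (elim exE)
  then show ?thesis unfolding accepts_def
    by (intro bexI[of _ "U m"]) (use U(1)[of m] c[of m] in auto)
qed

text \<open>On this event the test decides correctly under the null and under separated
  alternatives. The Chebyshev term is kept apart from \<open>24 / p\<close>: it becomes small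
  through the growth of \<open>ku\<close> relative to \<open>sqrt n / log p\<close>.\<close>

lemma whp_good_event:
  fixes M1 M2 hn \<tau> :: real
  defines "\<mu> \<equiv> \<lambda>n p. 8 * M1 * (1 + M1\<^sup>2) * hn * l1_rate n p" and "K \<equiv> 2 * M1 ^ 3 * hn\<^sup>2"
  assumes th: "(\<beta>, \<Sigma>, \<sigma>) \<in> param_space M1 M2 p k" and M1: "M1 > 1" and k: "k \<ge> 1" "k \<le> p"
    and p: "64 * M1 + 3 \<le> real p" and n: "2048 * real k * ln (real p) \<le> real n"
    and hn: "hn > 0" "(\<Sum>j<p. (h j)\<^sup>2) = hn\<^sup>2" and \<tau>: "\<tau> > 0"
  shows "whp (data_law n p (\<beta>, \<Sigma>, \<sigma>)) (24 / p + M2\<^sup>2 * K / (n * \<tau>\<^sup>2)) (\<lambda>z.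
      (\<forall>j<p. \<bar>score p n z (\<lambda>j. Matrix.vec_index \<beta> j) (unit_fun j)\<bar> < 4 * (M1 + M2\<^sup>2) * l1_rate n p) \<and>
      feasible p n h (\<mu> n p) K (covariates n z) (direction p n h (\<mu> n p) K (covariates n z)) \<and>
      restricted_eigenvalue p n (1 / (16 * M1)) (2 * k) (covariates n z) \<and>
      \<bar>score p n z (\<lambda>j. Matrix.vec_index \<beta> j) (direction p n h (\<mu> n p) K (covariates n z))\<bar> < \<tau>)"
proof -
  let ?P = "data_law n p (\<beta>, \<Sigma>, \<sigma>)"
  define r where "r = l1_rate n p"
  have p3: "real p \<ge> 3" using p M1 by linarith
  then have p0: "p > 0" by (cases p) auto
  have l: "ln (real p) > 0" using p3 by simp
  have kl: "ln (real p) \<le> k * ln (real p)" using k l mult_right_mono[of 1 "real k" "ln (real p)"] by simp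
  have nk: "2048 * (k * ln (real p)) \<le> n" using n by (simp add: mult.assoc)
  have n0: "n > 0" using nk kl l by (cases n) auto
  have n256: "256 * ln (real p) \<le> n" using nk kl l by linarith
  have M10: "M1 > 0" using M1 by simp
  have r2: "r\<^sup>2 = ln (real p) / n" using l by (simp add: r_def l1_rate_def)
  have r0: "0 \<le> r" using l by (simp add: r_def l1_rate_def)
  have "ln (real p) / n \<le> 1 / 16" using n256 n0 l by (simp add: field_simps)
  then have "r\<^sup>2 \<le> (1 / 4)\<^sup>2" unfolding r2 by (simp add: power_divide)
  then have r4: "r \<le> 1 / 4" by (rule power2_le_imp_le) simp
  have e1: "exp (- ln (real p)) = 1 / p" using p0 by (simp add: exp_minus inverse_eq_divide)
  have sc: "whp ?P (4 * exp (- 4 * ln (real p))) (\<lambda>z. \<bar>score p n z (\<lambda>j. Matrix.vec_index \<beta> j) (unit_fun j)\<bar> < 4 * (M1 + M2\<^sup>2) * r)"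
    if j: "j < p" for j
  proof (rule whp_mono[OF whp_score[OF th p0 M10 n0 _ _ j, of "8 * r"]])
    \<comment> \<open>The choice \<open>t = 8 * r\<close> turns the exponent
      \<open>n * t\<^sup>2 / 16\<close> into \<open>4 * ln p\<close>, enough for a union over
      \<open>p\<close> coordinates.\<close>
    show "0 \<le> 8 * r" "8 * r \<le> 2" using r0 r4 by auto
    show "4 * exp (- real n * (8 * r)\<^sup>2 / 16) \<le> 4 * exp (- 4 * ln (real p))"
      using n0 by (simp add: power_mult_distrib r2)
    fix z assume "\<bar>score p n z (\<lambda>j. Matrix.vec_index \<beta> j) (unit_fun j)\<bar> < (M1 + M2\<^sup>2) * (8 * r) / 2"
    moreover have "(M1 + M2\<^sup>2) * (8 * r) / 2 = 4 * (M1 + M2\<^sup>2) * r" by simp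
    ultimately show "\<bar>score p n z (\<lambda>j. Matrix.vec_index \<beta> j) (unit_fun j)\<bar> < 4 * (M1 + M2\<^sup>2) * r" by (simp only:)
  qed
  have sc': "whp ?P (card {..<p} * (4 * exp (- 4 * ln (real p)))) (\<lambda>z. \<forall>j\<in>{..<p}. \<bar>score p n z (\<lambda>j. Matrix.vec_index \<beta> j) (unit_fun j)\<bar> < 4 * (M1 + M2\<^sup>2) * r)"
    by (rule whp_ball) (use sc in auto)
  have "whp ?P (card {..<p} * (4 * exp (- 4 * ln (real p))) + (8 / p + (8 / p + M2\<^sup>2 * K / (n * \<tau>\<^sup>2)))) (\<lambda>z.
      (\<forall>j\<in>{..<p}. \<bar>score p n z (\<lambda>j. Matrix.vec_index \<beta> j) (unit_fun j)\<bar> < 4 * (M1 + M2\<^sup>2) * r) \<and>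
      ((\<exists>w. feasible p n h (\<mu> n p) K (covariates n z) w) \<and>
      (restricted_eigenvalue p n (1 / (16 * M1)) (2 * k) (covariates n z) \<and>
      \<bar>score p n z (\<lambda>j. Matrix.vec_index \<beta> j) (direction p n h (\<mu> n p) K (covariates n z))\<bar> < \<tau>)))"
  proof (intro whp_conj sc')
    show "whp ?P (8 / p) (\<lambda>z. \<exists>w. feasible p n h (\<mu> n p) K (covariates n z) w)"
      unfolding \<mu>_def K_def by (rule whp_feasible[OF th M1 p3 n256 hn])
    show "whp ?P (8 / p) (\<lambda>z. restricted_eigenvalue p n (1 / (16 * M1)) (2 * k) (covariates n z))"
      by (rule whp_restricted_eigenvalue[OF th M1 k p n])
    show "whp ?P (M2\<^sup>2 * K / (n * \<tau>\<^sup>2)) (\<lambda>z. \<bar>score p n z (\<lambda>j. Matrix.vec_index \<beta> j) (direction p n h (\<mu> n p) K (covariates n z))\<bar> < \<tau>)"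
      by (rule whp_debiasing_score[OF th p0 M10 n0 _ \<tau>]) (use M10 in \<open>simp add: K_def\<close>)
  qed
  then show ?thesis
  proof (rule whp_mono)
    have "exp (- 4 * ln (real p)) \<le> exp (- ln (real p)) * exp (- ln (real p))" using l by (simp add: exp_add[symmetric])
    then have e4: "exp (- 4 * ln (real p)) \<le> 1 / p * (1 / p)" unfolding e1 .
    have "real p * exp (- 4 * ln (real p)) \<le> real p * (1 / p * (1 / p))" by (intro mult_left_mono e4) auto
    also have "\<dots> = 1 / p" using p0 by simp
    finally have "real (card {..<p}) * (4 * exp (- 4 * ln (real p))) \<le> 4 * (1 / p)" by simp
    moreover have "1 / real p \<ge> 0" by simp
    moreover have "24 / real p = 24 * (1 / p)" "8 / real p = 8 * (1 / p)" by simp_all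
    ultimately show "real (card {..<p}) * (4 * exp (- 4 * ln (real p))) + (8 / real p + (8 / real p + M2\<^sup>2 * K / (real n * \<tau>\<^sup>2)))
        \<le> 24 / real p + M2\<^sup>2 * K / (real n * \<tau>\<^sup>2)"
      by linarith
  next
    fix z
    assume "(\<forall>j\<in>{..<p}. \<bar>score p n z (\<lambda>j. Matrix.vec_index \<beta> j) (unit_fun j)\<bar> < 4 * (M1 + M2\<^sup>2) * r) \<and>
      ((\<exists>w. feasible p n h (\<mu> n p) K (covariates n z) w) \<and>
      (restricted_eigenvalue p n (1 / (16 * M1)) (2 * k) (covariates n z) \<and>
      \<bar>score p n z (\<lambda>j. Matrix.vec_index \<beta> j) (direction p n h (\<mu> n p) K (covariates n z))\<bar> < \<tau>))"
    then show "(\<forall>j<p. \<bar>score p n z (\<lambda>j. Matrix.vec_index \<beta> j) (unit_fun j)\<bar> < 4 * (M1 + M2\<^sup>2) * l1_rate n p) \<and>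
      feasible p n h (\<mu> n p) K (covariates n z) (direction p n h (\<mu> n p) K (covariates n z)) \<and>
      restricted_eigenvalue p n (1 / (16 * M1)) (2 * k) (covariates n z) \<and>
      \<bar>score p n z (\<lambda>j. Matrix.vec_index \<beta> j) (direction p n h (\<mu> n p) K (covariates n z))\<bar> < \<tau>"
      using direction_feasible unfolding r_def[symmetric] by blast
  qed
qed

section \<open>Errors of the test\<close>

lemma whp_expectation_le:
  fixes A :: "(nat \<Rightarrow> obs) \<Rightarrow> bool"
  assumes P: "prob_space P" and A: "Measurable.pred P A" and w: "whp P \<epsilon> A"
  shows "(\<integral>z. (if A z then 0 else 1) \<partial>P) \<le> \<epsilon>"
proof -
  interpret prob_space P by fact
  have "(\<integral>z. (if A z then 0 else 1) \<partial>P) = (\<integral>z. indicator {z \<in> space P. \<not> A z} z \<partial>P)"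
    by (intro Bochner_Integration.integral_cong) auto
  also have "\<dots> = measure P {z \<in> space P. \<not> A z}" using A by simp
  also have "\<dots> \<le> \<epsilon>"
  proof -
    from w obtain B where B: "B \<in> sets P" "measure P B \<le> \<epsilon>" "{z \<in> space P. \<not> A z} \<subseteq> B" by (auto simp: whp_def)
    then show ?thesis using finite_measure_mono[OF B(3,1)] by linarith
  qed
  finally show ?thesis .
qed

lemma whp_expectation_ge:
  fixes A :: "(nat \<Rightarrow> obs) \<Rightarrow> bool"
  assumes P: "prob_space P" and A: "Measurable.pred P A" and w: "whp P \<epsilon> (\<lambda>z. \<not> A z)"
  shows "1 - \<epsilon> \<le> (\<integral>z. (if A z then 0 else 1) \<partial>P)"
proof -
  interpret prob_space P by fact
  have "(\<integral>z. (if A z then 0 else 1) \<partial>P) = (\<integral>z. indicator {z \<in> space P. \<not> A z} z \<partial>P)"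
    by (intro Bochner_Integration.integral_cong) auto
  also have "\<dots> = measure P {z \<in> space P. \<not> A z}" using A by simp
  also have "\<dots> = 1 - measure P {z \<in> space P. A z}"
    using A by (intro prob_neg) simp
  finally have "(\<integral>z. (if A z then 0 else 1) \<partial>P) = 1 - measure P {z \<in> space P. A z}" .
  moreover from w obtain B where B: "B \<in> sets P" "measure P B \<le> \<epsilon>" "{z \<in> space P. A z} \<subseteq> B" by (auto simp: whp_def)
  then have "measure P {z \<in> space P. A z} \<le> \<epsilon>" using finite_measure_mono[OF B(3,1)] by linarith
  ultimately show ?thesis by simp
qed

text \<open>Read off \<open>debiased_error\<close>: \<open>256 * M1\<close> is 4 from there, 4 from
  the score bound \<open>lam\<close> and \<open>16 * M1\<close> from the inverse eigenvalue; the
  last factor adds truncation and Gram errors. The final 4 is the \<open>3 * \<tau>\<close> from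
  there plus one \<open>\<tau>\<close> for the distance of \<open>\<xi> \<bullet> b\<close> from
  \<open>t0\<close>.\<close>

definition upper_const :: "real \<Rightarrow> real \<Rightarrow> real" where
  "upper_const M1 M2 = 256 * M1 * (M1 + M2\<^sup>2) * (1 + 8 * M1 * (1 + M1\<^sup>2)) + 4"

text \<open>The test rejects when no candidate is accepted. A parameter of sparsity \<open>k\<close>
  also has sparsity \<open>ku\<close>, so the good event at \<open>ku\<close> serves null and
  alternative alike.\<close>

lemma tau_adap_upper:
  fixes M1 M2 \<alpha> \<eta> hn :: real and n p ku k :: nat and \<xi> :: "real vec"
  assumes M1: "M1 > 1" and ku: "ku \<ge> 1" "ku \<le> p" and k: "k \<le> ku"
    and p: "64 * M1 + 3 \<le> real p" and n: "2048 * real ku * ln (real p) \<le> real n"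
    and hn: "hn > 0" "(\<Sum>j<p. (h j)\<^sup>2) = hn\<^sup>2"
    and tail: "\<And>j. j < p \<Longrightarrow> \<bar>Matrix.vec_index \<xi> j - h j\<bar> \<le> hn * l1_rate n p"
    and err: "24 / p + 2 * M2\<^sup>2 * M1 ^ 3 * n / (real ku * ln (real p))\<^sup>2 \<le> \<alpha>"
      "24 / p + 2 * M2\<^sup>2 * M1 ^ 3 * n / (real ku * ln (real p))\<^sup>2 \<le> \<eta>"
  shows "tau_adap M1 M2 \<alpha> \<eta> n p t0 ku k \<xi> \<le> ereal (upper_const M1 M2 * (hn * (ku * ln (real p) / n)))"
proof -
  define r where "r = l1_rate n p"
  define \<mu> where "\<mu> = 8 * M1 * (1 + M1\<^sup>2) * hn * r"
  define K where "K = 2 * M1 ^ 3 * hn\<^sup>2"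
  define lam where "lam = 4 * (M1 + M2\<^sup>2) * r"
  define \<tau> where "\<tau> = hn * (ku * ln (real p) / n)"
  define x where "x j = Matrix.vec_index \<xi> j" for j
  have p3: "real p \<ge> 3" using p M1 by linarith
  then have p0: "p > 0" by (cases p) auto
  have l: "ln (real p) > 0" using p3 by simp
  have kl: "ln (real p) \<le> ku * ln (real p)" using ku l mult_right_mono[of 1 "real ku" "ln (real p)"] by simp
  have nk: "2048 * (ku * ln (real p)) \<le> n" using n by (simp add: mult.assoc)
  have n0: "n > 0" using nk kl l by (cases n) auto
  have M10: "M1 > 0" using M1 by simp
  have r2: "r * r = ln (real p) / n" using l by (simp add: r_def l1_rate_def)
  have r0: "0 \<le> r" using l by (simp add: r_def l1_rate_def)
  have \<tau>0: "\<tau> > 0" using hn l n0 ku by (simp add: \<tau>_def)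
  have C0: "upper_const M1 M2 > 0" unfolding upper_const_def using M10
    by (intro add_nonneg_pos mult_nonneg_nonneg add_nonneg_nonneg) auto
  define \<epsilon> where "\<epsilon> = 24 / p + M2\<^sup>2 * K / (n * \<tau>\<^sup>2)"
  \<comment> \<open>The factor \<open>hn\<close> cancels: the debiasing score has standard deviation
    of order \<open>hn / sqrt n\<close>, against a tolerance \<open>\<tau>\<close> proportional to
    \<open>hn\<close>.\<close>
  have eps: "\<epsilon> \<le> \<alpha>" "\<epsilon> \<le> \<eta>"
  proof -
    have "M2\<^sup>2 * K / (n * \<tau>\<^sup>2) = 2 * M2\<^sup>2 * M1 ^ 3 * n / (real ku * ln (real p))\<^sup>2"
      using hn n0 by (simp add: K_def \<tau>_def power2_eq_square mult.assoc)
    then show "\<epsilon> \<le> \<alpha>" "\<epsilon> \<le> \<eta>" using err by (simp_all add: \<epsilon>_def)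
  qed
  define A where "A = accepts p n h \<mu> K lam x t0 ku \<tau>"
  define \<psi> where "\<psi> z = (if A z then 0 else 1 :: real)" for z
  have Am: "Measurable.pred (data_space n p) A" unfolding A_def by (rule accepts_measurable)
  have Am': "Measurable.pred (data_law n p \<theta>) A" for \<theta>
    using Am by (simp add: pred_def space_data_law)
  have \<psi>m: "\<psi> \<in> borel_measurable (data_space n p)" unfolding \<psi>_def[abs_def] using Am by measurable
  note good = whp_good_event[of _ _ _ M1 M2 p ku, OF _ M1 ku p n hn \<tau>0, folded K_def r_def, folded lam_def \<mu>_def \<epsilon>_def]
  have null: "expect n p \<theta> \<psi> \<le> \<alpha>" if th: "\<theta> \<in> null_space M1 M2 p ku \<xi> t0" for \<theta>
  proof -
    obtain \<beta> \<Sigma> \<sigma> where \<theta>: "\<theta> = (\<beta>, \<Sigma>, \<sigma>)" "(\<beta>, \<Sigma>, \<sigma>) \<in> param_space M1 M2 p ku" "Matrix.scalar_prod \<xi> \<beta> = t0"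
      using th by (auto simp: null_space_def)
    then have b: "\<beta> \<in> carrier_vec p" "l0_norm \<beta> \<le> ku" by (auto simp: param_space_def)
    have "whp (data_law n p \<theta>) \<epsilon> A"
      unfolding \<theta>(1)
    proof (rule whp_mono[OF good[OF \<theta>(2)] order_refl])
      fix z
      assume z: "(\<forall>j<p. \<bar>score p n z (\<lambda>j. Matrix.vec_index \<beta> j) (unit_fun j)\<bar> < lam) \<and>
        feasible p n h \<mu> K (covariates n z) (direction p n h \<mu> K (covariates n z)) \<and>
        restricted_eigenvalue p n (1 / (16 * M1)) (2 * ku) (covariates n z) \<and>
        \<bar>score p n z (\<lambda>j. Matrix.vec_index \<beta> j) (direction p n h \<mu> K (covariates n z))\<bar> < \<tau>"
      show "A z" unfolding A_def
      proof (rule accepts_null[where \<beta> = "\<lambda>j. Matrix.vec_index \<beta> j"])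
        show "card {j. j < p \<and> Matrix.vec_index \<beta> j \<noteq> 0} \<le> ku" using b by (simp add: l0_norm_def)
        show "(\<Sum>j<p. x j * Matrix.vec_index \<beta> j) = t0"
          using \<theta>(3) scalar_prod_sum[OF b(1), of \<xi>] by (simp add: x_def)
      qed (use z \<tau>0 in auto)
    qed
    then have "expect n p \<theta> \<psi> \<le> \<epsilon>" unfolding \<psi>_def[abs_def]
      using prob_space_data_law[OF \<theta>(2) p0 M10] \<theta>(1) by (intro whp_expectation_le Am') auto
    with eps show ?thesis by linarith
  qed
  have alt: "1 - \<eta> \<le> expect n p \<theta> \<psi>" if th: "\<theta> \<in> alt_space M1 M2 (upper_const M1 M2 * \<tau>) p k \<xi> t0" for \<theta>
  proof -
    obtain \<beta> \<Sigma> \<sigma> where \<theta>: "\<theta> = (\<beta>, \<Sigma>, \<sigma>)" "(\<beta>, \<Sigma>, \<sigma>) \<in> param_space M1 M2 p k"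
        "upper_const M1 M2 * \<tau> \<le> \<bar>Matrix.scalar_prod \<xi> \<beta> - t0\<bar>"
      using th by (auto simp: alt_space_def)
    then have b: "\<beta> \<in> carrier_vec p" "l0_norm \<beta> \<le> ku" and th2: "(\<beta>, \<Sigma>, \<sigma>) \<in> param_space M1 M2 p ku"
      using k by (auto simp: param_space_def)
    have "whp (data_law n p \<theta>) \<epsilon> (\<lambda>z. \<not> A z)"
      unfolding \<theta>(1)
    proof (rule whp_mono[OF good[OF th2] order_refl], rule notI)
      fix z
      assume z: "(\<forall>j<p. \<bar>score p n z (\<lambda>j. Matrix.vec_index \<beta> j) (unit_fun j)\<bar> < lam) \<and>
        feasible p n h \<mu> K (covariates n z) (direction p n h \<mu> K (covariates n z)) \<and>
        restricted_eigenvalue p n (1 / (16 * M1)) (2 * ku) (covariates n z) \<and>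
        \<bar>score p n z (\<lambda>j. Matrix.vec_index \<beta> j) (direction p n h \<mu> K (covariates n z))\<bar> < \<tau>"
      assume "A z"
      then obtain c where c: "card {j. j < p \<and> c j \<noteq> 0} \<le> ku" "\<bar>(\<Sum>j<p. x j * c j) - t0\<bar> < \<tau>"
        "\<And>j. j < p \<Longrightarrow> \<bar>score p n z c (unit_fun j)\<bar> < lam"
        "\<bar>score p n z c (direction p n h \<mu> K (covariates n z))\<bar> < 2 * \<tau>"
        unfolding A_def accepts_def by blast
      have "\<bar>(\<Sum>j<p. x j * Matrix.vec_index \<beta> j) - (\<Sum>j<p. x j * c j)\<bar>
          \<le> (hn * r + \<mu>) * (4 * real ku * lam / (1 / (16 * M1))) + 3 * \<tau>"
      proof (rule debiased_error[where h=h and u="direction p n h \<mu> K (covariates n z)"])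
        show "card {j. j < p \<and> Matrix.vec_index \<beta> j \<noteq> 0} \<le> ku" using b by (simp add: l0_norm_def)
        show "1 / (16 * M1) * (\<Sum>j<p. (\<delta> j)\<^sup>2) \<le> gram p n (covariates n z) \<delta> \<delta>"
          if "card {j. j < p \<and> \<delta> j \<noteq> 0} \<le> 2 * ku" for \<delta>
          using z that unfolding restricted_eigenvalue_def by blast
        show "\<bar>x j - h j\<bar> \<le> hn * r" if "j < p" for j using tail[OF that] by (simp add: x_def r_def)
        show "\<bar>gram p n (covariates n z) (unit_fun j) (direction p n h \<mu> K (covariates n z)) - h j\<bar> \<le> \<mu>" if "j < p" for j
          using z that unfolding feasible_def by (simp add: less_imp_le)
      qed (use z c M10 p0 in auto)
      also have "(hn * r + \<mu>) * (4 * real ku * lam / (1 / (16 * M1))) = (upper_const M1 M2 - 4) * (hn * (ku * (r * r)))"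
        by (simp add: \<mu>_def lam_def upper_const_def algebra_simps)
      also have "hn * (ku * (r * r)) = \<tau>" unfolding r2 \<tau>_def by simp
      finally have "\<bar>(\<Sum>j<p. x j * Matrix.vec_index \<beta> j) - (\<Sum>j<p. x j * c j)\<bar> \<le> upper_const M1 M2 * \<tau> - \<tau>"
        by (simp add: algebra_simps)
      then have "\<bar>(\<Sum>j<p. x j * Matrix.vec_index \<beta> j) - t0\<bar> < upper_const M1 M2 * \<tau>" using c(2) by linarith
      then show False using \<theta>(3) scalar_prod_sum[OF b(1), of \<xi>] by (simp add: x_def)
    qed
    then have "1 - \<epsilon> \<le> expect n p \<theta> \<psi>" unfolding \<psi>_def[abs_def]
      using prob_space_data_law[OF \<theta>(2) p0 M10] \<theta>(1) by (intro whp_expectation_ge Am') auto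
    with eps show ?thesis by linarith
  qed
  have "\<psi> \<in> tests n p \<alpha> (null_space M1 M2 p ku \<xi> t0)"
    unfolding tests_def using \<psi>m null by (auto simp: \<psi>_def SUP_le_iff)
  moreover have "ereal (1 - \<eta>) \<le> (INF \<theta>\<in>alt_space M1 M2 (upper_const M1 M2 * \<tau>) p k \<xi> t0. ereal (expect n p \<theta> \<psi>))"
    using alt by (intro INF_greatest) simp
  ultimately have "ereal (1 - \<eta>) \<le> (SUP \<psi>\<in>tests n p \<alpha> (null_space M1 M2 p ku \<xi> t0).
      INF \<theta>\<in>alt_space M1 M2 (upper_const M1 M2 * \<tau>) p k \<xi> t0. ereal (expect n p \<theta> \<psi>))"
    by (intro SUP_upper2[where i=\<psi>])
  then show ?thesis unfolding tau_adap_def \<tau>_def[symmetric]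
    using C0 \<tau>0 by (intro INF_lower) auto
qed

section \<open>Rates along a sequence\<close>

lemma loading_vector_nth_0:
  assumes "loading_vector p \<xi>"
  shows "Matrix.vec_index \<xi> 0 \<noteq> 0"
proof
  assume z: "Matrix.vec_index \<xi> 0 = 0"
  have "\<xi> = 0\<^sub>v p"
  proof (rule eq_vecI)
    fix i assume "i < dim_vec (0\<^sub>v p :: real vec)"
    then have i: "i < p" by simp
    then have "\<bar>Matrix.vec_index \<xi> i\<bar> \<le> \<bar>Matrix.vec_index \<xi> 0\<bar>" using assms unfolding loading_vector_def by blast
    then show "Matrix.vec_index \<xi> i = Matrix.vec_index (0\<^sub>v p) i" using z i by simp
  qed (use assms in \<open>auto simp: loading_vector_def\<close>)
  then show False using assms by (simp add: loading_vector_def)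
qed

text \<open>The first \<open>q\<close> entries all dominate entry \<open>j\<close>, so a late entry
  is at most the head norm divided by \<open>sqrt q\<close>.\<close>

lemma loading_vector_head:
  assumes L: "loading_vector p \<xi>" and q: "q \<le> j" "j < p"
  shows "real q * (Matrix.vec_index \<xi> j)\<^sup>2 \<le> (\<Sum>i<q. (Matrix.vec_index \<xi> i)\<^sup>2)"
proof -
  have "(\<Sum>i<q. (Matrix.vec_index \<xi> j)\<^sup>2) \<le> (\<Sum>i<q. (Matrix.vec_index \<xi> i)\<^sup>2)"
  proof (rule sum_mono)
    fix i assume "i \<in> {..<q}"
    then have "i \<le> j" using q by simp
    then have "\<bar>Matrix.vec_index \<xi> j\<bar> \<le> \<bar>Matrix.vec_index \<xi> i\<bar>" using L q(2) unfolding loading_vector_def by blast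
    then show "(Matrix.vec_index \<xi> j)\<^sup>2 \<le> (Matrix.vec_index \<xi> i)\<^sup>2" by (simp add: abs_le_square_iff)
  qed
  then show ?thesis by simp
qed

text \<open>The sum splits into \<open>c\<close> consecutive blocks of length \<open>h\<close>, none
  of which exceeds the first.\<close>

lemma sum_antimono_mult_le:
  fixes f :: "nat \<Rightarrow> real"
  assumes f: "\<And>i j. i \<le> j \<Longrightarrow> f j \<le> f i"
  shows "(\<Sum>j<c * h. f j) \<le> real c * (\<Sum>j<h. f j)"
proof (induction c)
  case (Suc c)
  have "(\<Sum>j<Suc c * h. f j) = (\<Sum>j<c * h. f j) + (\<Sum>j<h. f (c * h + j))"
    by (subst sum.nat_group[symmetric], subst sum.nat_group[symmetric])
      (simp add: sum.shift_bounds_nat_ivl[of f 0 "c * h" h, simplified] atLeast0LessThan add.commute)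
  also have "(\<Sum>j<h. f (c * h + j)) \<le> (\<Sum>j<h. f j)" by (intro sum_mono f) simp
  finally show ?case using Suc by (simp add: algebra_simps)
qed simp

text \<open>Comparison with a head of \<open>n / log p\<close> entries bounds every discarded entry
  by the head norm times \<open>l1_rate n p\<close>, which is the tail condition of
  \<open>tau_adap_upper\<close>.\<close>

lemma tau_adap_upper_H:
  fixes M1 M2 \<alpha> \<eta> :: real and n p ku k :: nat and \<xi> :: "real vec"
  assumes M1: "M1 > 1" and ku: "ku \<ge> 1" "ku \<le> p" and k: "k \<le> ku"
    and p: "64 * M1 + 3 \<le> real p" and n: "2048 * real ku * ln (real p) \<le> real n"
    and L: "loading_vector p \<xi>"
    and err: "24 / p + 2 * M2\<^sup>2 * M1 ^ 3 * n / (real ku * ln (real p))\<^sup>2 \<le> \<alpha>"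
      "24 / p + 2 * M2\<^sup>2 * M1 ^ 3 * n / (real ku * ln (real p))\<^sup>2 \<le> \<eta>"
  shows "tau_adap M1 M2 \<alpha> \<eta> n p t0 ku k \<xi>
    \<le> ereal (upper_const M1 M2 * (H (real n / ln (real p)) \<xi> * (ku * ln (real p) / n)))"
proof (rule tau_adap_upper[OF M1 ku k p n _ _ _ err])
  define x where "x j = Matrix.vec_index \<xi> j" for j
  define q where "q = nat \<lceil>real n / ln (real p)\<rceil>"
  define hn where "hn = H (real n / ln (real p)) \<xi>"
  define h where "h j = (if j < q then x j else 0)" for j
  have dim: "dim_vec \<xi> = p" using L by (auto simp: loading_vector_def)
  have lp: "ln (real p) > 0" using p M1 by (intro ln_gt_zero) linarith
  have "0 < 2048 * real ku * ln (real p)" using lp ku by simp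
  then have n0: "real n > 0" using n by linarith
  have q: "real n / ln (real p) \<le> real q" unfolding q_def by (rule nat_ceiling_bounds) (use lp in simp)
  moreover have "real n / ln (real p) > 0" using n0 lp by simp
  ultimately have q0: "q > 0" by (intro gr0I) simp
  have sum: "(\<Sum>j<min q p. (x j)\<^sup>2) = (\<Sum>j<p. (h j)\<^sup>2)"
    by (intro sum.mono_neutral_cong_left) (auto simp: h_def)
  have hn2: "hn\<^sup>2 = (\<Sum>j<min q p. (x j)\<^sup>2)" unfolding hn_def H_def dim q_def[symmetric] x_def
    by (simp add: sum_nonneg)
  have "(x 0)\<^sup>2 \<le> (\<Sum>j<min q p. (x j)\<^sup>2)" using q0 ku by (intro member_le_sum) auto
  moreover have "(x 0)\<^sup>2 > 0" using loading_vector_nth_0[OF L] by (simp add: x_def)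
  ultimately have "hn\<^sup>2 > 0" unfolding hn2 by linarith
  moreover have "hn \<ge> 0" unfolding hn_def H_def by (simp add: sum_nonneg)
  ultimately have hn0: "hn > 0" by (cases "hn = 0") auto
  then show "H (real n / ln (real p)) \<xi> > 0" by (simp add: hn_def)
  show "(\<Sum>j<p. (h j)\<^sup>2) = (H (real n / ln (real p)) \<xi>)\<^sup>2" unfolding sum[symmetric] hn2[symmetric] hn_def ..
  fix j assume j: "j < p"
  have l0: "l1_rate n p \<ge> 0" using lp by (simp add: l1_rate_def)
  show "\<bar>Matrix.vec_index \<xi> j - h j\<bar> \<le> H (real n / ln (real p)) \<xi> * l1_rate n p"
  proof (cases "j < q")
    case True
    then show ?thesis using hn0 l0 by (simp add: h_def x_def hn_def)
  next
    case False
    then have "real q * (x j)\<^sup>2 \<le> (\<Sum>i<q. (x i)\<^sup>2)" unfolding x_def using j by (intro loading_vector_head[OF L]) auto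
    moreover have "min q p = q" using False j by simp
    ultimately have "real q * (x j)\<^sup>2 \<le> hn\<^sup>2" unfolding hn2 by simp
    moreover have "real n / ln (real p) * (x j)\<^sup>2 \<le> real q * (x j)\<^sup>2" using q by (intro mult_right_mono) auto
    ultimately have "real n / ln (real p) * (x j)\<^sup>2 \<le> hn\<^sup>2" by linarith
    then have "(x j)\<^sup>2 \<le> hn\<^sup>2 * (ln (real p) / n)" using n0 lp by (simp add: field_simps)
    then have "sqrt ((x j)\<^sup>2) \<le> sqrt (hn\<^sup>2 * (ln (real p) / n))" by (rule real_sqrt_le_mono)
    then have "\<bar>x j\<bar> \<le> hn * l1_rate n p" unfolding l1_rate_def real_sqrt_mult real_sqrt_abs using hn0 by (simp only: abs_of_pos)
    then show ?thesis using False by (simp add: h_def x_def hn_def)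
  qed
qed

text \<open>The sparsity budget \<open>h + 2 * s \<le> ku\<close> is spent with
  \<open>h = s\<close>, about a quarter of \<open>ku\<close>, so that the head and the random part
  are both of order \<open>ku\<close>. The constraints on \<open>\<kappa>\<close> pass to the spike
  strength, which is at most \<open>\<kappa>\<close>.\<close>

lemma tau_adap_lower_H:
  fixes M1 M2 \<alpha> \<eta> \<kappa> \<epsilon> t0 :: real and n p ku k :: nat and \<xi> :: "real vec"
  assumes M1: "M1 > 1" and M2: "M2 > 0"
    and \<kappa>: "0 < \<kappa>" "2 * \<kappa> \<le> 1 - 1 / M1" "1 + 2 * \<kappa> + 2 * \<kappa>\<^sup>2 \<le> M1" "8 * \<kappa>\<^sup>2 \<le> 1"
    and ku: "ku \<ge> 4" "ku \<le> p" and k: "k \<ge> 1" and n: "real ku * ln (real p) \<le> real n"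
    and L: "loading_vector p \<xi>"
    and \<epsilon>: "\<epsilon> > 0" "\<alpha> + \<epsilon> < 1 - \<eta>"
    and chi: "(real ku)\<^sup>2 * real p powr (4 * \<kappa>\<^sup>2) / p \<le> ln (1 + \<epsilon>\<^sup>2)"
  shows "ereal (M2 * \<kappa>\<^sup>2 / 48 * (ku * ln (real p) / n * H (real ku) \<xi>)) \<le> tau_adap M1 M2 \<alpha> \<eta> n p t0 ku k \<xi>"
proof -
  define s where "s = ku div 4"
  \<comment> \<open>The largest block size that fits: after the head, the blocks use
    \<open>2 * s * B\<close> coordinates. It is at least \<open>p / (8 * s)\<close>.\<close>
  define B where "B = (p - s) div (2 * s)"
  define r where "r = real s * ln (real p) / n"
  \<comment> \<open>Then \<open>4 * n * a\<^sup>2 / s = 4 * \<kappa>\<^sup>2 * ln p\<close>, so a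
    common block costs only a small power of \<open>p\<close>.\<close>
  define a where "a = \<kappa> * sqrt r"
  define x where "x j = Matrix.vec_index \<xi> j" for j
  define R where "R = sqrt (\<Sum>j<s. (x j)\<^sup>2)"
  have dim: "dim_vec \<xi> = p" and \<xi>: "\<xi> \<in> carrier_vec p" using L by (auto simp: loading_vector_def)
  have "ku = 4 * s + ku mod 4" "ku mod 4 < 4" by (simp_all add: s_def)
  moreover from this have "s \<ge> 1" using ku(1) by linarith
  ultimately have s: "s > 0" "4 * s \<le> ku" "ku \<le> 8 * s" by linarith+
  have lp: "ln (real p) > 0" using ku by (intro ln_gt_zero) simp
  have "0 < real ku * ln (real p)" using lp ku by simp
  then have n0: "real n > 0" using n by linarith
  have r0: "r > 0" using s lp n0 by (simp add: r_def)
  have "real s * ln (real p) \<le> real ku * ln (real p)" using s lp by (intro mult_right_mono) auto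
  then have r1: "r \<le> 1" unfolding r_def using n n0 by (simp add: divide_le_eq)
  have sr: "0 < sqrt r" "sqrt r \<le> 1" using r0 r1 by simp_all
  have a2: "a\<^sup>2 = \<kappa>\<^sup>2 * r" using r0 by (simp add: a_def power_mult_distrib)
  have a0: "a > 0" using \<kappa>(1) sr by (simp add: a_def)
  have "\<kappa> * sqrt r \<le> \<kappa> * 1" using sr \<kappa>(1) by (intro mult_left_mono) auto
  then have a\<kappa>: "a \<le> \<kappa>" by (simp add: a_def)
  have a2\<kappa>: "a\<^sup>2 \<le> \<kappa>\<^sup>2" using a0 a\<kappa> by (intro power_mono) auto
  have ac: "2 * a \<le> 1 - 1 / M1" "1 + 2 * a + 2 * a\<^sup>2 \<le> M1" "8 * a\<^sup>2 \<le> 1" using \<kappa> a\<kappa> a2\<kappa> by linarith+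
  have "(p - s) = 2 * s * B + (p - s) mod (2 * s)" unfolding B_def by simp
  moreover have "(p - s) mod (2 * s) < 2 * s" using s by simp
  moreover have "4 * s \<le> p" using s(2) ku(2) by linarith
  ultimately obtain D where D: "D = s * B" "p - s < 2 * D + 2 * s" "2 * D \<le> p - s" "4 * s \<le> p" by simp
  have pB: "s + 2 * (s * B) \<le> p" using D unfolding D(1)[symmetric] by linarith
  have "p \<le> 8 * D" using D(2-4) by linarith
  then have "real p \<le> real (8 * D)" by (simp only: of_nat_le_iff)
  then have pD: "real p \<le> 8 * (real s * real B)" unfolding D(1) by simp
  have p0: "real p > 0" using ku by simp
  have B0: "B > 0" using pD p0 by (cases "B = 0") auto
  have chi': "exp (s * exp (4 * real n * a\<^sup>2 / s) / B) \<le> 1 + \<epsilon>\<^sup>2"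
  proof -
    have "4 * real n * a\<^sup>2 / s = 4 * \<kappa>\<^sup>2 * ln (real p)" unfolding a2 r_def using n0 s by simp
    then have e: "exp (4 * real n * a\<^sup>2 / s) = real p powr (4 * \<kappa>\<^sup>2)" using p0 by (simp add: powr_def)
    have "real s / B = 8 * (real s)\<^sup>2 / (8 * (real s * real B))" using s B0 by (simp add: power2_eq_square)
    also have "\<dots> \<le> 8 * (real s)\<^sup>2 / p" using pD p0 by (intro divide_left_mono) auto
    also have "\<dots> \<le> (real ku)\<^sup>2 / p"
    proof (rule divide_right_mono)
      have "(4 * real s)\<^sup>2 \<le> (real ku)\<^sup>2" using s(2) by (intro power_mono) auto
      then have "16 * (real s)\<^sup>2 \<le> (real ku)\<^sup>2" by (simp add: power_mult_distrib)
      then show "8 * (real s)\<^sup>2 \<le> (real ku)\<^sup>2" using zero_le_power2[of "real s"] by linarith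
    qed simp
    finally have "real s / B * real p powr (4 * \<kappa>\<^sup>2) \<le> (real ku)\<^sup>2 / p * real p powr (4 * \<kappa>\<^sup>2)"
      by (rule mult_right_mono) simp
    then have "s * exp (4 * real n * a\<^sup>2 / s) / B \<le> ln (1 + \<epsilon>\<^sup>2)" unfolding e using chi by simp
    then have "exp (s * exp (4 * real n * a\<^sup>2 / s) / B) \<le> exp (ln (1 + \<epsilon>\<^sup>2))" by simp
    moreover have "1 + \<epsilon>\<^sup>2 > 0" by (simp add: add_pos_nonneg)
    ultimately show ?thesis by simp
  qed
  have low: "ereal (M2 * (a\<^sup>2 / (1 + a\<^sup>2)) * R) \<le> tau_adap M1 M2 \<alpha> \<eta> n p t0 ku k \<xi>"
    unfolding R_def x_def
    by (rule tau_adap_lower[OF M1 M2 a0 ac s(1) s(1) B0 pB _ k \<xi> loading_vector_nth_0[OF L] \<epsilon> chi']) (use s(2) in simp)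
  have R0: "R \<ge> 0" by (simp add: R_def sum_nonneg)
  \<comment> \<open>Since \<open>ku \<le> 8 * s\<close> and the entries decrease, the squared norm
    grows by a factor of at most 8, rounded up to 9 for the sake of the root. Padding with zeros
    beyond \<open>p\<close> keeps the sequence decreasing.\<close>
  have HR: "H (real ku) \<xi> \<le> 3 * R"
  proof -
    define f where "f j = (if j < p then (x j)\<^sup>2 else 0)" for j
    have f: "f j \<le> f i" if "i \<le> j" for i j
    proof (cases "j < p")
      case True
      then have "\<bar>x j\<bar> \<le> \<bar>x i\<bar>" using L that unfolding loading_vector_def x_def by blast
      then show ?thesis using True that by (simp add: f_def abs_le_square_iff)
    qed (simp add: f_def)
    have "(\<Sum>j<min ku p. (x j)\<^sup>2) = (\<Sum>j<ku. f j)"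
      by (intro sum.mono_neutral_cong_left) (auto simp: f_def)
    also have "\<dots> \<le> (\<Sum>j<8 * s. f j)" using s(3) by (intro sum_mono2) (auto simp: f_def)
    also have "\<dots> \<le> real 8 * (\<Sum>j<s. f j)" by (rule sum_antimono_mult_le) (rule f)
    also have "(\<Sum>j<s. f j) = (\<Sum>j<s. (x j)\<^sup>2)" using D(4) by (intro sum.cong) (auto simp: f_def)
    finally have "(\<Sum>j<min ku p. (x j)\<^sup>2) \<le> 9 * (\<Sum>j<s. (x j)\<^sup>2)"
      using sum_nonneg[of "{..<s}" "\<lambda>j. (x j)\<^sup>2"] by simp
    then have "sqrt (\<Sum>j<min ku p. (x j)\<^sup>2) \<le> sqrt (9 * (\<Sum>j<s. (x j)\<^sup>2))" by (rule real_sqrt_le_mono)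
    moreover have "sqrt 9 = (3 :: real)" by (rule real_sqrt_unique) auto
    ultimately show ?thesis by (simp add: H_def dim R_def x_def real_sqrt_mult)
  qed
  \<comment> \<open>The denominator is at most 2, and \<open>ku \<le> 8 * s\<close> accounts for the
    8 in 16; together with the factor 3 from \<open>HR\<close> this gives 48.\<close>
  have ra: "\<kappa>\<^sup>2 / 16 * (ku * ln (real p) / n) \<le> a\<^sup>2 / (1 + a\<^sup>2)"
  proof -
    have "ku * ln (real p) / n \<le> 8 * s * ln (real p) / n"
      using s(3) lp by (intro divide_right_mono mult_right_mono) auto
    then have "\<kappa>\<^sup>2 / 16 * (ku * ln (real p) / n) \<le> \<kappa>\<^sup>2 / 16 * (8 * r)"
      by (intro mult_left_mono) (simp_all add: r_def)
    also have "\<dots> = a\<^sup>2 / 2" by (simp add: a2)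
    also have "\<dots> \<le> a\<^sup>2 / (1 + a\<^sup>2)" using ac(3) by (intro divide_left_mono) (auto simp: add_pos_nonneg)
    finally show ?thesis .
  qed
  have "M2 * \<kappa>\<^sup>2 / 48 * (ku * ln (real p) / n * H (real ku) \<xi>) = M2 * ((\<kappa>\<^sup>2 / 16 * (ku * ln (real p) / n)) * (H (real ku) \<xi> / 3))"
    by simp
  also have "\<dots> \<le> M2 * (a\<^sup>2 / (1 + a\<^sup>2) * R)"
    using M2 HR by (intro mult_left_mono mult_mono ra) (auto simp: H_def sum_nonneg)
  finally have "M2 * \<kappa>\<^sup>2 / 48 * (ku * ln (real p) / n * H (real ku) \<xi>) \<le> M2 * (a\<^sup>2 / (1 + a\<^sup>2)) * R"
    by (simp only: mult.assoc)
  then show ?thesis using low by (meson ereal_less_eq(3) order.trans)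
qed

text \<open>Up to a constant the ratio is a negative power of \<open>p\<close>. Used with
  \<open>d = 1\<close>, \<open>x = 0\<close> to get \<open>ku \<le> p\<close>, and with
  \<open>d = 2\<close>, \<open>x = 4 * \<kappa>\<^sup>2\<close> for the second moment of the
  mixture.\<close>

lemma powr_ratio_tendsto_0:
  fixes p ku :: "nat \<Rightarrow> nat"
  assumes p: "filterlim p at_top sequentially" and ku: "(\<lambda>m. real (ku m)) \<in> O(\<lambda>m. real (p m) powr \<gamma>)"
    and x: "real d * \<gamma> + x < 1"
  shows "((\<lambda>m. real (ku m) ^ d * real (p m) powr x / p m) \<longlongrightarrow> 0) sequentially"
proof -
  have pr: "filterlim (\<lambda>m. real (p m)) at_top sequentially"
    by (rule filterlim_compose[OF filterlim_real_sequentially p])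
  obtain C where C: "C > 0" "\<forall>\<^sub>F m in sequentially. norm (real (ku m)) \<le> C * norm (real (p m) powr \<gamma>)"
    using landau_o.bigE[OF ku] by blast
  have lim: "((\<lambda>m. C ^ d * real (p m) powr (real d * \<gamma> + x - 1)) \<longlongrightarrow> 0) sequentially"
    by (rule tendsto_mult_right_zero) (rule tendsto_neg_powr[OF _ pr], use x in simp)
  show ?thesis
  proof (rule tendsto_sandwich[OF _ _ tendsto_const lim])
    show "\<forall>\<^sub>F m in sequentially. real (ku m) ^ d * real (p m) powr x / p m \<le> C ^ d * real (p m) powr (real d * \<gamma> + x - 1)"
      using C(2) eventually_compose_filterlim[OF eventually_gt_at_top[of 0] p]
    proof eventually_elim
      case (elim m)
      have "real (ku m) ^ d \<le> (C * real (p m) powr \<gamma>) ^ d" using elim(1) by (intro power_mono) auto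
      also have "\<dots> = C ^ d * real (p m) powr (real d * \<gamma>)"
        using elim(2) by (simp add: power_mult_distrib powr_power mult.commute)
      finally have "real (ku m) ^ d * (real (p m) powr x / p m) \<le> C ^ d * real (p m) powr (real d * \<gamma>) * (real (p m) powr x / p m)"
        by (rule mult_right_mono) simp
      also have "\<dots> = C ^ d * real (p m) powr (real d * \<gamma> + x - 1)"
        using elim(2) by (simp add: powr_add powr_diff)
      finally show ?case by simp
    qed
  qed simp
qed

theorem corollary3:
  fixes M1 M2 \<alpha> \<eta> \<gamma> :: real
  assumes "M1 > 1" and "M2 > 0"
    and "0 < \<alpha>" and "\<alpha> < 1" and "0 < \<eta>" and "\<eta> < 1" and "\<alpha> + \<eta> < 1"
    and "0 \<le> \<gamma>" and "\<gamma> < 1 / 2"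
  shows "\<exists>c::real. c > 0 \<and>
    (\<forall>(n :: nat \<Rightarrow> nat) (p :: nat \<Rightarrow> nat) (ku :: nat \<Rightarrow> nat) (k :: nat \<Rightarrow> nat)
       (\<xi> :: nat \<Rightarrow> real vec) (t0 :: nat \<Rightarrow> real).
       filterlim n at_top sequentially \<longrightarrow>
       filterlim p at_top sequentially \<longrightarrow>
       filterlim ku at_top sequentially \<longrightarrow>
       (\<forall>m. loading_vector (p m) (\<xi> m)) \<longrightarrow>
       (\<forall>m. 1 \<le> k m \<and> k m \<le> ku m) \<longrightarrow>
       (\<lambda>m. real (ku m)) \<in> O(\<lambda>m. real (p m) powr \<gamma>) \<longrightarrow>
       (\<forall>\<^sub>F m in sequentially. real (n m) \<ge> c * real (ku m) * ln (real (p m))) \<longrightarrow>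
       (\<lambda>m. sqrt (real (n m)) / ln (real (p m))) \<in> o(\<lambda>m. real (ku m)) \<longrightarrow>
       (\<lambda>m. H (real (ku m)) (\<xi> m)) \<in> \<Theta>(\<lambda>m. H (real (n m) / ln (real (p m))) (\<xi> m)) \<longrightarrow>
       asymp_eq
         (\<lambda>m. tau_adap M1 M2 \<alpha> \<eta> (n m) (p m) (t0 m) (ku m) (k m) (\<xi> m))
         (\<lambda>m. ereal (real (ku m) * ln (real (p m)) / real (n m) * H (real (ku m)) (\<xi> m))))"
proof (intro exI[of _ 2048] conjI allI impI)
  \<comment> \<open>The sample size constant of \<open>whp_restricted_eigenvalue\<close>, the most
    demanding of all steps.\<close>
  show "(2048 :: real) > 0" by simp
  fix n p ku k :: "nat \<Rightarrow> nat" and \<xi> :: "nat \<Rightarrow> real vec" and t0 :: "nat \<Rightarrow> real"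
  assume p: "filterlim p at_top sequentially" and ku: "filterlim ku at_top sequentially"
    and L: "\<forall>m. loading_vector (p m) (\<xi> m)" and k: "\<forall>m. 1 \<le> k m \<and> k m \<le> ku m"
    and O: "(\<lambda>m. real (ku m)) \<in> O(\<lambda>m. real (p m) powr \<gamma>)"
    and n: "\<forall>\<^sub>F m in sequentially. real (n m) \<ge> 2048 * real (ku m) * ln (real (p m))"
    and o: "(\<lambda>m. sqrt (real (n m)) / ln (real (p m))) \<in> o(\<lambda>m. real (ku m))"
    and T: "(\<lambda>m. H (real (ku m)) (\<xi> m)) \<in> \<Theta>(\<lambda>m. H (real (n m) / ln (real (p m))) (\<xi> m))"
  note M = assms(1,2)
  let ?tau = "\<lambda>m. tau_adap M1 M2 \<alpha> \<eta> (n m) (p m) (t0 m) (ku m) (k m) (\<xi> m)"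
  let ?rate = "\<lambda>m. real (ku m) * ln (real (p m)) / real (n m) * H (real (ku m)) (\<xi> m)"
  have H0: "H t \<zeta> \<ge> 0" for t \<zeta> by (simp add: H_def sum_nonneg)
  have pr: "filterlim (\<lambda>m. real (p m)) at_top sequentially"
    by (rule filterlim_compose[OF filterlim_real_sequentially p])
  have large: "\<forall>\<^sub>F m in sequentially. C \<le> real (p m)" for C
    using pr unfolding filterlim_at_top by blast
  have ku4: "\<forall>\<^sub>F m in sequentially. 4 \<le> ku m" using ku unfolding filterlim_at_top by blast
  have "((\<lambda>m. real (ku m) ^ 1 * real (p m) powr 0 / p m) \<longlongrightarrow> 0) sequentially"
    by (rule powr_ratio_tendsto_0[OF p O]) (use assms(9) in simp)
  then have "\<forall>\<^sub>F m in sequentially. real (ku m) ^ 1 * real (p m) powr 0 / p m < 1"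
    by (rule order_tendstoD(2)) simp
  with large[of 1] have kup: "\<forall>\<^sub>F m in sequentially. ku m \<le> p m"
    by eventually_elim (simp add: divide_less_eq)
  have "asymp_le ?tau (\<lambda>m. ereal (?rate m))"
  proof -
    define \<delta> where "\<delta> = min \<alpha> \<eta>"
    define K where "K = 2 * M2\<^sup>2 * M1 ^ 3"
    have \<delta>: "\<delta> > 0" "\<delta> \<le> \<alpha>" "\<delta> \<le> \<eta>" using assms by (auto simp: \<delta>_def)
    have K: "K > 0" using M by (simp add: K_def)
    \<comment> \<open>With this constant in the little-o relation the Chebyshev term is at most
      \<open>\<delta> / 2\<close>; \<open>p \<ge> 48 / \<delta>\<close> does the same for
      \<open>24 / p\<close>.\<close>
    define c where "c = sqrt (\<delta> / (2 * K))"
    have c: "c > 0" "c\<^sup>2 = \<delta> / (2 * K)" using \<delta> K by (simp_all add: c_def)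
    \<comment> \<open>Detection is stated with the head up to \<open>n / log p\<close>; this
      comparison passes to \<open>H\<close> at \<open>ku\<close>, in terms of which impossibility is
      proved.\<close>
    from T have "(\<lambda>m. H (real (n m) / ln (real (p m))) (\<xi> m)) \<in> O(\<lambda>m. H (real (ku m)) (\<xi> m))"
      by (simp add: bigtheta_def bigomega_iff_bigo)
    then obtain C where C: "C > 0"
      "\<forall>\<^sub>F m in sequentially. norm (H (real (n m) / ln (real (p m))) (\<xi> m)) \<le> C * norm (H (real (ku m)) (\<xi> m))"
      by (rule landau_o.bigE)
    define U where "U = upper_const M1 M2"
    have U: "U > 0" using M by (simp add: U_def upper_const_def add_pos_nonneg)
    have "\<forall>\<^sub>F m in sequentially. ?tau m \<le> ereal (U * C) * ereal (?rate m)"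
      using large[of "64 * M1 + 3"] large[of "48 / \<delta>"] n ku4 kup C(2) landau_o.smallD[OF o c(1)]
    proof eventually_elim
      case (elim m)
      have lp: "ln (real (p m)) > 0" using elim(1) M by (intro ln_gt_zero) linarith
      have p0: "real (p m) > 0" using elim(4,5) by linarith
      have "sqrt (real (n m)) / ln (real (p m)) \<le> c * real (ku m)" using elim(7) lp by simp
      then have "sqrt (real (n m)) / (real (ku m) * ln (real (p m))) \<le> c"
        using lp elim(4) by (simp add: field_simps)
      then have "(sqrt (real (n m)) / (real (ku m) * ln (real (p m))))\<^sup>2 \<le> c\<^sup>2" using lp by (intro power_mono) auto
      then have "n m / (real (ku m) * ln (real (p m)))\<^sup>2 \<le> \<delta> / (2 * K)" unfolding c(2) by (simp add: power_divide)
      then have "K * (n m / (real (ku m) * ln (real (p m)))\<^sup>2) \<le> K * (\<delta> / (2 * K))" using K by (intro mult_left_mono) auto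
      also have "\<dots> = \<delta> / 2" using K by simp
      finally have "K * n m / (real (ku m) * ln (real (p m)))\<^sup>2 \<le> \<delta> / 2" by simp
      moreover have "24 / p m \<le> \<delta> / 2" using elim(2) \<delta>(1) p0 by (simp add: field_simps)
      ultimately have err: "24 / p m + 2 * M2\<^sup>2 * M1 ^ 3 * n m / (real (ku m) * ln (real (p m)))\<^sup>2 \<le> \<delta>"
        unfolding K_def[symmetric] by linarith
      have "?tau m \<le> ereal (U * (H (real (n m) / ln (real (p m))) (\<xi> m) * (ku m * ln (real (p m)) / n m)))"
        unfolding U_def
        by (rule tau_adap_upper_H[OF M(1) _ elim(5) _ elim(1,3) _ order.trans[OF err \<delta>(2)] order.trans[OF err \<delta>(3)]])
          (use elim(4) k L in auto)
      also have "\<dots> \<le> ereal (U * (C * H (real (ku m)) (\<xi> m) * (ku m * ln (real (p m)) / n m)))"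
        unfolding ereal_less_eq using elim(6) H0 U lp by (intro mult_left_mono mult_right_mono) auto
      also have "\<dots> = ereal (U * C) * ereal (?rate m)" by (simp add: mult_ac)
      finally show ?case .
    qed
    then show ?thesis unfolding asymp_le_def using U C(1) by (intro exI[of _ "U * C"]) simp
  qed
  moreover have "asymp_le (\<lambda>m. ereal (?rate m)) ?tau"
  proof -
    define \<epsilon> where "\<epsilon> = (1 - \<alpha> - \<eta>) / 2"
    have \<epsilon>: "\<epsilon> > 0" "\<alpha> + \<epsilon> < 1 - \<eta>" using assms by (auto simp: \<epsilon>_def field_simps)
    \<comment> \<open>The bound \<open>1 / 4\<close> gives
      \<open>4 * \<kappa>\<^sup>2 \<le> \<kappa>\<close>; the two bounds in \<open>M1\<close> keep
      the spiked eigenvalues between \<open>1 / M1\<close> and \<open>M1\<close>; the last one gives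
      \<open>2 * \<gamma> + 4 * \<kappa>\<^sup>2 < 1\<close>, which makes the chi-square bound
      vanish.\<close>
    define \<kappa> where "\<kappa> = min (min (1 / 4) ((1 - 1 / M1) / 2)) (min ((M1 - 1) / 4) ((1 - 2 * \<gamma>) / 2))"
    have "1 / M1 < 1" using M by simp
    then have \<kappa>0: "\<kappa> > 0" using assms by (simp add: \<kappa>_def)
    have \<kappa>: "\<kappa> \<le> 1 / 4" "2 * \<kappa> \<le> 1 - 1 / M1" "4 * \<kappa> \<le> M1 - 1" "2 * \<kappa> \<le> 1 - 2 * \<gamma>"
    proof -
      have "\<kappa> \<le> (1 - 1 / M1) / 2" "\<kappa> \<le> (M1 - 1) / 4" "\<kappa> \<le> (1 - 2 * \<gamma>) / 2"
        unfolding \<kappa>_def min_le_iff_disj by blast+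
      then show "2 * \<kappa> \<le> 1 - 1 / M1" "4 * \<kappa> \<le> M1 - 1" "2 * \<kappa> \<le> 1 - 2 * \<gamma>"
        unfolding le_divide_eq_numeral1 by (simp_all only: mult.commute)
      show "\<kappa> \<le> 1 / 4" unfolding \<kappa>_def min_le_iff_disj by blast
    qed
    have "\<kappa> * \<kappa> \<le> \<kappa> * (1 / 4)" using \<kappa>(1) \<kappa>0 by (intro mult_left_mono) auto
    then have \<kappa>2: "4 * \<kappa>\<^sup>2 \<le> \<kappa>" by (simp add: power2_eq_square)
    have \<kappa>c: "1 + 2 * \<kappa> + 2 * \<kappa>\<^sup>2 \<le> M1" "8 * \<kappa>\<^sup>2 \<le> 1" using \<kappa> \<kappa>2 \<kappa>0 by linarith+
    have ln0: "ln (1 + \<epsilon>\<^sup>2) > 0" using \<epsilon> by (intro ln_gt_zero) simp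
    have "((\<lambda>m. real (ku m) ^ 2 * real (p m) powr (4 * \<kappa>\<^sup>2) / p m) \<longlongrightarrow> 0) sequentially"
      by (rule powr_ratio_tendsto_0[OF p O]) (use \<kappa> \<kappa>2 \<kappa>0 in simp)
    from order_tendstoD(2)[OF this ln0]
    have chi: "\<forall>\<^sub>F m in sequentially. (real (ku m))\<^sup>2 * real (p m) powr (4 * \<kappa>\<^sup>2) / p m < ln (1 + \<epsilon>\<^sup>2)" .
    define C where "C = 48 / (M2 * \<kappa>\<^sup>2)"
    have C: "C > 0" "C * (M2 * \<kappa>\<^sup>2 / 48) = 1" using M \<kappa>0 by (simp_all add: C_def)
    have "\<forall>\<^sub>F m in sequentially. ereal (?rate m) \<le> ereal C * ?tau m"
      using large[of 1] n ku4 kup chi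
    proof eventually_elim
      case (elim m)
      have "ln (real (p m)) \<ge> 0" using elim(1) by simp
      then have "0 \<le> real (ku m) * ln (real (p m))" by simp
      then have n': "real (ku m) * ln (real (p m)) \<le> real (n m)" using elim(2) by linarith
      have "ereal (M2 * \<kappa>\<^sup>2 / 48 * ?rate m) \<le> ?tau m"
        by (rule tau_adap_lower_H[OF M \<kappa>0 \<kappa>(2) \<kappa>c elim(3,4) _ n' _ \<epsilon> less_imp_le[OF elim(5)]]) (use k L in auto)
      then have "ereal C * ereal (M2 * \<kappa>\<^sup>2 / 48 * ?rate m) \<le> ereal C * ?tau m" using C(1) by (intro ereal_mult_left_mono) auto
      moreover have "C * (M2 * \<kappa>\<^sup>2 / 48 * ?rate m) = ?rate m" using C(2) by (simp only: mult.assoc[symmetric] mult_1)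
      ultimately show ?case by simp
    qed
    then show ?thesis unfolding asymp_le_def using C(1) by blast
  qed
  ultimately show "asymp_eq ?tau (\<lambda>m. ereal (?rate m))" by (simp add: asymp_eq_def)
qed

end
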